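(* The satisfiability, validity, and model checking problems for $\mathrm{LTLf}^+$ are EXPSPACE-complete, and the satisfiability, validity, and model checking problems for $\mathrm{PPLTL}^+$ are PSPACE-complete.
   Context: $AP$ is a fixed finite nonempty set of atoms, $\Sigma=2^{AP}$. LTLf (future operators $X,U$ over finite traces, evaluated at the first position) and PPLTL (past operators $Y,S$ over finite traces, evaluated at the last position) are the standard temporal logics on finite traces; $[\Phi]$ is the set of nonempty finite traces satisfying $\Phi$. For a set $Z$ of finite traces: $\forall Z$ / $\exists Z$ / $\exists^\infty Z$ / $\forall^\infty Z$ is the set of infinite traces all / some / infinitely many / all but finitely many of whose nonempty finite prefixes lie in $Z$. $\mathrm{LTLf}^+$ (resp. $\mathrm{PPLTL}^+$) formulas: $\Psi::=\forall\Phi\mid\exists\Phi\mid\exists^\infty\Phi\mid\forall^\infty\Phi\mid\Psi\vee\Psi\mid\Psi\wedge\Psi\mid\neg\Psi$ with $\Phi$ in LTLf (resp. PPLTL), $[\mathbb{Q}\Phi]=\mathbb{Q}[\Phi]$, Boolean connectives set-theoretic on $(2^{AP})^\omega$. Satisfiability: decide $[\Psi]\neq\emptyset$. Validity: decide $[\Psi]=(2^{AP})^\omega$. Model checking: given $\Psi$ and a finite nondeterministic transition system $T=(\Sigma,Q,I,\delta)$ with $I\subseteq Q$, $\delta\subseteq Q\times\Sigma\times Q$ (not necessarily total), decide whether every infinite trace generated by $T$ (i.e. having an infinite run $\rho_0\in I$, $(\rho_i,\tau_i,\rho_{i+1})\in\delta$) lies in $[\Psi]$. Complexity is measured in the size of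 the input. *)

theory Defs
  imports Main
begin

section \<open>Temporal logics on finite traces\<close>

text \<open>The finite nonempty set AP of atoms is the universe of a type \<open>'a\<close> (of class \<open>finite\<close> where
  it matters); letters are sets of atoms.\<close>

type_synonym 'a fin_trace = "'a set list"
type_synonym 'a inf_trace = "nat \<Rightarrow> 'a set"

datatype 'a ltlf =
    AtomF 'a
  | NotF "'a ltlf"
  | AndF "'a ltlf" "'a ltlf"
  | OrF "'a ltlf" "'a ltlf"
  | NextF "'a ltlf"
  | UntilF "'a ltlf" "'a ltlf"

datatype 'a ppltl =
    AtomP 'a
  | NotP "'a ppltl"
  | AndP "'a ppltl" "'a ppltl"
  | OrP "'a ppltl" "'a ppltl"
  | YesterdayP "'a ppltl"
  | SinceP "'a ppltl" "'a ppltl"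

text \<open>Positions are counted from 0. \<open>NextF\<close> and \<open>YesterdayP\<close> are the strong operators: they
  require the next (previous) position to exist.\<close>

fun ltlf_holds :: "'a fin_trace \<Rightarrow> nat \<Rightarrow> 'a ltlf \<Rightarrow> bool" where
  "ltlf_holds t i (AtomF p) \<longleftrightarrow> p \<in> t ! i"
| "ltlf_holds t i (NotF \<phi>) \<longleftrightarrow> \<not> ltlf_holds t i \<phi>"
| "ltlf_holds t i (AndF \<phi> \<psi>) \<longleftrightarrow> ltlf_holds t i \<phi> \<and> ltlf_holds t i \<psi>"
| "ltlf_holds t i (OrF \<phi> \<psi>) \<longleftrightarrow> ltlf_holds t i \<phi> \<or> ltlf_holds t i \<psi>"
| "ltlf_holds t i (NextF \<phi>) \<longleftrightarrow> i + 1 < length t \<and> ltlf_holds t (i + 1) \<phi>"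
| "ltlf_holds t i (UntilF \<phi> \<psi>) \<longleftrightarrow>
     (\<exists>j. i \<le> j \<and> j < length t \<and> ltlf_holds t j \<psi> \<and>
       (\<forall>k. i \<le> k \<and> k < j \<longrightarrow> ltlf_holds t k \<phi>))"

fun ppltl_holds :: "'a fin_trace \<Rightarrow> nat \<Rightarrow> 'a ppltl \<Rightarrow> bool" where
  "ppltl_holds t i (AtomP p) \<longleftrightarrow> p \<in> t ! i"
| "ppltl_holds t i (NotP \<phi>) \<longleftrightarrow> \<not> ppltl_holds t i \<phi>"
| "ppltl_holds t i (AndP \<phi> \<psi>) \<longleftrightarrow> ppltl_holds t i \<phi> \<and> ppltl_holds t i \<psi>"
| "ppltl_holds t i (OrP \<phi> \<psi>) \<longleftrightarrow> ppltl_holds t i \<phi> \<or> ppltl_holds t i \<psi>"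
| "ppltl_holds t i (YesterdayP \<phi>) \<longleftrightarrow> 1 \<le> i \<and> ppltl_holds t (i - 1) \<phi>"
| "ppltl_holds t i (SinceP \<phi> \<psi>) \<longleftrightarrow>
     (\<exists>j. j \<le> i \<and> ppltl_holds t j \<psi> \<and> (\<forall>k. j < k \<and> k \<le> i \<longrightarrow> ppltl_holds t k \<phi>))"

definition ltlf_lang :: "'a ltlf \<Rightarrow> 'a fin_trace set" where
  "ltlf_lang \<phi> = {t. t \<noteq> [] \<and> ltlf_holds t 0 \<phi>}"

definition ppltl_lang :: "'a ppltl \<Rightarrow> 'a fin_trace set" where
  "ppltl_lang \<phi> = {t. t \<noteq> [] \<and> ppltl_holds t (length t - 1) \<phi>}"


section \<open>The logics with prefix quantifiers on infinite traces\<close>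

text \<open>\<open>'f\<close> is the type of base formulas.\<close>

datatype 'f plus =
    AllQ 'f
  | ExQ 'f
  | InfQ 'f
  | CofinQ 'f
  | OrQ "'f plus" "'f plus"
  | AndQ "'f plus" "'f plus"
  | NotQ "'f plus"

type_synonym 'a ltlf_plus = "'a ltlf plus"
type_synonym 'a ppltl_plus = "'a ppltl plus"

definition prefixes :: "'a inf_trace \<Rightarrow> 'a fin_trace set" where
  "prefixes w = {map w [0..<n] | n. n > 0}"

definition all_prefixes :: "'a fin_trace set \<Rightarrow> 'a inf_trace set" where
  "all_prefixes Z = {w. prefixes w \<subseteq> Z}"

definition some_prefix :: "'a fin_trace set \<Rightarrow> 'a inf_trace set" where
  "some_prefix Z = {w. prefixes w \<inter> Z \<noteq> {}}"

definition inf_many_prefixes :: "'a fin_trace set \<Rightarrow> 'a inf_trace set" where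
  "inf_many_prefixes Z = {w. infinite (prefixes w \<inter> Z)}"

definition cofin_many_prefixes :: "'a fin_trace set \<Rightarrow> 'a inf_trace set" where
  "cofin_many_prefixes Z = {w. finite (prefixes w - Z)}"

fun plus_lang :: "('f \<Rightarrow> 'a fin_trace set) \<Rightarrow> 'f plus \<Rightarrow> 'a inf_trace set" where
  "plus_lang L (AllQ \<phi>) = all_prefixes (L \<phi>)"
| "plus_lang L (ExQ \<phi>) = some_prefix (L \<phi>)"
| "plus_lang L (InfQ \<phi>) = inf_many_prefixes (L \<phi>)"
| "plus_lang L (CofinQ \<phi>) = cofin_many_prefixes (L \<phi>)"
| "plus_lang L (OrQ \<Psi> \<Psi>') = plus_lang L \<Psi> \<union> plus_lang L \<Psi>'"
| "plus_lang L (AndQ \<Psi> \<Psi>') = plus_lang L \<Psi> \<inter> plus_lang L \<Psi>'"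
| "plus_lang L (NotQ \<Psi>) = - plus_lang L \<Psi>"

definition ltlf_plus_lang :: "'a ltlf_plus \<Rightarrow> 'a inf_trace set" where
  "ltlf_plus_lang = plus_lang ltlf_lang"

definition ppltl_plus_lang :: "'a ppltl_plus \<Rightarrow> 'a inf_trace set" where
  "ppltl_plus_lang = plus_lang ppltl_lang"


section \<open>Transition systems\<close>

text \<open>As an input to a decision problem, a transition system is presented by the number \<open>n\<close> of its
  states, which are named \<open>0, ..., n - 1\<close>, and by listings of its initial states and transitions.\<close>

record 'a transition_system =
  num_states :: nat
  initials :: "nat list"
  transitions :: "(nat \<times> 'a set \<times> nat) list"

definition wf_ts :: "'a transition_system \<Rightarrow> bool" where
  "wf_ts T \<longleftrightarrow> set (initials T) \<subseteq> {..<num_states T} \<and>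
     set (transitions T) \<subseteq> {..<num_states T} \<times> UNIV \<times> {..<num_states T}"

definition generated_traces :: "'a transition_system \<Rightarrow> 'a inf_trace set" where
  "generated_traces T = {w. \<exists>\<rho>. \<rho> 0 \<in> set (initials T) \<and>
     (\<forall>i. (\<rho> i, w i, \<rho> (Suc i)) \<in> set (transitions T))}"


section \<open>Encoding of inputs as bit strings\<close>

text \<open>Numbers are written in unary and formulas in Polish notation, each constructor being
  represented by a number, so the length of the encoding of a formula is linear in its size, the
  set of atoms being fixed. The parameter \<open>c\<close> numbers the atoms and is meant to be injective. All
  encodings are prefix-free, so juxtaposition is unambiguous; this is proved below.\<close>

definition enc_nat :: "nat \<Rightarrow> bool list" where
  "enc_nat n = replicate n True @ [False]"

definition enc_list :: "('b \<Rightarrow> bool list) \<Rightarrow> 'b list \<Rightarrow> bool list" where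
  "enc_list e xs = enc_nat (length xs) @ concat (map e xs)"

fun enc_ltlf :: "('a \<Rightarrow> nat) \<Rightarrow> 'a ltlf \<Rightarrow> bool list" where
  "enc_ltlf c (AtomF p) = enc_nat 0 @ enc_nat (c p)"
| "enc_ltlf c (NotF \<phi>) = enc_nat 1 @ enc_ltlf c \<phi>"
| "enc_ltlf c (AndF \<phi> \<psi>) = enc_nat 2 @ enc_ltlf c \<phi> @ enc_ltlf c \<psi>"
| "enc_ltlf c (OrF \<phi> \<psi>) = enc_nat 3 @ enc_ltlf c \<phi> @ enc_ltlf c \<psi>"
| "enc_ltlf c (NextF \<phi>) = enc_nat 4 @ enc_ltlf c \<phi>"
| "enc_ltlf c (UntilF \<phi> \<psi>) = enc_nat 5 @ enc_ltlf c \<phi> @ enc_ltlf c \<psi>"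

fun enc_ppltl :: "('a \<Rightarrow> nat) \<Rightarrow> 'a ppltl \<Rightarrow> bool list" where
  "enc_ppltl c (AtomP p) = enc_nat 0 @ enc_nat (c p)"
| "enc_ppltl c (NotP \<phi>) = enc_nat 1 @ enc_ppltl c \<phi>"
| "enc_ppltl c (AndP \<phi> \<psi>) = enc_nat 2 @ enc_ppltl c \<phi> @ enc_ppltl c \<psi>"
| "enc_ppltl c (OrP \<phi> \<psi>) = enc_nat 3 @ enc_ppltl c \<phi> @ enc_ppltl c \<psi>"
| "enc_ppltl c (YesterdayP \<phi>) = enc_nat 4 @ enc_ppltl c \<phi>"
| "enc_ppltl c (SinceP \<phi> \<psi>) = enc_nat 5 @ enc_ppltl c \<phi> @ enc_ppltl c \<psi>"

fun enc_plus :: "('f \<Rightarrow> bool list) \<Rightarrow> 'f plus \<Rightarrow> bool list" where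
  "enc_plus e (AllQ \<phi>) = enc_nat 0 @ e \<phi>"
| "enc_plus e (ExQ \<phi>) = enc_nat 1 @ e \<phi>"
| "enc_plus e (InfQ \<phi>) = enc_nat 2 @ e \<phi>"
| "enc_plus e (CofinQ \<phi>) = enc_nat 3 @ e \<phi>"
| "enc_plus e (OrQ \<Psi> \<Psi>') = enc_nat 4 @ enc_plus e \<Psi> @ enc_plus e \<Psi>'"
| "enc_plus e (AndQ \<Psi> \<Psi>') = enc_nat 5 @ enc_plus e \<Psi> @ enc_plus e \<Psi>'"
| "enc_plus e (NotQ \<Psi>) = enc_nat 6 @ enc_plus e \<Psi>"

definition enc_ltlf_plus :: "('a \<Rightarrow> nat) \<Rightarrow> 'a ltlf_plus \<Rightarrow> bool list" where
  "enc_ltlf_plus c = enc_plus (enc_ltlf c)"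

definition enc_ppltl_plus :: "('a \<Rightarrow> nat) \<Rightarrow> 'a ppltl_plus \<Rightarrow> bool list" where
  "enc_ppltl_plus c = enc_plus (enc_ppltl c)"

definition enc_letter :: "('a \<Rightarrow> nat) \<Rightarrow> 'a set \<Rightarrow> bool list" where
  "enc_letter c A = enc_list enc_nat (sorted_list_of_set (c ` A))"

definition enc_transition :: "('a \<Rightarrow> nat) \<Rightarrow> nat \<times> 'a set \<times> nat \<Rightarrow> bool list" where
  "enc_transition c = (\<lambda>(p, A, q). enc_nat p @ enc_letter c A @ enc_nat q)"

definition enc_ts :: "('a \<Rightarrow> nat) \<Rightarrow> 'a transition_system \<Rightarrow> bool list" where
  "enc_ts c T = enc_nat (num_states T) @ enc_list enc_nat (initials T) @
     enc_list (enc_transition c) (transitions T)"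

definition prefix_free :: "('b \<Rightarrow> bool list) \<Rightarrow> bool" where
  "prefix_free e \<longleftrightarrow> (\<forall>x y u v. e x @ u = e y @ v \<longrightarrow> x = y \<and> u = v)"

lemma prefix_freeD: "prefix_free e \<Longrightarrow> e x @ u = e y @ v \<longleftrightarrow> x = y \<and> u = v"
  by (auto simp: prefix_free_def)

lemma enc_nat_append_iff [simp]: "enc_nat m @ u = enc_nat n @ v \<longleftrightarrow> m = n \<and> u = v"
proof (induction m arbitrary: n)
  case 0
  then show ?case by (cases n) (auto simp: enc_nat_def)
next
  case (Suc m)
  then show ?case by (cases n) (auto simp: enc_nat_def)
qed

lemma prefix_free_enc_nat: "prefix_free enc_nat"
  by (simp add: prefix_free_def)

lemma prefix_free_enc_list:
  assumes "prefix_free e"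
  shows "prefix_free (enc_list e)"
proof -
  have "concat (map e xs) @ u = concat (map e ys) @ v \<Longrightarrow> xs = ys \<and> u = v"
    if "length xs = length ys" for xs ys u v
    using that by (induction xs ys rule: list_induct2) (auto simp: prefix_freeD[OF assms])
  then show ?thesis
    unfolding prefix_free_def enc_list_def append_assoc enc_nat_append_iff by blast
qed

lemma prefix_free_enc_ltlf:
  assumes "inj c"
  shows "prefix_free (enc_ltlf c)"
proof -
  have "enc_ltlf c \<phi> @ u = enc_ltlf c \<psi> @ v \<longleftrightarrow> \<phi> = \<psi> \<and> u = v" for \<phi> \<psi> u v
  proof (induction \<phi> arbitrary: \<psi> u v)
    case (AtomF p)
    then show ?case by (cases \<psi>) (auto simp: inj_eq[OF assms])
  next
    case (NotF \<phi>)
    then show ?case by (cases \<psi>) auto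
  next
    case (AndF \<phi>1 \<phi>2)
    then show ?case by (cases \<psi>) auto
  next
    case (OrF \<phi>1 \<phi>2)
    then show ?case by (cases \<psi>) auto
  next
    case (NextF \<phi>)
    then show ?case by (cases \<psi>) auto
  next
    case (UntilF \<phi>1 \<phi>2)
    then show ?case by (cases \<psi>) auto
  qed
  then show ?thesis by (simp add: prefix_free_def)
qed

lemma prefix_free_enc_ppltl:
  assumes "inj c"
  shows "prefix_free (enc_ppltl c)"
proof -
  have "enc_ppltl c \<phi> @ u = enc_ppltl c \<psi> @ v \<longleftrightarrow> \<phi> = \<psi> \<and> u = v" for \<phi> \<psi> u v
  proof (induction \<phi> arbitrary: \<psi> u v)
    case (AtomP p)
    then show ?case by (cases \<psi>) (auto simp: inj_eq[OF assms])
  next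
    case (NotP \<phi>)
    then show ?case by (cases \<psi>) auto
  next
    case (AndP \<phi>1 \<phi>2)
    then show ?case by (cases \<psi>) auto
  next
    case (OrP \<phi>1 \<phi>2)
    then show ?case by (cases \<psi>) auto
  next
    case (YesterdayP \<phi>)
    then show ?case by (cases \<psi>) auto
  next
    case (SinceP \<phi>1 \<phi>2)
    then show ?case by (cases \<psi>) auto
  qed
  then show ?thesis by (simp add: prefix_free_def)
qed

lemma prefix_free_enc_plus:
  assumes "prefix_free e"
  shows "prefix_free (enc_plus e)"
proof -
  have "enc_plus e \<phi> @ u = enc_plus e \<psi> @ v \<longleftrightarrow> \<phi> = \<psi> \<and> u = v" for \<phi> \<psi> u v
  proof (induction \<phi> arbitrary: \<psi> u v)
    case (OrQ \<phi>1 \<phi>2)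
    then show ?case by (cases \<psi>) auto
  next
    case (AndQ \<phi>1 \<phi>2)
    then show ?case by (cases \<psi>) auto
  next
    case (NotQ \<phi>)
    then show ?case by (cases \<psi>) auto
  qed (case_tac \<psi>; auto simp: prefix_freeD[OF assms])+
  then show ?thesis by (simp add: prefix_free_def)
qed

lemma prefix_free_enc_ltlf_plus: "inj c \<Longrightarrow> prefix_free (enc_ltlf_plus c)"
  by (simp add: enc_ltlf_plus_def prefix_free_enc_plus prefix_free_enc_ltlf)

lemma prefix_free_enc_ppltl_plus: "inj c \<Longrightarrow> prefix_free (enc_ppltl_plus c)"
  by (simp add: enc_ppltl_plus_def prefix_free_enc_plus prefix_free_enc_ppltl)

lemma prefix_free_enc_ts:
  fixes c :: "'a::finite \<Rightarrow> nat"
  assumes "inj c"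
  shows "prefix_free (enc_ts c)"
proof -
  have "sorted_list_of_set (c ` A) = sorted_list_of_set (c ` B) \<longleftrightarrow> A = B" for A B
    using sorted_list_of_set.sorted_key_list_of_set_inject[of "c ` A" "c ` B"]
    by (auto simp: inj_image_eq_iff[OF assms])
  then have letter: "prefix_free (enc_letter c)"
    unfolding prefix_free_def enc_letter_def
    by (simp add: prefix_freeD[OF prefix_free_enc_list[OF prefix_free_enc_nat]])
  have "prefix_free (enc_transition c)"
    by (auto simp: prefix_free_def enc_transition_def prefix_freeD[OF letter])
  note transitions = prefix_freeD[OF prefix_free_enc_list[OF this]]
  show ?thesis
    unfolding prefix_free_def enc_ts_def append_assoc enc_nat_append_iff transitions
      prefix_freeD[OF prefix_free_enc_list[OF prefix_free_enc_nat]]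
    by (auto intro: transition_system.equality)
qed


section \<open>Decision problems\<close>

text \<open>A decision problem is the set of encodings of its positive instances. The parameters \<open>e\<close> and
  \<open>S\<close> are the encoding and the semantics of the formulas.\<close>

definition satisfiability :: "('f \<Rightarrow> bool list) \<Rightarrow> ('f \<Rightarrow> 'a inf_trace set) \<Rightarrow> bool list set" where
  "satisfiability e S = {e \<Psi> | \<Psi>. S \<Psi> \<noteq> {}}"

definition validity :: "('f \<Rightarrow> bool list) \<Rightarrow> ('f \<Rightarrow> 'a inf_trace set) \<Rightarrow> bool list set" where
  "validity e S = {e \<Psi> | \<Psi>. S \<Psi> = UNIV}"

definition model_checking ::
    "('a \<Rightarrow> nat) \<Rightarrow> ('f \<Rightarrow> bool list) \<Rightarrow> ('f \<Rightarrow> 'a inf_trace set) \<Rightarrow> bool list set" where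
  "model_checking c e S = {e \<Psi> @ enc_ts c T | \<Psi> T. wf_ts T \<and> generated_traces T \<subseteq> S \<Psi>}"


section \<open>Turing machines\<close>

text \<open>Deterministic Turing machines with finitely many two-way infinite tapes. States and tape
  symbols are initial segments of the natural numbers; the symbol 0 is the blank, and 1 and 2 are
  the bits \<open>False\<close> and \<open>True\<close>. The transition function maps a state and the list of scanned symbols
  to a new state and, for each tape, the symbol to write and the move of the head.\<close>

datatype move = MoveLeft | Stay | MoveRight

record tm =
  num_tapes :: nat
  num_symbols :: nat
  num_control :: nat
  start :: nat
  accept :: nat
  reject :: nat
  trans :: "nat \<Rightarrow> nat list \<Rightarrow> nat \<times> (nat \<times> move) list"

definition wf_tm :: "tm \<Rightarrow> bool" where
  "wf_tm M \<longleftrightarrow> num_tapes M \<ge> 1 \<and> num_symbols M \<ge> 3 \<and>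
     start M < num_control M \<and> accept M < num_control M \<and> reject M < num_control M \<and>
     accept M \<noteq> reject M \<and>
     (\<forall>q ss. q < num_control M \<and> length ss = num_tapes M \<and> set ss \<subseteq> {..<num_symbols M} \<longrightarrow>
       (case trans M q ss of (q', as) \<Rightarrow>
         q' < num_control M \<and> length as = num_tapes M \<and>
         (\<forall>(s, m) \<in> set as. s < num_symbols M)))"

text \<open>A tape is a head position together with the contents of the cells.\<close>

type_synonym tape = "int \<times> (int \<Rightarrow> nat)"
type_synonym config = "nat \<times> tape list"

fun move_head :: "move \<Rightarrow> int \<Rightarrow> int" where
  "move_head MoveLeft h = h - 1"
| "move_head Stay h = h"
| "move_head MoveRight h = h + 1"

definition scanned :: "tape \<Rightarrow> nat" where
  "scanned = (\<lambda>(h, f). f h)"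

definition act :: "nat \<times> move \<Rightarrow> tape \<Rightarrow> tape" where
  "act = (\<lambda>(s, m) (h, f). (move_head m h, f(h := s)))"

definition halted :: "tm \<Rightarrow> config \<Rightarrow> bool" where
  "halted M cf \<longleftrightarrow> fst cf \<in> {accept M, reject M}"

definition step :: "tm \<Rightarrow> config \<Rightarrow> config" where
  "step M cf = (if halted M cf then cf
     else (case cf of (q, ts) \<Rightarrow> (case trans M q (map scanned ts) of
       (q', as) \<Rightarrow> (q', map2 act as ts))))"

definition bit_symbol :: "bool \<Rightarrow> nat" where
  "bit_symbol b = (if b then 2 else 1)"

definition input_tape :: "bool list \<Rightarrow> tape" where
  "input_tape w = (0, \<lambda>i. if 0 \<le> i \<and> i < int (length w) then bit_symbol (w ! nat i) else 0)"

definition init_config :: "tm \<Rightarrow> bool list \<Rightarrow> config" where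
  "init_config M w = (start M, input_tape w # replicate (num_tapes M - 1) (0, \<lambda>_. 0))"

definition run :: "tm \<Rightarrow> bool list \<Rightarrow> nat \<Rightarrow> config" where
  "run M w t = (step M ^^ t) (init_config M w)"

definition decides :: "tm \<Rightarrow> bool list set \<Rightarrow> bool" where
  "decides M L \<longleftrightarrow> (\<forall>w. \<exists>t. fst (run M w t) = (if w \<in> L then accept M else reject M))"

text \<open>The cells, on all tapes, that are scanned in the first \<open>t\<close> steps.\<close>

definition scanned_cells :: "tm \<Rightarrow> bool list \<Rightarrow> nat \<Rightarrow> (nat \<times> int) set" where
  "scanned_cells M w t = {(i, fst (snd (run M w t') ! i)) | i t'. i < num_tapes M \<and> t' \<le> t}"

text \<open>The output is read off the last tape, from cell 0 up to the first blank.\<close>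

definition has_output :: "config \<Rightarrow> bool list \<Rightarrow> bool" where
  "has_output cf v \<longleftrightarrow> (\<forall>i<length v. snd (last (snd cf)) (int i) = bit_symbol (v ! i)) \<and>
     snd (last (snd cf)) (int (length v)) = 0"


section \<open>Complexity classes and completeness\<close>

definition dspace :: "(nat \<Rightarrow> nat) \<Rightarrow> bool list set set" where
  "dspace s = {L. \<exists>M d. wf_tm M \<and> decides M L \<and>
     (\<forall>w t. card (scanned_cells M w t) \<le> d * s (length w) + d)}"

definition PSPACE :: "bool list set set" where
  "PSPACE = (\<Union>k. dspace (\<lambda>n. n ^ k))"

definition EXPSPACE :: "bool list set set" where
  "EXPSPACE = (\<Union>k. dspace (\<lambda>n. 2 ^ (n ^ k)))"

definition poly_time_computable :: "(bool list \<Rightarrow> bool list) \<Rightarrow> bool" where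
  "poly_time_computable f \<longleftrightarrow> (\<exists>M k d. wf_tm M \<and>
     (\<forall>w. \<exists>t \<le> d * length w ^ k + d. halted M (run M w t) \<and> has_output (run M w t) (f w)))"

definition poly_reducible :: "bool list set \<Rightarrow> bool list set \<Rightarrow> bool" where
  "poly_reducible L L' \<longleftrightarrow> (\<exists>f. poly_time_computable f \<and> (\<forall>w. w \<in> L \<longleftrightarrow> f w \<in> L'))"

definition complete_for :: "bool list set set \<Rightarrow> bool list set \<Rightarrow> bool" where
  "complete_for C L \<longleftrightarrow> L \<in> C \<and> (\<forall>L' \<in> C. poly_reducible L' L)"

end

theory Submission imports Defs begin

section \<open>Structured programs with step counts and invariants, compiled to Turing
  machines\<close>

section \<open>Structured tape programs\<close>

text \<open>Upper bounds. Along a trace, the truth values of all subformulas of a PPLTL formula form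
  a bit vector that each letter updates deterministically, so an encoding of length n gives an
  automaton with at most 2^n states. Reversing a trace exchanges LTLf and PPLTL
  (\<open>holds_mir\<close>), and the two encodings agree under this exchange
  (\<open>enc_mir\<close>); hence LTLf+ is PPLTL+ read on reversed prefixes. An automaton that still
  reads from left to right must then store the whole map from the vector at the next position to the
  vector at the first one: 2^n entries of n bits, so (2^n)^(2^n) states (\<open>machine_L\<close>).

  Whether a trace satisfies a formula with prefix quantifiers depends only on which truth values of
  base formulas occur on its prefixes at all, and which occur infinitely often. A trace of the
  transition system with a prescribed truth value therefore exists iff the product of system and
  automaton has a suitable lasso, which amounts to two reachability questions
  (\<open>lasso_correct\<close>). Savitch's recursion answers them deterministically in space
  quadratic in the number of bits of a node (\<open>reach_eval_correct\<close>): polynomial for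
  PPLTL+, and 2^O(n) for LTLf+. Satisfiability asks for a trace inside the language, validity and
  model checking for the absence of one outside; being deterministic, the procedure serves both.

  The space bounds are not obtained by writing machines by hand. Primitive recursive terms are
  compiled to machines whose registers hold binary numbers, so the space is governed by the largest
  value that occurs (\<open>compile_correct\<close>). A class \<open>E2\<close> of functions with
  polynomially bounded values contains arithmetic, bounded quantifiers, parsing and Savitch's
  recursion, the latter as an and-or tree traversed with one bit per level. A predicate of the class
  that is given an extra argument 2^b runs in space linear in b plus the length of the input
  (\<open>E2_dspace\<close>).

  Lower bounds. An accepting computation in bounded space is one infinite sequence of letters, the
  configurations written one after another as rows of a fixed width W, with local conditions on the
  places p, p+1, p+W, p+W+1 (\<open>tiling_iff\<close>). For PPLTL+ the width is polynomial and W
  steps back are nested yesterdays (\<open>formP_satisfiable\<close>). For LTLf+ the width is 2^N,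
  and every cell is followed by its N-bit address. Here the end of a prefix works as a marker: the
  address just before the end lies at fixed distances from it, so short formulas compare it with the
  address at p, and demanding exactly one row start in between forces the distance W
  (\<open>fh_vert\<close>, \<open>formF_satisfiable\<close>). The formulas are printed by simple
  loop programs, which run in polynomial time (\<open>gen_poly_time\<close>). As both classes are
  closed under complement, hardness passes to validity by negation, and to model checking by a
  system that generates all traces (\<open>expressible_reducible\<close>).\<close>

datatype prog =
  Act nat "nat option" move
 | Seq prog prog (infixr ";;" 60)
 | Cond nat "nat set" prog prog
 | Loop nat "nat set" prog

fun prog_ok :: "nat => nat => prog => bool" where
 "prog_ok k m (Act r so mv) \<longleftrightarrow> r < k & (case so of None => True | Some s => s < m)"
| "prog_ok k m (p ;; q) \<longleftrightarrow> prog_ok k m p & prog_ok k m q"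
| "prog_ok k m (Cond r S p q) \<longleftrightarrow> r < k & prog_ok k m p & prog_ok k m q"
| "prog_ok k m (Loop r S p) \<longleftrightarrow> r < k & prog_ok k m p"

lemma prog_ok_mono: "prog_ok k m p ==> k <= k' ==> m <= m' ==> prog_ok k' m' p"
 by (induction p) (auto split: option.splits)

lemma prog_ok_ex: "EX k m. prog_ok k m p"
proof (induction p)
 case (Act r so mv)
 have "prog_ok (Suc r) (case so of None => 0 | Some s => Suc s) (Act r so mv)"
  by (auto split: option.splits)
 then show ?case by blast
next
 case (Seq p q)
 then obtain k m k' m' where "prog_ok k m p" "prog_ok k' m' q" by blast
 then have "prog_ok (max k k') (max m m') (p ;; q)"
  using prog_ok_mono by (metis max.cobounded1 max.cobounded2 prog_ok.simps(2))
 then show ?case by blast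
next
 case (Cond r S p q)
 then obtain k m k' m' where "prog_ok k m p" "prog_ok k' m' q" by blast
 then have "prog_ok (max (Suc r) (max k k')) (max m m') (Cond r S p q)"
  using prog_ok_mono by (auto simp: less_max_iff_disj)
 then show ?case by blast
next
 case (Loop r S p)
 then obtain k m where "prog_ok k m p" by blast
 then have "prog_ok (max (Suc r) k) m (Loop r S p)"
  using prog_ok_mono by (auto simp: less_max_iff_disj)
 then show ?case by blast
qed

definition act_tape :: "nat option => move => tape => tape" where
 "act_tape so mv = (%(h, f). (move_head mv h, case so of None => f | Some s => f(h := s)))"

text \<open>Big-step execution with an exact step count. \<open>I\<close> is demanded of the tapes
  after every single action, so a derivation certifies an invariant of the whole run; this is how
  space bounds survive the compilation.\<close>

inductive bs :: "(tape list => bool) => prog => tape list => nat => tape list => bool" for I where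
 Act: "r < length ts ==> I (ts[r := act_tape so mv (ts ! r)]) ==>
  bs I (Act r so mv) ts 1 (ts[r := act_tape so mv (ts ! r)])"
| Seq: "bs I p ts t ts' ==> bs I q ts' u ts'' ==> bs I (p ;; q) ts (Suc (t + u)) ts''"
| CondT: "scanned (ts ! r) \<in> S ==> bs I p ts t ts' ==> bs I (Cond r S p q) ts (Suc t) ts'"
| CondF: "scanned (ts ! r) \<notin> S ==> bs I q ts t ts' ==> bs I (Cond r S p q) ts (Suc t) ts'"
| LoopT: "scanned (ts ! r) \<in> S ==> bs I p ts t ts' ==> bs I (Loop r S p) ts' u ts'' ==>
  bs I (Loop r S p) ts (Suc (t + u)) ts''"
| LoopF: "scanned (ts ! r) \<notin> S ==> bs I (Loop r S p) ts 1 ts"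

definition idle :: "nat list => (nat \<times> move) list" where
 "idle ss = map (%s. (s, Stay)) ss"

text \<open>The continuation still to be executed serves as the control state.\<close>

fun nxt :: "prog list => nat list => prog list \<times> (nat \<times> move) list" where
 "nxt [] ss = ([], idle ss)"
| "nxt (Act r so mv # K) ss =
  (K, (idle ss)[r := (case so of None => ss ! r | Some s => s, mv)])"
| "nxt ((p ;; q) # K) ss = (p # q # K, idle ss)"
| "nxt (Cond r S p q # K) ss = ((if ss ! r \<in> S then p else q) # K, idle ss)"
| "nxt (Loop r S p # K) ss = (if ss ! r \<in> S then p # Loop r S p # K else K, idle ss)"

text \<open>All continuations that can arise while the program runs in front of \<open>K\<close>. A
  loop puts itself below its body instead of being unrolled, which keeps the set finite and makes a
  finite control possible.\<close>

fun conts :: "prog => prog list => prog list set" where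
 "conts (Act r so mv) K = {Act r so mv # K}"
| "conts (p ;; q) K = {(p ;; q) # K} \<union> conts p (q # K) \<union> conts q K"
| "conts (Cond r S p q) K = {Cond r S p q # K} \<union> conts p K \<union> conts q K"
| "conts (Loop r S p) K = {Loop r S p # K} \<union> conts p (Loop r S p # K)"

lemma finite_conts: "finite (conts p K)"
 by (induction p K rule: conts.induct) auto

lemma self_conts: "p # K \<in> conts p K"
 by (cases p) auto

lemma nxt_conts: "K' \<in> conts p K ==> fst (nxt K' ss) \<in> conts p K \<union> {K}"
 by (induction p K rule: conts.induct) (auto simp: self_conts split: if_splits)

definition cont_ok :: "nat => nat => prog list => bool" where
 "cont_ok k m K \<longleftrightarrow> (\<forall>p \<in> set K. prog_ok k m p)"

lemma conts_ok: "K' \<in> conts p K ==> prog_ok k m p ==> cont_ok k m K ==> cont_ok k m K'"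
 by (induction p K rule: conts.induct) (auto simp: cont_ok_def)

lemma nxt_acts:
 assumes "cont_ok k m K" "length ss = k" "set ss \<subseteq> {..<m}" "nxt K ss = (K', as)"
 shows "length as = k & (\<forall>(s, mv) \<in> set as. s < m)"
 using assms
proof (induction K ss rule: nxt.induct)
 case (2 r so mv K ss)
 have "r < length ss" using 2 by (simp add: cont_ok_def)
 then have "ss ! r < m" using 2(2) \<open>set ss \<subseteq> {..<m}\<close> nth_mem by blast
 then have "(case so of None => ss ! r | Some s => s) < m"
  using 2 by (auto simp: cont_ok_def split: option.splits)
 then show ?case using 2 by (auto simp: idle_def cont_ok_def dest!: set_update_subset_insert[THEN subsetD])
qed (auto simp: idle_def)

definition sstep :: "prog list \<times> tape list => prog list \<times> tape list" where
 "sstep = (%(K, ts). case nxt K (map scanned ts) of (K', as) => (K', map2 act as ts))"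

lemma act_scanned: "act (scanned t, Stay) t = t"
 by (auto simp: act_def scanned_def split: prod.splits)

lemma act_idle: "map2 act (idle (map scanned ts)) ts = ts"
 by (rule nth_equalityI) (auto simp: idle_def act_scanned)

lemma act_idle_update:
 "r < length ts ==> map2 act ((idle (map scanned ts))[r := a]) ts = ts[r := act a (ts ! r)]"
 by (rule nth_equalityI) (auto simp: idle_def act_scanned nth_list_update)

lemma act_tape_eq: "act (case so of None => scanned t | Some s => s, mv) t = act_tape so mv t"
 by (auto simp: act_def act_tape_def scanned_def split: option.splits prod.splits)

inductive steps :: "(tape list => bool) => nat => prog list \<times> tape list => prog list \<times> tape list => bool" for I where
 refl: "I ts ==> steps I 0 (K, ts) (K, ts)"
| step: "K ~= [] ==> I ts ==> steps I t (sstep (K, ts)) c ==> steps I (Suc t) (K, ts) c"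

lemma sstep_simps:
 "r < length ts ==> sstep (Act r so mv # K, ts) = (K, ts[r := act_tape so mv (ts ! r)])"
 "sstep ((p ;; q) # K, ts) = (p # q # K, ts)"
 "r < length ts ==> sstep (Cond r S p q # K, ts) = ((if scanned (ts ! r) \<in> S then p else q) # K, ts)"
 "r < length ts ==> sstep (Loop r S p # K, ts) =
  (if scanned (ts ! r) \<in> S then p # Loop r S p # K else K, ts)"
 using act_tape_eq[of "ts ! r" so mv]
 by (auto simp: sstep_def act_idle act_idle_update cong: option.case_cong)

lemma bs_length: "bs I p ts t ts' ==> length ts' = length ts"
 by (induction rule: bs.induct) auto

text \<open>Each constructor of a big-step derivation costs one step to unfold, so the counts agree
  exactly. The arbitrary continuation \<open>K\<close> lets the induction pass through sequences and
  loops.\<close>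

lemma bs_steps:
 assumes "bs I p ts t ts'" "I ts" "prog_ok (length ts) m p" "steps I u (K, ts') c"
 shows "steps I (t + u) (p # K, ts) c"
 using assms
proof (induction arbitrary: K u c rule: bs.induct)
 case (Act r ts so mv)
 then show ?case by (auto intro!: steps.step simp: sstep_simps)
next
 case (Seq p ts t ts' q v ts'')
 have "I ts'" using Seq.hyps(1) Seq.prems(1) by (induction rule: bs.induct) auto
 then have "steps I (v + u) (q # K, ts') c"
  using Seq by (auto simp: bs_length)
 then have "steps I (t + (v + u)) (p # q # K, ts) c" using Seq by auto
 then show ?case using Seq by (auto intro!: steps.step simp: sstep_simps ac_simps)
next
 case (LoopT ts r S p t ts' v ts'')
 have "I ts'" using LoopT.hyps(2) LoopT.prems(1) by (induction rule: bs.induct) auto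
 then have "steps I (v + u) (Loop r S p # K, ts') c"
  using LoopT by (auto simp: bs_length)
 then have "steps I (t + (v + u)) (p # Loop r S p # K, ts) c" using LoopT by auto
 then show ?case using LoopT by (auto intro!: steps.step simp: sstep_simps ac_simps)
qed (auto intro!: steps.step simp: sstep_simps)

text \<open>Control states 0 and 1 accept and reject; the others are numbered continuations. The final
 decision tests whether tape \<open>r\<close> scans a blank.\<close>

definition cnum :: "prog => prog list => nat" where
 "cnum p = (SOME h. bij_betw h (conts p [] \<union> {[]}) {0..<card (conts p [] \<union> {[]})})"

definition prog_tm :: "nat => nat => nat => prog => tm" where
 "prog_tm k m r p = \<lparr>num_tapes = k, num_symbols = m, num_control = 2 + card (conts p [] \<union> {[]}),
   start = 2 + cnum p [p], accept = 0, reject = 1,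
   trans = (%q ss. if q < 2 then (q, idle ss) else
   let K = inv_into (conts p [] \<union> {[]}) (cnum p) (q - 2) in
   if K = [] then (if ss ! r = 0 then 1 else 0, idle ss)
   else case nxt K ss of (K', as) => (2 + cnum p K', as))\<rparr>"

lemma cnum_bij: "bij_betw (cnum p) (conts p [] \<union> {[]}) {0..<card (conts p [] \<union> {[]})}"
 unfolding cnum_def using someI_ex[OF ex_bij_betw_finite_nat[of "conts p [] \<union> {[]}"]]
 by (simp add: finite_conts)

lemma cnum_inv: "K \<in> conts p [] \<union> {[]} ==> inv_into (conts p [] \<union> {[]}) (cnum p) (cnum p K) = K"
 using cnum_bij by (meson bij_betw_imp_inj_on inv_into_f_f)

lemma cnum_less: "K \<in> conts p [] \<union> {[]} ==> cnum p K < card (conts p [] \<union> {[]})"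
 using cnum_bij[of p] by (metis atLeastLessThan_iff bij_betwE)

lemma wf_prog_tm:
 assumes "prog_ok k m p" "1 <= k" "3 <= m"
 shows "wf_tm (prog_tm k m r p)"
proof -
 have main: "case trans (prog_tm k m r p) q ss of (q', as) => q' < num_control (prog_tm k m r p) & length as = k &
   (\<forall>(s, mv) \<in> set as. s < m)"
  if q: "q < num_control (prog_tm k m r p)" and ss: "length ss = k" "set ss \<subseteq> {..<m}" for q ss
 proof -
  let ?C = "conts p [] \<union> {[]}"
  have idle: "length (idle ss) = k & (\<forall>(s, mv) \<in> set (idle ss). s < m)"
   using ss by (auto simp: idle_def)
  show ?thesis
  proof (cases "q < 2")
   case True
   then show ?thesis using idle by (simp add: prog_tm_def)
  next
   case False
   define K where "K = inv_into ?C (cnum p) (q - 2)"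
   have "q - 2 \<in> cnum p ` ?C"
   using cnum_bij[of p] False q by (auto simp: bij_betw_def prog_tm_def)
   then have K: "K \<in> ?C" unfolding K_def by (rule inv_into_into)
   then have ok: "cont_ok k m K" using conts_ok[OF _ assms(1)] by (auto simp: cont_ok_def)
   obtain K' as where n: "nxt K ss = (K', as)" by fastforce
   have "K' \<in> ?C" using nxt_conts[of K p "[]" ss] K n by auto
   then have "cnum p K' < card ?C" by (rule cnum_less)
   then show ?thesis
   using False idle nxt_acts[OF ok ss n] n
   by (simp add: prog_tm_def K_def[symmetric] Let_def del: Un_insert_right)
  qed
 qed
 have "[p] \<in> conts p [] \<union> {[]}" by (simp add: self_conts)
 then have "cnum p [p] < card (conts p [] \<union> {[]})" by (rule cnum_less)
 then show ?thesis using main assms(2,3)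
  unfolding wf_tm_def by (auto simp: prog_tm_def simp del: Un_insert_right)
qed

lemma step_prog_tm:
 assumes "K \<in> conts p []" "K ~= []" "sstep (K, ts) = (K', ts')"
 shows "step (prog_tm k m r p) (2 + cnum p K, ts) = (2 + cnum p K', ts') & K' \<in> conts p [] \<union> {[]}"
 using assms nxt_conts[of K p "[]" "map scanned ts"] cnum_inv[of K p]
 by (auto simp: step_def halted_def prog_tm_def sstep_def Let_def split: prod.splits simp del: Un_insert_right)

lemma steps_run:
 assumes "steps I t c c'" "fst c \<in> conts p [] \<union> {[]}"
 shows "(step (prog_tm k m r p) ^^ t) (2 + cnum p (fst c), snd c) = (2 + cnum p (fst c'), snd c') &
   fst c' \<in> conts p [] \<union> {[]} &
   (\<forall>u\<le>t. I (snd ((step (prog_tm k m r p) ^^ u) (2 + cnum p (fst c), snd c))))"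
 using assms
proof (induction rule: steps.induct)
 case (step K ts t c)
 obtain K' ts' where s: "sstep (K, ts) = (K', ts')" by fastforce
 have K: "K \<in> conts p []" using step by auto
 note sp = step_prog_tm[OF K step(1) s, of k m r]
 have IH: "(step (prog_tm k m r p) ^^ t) (2 + cnum p K', ts') = (2 + cnum p (fst c), snd c) &
   fst c \<in> conts p [] \<union> {[]} &
   (\<forall>u\<le>t. I (snd ((step (prog_tm k m r p) ^^ u) (2 + cnum p K', ts'))))"
  using step.IH sp s by simp
 have "I (snd ((step (prog_tm k m r p) ^^ u) (2 + cnum p K, ts)))" if "u <= Suc t" for u
 proof (cases u)
  case (Suc v)
  then show ?thesis using that IH sp by (simp add: funpow_swap1)
 qed (use step in simp)
 then show ?case using IH sp by (simp add: funpow_swap1)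
qed auto

lemma step_final:
 "step (prog_tm k m r p) (2 + cnum p [], ts) = (if map scanned ts ! r = 0 then 1 else 0, ts)"
 using cnum_inv[of "[]" p]
 by (auto simp: step_def halted_def prog_tm_def act_idle simp del: Un_insert_right)

lemma step_halted: "halted M cf ==> (step M ^^ n) cf = cf"
 by (induction n) (auto simp: step_def)

lemma bs_I: "bs I p ts t ts' ==> I ts ==> I ts'"
 by (induction rule: bs.induct) auto

text \<open>The additional step is the final decision at the empty continuation. The invariant also
  holds at all later times, since a halted machine stays put.\<close>

lemma prog_run:
 assumes "bs I p (snd (init_config (prog_tm k m r p) w)) t ts'" "I (snd (init_config (prog_tm k m r p) w))"
  "prog_ok k m p" "1 <= k" "r < k"
 shows "run (prog_tm k m r p) w (Suc t) = (if scanned (ts' ! r) = 0 then 1 else 0, ts')"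
  and "I (snd (run (prog_tm k m r p) w u))"
proof -
 let ?M = "prog_tm k m r p" and ?ts = "snd (init_config (prog_tm k m r p) w)"
 have len: "length ?ts = k" using assms(4) by (simp add: init_config_def prog_tm_def)
 have "I ts'" using bs_I[OF assms(1,2)] .
 then have "steps I (t + 0) ([p], ?ts) ([], ts')"
  using bs_steps[OF assms(1,2)] assms(3) len steps.refl by metis
 then have s: "steps I t ([p], ?ts) ([], ts')" by simp
 have ini: "init_config ?M w = (2 + cnum p [p], ?ts)" by (simp add: init_config_def prog_tm_def)
 have st: "run ?M w t = (2 + cnum p [], ts')" "\<forall>u\<le>t. I (snd (run ?M w u))"
  using steps_run[OF s, of p k m r] ini by (simp_all add: self_conts run_def)
 have l': "length ts' = k" using bs_length[OF assms(1)] len by simp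
 show fin: "run ?M w (Suc t) = (if scanned (ts' ! r) = 0 then 1 else 0, ts')"
  using st(1) step_final[of k m r p ts'] l' assms(5) by (simp add: run_def)
 show "I (snd (run ?M w u))"
 proof (cases "u <= t")
  case False
  then obtain v where v: "u = v + Suc t" using less_iff_Suc_add[of t u] by (metis add.commute add_Suc_right not_le)
  have "halted ?M (run ?M w (Suc t))" using fin by (simp add: halted_def prog_tm_def)
  then have "run ?M w u = run ?M w (Suc t)"
   unfolding v run_def using step_halted by (metis comp_apply funpow_add)
  then show ?thesis using fin \<open>I ts'\<close> by simp
 qed (use st in simp)
qed

text \<open>A head confined to positions of absolute value at most \<open>H w\<close> scans at most
  \<open>2 * H w + 1\<close> cells, so an invariant on head positions alone bounds the
  space.\<close>

theorem prog_dspace: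
 assumes p: "prog_ok k m p" "1 <= k" "3 <= m" "r < k"
  and run: "!!w. EX t ts'. bs (I w) p (input_tape w # replicate (k - 1) (0, %_. 0)) t ts' &
   (scanned (ts' ! r) ~= 0 \<longleftrightarrow> w \<in> L)"
  and I0: "!!w. I w (input_tape w # replicate (k - 1) (0, %_. 0))"
  and I: "!!w ts i. I w ts ==> i < k ==> \<bar>fst (ts ! i)\<bar> \<le> int (H w)"
  and H: "!!w. H w <= d * s (length w) + d"
 shows "L \<in> dspace s"
proof -
 let ?M = "prog_tm k m r p"
 have ini: "snd (init_config ?M w) = input_tape w # replicate (k - 1) (0, %_. 0)" for w
  by (simp add: init_config_def prog_tm_def)
 have "EX t. fst (run ?M w t) = (if w \<in> L then accept ?M else reject ?M)" for w
 proof -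
  obtain t ts' where t: "bs (I w) p (input_tape w # replicate (k - 1) (0, %_. 0)) t ts'"
   "scanned (ts' ! r) ~= 0 \<longleftrightarrow> w \<in> L" using run by blast
  show ?thesis
   using prog_run(1)[of "I w" p k m r w t ts'] t I0 p ini
   by (intro exI[of _ "Suc t"]) (auto simp: prog_tm_def)
 qed
 then have dec: "decides ?M L" by (simp add: decides_def)
 have "card (scanned_cells ?M w t) <= (4 * k * d + k) * s (length w) + (4 * k * d + k)" for w t
 proof -
  obtain u ts' where u: "bs (I w) p (input_tape w # replicate (k - 1) (0, %_. 0)) u ts'" using run by blast
  have "I w (snd (run ?M w v))" for v
   using prog_run(2)[of "I w" p k m r w u ts'] u I0 p ini by auto
  note Iv = this
  have sub: "scanned_cells ?M w t \<subseteq> {..<k} \<times> {- int (H w)..int (H w)}"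
  proof
   fix x assume "x \<in> scanned_cells ?M w t"
   then obtain i u where x: "x = (i, fst (snd (run ?M w u) ! i))" "i < k"
   by (auto simp: scanned_cells_def prog_tm_def)
   then show "x \<in> {..<k} \<times> {- int (H w)..int (H w)}"
   using I[OF \<open>!!v. I w (snd (run ?M w v))\<close>[of u], of i] by (auto simp: abs_le_iff)
  qed
  have "card (scanned_cells ?M w t) <= card ({..<k} \<times> {- int (H w)..int (H w)})"
   by (rule card_mono[OF _ sub]) simp
  also have "\<dots> = k * (2 * H w + 1)" by (simp add: card_cartesian_product nat_add_distrib nat_mult_distrib)
  also have "\<dots> \<le> k * (2 * (d * s (length w) + d) + 1)" using H[of w] by simp
  also have "\<dots> \<le> (4 * k * d + k) * s (length w) + (4 * k * d + k)"
  proof -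
   have "2 * (d * s (length w) + d) + 1 <= (4 * d + 1) * s (length w) + (4 * d + 1)" by (simp add: add_mult_distrib)
   then have "k * (2 * (d * s (length w) + d) + 1) <= k * ((4 * d + 1) * s (length w) + (4 * d + 1))" by (rule mult_le_mono2)
   then show ?thesis by (simp add: algebra_simps)
  qed
  finally show ?thesis .
 qed
 then show ?thesis using dec wf_prog_tm[OF p(1-3)] unfolding dspace_def by blast
qed

theorem prog_poly_time:
 assumes p: "prog_ok k m p" "1 <= k" "3 <= m"
  and run: "!!w. \<exists>t\<le>d * length w ^ j + d. EX ts'. bs (%_. True) p (input_tape w # replicate (k - 1) (0, %_. 0)) t ts' &
   has_output (0, ts') (f w)"
 shows "poly_time_computable f"
proof -
 let ?M = "prog_tm k m 0 p"
 have ini: "snd (init_config ?M w) = input_tape w # replicate (k - 1) (0, %_. 0)" for w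
  by (simp add: init_config_def prog_tm_def)
 have "\<exists>t\<le>Suc d * length w ^ j + Suc d. halted ?M (run ?M w t) & has_output (run ?M w t) (f w)" for w
 proof -
  obtain t ts' where t: "t <= d * length w ^ j + d"
   "bs (%_. True) p (input_tape w # replicate (k - 1) (0, %_. 0)) t ts'"
   "has_output (0, ts') (f w)" using run by blast
  have r: "run ?M w (Suc t) = (if scanned (ts' ! 0) = 0 then 1 else 0, ts')"
   using prog_run(1)[of "%_. True" p k m 0 w t ts'] t p ini by simp
  then have "halted ?M (run ?M w (Suc t))" by (simp add: halted_def prog_tm_def)
  moreover have "has_output (run ?M w (Suc t)) (f w)" using t(3) by (simp add: r has_output_def)
  ultimately show ?thesis using t(1) by (intro exI[of _ "Suc t"]) auto
 qed
 then show ?thesis using wf_prog_tm[OF p] unfolding poly_time_computable_def by blast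
qed

section \<open>Tapes as stacks of symbols\<close>

section \<open>Stacks\<close>

text \<open>The stack occupies the cells from the head to the bottom \<open>b\<close>, where a blank
  ends it; entries are positive, so a blank under the head means that the stack is empty. Cells left
  of the head are unconstrained, so popping is a mere move.\<close>

fun stk :: "int => (int => nat) => int => nat list => bool" where
 "stk b f h [] \<longleftrightarrow> h = b & f h = 0"
| "stk b f h (x # l) \<longleftrightarrow> f h = x & 0 < x & stk b f (h + 1) l"

definition outp :: "tape => nat list => bool" where
 "outp t l \<longleftrightarrow> fst t = int (length l) & (\<forall>i<length l. snd t (int i) = rev l ! i) &
   (\<forall>i\<ge>int (length l). snd t i = 0)"

lemma stk_pos: "stk b f h l ==> h = b - int (length l)"
proof (induction l arbitrary: h)
 case (Cons x l)
 then have "h + 1 = b - int (length l)" by auto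
 then show ?case by simp
qed auto

lemma upd_same: "r ~= s ==> sg(r := l, s := sg s) = sg(r := l)"
 by auto

lemma stk_upd: "stk b f h l ==> i < h ==> stk b (f(i := s)) h l"
 by (induction l arbitrary: h) auto

definition top :: "nat list => nat" where
 "top l = (case l of [] => 0 | x # _ => x)"

lemma top_simps [simp]: "top [] = 0" "top (x # l) = x"
 by (simp_all add: top_def)

lemma stk_scanned: "stk b (snd t) (fst t) l ==> scanned t = top l"
 by (cases l) (auto simp: scanned_def split: prod.splits)

text \<open>Tapes \<open>0, \<dots>, k - 1\<close> hold stacks that grow to the left, with the head on the top element and
 the bottom at position \<open>b r\<close>; tape \<open>k\<close> grows to the right and is only written.\<close>

locale stack_machine =
 fixes k :: nat and b :: "nat => int" and J :: "(nat => nat list) => bool"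
begin

definition rep :: "tape list => (nat => nat list) => bool" where
 "rep ts sg \<longleftrightarrow> length ts = Suc k & (\<forall>r<k. stk (b r) (snd (ts ! r)) (fst (ts ! r)) (sg r)) & outp (ts ! k) (sg k)"

text \<open>Only head positions are mentioned: they are all that a space bound needs, and the
  condition survives the moment between the move and the write of a push, when the tapes need not
  represent any stacks.\<close>

definition HJ :: "tape list => bool" where
 "HJ ts \<longleftrightarrow> (\<exists>sg. J sg & (\<forall>r<k. fst (ts ! r) = b r - int (length (sg r))) & fst (ts ! k) = int (length (sg k)))"

definition ex :: "prog => (nat => nat list) => nat => (nat => nat list) => bool" where
 "ex p sg T sg' \<longleftrightarrow> (ALL ts. rep ts sg --> (\<exists>t\<le>T. EX ts'. bs HJ p ts t ts' & rep ts' sg'))"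

lemma rep_HJ: "rep ts sg ==> J sg ==> HJ ts"
 unfolding rep_def HJ_def outp_def using stk_pos by blast

lemma ex_weaken: "ex p sg T sg' ==> T <= T' ==> ex p sg T' sg'"
 unfolding ex_def by (meson le_trans)

lemma ex_seq: "ex p sg T sg' ==> ex q sg' U sg'' ==> ex (p ;; q) sg (Suc (T + U)) sg''"
 unfolding ex_def by (meson add_le_mono bs.Seq Suc_le_mono)

lemma ex_seq': "ex p sg T sg' ==> ex q sg' U sg'' ==> Suc (T + U) <= V ==> ex (p ;; q) sg V sg''"
 using ex_seq ex_weaken by blast

lemma rep_scanned: "rep ts sg ==> r < k ==> scanned (ts ! r) = top (sg r)"
 unfolding rep_def using stk_scanned by blast

lemma ex_condT: "top (sg r) \<in> S ==> r < k ==> ex p sg T sg' ==> ex (Cond r S p q) sg (Suc T) sg'"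
 unfolding ex_def by (metis bs.CondT rep_scanned Suc_le_mono)

lemma ex_condF: "top (sg r) \<notin> S ==> r < k ==> ex q sg T sg' ==> ex (Cond r S p q) sg (Suc T) sg'"
 unfolding ex_def by (metis bs.CondF rep_scanned Suc_le_mono)

lemma ex_loopF: "top (sg r) \<notin> S ==> r < k ==> ex (Loop r S p) sg 1 sg"
 unfolding ex_def by (metis bs.LoopF rep_scanned order_refl)

lemma ex_loopT: "top (sg r) \<in> S ==> r < k ==> ex p sg T sg' ==> ex (Loop r S p) sg' U sg'' ==>
  ex (Loop r S p) sg (Suc (T + U)) sg''"
 unfolding ex_def by (metis bs.LoopT rep_scanned add_le_mono Suc_le_mono)

lemma ex_loopT': "top (sg r) \<in> S ==> r < k ==> ex p sg T sg' ==> ex (Loop r S p) sg' U sg'' ==> Suc (T + U) <= V ==>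
  ex (Loop r S p) sg V sg''"
 using ex_loopT ex_weaken by blast

definition push :: "nat => nat => prog" where
 "push r s = Act r None MoveLeft ;; Act r (Some s) Stay"

definition pop :: "nat => prog" where
 "pop r = Act r None MoveRight"

definition emit :: "nat => prog" where
 "emit s = Act k (Some s) MoveRight"

definition skip :: prog where
 "skip = Act 0 None Stay"

lemma ex_push:
 assumes "r < k" "0 < s" "J (sg(r := s # sg r))"
 shows "ex (push r s) sg 3 (sg(r := s # sg r))"
 unfolding ex_def
proof (intro allI impI)
 fix ts assume rep: "rep ts sg"
 obtain h f where t: "ts ! r = (h, f)" by fastforce
 define t1 where "t1 = ts[r := act_tape None MoveLeft (ts ! r)]"
 define t2 where "t2 = t1[r := act_tape (Some s) Stay (t1 ! r)]"
 have len: "length ts = Suc k" using rep by (simp add: rep_def)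
 have t2: "t2 = ts[r := (h - 1, f(h - 1 := s))]"
  using len assms(1) by (simp add: t2_def t1_def t act_tape_def)
 have h: "stk (b r) f h (sg r)" using rep assms(1) t by (auto simp: rep_def)
 have r2: "rep t2 (sg(r := s # sg r))"
  using rep assms h stk_upd[OF h, of "h - 1" s] by (auto simp: rep_def t2 nth_list_update)
 have h2: "HJ t2" using rep_HJ[OF r2 assms(3)] .
 \<comment> \<open>The intermediate tapes satisfy \<open>HJ\<close> because their heads stand where
   they stand after the push.\<close>
 have "fst (t1 ! i) = fst (t2 ! i)" if "i <= k" for i
  using that len assms(1) by (auto simp: t2 t1_def t act_tape_def nth_list_update)
 then have "HJ t1" using h2 unfolding HJ_def by (metis less_imp_le order_refl)
 then have "bs HJ (push r s) ts (Suc (1 + 1)) t2"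
  unfolding push_def using h2 len assms(1) bs.Act[of r ts HJ None MoveLeft] bs.Act[of r t1 HJ "Some s" Stay]
  by (intro bs.Seq) (auto simp: t1_def t2_def)
 then show "\<exists>t\<le>3. EX ts'. bs HJ (push r s) ts t ts' & rep ts' (sg(r := s # sg r))"
  using r2 by (intro exI[of _ "3::nat"] exI[of _ t2] conjI) (simp_all add: numeral_3_eq_3)
qed

lemma ex_pop:
 assumes "r < k" "sg r = x # l" "J (sg(r := l))"
 shows "ex (pop r) sg 1 (sg(r := l))"
 unfolding ex_def
proof (intro allI impI)
 fix ts assume rep: "rep ts sg"
 obtain h f where t: "ts ! r = (h, f)" by fastforce
 define t1 where "t1 = ts[r := act_tape None MoveRight (ts ! r)]"
 have len: "length ts = Suc k" using rep by (simp add: rep_def)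
 have t1: "t1 = ts[r := (h + 1, f)]" using len assms(1) by (simp add: t1_def t act_tape_def)
 have "stk (b r) f h (x # l)" using rep assms(1,2) t by (auto simp: rep_def)
 then have r1: "rep t1 (sg(r := l))"
  using rep assms by (auto simp: rep_def t1 nth_list_update)
 have "bs HJ (pop r) ts 1 t1"
  unfolding pop_def t1_def using rep_HJ[OF r1 assms(3)] len assms(1)
  by (intro bs.Act) (auto simp: t1_def)
 then show "\<exists>t\<le>1. EX ts'. bs HJ (pop r) ts t ts' & rep ts' (sg(r := l))"
  using r1 by blast
qed

lemma ex_emit:
 assumes "J (sg(k := s # sg k))"
 shows "ex (emit s) sg 1 (sg(k := s # sg k))"
 unfolding ex_def
proof (intro allI impI)
 fix ts assume rep: "rep ts sg"
 obtain h f where t: "ts ! k = (h, f)" by fastforce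
 define t1 where "t1 = ts[k := act_tape (Some s) MoveRight (ts ! k)]"
 have len: "length ts = Suc k" using rep by (simp add: rep_def)
 have t1: "t1 = ts[k := (h + 1, f(h := s))]" using len by (simp add: t1_def t act_tape_def)
 have "outp (h, f) (sg k)" using rep t by (auto simp: rep_def)
 then have "outp (h + 1, f(h := s)) (s # sg k)"
  by (auto simp: outp_def nth_append less_Suc_eq)
 then have r1: "rep t1 (sg(k := s # sg k))"
  using rep by (auto simp: rep_def t1 nth_list_update)
 have "bs HJ (emit s) ts 1 t1"
  unfolding emit_def t1_def using rep_HJ[OF r1 assms] len
  by (intro bs.Act) (auto simp: t1_def)
 then show "\<exists>t\<le>1. EX ts'. bs HJ (emit s) ts t ts' & rep ts' (sg(k := s # sg k))"
  using r1 by blast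
qed

lemma ex_skip:
 assumes "J sg"
 shows "ex skip sg 1 sg"
 unfolding ex_def
proof (intro allI impI)
 fix ts assume rep: "rep ts sg"
 then have len: "length ts = Suc k" by (simp add: rep_def)
 have "ts[0 := act_tape None Stay (ts ! 0)] = ts"
  using len by (cases ts) (auto simp: act_tape_def split: prod.splits)
 then have "bs HJ skip ts 1 ts"
  using bs.Act[of 0 ts HJ None Stay] rep_HJ[OF rep assms] len by (simp add: skip_def)
 then show "\<exists>t\<le>1. EX ts'. bs HJ skip ts t ts' & rep ts' sg" using rep by blast
qed

lemma ex_clear:
 assumes "r < k" "0 \<notin> set (sg r)" "!!l. length l <= length (sg r) ==> J (sg(r := l))"
 shows "ex (Loop r (-{0}) (pop r)) sg (2 * length (sg r) + 1) (sg(r := []))"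
 using assms(2,3)
proof (induction "sg r" arbitrary: sg)
 case Nil
 then show ?case using ex_loopF[of sg r "-{0}"] assms(1) by (metis Compl_iff fun_upd_triv insertI1 list.size(3) mult_0_right add_0 top_simps(1))
next
 case (Cons x l)
 have 1: "ex (pop r) sg 1 (sg(r := l))" using Cons.hyps(2) assms(1) Cons.prems(2)[of l]
  by (intro ex_pop) (auto simp flip: Cons.hyps(2))
 have 2: "ex (Loop r (-{0}) (pop r)) (sg(r := l)) (2 * length l + 1) (sg(r := []))"
  using Cons.hyps(1)[of "sg(r := l)"] Cons.prems by (auto simp flip: Cons.hyps(2))
 show ?case
  using Cons.prems(1) assms(1) by (intro ex_loopT'[OF _ _ 1 2]) (auto simp flip: Cons.hyps(2))
qed

definition unload :: "nat => nat => prog" where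
 "unload r s = Loop r {1, 2} (Cond r {2} (pop r ;; push s 2) (pop r ;; push s 1))"

lemma ex_unload:
 assumes "r < k" "s < k" "r ~= s" "set (sg r) \<subseteq> {1, 2}"
  "!!l l'. length l + length l' <= length (sg r) + length (sg s) ==> length l <= length (sg r) ==> J (sg(r := l, s := l'))"
 shows "ex (unload r s) sg (8 * length (sg r) + 1) (sg(r := [], s := rev (sg r) @ sg s))"
 using assms(4,5)
proof (induction "sg r" arbitrary: sg)
 case Nil
 then have "sg(r := [], s := rev (sg r) @ sg s) = sg" by (auto simp flip: Nil.hyps)
 moreover have "top (sg r) \<notin> {1, 2}" by (simp flip: Nil.hyps)
 ultimately show ?case using ex_loopF[of sg r "{1,2}"] assms(1)
  unfolding unload_def Nil.hyps[symmetric] by (metis add_0 list.size(3) mult_0_right rev.simps(1))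
next
 case (Cons x l)
 let ?sg = "sg(r := l)" and ?sg' = "sg(r := l, s := x # sg s)"
 have x: "x = 1 \<or> x = 2" using Cons.prems(1) by (auto simp flip: Cons.hyps(2))
 have "J (sg(r := l, s := sg s))" using Cons.prems(2)[of l "sg s"] by (simp flip: Cons.hyps(2))
 then have J1: "J ?sg" using upd_same[OF assms(3)] by metis
 have J2: "J ?sg'" using Cons.prems(2)[of l "x # sg s"] by (simp flip: Cons.hyps(2))
 have 1: "ex (pop r) sg 1 ?sg" using Cons.hyps(2) assms(1) J1 by (intro ex_pop) (auto simp flip: Cons.hyps(2))
 have 2: "ex (push s x) ?sg 3 ?sg'" using ex_push[of s x ?sg] assms(2,3) J2 x by auto
 have 3: "ex (Cond r {2} (pop r ;; push s 2) (pop r ;; push s 1)) sg 6 ?sg'"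
 proof (cases "x = 2")
  case True
  then show ?thesis using ex_condT[of sg r "{2}", OF _ assms(1) ex_seq[OF 1 2]] by (simp flip: Cons.hyps(2))
 next
  case False
  then show ?thesis using ex_condF[of sg r "{2}", OF _ assms(1) ex_seq[OF 1 2]] x by (simp flip: Cons.hyps(2))
 qed
 have 4: "ex (unload r s) ?sg' (8 * length l + 1) (sg(r := [], s := rev l @ x # sg s))"
 proof -
  have "J (?sg'(r := la, s := l'))" if "length la + length l' <= length (?sg' r) + length (?sg' s)"
   "length la <= length (?sg' r)" for la l'
   using Cons.prems(2)[of la l'] that assms(3) by (simp add: fun_upd_twist flip: Cons.hyps(2))
  then show ?thesis
   using Cons.hyps(1)[of ?sg'] Cons.prems assms(3) by (simp add: fun_upd_twist flip: Cons.hyps(2))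
 qed
 show ?case unfolding unload_def
  using x by (intro ex_loopT'[OF _ assms(1) 3 4[unfolded unload_def], THEN back_subst[of "ex _ _ _"]])
   (auto simp flip: Cons.hyps(2))
qed

definition shift :: "nat => nat => nat => nat => prog" where
 "shift r a s c = Loop r {a} (pop r ;; push s c)"

lemma ex_shift:
 assumes "r < k" "s < k" "r ~= s" "0 < c" "sg r = replicate j a @ l" "top l ~= a"
  "!!i i'. i + i' <= j ==> J (sg(r := replicate i a @ l, s := replicate i' c @ sg s))"
 shows "ex (shift r a s c) sg (6 * j + 1) (sg(r := l, s := replicate j c @ sg s))"
 using assms(5,7)
proof (induction j arbitrary: sg)
 case 0
 then have "sg(r := l, s := replicate 0 c @ sg s) = sg" by auto
 then show ?case using ex_loopF[of sg r "{a}"] 0(1) assms(1,6) unfolding shift_def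
  by (metis add_0 append_Nil mult_0_right replicate_0 singletonD)
next
 case (Suc j)
 let ?sg = "sg(r := replicate j a @ l)" and ?sg' = "sg(r := replicate j a @ l, s := c # sg s)"
 have J1: "J ?sg" using Suc.prems(2)[of j 0] upd_same[OF assms(3)] by (metis add_0_right append_Nil le_SucI order_refl replicate_0)
 have "replicate 1 c @ sg s = c # sg s" by simp
 then have J2: "J ?sg'" using Suc.prems(2)[of j 1] by (metis Suc_eq_plus1 order_refl)
 have 1: "ex (pop r) sg 1 ?sg" using Suc.prems(1) assms(1) J1 by (intro ex_pop) auto
 have 2: "ex (push s c) ?sg 3 ?sg'" using ex_push[of s c ?sg] assms(2,3,4) J2 by auto
 have 4: "ex (shift r a s c) ?sg' (6 * j + 1) (sg(r := l, s := replicate (Suc j) c @ sg s))"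
 proof -
  have "J (?sg'(r := replicate i a @ l, s := replicate i' c @ ?sg' s))" if "i + i' <= j" for i i'
  proof -
   have "?sg'(r := replicate i a @ l, s := replicate i' c @ ?sg' s) =
   sg(r := replicate i a @ l, s := replicate (Suc i') c @ sg s)"
   using assms(3) by (auto simp: replicate_app_Cons_same fun_eq_iff)
   then show ?thesis using Suc.prems(2)[of i "Suc i'"] that by (metis add_Suc_right Suc_le_mono)
  qed
  note J3 = this
  have e: "?sg'(r := l, s := replicate j c @ ?sg' s) = sg(r := l, s := replicate (Suc j) c @ sg s)"
   using assms(3) by (auto simp: replicate_app_Cons_same fun_eq_iff)
  have "?sg' r = replicate j a @ l" using assms(3) by simp
  then have "ex (shift r a s c) ?sg' (6 * j + 1) (?sg'(r := l, s := replicate j c @ ?sg' s))"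
   using J3 by (rule Suc.IH)
  then show ?thesis unfolding e .
 qed
 show ?case unfolding shift_def
  using Suc.prems(1) by (intro ex_loopT'[OF _ assms(1) ex_seq[OF 1 2] 4[unfolded shift_def]]) auto
qed

end

section \<open>Binary arithmetic in registers\<close>

section \<open>Binary numbers on stacks\<close>

text \<open>Binary digits, least significant first, with symbol 1 for the digit zero and 2 for the
  digit one, as the blank ends a stack. Without leading zeros the number 0 is the empty stack, so a
  test for zero is a test for a blank.\<close>

fun bin :: "nat => nat list" where
 "bin n = (if n = 0 then [] else (if odd n then 2 else 1) # bin (n div 2))"

declare bin.simps [simp del]

lemma bin_0 [simp]: "bin 0 = []"
 by (simp add: bin.simps)

lemma bin_double: "0 < n ==> bin (2 * n) = 1 # bin n"
 by (subst bin.simps) simp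

lemma bin_Suc_double: "bin (Suc (2 * n)) = 2 # bin n"
 by (subst bin.simps) simp

lemma set_bin: "set (bin n) \<subseteq> {1, 2}"
 by (induction n rule: bin.induct) (subst bin.simps, auto)

lemma bin_eq_Nil [simp]: "bin n = [] \<longleftrightarrow> n = 0"
 by (subst bin.simps) simp

lemma length_bin: "n < 2 ^ H ==> length (bin n) <= H"
proof (induction H arbitrary: n)
 case (Suc H)
 then have "n div 2 < 2 ^ H" by auto
 then show ?case using Suc.IH[of "n div 2"] by (subst bin.simps) auto
qed auto

text \<open>Incrementing turns the low ones into zeros and the digit above them into a one;
  \<open>l\<close> is empty when all digits are ones and a new digit has to be added.\<close>

lemma bin_inc: "EX j l. top l ~= 2 & bin n = replicate j 2 @ l &
  bin (Suc n) = replicate j 1 @ 2 # (if l = [] then [] else tl l) & (l ~= [] --> top l = 1)"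
proof (induction n rule: bin.induct)
 case (1 n)
 consider "n = 0" | m where "n = 2 * m" "m > 0" | m where "n = Suc (2 * m)"
  by (metis oddE evenE Suc_eq_plus1 gr0I mult_0_right)
 then show ?case
 proof cases
  case 1
  then show ?thesis using bin_Suc_double[of 0] by (intro exI[of _ 0] exI[of _ "[]"]) auto
 next
  case 2
  then show ?thesis by (intro exI[of _ 0] exI[of _ "1 # bin m"]) (auto simp: bin_double bin_Suc_double)
 next
  case 3
  then have "n ~= 0" "n div 2 = m" by auto
  with 1 obtain j l where "top l ~= 2 & bin m = replicate j 2 @ l &
   bin (Suc m) = replicate j 1 @ 2 # (if l = [] then [] else tl l) & (l ~= [] --> top l = 1)" by blast
  moreover have "bin (Suc n) = 1 # bin (Suc m)" using bin_double[of "Suc m"] 3 by simp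
  ultimately show ?thesis using 3
   by (intro exI[of _ "Suc j"] exI[of _ l]) (auto simp: bin_Suc_double)
 qed
qed

text \<open>Decrementing turns the low zeros into ones and the lowest one into a zero, except that a
  leading one disappears.\<close>

lemma bin_dec: "0 < n ==> EX j l. bin n = replicate j 1 @ 2 # l & (l ~= [] --> top l ~= 0) &
  bin (n - 1) = replicate j 2 @ (if l = [] then [] else 1 # l)"
proof (induction n rule: bin.induct)
 case (1 n)
 consider m where "n = 2 * m" "m > 0" | m where "n = Suc (2 * m)"
  using 1(2) by (metis oddE evenE Suc_eq_plus1 gr0I mult_0_right)
 then show ?case
 proof cases
  case 1
  with "1.IH" obtain j l where "bin m = replicate j 1 @ 2 # l & (l ~= [] --> top l ~= 0) &
   bin (m - 1) = replicate j 2 @ (if l = [] then [] else 1 # l)" by auto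
  moreover have "bin (n - 1) = 2 # bin (m - 1)" using bin_Suc_double[of "m - 1"] 1 by (cases m) auto
  ultimately show ?thesis using 1
   by (intro exI[of _ "Suc j"] exI[of _ l]) (auto simp: bin_double)
 next
  case 2
  have "bin m ~= [] --> top (bin m) ~= 0" using set_bin[of m] by (cases "bin m") auto
  then show ?thesis using 2 bin_double[of m]
   by (intro exI[of _ 0] exI[of _ "bin m"]) (auto simp: bin_Suc_double)
 qed
qed

locale num_machine =
 fixes k :: nat and bot :: "nat => int" and H :: nat
begin

definition Jb :: "(nat => nat list) => bool" where
 "Jb sg \<longleftrightarrow> (\<forall>r\<le>k. length (sg r) <= H)"

lemma Jb_upd: "Jb sg ==> length l <= H ==> Jb (sg(r := l))"
 by (simp add: Jb_def)

lemma JbD: "Jb sg ==> r < k ==> length (sg r) <= H"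
 by (simp add: Jb_def)

sublocale stack_machine k bot Jb .

definition nx :: "prog => (nat => nat list) => (nat => nat list) => bool" where
 "nx p sg sg' \<longleftrightarrow> (EX T. ex p sg T sg')"

lemma nxI: "ex p sg T sg' ==> sg' = sg'' ==> nx p sg sg''"
 by (auto simp: nx_def)

lemma nx_seq: "nx p sg sg' ==> nx q sg' sg'' ==> nx (p ;; q) sg sg''"
 unfolding nx_def using ex_seq by blast

lemma nx_cond: "r < k ==> nx (if top (sg r) \<in> S then p else q) sg sg' ==> nx (Cond r S p q) sg sg'"
 unfolding nx_def using ex_condT ex_condF by (metis (full_types))

lemma nx_loopT: "top (sg r) \<in> S ==> r < k ==> nx p sg sg' ==> nx (Loop r S p) sg' sg'' ==> nx (Loop r S p) sg sg''"
 unfolding nx_def using ex_loopT by blast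

lemma nx_loopF: "top (sg r) \<notin> S ==> r < k ==> nx (Loop r S p) sg sg"
 unfolding nx_def using ex_loopF by blast

lemma nx_pop: "r < k ==> sg r = x # l ==> Jb sg ==> sg(r := l) = sg' ==> nx (pop r) sg sg'"
 using ex_pop[of r sg x l] JbD[of sg r] by (intro nxI) (auto simp: Jb_upd)

lemma nx_push: "r < k ==> 0 < s ==> Jb sg ==> length (sg r) < H ==> sg(r := s # sg r) = sg' ==> nx (push r s) sg sg'"
 using ex_push[of r s sg] by (intro nxI) (auto simp: Jb_upd)

lemma nx_skip: "Jb sg ==> nx skip sg sg"
 using ex_skip by (auto simp: nx_def)

lemma nx_clear: "r < k ==> 0 \<notin> set (sg r) ==> Jb sg ==> nx (Loop r (-{0}) (pop r)) sg (sg(r := []))"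
 using ex_clear[of r sg] JbD[of sg r] by (intro nxI) (auto simp: Jb_upd)

lemma nx_unload:
 assumes "r < k" "s < k" "r ~= s" "set (sg r) \<subseteq> {1, 2}" "Jb sg" "length (sg r) + length (sg s) <= H"
  "sg(r := [], s := rev (sg r) @ sg s) = sg'"
 shows "nx (unload r s) sg sg'"
 using ex_unload[where sg = sg, OF assms(1-4)] assms(5-7) by (intro nxI) (auto simp: Jb_upd)

lemma nx_shift:
 assumes "r < k" "s < k" "r ~= s" "0 < c" "sg r = replicate j a @ l" "top l ~= a" "Jb sg"
  "j + length (sg s) <= H" "sg(r := l, s := replicate j c @ sg s) = sg'"
 shows "nx (shift r a s c) sg sg'"
 using ex_shift[where sg = sg, OF assms(1-6)] assms(5,7-9) JbD[OF assms(7,1)] by (intro nxI) (auto simp: Jb_upd)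

text \<open>Stack 0 is the scratch space on which the run of low digits is parked, already in its
  new form.\<close>

definition inc :: "nat => prog" where
 "inc r = shift r 2 0 1 ;; Cond r {1} (pop r ;; push r 2) (push r 2) ;; shift 0 1 r 1"

lemma nx_inc:
 assumes "0 < r" "r < k" "sg r = bin n" "sg 0 = []" "Jb sg" "Suc n < 2 ^ H"
 shows "nx (inc r) sg (sg(r := bin (Suc n)))"
proof -
 obtain j l where l: "top l ~= 2" "bin n = replicate j 2 @ l"
  "bin (Suc n) = replicate j 1 @ 2 # (if l = [] then [] else tl l)" "l ~= [] --> top l = 1"
  using bin_inc by blast
 have L: "length (bin n) <= H" "length (bin (Suc n)) <= H" using assms(6) length_bin by auto
 let ?l = "if l = [] then [] else tl l"
 let ?sg1 = "sg(r := l, 0 := replicate j 1)" and ?sg2 = "sg(r := 2 # ?l, 0 := replicate j 1)"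
 have len: "length l <= H" "j <= H" "Suc (length ?l) <= H" "Suc (j + length ?l) <= H" using L l by auto
 have J: "Jb ?sg1" "Jb ?sg2" using len assms(5) by (auto simp: Jb_upd)
 have 1: "nx (shift r 2 0 1) sg ?sg1"
  using assms l len by (intro nx_shift[where j = j and l = l]) auto
 have 2: "nx (Cond r {1} (pop r ;; push r 2) (push r 2)) ?sg1 ?sg2"
 proof (cases l)
  case Nil
  have "nx (push r 2) ?sg1 ?sg2" using assms Nil J len
   by (intro nx_push) auto
  then show ?thesis using Nil assms by (intro nx_cond) auto
 next
  case (Cons x l')
  have x: "x = 1" using l(4) Cons by auto
  have "nx (pop r) ?sg1 (sg(r := l', 0 := replicate j 1))" using assms Cons J
   by (intro nx_pop) auto
  moreover have "nx (push r 2) (sg(r := l', 0 := replicate j 1)) ?sg2" using assms Cons J len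
   by (intro nx_push) (auto simp: Jb_upd)
  ultimately show ?thesis using Cons x assms by (intro nx_cond) (auto intro: nx_seq)
 qed
 have 3: "nx (shift 0 1 r 1) ?sg2 (sg(r := bin (Suc n)))"
  using assms len J(2) l(3) by (intro nx_shift[where j = j and l = "[]"]) (auto simp: fun_eq_iff)
 show ?thesis unfolding inc_def using 1 2 3 nx_seq by blast
qed

definition dec :: "nat => prog" where
 "dec r = shift r 1 0 2 ;; pop r ;; Cond r {0} skip (push r 1) ;; shift 0 2 r 2"

lemma nx_dec:
 assumes "0 < r" "r < k" "sg r = bin n" "sg 0 = []" "Jb sg" "0 < n" "n < 2 ^ H"
 shows "nx (dec r) sg (sg(r := bin (n - 1)))"
proof -
 obtain j l where l: "bin n = replicate j 1 @ 2 # l" "l ~= [] --> top l ~= 0"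
  "bin (n - 1) = replicate j 2 @ (if l = [] then [] else 1 # l)"
  using bin_dec assms(6) by blast
 have L: "length (bin n) <= H" "length (bin (n - 1)) <= H" using assms(7) length_bin by auto
 let ?l = "if l = [] then [] else 1 # l"
 let ?sg1 = "sg(r := 2 # l, 0 := replicate j 2)" and ?sg2 = "sg(r := l, 0 := replicate j 2)"
  and ?sg3 = "sg(r := ?l, 0 := replicate j 2)"
 have len: "length l < H" "j <= H" "j + length ?l <= H" using L l by auto
 have J: "Jb ?sg1" "Jb ?sg2" "Jb ?sg3" using len assms(5) by (auto simp: Jb_upd)
 have 1: "nx (shift r 1 0 2) sg ?sg1"
  using assms l len by (intro nx_shift[where j = j and l = "2 # l"]) auto
 have 2: "nx (pop r) ?sg1 ?sg2" using assms J by (intro nx_pop) auto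
 have 3: "nx (Cond r {0} skip (push r 1)) ?sg2 ?sg3"
 proof (cases "l = []")
  case True
  then show ?thesis using assms nx_skip[OF J(3)] by (intro nx_cond) auto
 next
  case False
  have "nx (push r 1) ?sg2 ?sg3" using assms False J len by (intro nx_push) auto
  then show ?thesis using False assms l(2) by (intro nx_cond) auto
 qed
 have 4: "nx (shift 0 2 r 2) ?sg3 (sg(r := bin (n - 1)))"
  using assms len J(3) l(3) by (intro nx_shift[where j = j and l = "[]"]) (auto simp: fun_eq_iff)
 show ?thesis unfolding dec_def using 1 2 3 4 nx_seq by blast
qed

definition clear :: "nat => prog" where
 "clear r = Loop r (-{0}) (pop r)"

definition spread :: "nat => nat => prog" where
 "spread r s = Loop 0 {1, 2} (Cond 0 {2} (pop 0 ;; push r 2 ;; push s 2) (pop 0 ;; push r 1 ;; push s 1))"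

lemma nx_spread:
 assumes "0 < r" "0 < s" "r < k" "s < k" "r ~= s" "set (sg 0) \<subseteq> {1, 2}" "Jb sg"
  "length (sg 0) + length (sg r) <= H" "length (sg 0) + length (sg s) <= H"
 shows "nx (spread r s) sg (sg(0 := [], r := rev (sg 0) @ sg r, s := rev (sg 0) @ sg s))"
 using assms(6-9)
proof (induction "sg 0" arbitrary: sg)
 case Nil
 then have "sg(0 := [], r := rev (sg 0) @ sg r, s := rev (sg 0) @ sg s) = sg" by (auto simp flip: Nil.hyps)
 moreover have "nx (spread r s) sg sg"
  using assms(3) unfolding spread_def by (intro nx_loopF) (auto simp flip: Nil.hyps)
 ultimately show ?case by metis
next
 case (Cons x l)
 have s0: "sg 0 = x # l" using Cons.hyps(2) by simp
 let ?sg1 = "sg(0 := l)" and ?sg2 = "sg(0 := l, r := x # sg r)" and ?sg3 = "sg(0 := l, r := x # sg r, s := x # sg s)"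
 have len: "length l <= H" "length l + Suc (length (sg r)) <= H" "length l + Suc (length (sg s)) <= H"
  using Cons.prems s0 by auto
 have J: "Jb ?sg1" "Jb ?sg2" "Jb ?sg3" using Cons.prems(2) len by (auto simp: Jb_upd)
 have x: "x = 1 \<or> x = 2" using Cons.prems(1) s0 by auto
 have 1: "nx (pop 0) sg ?sg1" using assms(3) s0 Cons.prems(2) by (intro nx_pop) auto
 have 2: "nx (push r x) ?sg1 ?sg2" using assms(1,3) x J len by (intro nx_push) auto
 have 3: "nx (push s x) ?sg2 ?sg3" using assms x J len by (intro nx_push) auto
 have 4: "nx (Cond 0 {2} (pop 0 ;; push r 2 ;; push s 2) (pop 0 ;; push r 1 ;; push s 1)) sg ?sg3"
  using x 1 2 3 assms(3) s0 by (intro nx_cond) (auto intro!: nx_seq)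
 have "nx (spread r s) ?sg3 (?sg3(0 := [], r := rev (?sg3 0) @ ?sg3 r, s := rev (?sg3 0) @ ?sg3 s))"
  using Cons.prems(1) assms J(3) len s0 by (intro Cons.hyps(1)) auto
 moreover have "?sg3(0 := [], r := rev (?sg3 0) @ ?sg3 r, s := rev (?sg3 0) @ ?sg3 s) =
   sg(0 := [], r := rev (sg 0) @ sg r, s := rev (sg 0) @ sg s)"
  using assms s0 by (auto simp: fun_eq_iff)
 ultimately show ?case unfolding spread_def
  using x s0 assms(3) by (intro nx_loopT[OF _ _ 4]) auto
qed

text \<open>The source is emptied onto stack 0 and then restored while the target is filled; the two
  reversals cancel.\<close>

definition dup :: "nat => nat => prog" where
 "dup r s = clear s ;; unload r 0 ;; spread r s"

lemma nx_dup:
 assumes "0 < r" "0 < s" "r < k" "s < k" "r ~= s" "set (sg r) \<subseteq> {1, 2}" "sg 0 = []" "0 \<notin> set (sg s)" "Jb sg"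
 shows "nx (dup r s) sg (sg(s := sg r))"
proof -
 have len: "length (sg r) <= H" using assms(3,9) JbD by auto
 let ?sg1 = "sg(s := [])" and ?sg2 = "sg(s := [], r := [], 0 := rev (sg r))"
 have J: "Jb ?sg1" "Jb ?sg2" using len assms(9) by (auto simp: Jb_upd)
 have 1: "nx (clear s) sg ?sg1" unfolding clear_def using assms by (intro nx_clear) auto
 have 2: "nx (unload r 0) ?sg1 ?sg2" using assms J len by (intro nx_unload) auto
 have "nx (spread r s) ?sg2 (?sg2(0 := [], r := rev (?sg2 0) @ ?sg2 r, s := rev (?sg2 0) @ ?sg2 s))"
  using assms J len by (intro nx_spread) auto
 moreover have "?sg2(0 := [], r := rev (?sg2 0) @ ?sg2 r, s := rev (?sg2 0) @ ?sg2 s) = sg(s := sg r)"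
  using assms by (auto simp: fun_eq_iff)
 ultimately show ?thesis unfolding dup_def using 1 2 nx_seq by metis
qed

end

section \<open>Primitive recursive terms, run in the space of their largest value\<close>

section \<open>Primitive recursive terms\<close>

datatype pr = PVar nat | PZero | PSuc pr | PLet pr pr | PRec pr pr pr

definition cons_env :: "nat => (nat => nat) => nat => nat" (infixr "##" 65) where
 "x ## e = case_nat x e"

lemma cons_env_simps [simp]: "(x ## e) 0 = x" "(x ## e) (Suc i) = e i"
 by (simp_all add: cons_env_def)

fun eval :: "pr => (nat => nat) => nat" where
 "eval (PVar i) e = e i"
| "eval PZero e = 0"
| "eval (PSuc t) e = Suc (eval t e)"
| "eval (PLet t p) e = eval p (eval t e ## e)"
| "eval (PRec c b s) e = rec_nat (eval b e) (%i r. eval s (i ## r ## e)) (eval c e)"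

text \<open>The largest value that occurs in the evaluation.\<close>

fun peak :: "pr => (nat => nat) => nat" where
 "peak (PVar i) e = e i"
| "peak PZero e = 0"
| "peak (PSuc t) e = Suc (peak t e)"
| "peak (PLet t p) e = max (peak t e) (peak p (eval t e ## e))"
| "peak (PRec c b s) e = Max ({peak c e, peak b e} \<union>
  (%i. peak s (i ## rec_nat (eval b e) (%i r. eval s (i ## r ## e)) i ## e)) ` {..<eval c e})"

lemma eval_le_peak: "eval p e <= peak p e"
proof (induction p arbitrary: e)
 case (PLet p1 p2)
 then show ?case by (simp add: le_max_iff_disj)
next
 case (PRec c b s)
 show ?case
 proof (cases "eval c e")
  case 0
  then show ?thesis using PRec(2)[of e] by (auto simp: Max_ge_iff)
 next
  case (Suc n)
  let ?r = "rec_nat (eval b e) (%i r. eval s (i ## r ## e))"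
  have "eval s (n ## ?r n ## e) <= peak s (n ## ?r n ## e)" by (rule PRec)
  also have "\<dots> \<le> peak (PRec c b s) e" using Suc unfolding peak.simps by (intro Max_ge) auto
  finally show ?thesis using Suc by simp
 qed
qed auto

fun closed_pr :: "nat => pr => bool" where
 "closed_pr n (PVar i) \<longleftrightarrow> i < n"
| "closed_pr n PZero \<longleftrightarrow> True"
| "closed_pr n (PSuc t) \<longleftrightarrow> closed_pr n t"
| "closed_pr n (PLet t p) \<longleftrightarrow> closed_pr n t & closed_pr (Suc n) p"
| "closed_pr n (PRec c b s) \<longleftrightarrow> closed_pr n c & closed_pr n b & closed_pr (Suc (Suc n)) s"

fun regs :: "pr => nat" where
 "regs (PVar i) = 0"
| "regs PZero = 0"
| "regs (PSuc t) = regs t"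
| "regs (PLet t p) = max (regs t) (1 + regs p)"
| "regs (PRec c b s) = max (regs b) (max (1 + regs c) (3 + regs s))"

context num_machine begin

text \<open>The value of variable \<open>i\<close> is kept in register \<open>rh ! i\<close>; the result goes to register \<open>d\<close>, and the
 registers above \<open>d\<close> are scratch.\<close>

fun compile :: "pr => nat list => nat => prog" where
 "compile (PVar i) rh d = dup (rh ! i) d"
| "compile PZero rh d = clear d"
| "compile (PSuc t) rh d = compile t rh d ;; inc d"
| "compile (PLet t p) rh d = compile t rh d ;; compile p (d # rh) (d + 1) ;; dup (d + 1) d"
| "compile (PRec c b s) rh d = compile b rh d ;; compile c rh (d + 1) ;; clear (d + 2) ;;
   Loop (d + 1) (-{0}) (compile s ((d + 2) # d # rh) (d + 3) ;; dup (d + 3) d ;; inc (d + 2) ;; dec (d + 1))"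

definition st :: "(nat => nat) => nat => nat list" where
 "st nv r = (if r = 0 then [] else bin (nv r))"

definition small :: "(nat => nat) => bool" where
 "small nv \<longleftrightarrow> (ALL r. nv r < 2 ^ H)"

lemma small_upd: "small nv ==> n < 2 ^ H ==> small (nv(r := n))"
 by (simp add: small_def)

lemma smallD: "small nv ==> nv r < 2 ^ H"
 by (simp add: small_def)

lemma Jb_st: "small nv ==> Jb (st nv)"
 by (auto simp: Jb_def st_def small_def length_bin)

lemma st_upd: "0 < r ==> (st nv)(r := bin n) = st (nv(r := n))"
 by (auto simp: st_def fun_eq_iff)

lemma st_simps [simp]: "0 < r ==> st nv r = bin (nv r)" "st nv 0 = []"
 by (simp_all add: st_def)

lemma st_inc: "0 < r ==> r < k ==> small nv ==> Suc (nv r) < 2 ^ H ==> nx (inc r) (st nv) (st (nv(r := Suc (nv r))))"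
 using nx_inc[of r "st nv"] by (simp add: Jb_st st_upd)

lemma st_dec: "0 < r ==> r < k ==> small nv ==> 0 < nv r ==> nx (dec r) (st nv) (st (nv(r := nv r - 1)))"
 using nx_dec[of r "st nv"] by (simp add: Jb_st st_upd smallD)

lemma set_bin_no_0: "0 \<notin> set (bin n)"
 using set_bin[of n] by auto

lemma st_dup: "0 < r ==> 0 < s ==> r < k ==> s < k ==> r ~= s ==> small nv ==> nx (dup r s) (st nv) (st (nv(s := nv r)))"
 using nx_dup[of r s "st nv"] set_bin[of "nv r"] by (simp add: Jb_st st_upd set_bin_no_0)

lemma st_clear: "0 < r ==> r < k ==> small nv ==> nx (clear r) (st nv) (st (nv(r := 0)))"
 using nx_clear[of r "st nv"] st_upd[of r nv 0] by (simp add: Jb_st set_bin_no_0 clear_def)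

lemma top_bin: "top (bin n) = 0 \<longleftrightarrow> n = 0"
 using set_bin[of n] by (cases "bin n") (auto simp: dest: arg_cong[of _ _ "%l. l = []"])

text \<open>The space is governed by \<open>peak\<close>: as long as every value that occurs is
  below \<open>2 ^ H\<close>, each register fits into \<open>H\<close> digits, however long the
  loops run.\<close>

lemma compile_correct:
 assumes "closed_pr (length rh) p" "\<forall>i<length rh. 0 < rh ! i & rh ! i < d & nv (rh ! i) = e i" "0 < d"
  "d + regs p < k" "small nv" "peak p e < 2 ^ H"
 shows "\<exists>nv'. nx (compile p rh d) (st nv) (st nv') & nv' d = eval p e & (ALL r. r < d \<or> k <= r --> nv' r = nv r) & small nv'"
 using assms
proof (induction p arbitrary: rh d nv e)
 case (PVar i)
 let ?nv = "nv(d := nv (rh ! i))"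
 have i: "0 < rh ! i" "rh ! i < d" "nv (rh ! i) = e i" using PVar by auto
 have "nx (dup (rh ! i) d) (st nv) (st ?nv)" using PVar i by (intro st_dup) auto
 moreover have "small ?nv" using PVar.prems(5) by (simp add: small_def)
 moreover have "?nv d = eval (PVar i) e" "ALL r. r < d \<or> k <= r --> ?nv r = nv r" using i PVar.prems(4) by auto
 ultimately show ?case unfolding compile.simps by blast
next
 case PZero
 let ?nv = "nv(d := 0)"
 have "nx (clear d) (st nv) (st ?nv)" using PZero by (intro st_clear) auto
 moreover have "small ?nv" using PZero.prems(5) by (simp add: small_def)
 moreover have "?nv d = eval PZero e" "ALL r. r < d \<or> k <= r --> ?nv r = nv r" using PZero.prems(4) by auto
 ultimately show ?case unfolding compile.simps by blast
next
 case (PSuc p)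
 obtain nv' where n: "nx (compile p rh d) (st nv) (st nv')" "nv' d = eval p e"
   "ALL r. r < d \<or> k <= r --> nv' r = nv r" "small nv'"
  using PSuc.IH[of rh d nv e] PSuc.prems by auto
 have v: "Suc (nv' d) < 2 ^ H" using PSuc.prems(6) eval_le_peak[of p e] n(2) by auto
 have "nx (inc d) (st nv') (st (nv'(d := Suc (nv' d))))" using PSuc.prems n v by (intro st_inc) auto
 then have "nx (compile (PSuc p) rh d) (st nv) (st (nv'(d := Suc (nv' d))))" using n(1) nx_seq by auto
 moreover have "(nv'(d := Suc (nv' d))) d = eval (PSuc p) e" "small (nv'(d := Suc (nv' d)))"
  "ALL r. r < d \<or> k <= r --> (nv'(d := Suc (nv' d))) r = nv r"
  using n v PSuc.prems(4) by (auto simp: small_def)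
 ultimately show ?case by blast
next
 case (PLet t p)
 have kk: "d + regs t < k" "d + 1 + regs p < k" using PLet.prems(4) by auto
 obtain nv1 where n1: "nx (compile t rh d) (st nv) (st nv1)" "nv1 d = eval t e"
   "ALL r. r < d \<or> k <= r --> nv1 r = nv r" "small nv1"
  using PLet.IH(1)[of rh d nv e] PLet.prems kk by auto
 have "\<forall>i<length (d # rh). 0 < (d # rh) ! i & (d # rh) ! i < d + 1 & nv1 ((d # rh) ! i) = (eval t e ## e) i"
  using PLet.prems(2,3) n1 by (auto simp: nth_Cons less_SucI split: nat.splits)
 then obtain nv2 where n2: "nx (compile p (d # rh) (d + 1)) (st nv1) (st nv2)" "nv2 (d + 1) = eval p (eval t e ## e)"
   "ALL r. r < d + 1 \<or> k <= r --> nv2 r = nv1 r" "small nv2"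
  using PLet.IH(2)[of "d # rh" "d + 1" nv1 "eval t e ## e"] PLet.prems n1(4) kk by auto
 have 3: "nx (dup (d + 1) d) (st nv2) (st (nv2(d := nv2 (d + 1))))" using PLet.prems n2 by (intro st_dup) auto
 have "nx (compile (PLet t p) rh d) (st nv) (st (nv2(d := nv2 (d + 1))))"
  unfolding compile.simps using n1(1) n2(1) 3 by (blast intro: nx_seq)
 moreover have "(nv2(d := nv2 (d + 1))) d = eval (PLet t p) e" "small (nv2(d := nv2 (d + 1)))"
  "ALL r. r < d \<or> k <= r --> (nv2(d := nv2 (d + 1))) r = nv r"
  using n1 n2 PLet.prems(4) smallD[OF n2(4), of "d + 1"] by (auto intro!: small_upd)
 ultimately show ?case by blast
next
 case (PRec c b s)
 let ?r = "rec_nat (eval b e) (%i r. eval s (i ## r ## e))"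
 have kk: "d + regs b < k" "d + 1 + regs c < k" "d + 3 + regs s < k" using PRec.prems(4) by auto
 have pk: "peak c e < 2 ^ H" "peak b e < 2 ^ H" and pks: "!!i. i < eval c e ==> peak s (i ## ?r i ## e) < 2 ^ H"
  using PRec.prems(6) by (auto simp: Max_less_iff)
 obtain nv1 where n1: "nx (compile b rh d) (st nv) (st nv1)" "nv1 d = eval b e"
   "ALL r. r < d \<or> k <= r --> nv1 r = nv r" "small nv1"
  using PRec.IH(2)[of rh d nv e] PRec.prems pk kk by auto
 have "\<forall>i<length rh. 0 < rh ! i & rh ! i < d + 1 & nv1 (rh ! i) = e i"
  using PRec.prems(2) n1(3) by force
 then obtain nv2 where n2: "nx (compile c rh (d + 1)) (st nv1) (st nv2)" "nv2 (d + 1) = eval c e"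
   "ALL r. r < d + 1 \<or> k <= r --> nv2 r = nv1 r" "small nv2"
  using PRec.IH(1)[of rh "d + 1" nv1 e] PRec.prems pk n1(4) kk by auto
 define nv3 where "nv3 = nv2(d + 2 := 0)"
 have n3: "nx (clear (d + 2)) (st nv2) (st nv3)"
  unfolding nv3_def using PRec.prems n2 by (intro st_clear) auto
 let ?B = "compile s ((d + 2) # d # rh) (d + 3) ;; dup (d + 3) d ;; inc (d + 2) ;; dec (d + 1)"
 \<comment> \<open>Register \<open>d + 1\<close> counts down while \<open>d + 2\<close> counts up,
   so their sum remains \<open>eval c e\<close>, and \<open>d\<close> holds the partial result that
   belongs to the index in \<open>d + 2\<close>.\<close>
 have loop: "\<exists>nv'. nx (Loop (d + 1) (-{0}) ?B) (st mm) (st nv') & nv' d = ?r (eval c e) &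
   (ALL r. r < d \<or> k <= r --> nv' r = mm r) & small nv'"
  if "mm (d + 1) = j" "mm (d + 2) + j = eval c e" "mm d = ?r (mm (d + 2))"
   "ALL r. r < d \<or> k <= r --> mm r = nv r" "small mm" for mm j
  using that
 proof (induction j arbitrary: mm)
  case 0
  have "nx (Loop (d + 1) (-{0}) ?B) (st mm) (st mm)" using 0 PRec.prems by (intro nx_loopF) auto
  then show ?case using 0 by auto
 next
  case (Suc j)
  let ?i = "mm (d + 2)" and ?rh = "(d + 2) # d # rh" and ?e = "mm (d + 2) ## ?r (mm (d + 2)) ## e"
  have i: "?i < eval c e" using Suc.prems(2) by simp
  have "\<forall>i<length rh. 0 < rh ! i & rh ! i < d + 3 & mm (rh ! i) = e i"
   using PRec.prems(2) Suc.prems(4) by force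
  then have "\<forall>i<length ?rh. 0 < ?rh ! i & ?rh ! i < d + 3 & mm (?rh ! i) = ?e i"
   using PRec.prems(3) Suc.prems(3) by (auto simp: nth_Cons split: nat.splits)
  then obtain mm1 where m1: "nx (compile s ?rh (d + 3)) (st mm) (st mm1)" "mm1 (d + 3) = eval s ?e"
   "ALL r. r < d + 3 \<or> k <= r --> mm1 r = mm r" "small mm1"
   using PRec.IH(3)[of ?rh "d + 3" mm ?e] PRec.prems pks[OF i] Suc.prems(5) kk by auto
  define mm2 where "mm2 = mm1(d := mm1 (d + 3))"
  define mm3 where "mm3 = mm2(d + 2 := Suc (mm2 (d + 2)))"
  define mm4 where "mm4 = mm3(d + 1 := mm3 (d + 1) - 1)"
  have s2: "small mm2" unfolding mm2_def using m1(4) by (simp add: small_def)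
  have 2: "nx (dup (d + 3) d) (st mm1) (st mm2)"
   unfolding mm2_def using PRec.prems m1 by (intro st_dup) auto
  have "Suc ?i < 2 ^ H \<or> Suc ?i = eval c e" using i pk(1) eval_le_peak[of c e] by linarith
  then have le: "Suc ?i < 2 ^ H" using pk(1) eval_le_peak[of c e] by auto
  have d2: "mm2 (d + 2) = ?i" "mm2 (d + 1) = Suc j" using m1(3) Suc.prems(1) by (auto simp: mm2_def)
  have 3: "nx (inc (d + 2)) (st mm2) (st mm3)"
   unfolding mm3_def using PRec.prems s2 le d2 by (intro st_inc) auto
  have s3: "small mm3" unfolding mm3_def using s2 le d2 by (simp add: small_def)
  have 4: "nx (dec (d + 1)) (st mm3) (st mm4)"
   unfolding mm4_def using PRec.prems s3 d2 by (intro st_dec) (auto simp: mm3_def)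
  have s4: "small mm4" unfolding mm4_def using s3 less_imp_diff_less by (simp add: small_def)
  have body: "nx ?B (st mm) (st mm4)" using m1(1) 2 3 4 by (blast intro: nx_seq)
  have k: "d + 3 < k" using PRec.prems(4) by auto
  have a: "mm4 (d + 1) = j" "mm4 (d + 2) + j = eval c e" "mm4 d = ?r (mm4 (d + 2))"
   using d2 m1(2) Suc.prems(2) by (auto simp: mm4_def mm3_def mm2_def)
  have fr: "ALL r. r < d \<or> k <= r --> mm4 r = nv r" "ALL r. r < d \<or> k <= r --> mm4 r = mm r"
   using m1(3) Suc.prems(4) k by (auto simp: mm4_def mm3_def mm2_def)
  obtain nv' where n: "nx (Loop (d + 1) (-{0}) ?B) (st mm4) (st nv')" "nv' d = ?r (eval c e)"
   "ALL r. r < d \<or> k <= r --> nv' r = mm4 r" "small nv'"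
   using Suc.IH[OF a fr(1) s4] by blast
  have "nx (Loop (d + 1) (-{0}) ?B) (st mm) (st nv')"
   using Suc.prems(1) k by (intro nx_loopT[OF _ _ body n(1)]) (auto simp: top_bin)
  then show ?case using n fr(2) by auto
 qed
 have "small nv3" unfolding nv3_def using n2(4) by (simp add: small_def)
 moreover have "ALL r. r < d \<or> k <= r --> nv3 r = nv r" using n1 n2 PRec.prems(4) by (auto simp: nv3_def)
 ultimately obtain nv' where n: "nx (Loop (d + 1) (-{0}) ?B) (st nv3) (st nv')" "nv' d = ?r (eval c e)"
   "ALL r. r < d \<or> k <= r --> nv' r = nv3 r" "small nv'"
  using loop[of nv3 "eval c e"] n1 n2 by (auto simp: nv3_def)
 have "nx (compile (PRec c b s) rh d) (st nv) (st nv')"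
  using n1(1) n2(1) n3 n(1) unfolding compile.simps by (blast intro: nx_seq)
 then show ?case using n \<open>ALL r. r < d \<or> k <= r --> nv3 r = nv r\<close> by auto
qed

end

lemma stk_input:
 "j <= length w ==> stk (int (length w)) (snd (input_tape w)) (int j) (map bit_symbol (drop j w))"
proof (induction "length w - j" arbitrary: j)
 case 0
 then show ?case by (simp add: input_tape_def)
next
 case (Suc m)
 then have j: "j < length w" by simp
 have "stk (int (length w)) (snd (input_tape w)) (int (Suc j)) (map bit_symbol (drop (Suc j) w))"
  using Suc(2) j by (intro Suc(1)) auto
 then show ?case using j Cons_nth_drop_Suc[OF j, symmetric]
  by (simp add: input_tape_def bit_symbol_def ac_simps)
qed

lemma (in stack_machine) rep_init:
 assumes "0 < k" "b = (%r. if r = 0 then int (length w) else 0)"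
 shows "rep (input_tape w # replicate k (0, %_. 0)) ((%_. [])(0 := map bit_symbol w))"
proof -
 have "stk (b r) (snd ((input_tape w # replicate k (0, %_. 0)) ! r))
  (fst ((input_tape w # replicate k (0, %_. 0)) ! r)) (((%_. [])(0 := map bit_symbol w)) r)" if "r < k" for r
 proof (cases r)
  case 0
  then show ?thesis using stk_input[of 0 w] assms(2) by (simp add: input_tape_def)
 qed (use that assms(2) in auto)
 then show ?thesis using assms(1) by (auto simp: rep_def outp_def nth_Cons')
qed

text \<open>The word as a binary number, its first letter least significant, with an additional
  leading one that records the length.\<close>

fun code :: "bool list => nat" where
 "code [] = 1"
| "code (b # w) = 2 * code w + of_bool b"

lemma code_pos: "0 < code w"
 by (induction w) auto

lemma bin_code: "bin (code w) = map bit_symbol w @ [2]"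
proof (induction w)
 case Nil
 then show ?case using bin_Suc_double[of 0] by simp
next
 case (Cons b w)
 then show ?case using bin_double[OF code_pos[of w]] bin_Suc_double[of "code w"] by (simp add: bit_symbol_def)
qed

lemma length_code: "code w < 2 ^ H ==> length w < H"
 using length_bin[of "code w" H] by (simp add: bin_code)

theorem pr_dspace:
 assumes cl: "closed_pr (Suc m) p"
  and L: "!!w. eval p (code w ## (%_. 0)) ~= 0 \<longleftrightarrow> w \<in> L"
  and pk: "!!w. peak p (code w ## (%_. 0)) < 2 ^ H w" "!!w. code w < 2 ^ H w"
  and H: "!!w. H w <= d * s (length w) + d"
 shows "L \<in> dspace s"
proof -
 \<comment> \<open>The word is reversed onto stack 1 and back onto stack 2, on top of the digit that
   is the leading one of \<open>code w\<close>. All variables except the first are read from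
   register 1, which is empty again and hence has the value 0.\<close>
 define P where "P = stack_machine.unload 0 1 ;; stack_machine.push 2 2 ;; stack_machine.unload 1 2 ;;
   num_machine.compile p (2 # replicate m 1) 3"
 obtain k0 m0 where ok0: "prog_ok k0 m0 P" using prog_ok_ex by blast
 define k where "k = max k0 (4 + regs p)"
 define bot where "bot w = (%r::nat. if r = 0 then int (length w) else (0::int))" for w :: "bool list"
 define I where "I w = stack_machine.HJ k (bot w) (num_machine.Jb k (H w))" for w
 have ok: "prog_ok (Suc k) (max m0 3) P" using prog_ok_mono[OF ok0] by (simp add: k_def)
 have run: "(EX t ts'. bs (I w) P (input_tape w # replicate k (0, %_. 0)) t ts' &
   (scanned (ts' ! 3) ~= 0 \<longleftrightarrow> w \<in> L)) & I w (input_tape w # replicate k (0, %_. 0))" for w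
 proof -
  interpret num_machine k "bot w" "H w" .
  let ?ts = "input_tape w # replicate k (0, %_. 0)"
  define sg0 where "sg0 = ((%_. [])(0 := map bit_symbol w) :: nat => nat list)"
  define sg1 where "sg1 = ((%_. [])(1 := rev (map bit_symbol w)) :: nat => nat list)"
  define nv where "nv = ((%_. 0)(2 := code w) :: nat => nat)"
  have k: "3 < k" "3 + regs p < k" by (auto simp: k_def)
  have n: "length w < H w" using length_code pk(2) by blast
  have bits: "set (map bit_symbol w) \<subseteq> {1, 2}" by (auto simp: bit_symbol_def)
  have rep0: "rep ?ts sg0" unfolding sg0_def using k by (intro rep_init) (auto simp: bot_def)
  have J: "Jb sg0" "Jb sg1" "Jb (sg1(2 := [2]))" using n by (auto simp: Jb_def sg0_def sg1_def)
  have 1: "nx (unload 0 1) sg0 sg1"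
   using k bits J n by (intro nx_unload) (auto simp: sg0_def sg1_def fun_eq_iff)
  have 2: "nx (push 2 2) sg1 (sg1(2 := [2]))"
   using k J n by (intro nx_push) (auto simp: sg1_def)
  have "bin (code w) = map bit_symbol w @ [2]" by (rule bin_code)
  then have 3: "nx (unload 1 2) (sg1(2 := [2])) (st nv)"
   using k bits J n by (intro nx_unload) (auto simp: sg1_def nv_def st_def fun_eq_iff rev_map)
  have "\<exists>nv'. nx (compile p (2 # replicate m 1) 3) (st nv) (st nv') & nv' 3 = eval p (code w ## (%_. 0)) &
   (ALL r. r < 3 \<or> k <= r --> nv' r = nv r) & small nv'"
   using cl pk k by (intro compile_correct) (auto simp: nv_def small_def nth_Cons cons_env_def split: nat.splits)
  then obtain nv' where 4: "nx (compile p (2 # replicate m 1) 3) (st nv) (st nv')" "nv' 3 = eval p (code w ## (%_. 0))" by blast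
  have "nx P sg0 (st nv')" unfolding P_def using 1 2 3 4(1) by (blast intro: nx_seq)
  then obtain t ts' where b: "bs (I w) P ?ts t ts'" "rep ts' (st nv')"
   using rep0 unfolding nx_def ex_def I_def by blast
  have "scanned (ts' ! 3) = top (bin (nv' 3))" using rep_scanned[OF b(2)] k by simp
  then have "scanned (ts' ! 3) ~= 0 \<longleftrightarrow> w \<in> L" using 4(2) L by (simp add: top_bin)
  then show ?thesis using b(1) rep_HJ[OF rep0 J(1)] unfolding I_def by blast
 qed
 have "\<bar>fst (ts ! i)\<bar> \<le> int (2 * H w)" if hyp: "I w ts" "i < Suc k" for w ts i
 proof -
  interpret num_machine k "bot w" "H w" .
  obtain sg where sg: "Jb sg" "\<forall>r<k. fst (ts ! r) = bot w r - int (length (sg r))" "fst (ts ! k) = int (length (sg k))"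
   using hyp(1) unfolding I_def HJ_def by blast
  have "length w < H w" using length_code pk(2) by blast
  moreover have "length (sg i) <= H w" using sg(1) hyp(2) by (simp add: Jb_def)
  ultimately show ?thesis using sg hyp(2) by (cases "i = k") (auto simp: bot_def)
 qed
 moreover have "2 * H w <= (2 * d) * s (length w) + 2 * d" for w using H[of w] by simp
 ultimately show ?thesis
  using prog_dspace[OF ok, of 3 I L "%w. 2 * H w" "2 * d" s] run by (simp add: k_def)
qed

section \<open>Bounded recursion with polynomially bounded values\<close>

section \<open>Functions definable with polynomially bounded values\<close>

text \<open>The base of the polynomial bounds: being at least 2, it allows constants and sums to be
  absorbed into the exponent.\<close>

definition sm :: "nat => (nat => nat) => nat" where
 "sm n e = 2 + (\<Sum>i<n. e i)"

lemma sm_ge_2: "2 <= sm n e"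
 by (simp add: sm_def)

lemma sm_pos: "1 <= sm n e"
 by (simp add: sm_def)

lemma sm_mono: "n <= m ==> sm n e <= sm m e"
 unfolding sm_def by (auto intro!: sum_mono2)

definition bnd :: "((nat => nat) => nat) => bool" where
 "bnd g \<longleftrightarrow> (EX n k. ALL e. g e <= sm n e ^ k)"

lemma bnd_le: "bnd g ==> (!!e. h e <= g e) ==> bnd h"
 unfolding bnd_def by (meson le_trans)

lemma sm_power_mono: "n <= m ==> k <= l ==> sm n e ^ k <= sm m e ^ l"
 by (meson power_mono power_increasing sm_mono sm_pos le_trans zero_le)

lemma bndE2:
 assumes "bnd g" "bnd h"
 obtains n k where "!!e. g e <= sm n e ^ k" "!!e. h e <= sm n e ^ k"
proof -
 obtain n k m l where *: "ALL e. g e <= sm n e ^ k" "ALL e. h e <= sm m e ^ l" using assms by (auto simp: bnd_def)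
 show ?thesis
  by (rule that[of "max n m" "max k l"])
   (meson * le_trans sm_power_mono max.cobounded1 max.cobounded2)+
qed

lemma bnd_add: assumes "bnd g" "bnd h" shows "bnd (%e. g e + h e)"
proof -
 obtain n k where *: "!!e. g e <= sm n e ^ k" "!!e. h e <= sm n e ^ k" using bndE2[OF assms] by blast
 have "g e + h e <= sm n e ^ Suc k" for e
 proof -
  have "g e + h e <= 2 * sm n e ^ k" using *[of e] by simp
  also have "\<dots> \<le> sm n e * sm n e ^ k" using sm_ge_2 by simp
  finally show ?thesis by simp
 qed
 then show ?thesis unfolding bnd_def by blast
qed

lemma bnd_mult: assumes "bnd g" "bnd h" shows "bnd (%e. g e * h e)"
proof -
 obtain n k where *: "!!e. g e <= sm n e ^ k" "!!e. h e <= sm n e ^ k" using bndE2[OF assms] by blast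
 have "g e * h e <= sm n e ^ (k + k)" for e
  using mult_le_mono[OF *(1)[of e] *(2)[of e]] by (simp add: power_add)
 then show ?thesis unfolding bnd_def by blast
qed

lemma bnd_const: "bnd (%e. c)"
proof -
 have "c <= sm 0 e ^ c" for e using less_exp[of c] by (simp add: sm_def less_imp_le numeral_2_eq_2)
 then show ?thesis unfolding bnd_def by blast
qed

lemma bnd_var: "bnd (%e. e i)"
 unfolding bnd_def
proof (intro exI allI)
 fix e :: "nat => nat"
 have "e i <= (\<Sum>j<Suc i. e j)" by simp
 then show "e i <= sm (Suc i) e ^ 1" by (simp add: sm_def)
qed

lemma bnd_power: "bnd g ==> bnd (%e. g e ^ k)"
 by (induction k) (auto intro: bnd_mult bnd_const)

lemma bnd_max: "bnd g ==> bnd h ==> bnd (%e. max (g e) (h e))"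
 by (rule bnd_le[OF bnd_add[of g h]]) auto

lemma bnd_sum: "bnd (%e. \<Sum>i<n. e i)"
 by (induction n) (auto intro: bnd_add bnd_const bnd_var)

lemma bnd_sm: "bnd (sm n)"
 using bnd_add[OF bnd_const bnd_sum, of 2 n] by (simp add: sm_def[abs_def])

lemma bnd_Suc: "bnd f ==> bnd (%e. Suc (f e))"
 using bnd_add[OF bnd_const[of 1], of f] by simp

text \<open>In the spirit of Grzegorczyk's class of that name. Values polynomial in the arguments
  have linearly many digits, so such functions run in linear space; for this, intermediate values
  are bounded and not only the result.\<close>

definition E2 :: "((nat => nat) => nat) => bool" where
 "E2 f \<longleftrightarrow> (EX p n. closed_pr n p & (ALL e. eval p e = f e) & bnd (peak p))"

lemma E2_bnd: "E2 f ==> bnd f"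
 unfolding E2_def by (metis bnd_le eval_le_peak)

lemma closed_pr_mono: "closed_pr n p ==> n <= m ==> closed_pr m p"
 by (induction p arbitrary: n m) auto

lemma cons_env_agree: "(\<forall>i<n. e i = e' i) ==> \<forall>i<Suc n. (x ## e) i = (x ## e') i"
 by (auto simp: less_Suc_eq_0_disj)

lemma eval_cong: "closed_pr n p ==> (\<forall>i<n. e i = e' i) ==> eval p e = eval p e'"
proof (induction p arbitrary: n e e')
 case (PLet t p)
 have "eval t e = eval t e'" using PLet by auto
 moreover have "eval p (eval t e' ## e) = eval p (eval t e' ## e')"
  using PLet.IH(2)[OF _ cons_env_agree[OF PLet.prems(2)]] PLet.prems(1) by simp
 ultimately show ?case by simp
next
 case (PRec c b s)
 have "eval s (i ## r ## e) = eval s (i ## r ## e')" for i r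
  using PRec.IH(3)[OF _ cons_env_agree[OF cons_env_agree[OF PRec.prems(2)]]] PRec.prems(1) by simp
 moreover have "eval c e = eval c e'" "eval b e = eval b e'" using PRec by auto
 ultimately show ?case by simp
next
 case (PSuc t)
 then show ?case by auto
qed auto

lemma E2_cong: "E2 f ==> EX n. ALL e e'. (\<forall>i<n. e i = e' i) --> f e = f e'"
 unfolding E2_def by (metis eval_cong)

lemma E2_var: "E2 (%e. e i)"
 unfolding E2_def
proof (intro exI conjI)
 show "closed_pr (Suc i) (PVar i)" by simp
 show "bnd (peak (PVar i))" by (rule bnd_le[OF bnd_var[of i]]) simp
qed simp

lemma E2_Suc: "E2 f ==> E2 (%e. Suc (f e))"
 unfolding E2_def
proof (elim exE conjE)
 fix p n assume *: "closed_pr n p" "ALL e. eval p e = f e" "bnd (peak p)"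
 show "EX p n. closed_pr n p & (ALL e. eval p e = Suc (f e)) & bnd (peak p)"
  using * bnd_le[OF bnd_Suc[OF *(3)], of "peak (PSuc p)"] by (intro exI[of _ "PSuc p"] exI[of _ n]) simp
qed

lemma E2_zero: "E2 (%e. 0)"
 unfolding E2_def using bnd_le[OF bnd_const[of 0], of "peak PZero"] by (intro exI[of _ PZero] exI[of _ 0]) simp

lemma E2_const: "E2 (%e. c)"
 by (induction c) (auto intro: E2_zero E2_Suc)

lemma bnd_sub: "bnd g ==> (!!i. bnd (s i)) ==> bnd (%e. g (%i. s i e))"
proof -
 assume g: "bnd g" and s: "!!i. bnd (s i)"
 obtain n k where nk: "!!e. g e <= sm n e ^ k" using g by (auto simp: bnd_def)
 have "bnd (%e. \<Sum>i<n. s i e)" by (induction n) (auto intro: bnd_add bnd_const s)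
 then have "bnd (%e. sm n (%i. s i e) ^ k)"
  unfolding sm_def by (intro bnd_power bnd_add bnd_const)
 then show ?thesis by (rule bnd_le) (rule nk)
qed

lemma bnd_cons: "bnd g ==> bnd t ==> bnd (%e. g (t e ## e))"
proof -
 assume g: "bnd g" and t: "bnd t"
 have "bnd (%e. (t e ## e) i)" for i using t bnd_var by (cases i) auto
 from bnd_sub[OF g this] show ?thesis by simp
qed

lemma E2_cons: "E2 g ==> E2 t ==> E2 (%e. g (t e ## e))"
proof -
 assume g: "E2 g" and t: "E2 t"
 obtain p n where p: "closed_pr n p" "!!e. eval p e = g e" "bnd (peak p)" using g by (auto simp: E2_def)
 obtain q m where q: "closed_pr m q" "!!e. eval q e = t e" "bnd (peak q)" using t by (auto simp: E2_def)
 have "bnd (%e. max (peak q e) (peak p (t e ## e)))"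
  by (intro bnd_max q bnd_cons p E2_bnd[OF t])
 then have "bnd (peak (PLet q p))" by (rule bnd_le) (simp add: q)
 moreover have "closed_pr (max n m) (PLet q p)"
  using closed_pr_mono[OF p(1), of "Suc (max n m)"] closed_pr_mono[OF q(1), of "max n m"] by simp
 ultimately show ?thesis unfolding E2_def using p q by (metis eval.simps(4))
qed

fun ren :: "(nat => nat) => pr => pr" where
 "ren f (PVar i) = PVar (f i)"
| "ren f PZero = PZero"
| "ren f (PSuc t) = PSuc (ren f t)"
| "ren f (PLet t p) = PLet (ren f t) (ren (0 ## (Suc \<circ> f)) p)"
| "ren f (PRec c b s) = PRec (ren f c) (ren f b) (ren (0 ## 1 ## (Suc \<circ> Suc \<circ> f)) s)"

lemma cons_comp: "(x ## e) \<circ> (0 ## (Suc \<circ> f)) = x ## (e \<circ> f)"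
 "(x ## y ## e) \<circ> (0 ## 1 ## (Suc \<circ> Suc \<circ> f)) = x ## y ## (e \<circ> f)"
 by (auto simp: fun_eq_iff cons_env_def split: nat.splits)

lemma eval_ren: "eval (ren f p) e = eval p (e \<circ> f)"
 by (induction p arbitrary: f e) (simp_all only: ren.simps eval.simps cons_comp o_apply)

lemma peak_ren: "peak (ren f p) e = peak p (e \<circ> f)"
proof (induction p arbitrary: f e)
 case (PRec c b s)
 then show ?case by (simp only: ren.simps peak.simps eval_ren cons_comp)
qed (simp_all only: ren.simps peak.simps eval_ren cons_comp o_apply)

lemma closed_ren: "closed_pr n p ==> (\<forall>i<n. f i < m) ==> closed_pr m (ren f p)"
proof (induction p arbitrary: n m f)
 case (PLet t p)
 have "\<forall>i<Suc n. (0 ## (Suc \<circ> f)) i < Suc m" using PLet.prems by (auto simp: less_Suc_eq_0_disj)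
 then show ?case using PLet by auto
next
 case (PRec c b s)
 have "\<forall>i<Suc (Suc n). (0 ## 1 ## (Suc \<circ> Suc \<circ> f)) i < Suc (Suc m)"
  using PRec.prems by (auto simp: less_Suc_eq_0_disj)
 then show ?case using PRec by auto
qed auto

lemma E2_ren: "E2 g ==> E2 (%e. g (%i. e (f i)))"
proof -
 assume g: "E2 g"
 obtain p n where p: "closed_pr n p" "!!e. eval p e = g e" "bnd (peak p)" using g by (auto simp: E2_def)
 have "closed_pr (Suc (Max (f ` {..<n}))) (ren f p)"
  by (rule closed_ren[OF p(1)]) (auto simp: less_Suc_eq_le intro!: Max_ge)
 moreover have "bnd (peak (ren f p))"
  using bnd_sub[OF p(3), of "%i e. e (f i)"] bnd_var by (simp add: peak_ren[abs_def] comp_def)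
 moreover have "eval (ren f p) e = g (%i. e (f i))" for e by (simp add: eval_ren p(2) comp_def)
 ultimately show ?thesis unfolding E2_def by blast
qed

lemma E2_args:
 "E2 g ==> (\<forall>t \<in> set ts. E2 t) ==> E2 (%e. g (foldr (##) (map (%t. t e) ts) e))"
proof (induction ts arbitrary: g)
 case (Cons t ts)
 define g1 where "g1 = (%e. g (t (%i. e (i + length ts)) ## e))"
 have "E2 g1" unfolding g1_def using Cons.prems by (intro E2_cons E2_ren[of t "%i. i + length ts"]) auto
 then have "E2 (%e. g1 (foldr (##) (map (%t. t e) ts) e))" using Cons by auto
 moreover have "(%i. foldr (##) xs e (i + length xs)) = e" for xs and e :: "nat => nat"
  by (induction xs) auto
 from this[of "map (%t. t _) ts"] have "(%i. foldr (##) (map (%t. t e) ts) e (i + length ts)) = e" for e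
  by (metis length_map)
 ultimately show ?case by (simp add: g1_def)
qed simp

lemma E2_sub: "E2 g ==> (!!i. E2 (s i)) ==> E2 (%e. g (%i. s i e))"
proof -
 assume g: "E2 g" and s: "!!i. E2 (s i)"
 obtain n where n: "!!e e'. (\<forall>i<n. e i = e' i) ==> g e = g e'" using E2_cong[OF g] by blast
 have f: "i < length xs ==> foldr (##) xs e i = xs ! i" for xs i and e :: "nat => nat"
  by (induction xs arbitrary: i) (auto simp: nth_Cons' gr0_conv_Suc)
 have "E2 (%e. g (foldr (##) (map (%t. t e) (map s [0..<n])) e))"
  using s by (intro E2_args g) auto
 moreover have "g (foldr (##) (map (%t. t e) (map s [0..<n])) e) = g (%i. s i e)" for e
  by (rule n) (auto simp: f)
 ultimately show ?thesis by simp
qed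

lemma E2_inst: "E2 (%e. f (e 0) (%i. e (Suc i))) ==> E2 t ==> (!!i. E2 (s i)) ==> E2 (%e. f (t e) (%i. s i e))"
 using E2_sub[of "%e. f (e 0) (%i. e (Suc i))" "%i. case i of 0 => t | Suc j => s j"]
 by (auto split: nat.splits)

lemma E2_inst2:
 "E2 (%e. f (e 0) (e 1) (%i. e (Suc (Suc i)))) ==> E2 t ==> E2 u ==> (!!i. E2 (s i)) ==> E2 (%e. f (t e) (u e) (%i. s i e))"
 using E2_sub[of "%e. f (e 0) (e 1) (%i. e (Suc (Suc i)))" "%i. case i of 0 => t | Suc 0 => u | Suc (Suc j) => s j"]
 by (auto split: nat.splits)

text \<open>Bounded recursion. The step sees only the index, the partial result and the old
  arguments, so a bound \<open>B\<close> on the partial results yields one on all values met while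
  evaluating the step.\<close>

lemma E2_rec:
 assumes "E2 c" "E2 b" and s: "E2 (%e. s (e 0) (e 1) (%i. e (Suc (Suc i))))"
  and B: "bnd B" "!!e i. i <= c e ==> rec_nat (b e) (%i r. s i r e) i <= B e"
 shows "E2 (%e. rec_nat (b e) (%i r. s i r e) (c e))"
proof -
 obtain pc nc where pc: "closed_pr nc pc" "!!e. eval pc e = c e" "bnd (peak pc)" using assms by (auto simp: E2_def)
 obtain pb nb where pb: "closed_pr nb pb" "!!e. eval pb e = b e" "bnd (peak pb)" using assms by (auto simp: E2_def)
 obtain ps ns where ps: "closed_pr ns ps" "!!e. eval ps e = s (e 0) (e 1) (%i. e (Suc (Suc i)))" "bnd (peak ps)"
  using s by (auto simp: E2_def)
 obtain n k where nk: "!!e. peak ps e <= sm n e ^ k" using ps(3) by (auto simp: bnd_def)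
 have ev: "eval (PRec pc pb ps) e = rec_nat (b e) (%i r. s i r e) (c e)" for e
  using pc pb ps by simp
 let ?G = "%e. max (peak pc e) (max (peak pb e) ((c e + B e + sm n e) ^ k))"
 have "peak (PRec pc pb ps) e <= ?G e" for e
 proof -
  have "peak ps (i ## rec_nat (b e) (%i r. s i r e) i ## e) <= (c e + B e + sm n e) ^ k" if "i < c e" for i
  proof -
   let ?r = "rec_nat (b e) (%i r. s i r e) i"
   have "(\<Sum>j<n. (i ## ?r ## e) j) <= (\<Sum>j<Suc (Suc n). (i ## ?r ## e) j)" by (rule sum_mono2) auto
   also have "\<dots> = i + (?r + (\<Sum>j<n. e j))"
   by (simp add: sum.lessThan_Suc_shift del: sum.lessThan_Suc)
   finally have "sm n (i ## ?r ## e) <= c e + B e + sm n e"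
   using B(2)[of i e] that by (simp add: sm_def)
   then have "sm n (i ## ?r ## e) ^ k <= (c e + B e + sm n e) ^ k" by (rule power_mono) simp
   then show ?thesis using nk le_trans by blast
  qed
  then show ?thesis unfolding peak.simps
   by (intro Max.boundedI) (auto simp: pc(2) pb(2) ps(2) le_max_iff_disj)
 qed
 moreover have "bnd ?G"
  by (intro bnd_max pc pb bnd_power bnd_add bnd_sm B E2_bnd assms(1))
 ultimately have "bnd (peak (PRec pc pb ps))" using bnd_le by blast
 moreover have "closed_pr (nc + nb + ns) (PRec pc pb ps)"
  using closed_pr_mono[OF pc(1)] closed_pr_mono[OF pb(1)] closed_pr_mono[OF ps(1)] by simp
 ultimately show ?thesis unfolding E2_def using ev by blast
qed

lemma E2_app1: "E2 (%e. f (e 0)) ==> E2 a ==> E2 (%e. f (a e))"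
 using E2_args[of "%e. f (e 0)" "[a]"] by simp

lemma E2_app2: "E2 (%e. f (e 0) (e 1)) ==> E2 a ==> E2 b ==> E2 (%e. f (a e) (b e))"
 using E2_args[of "%e. f (e 0) (e 1)" "[a, b]"] by simp

lemma E2_app3: "E2 (%e. f (e 0) (e 1) (e 2)) ==> E2 a ==> E2 b ==> E2 c ==> E2 (%e. f (a e) (b e) (c e))"
 using E2_args[of "%e. f (e 0) (e 1) (e 2)" "[a, b, c]"] by (simp add: numeral_eq_Suc)

lemma E2_app4: "E2 (%e. f (e 0) (e 1) (e 2) (e 3)) ==> E2 a ==> E2 b ==> E2 c ==> E2 d ==>
  E2 (%e. f (a e) (b e) (c e) (d e))"
 using E2_args[of "%e. f (e 0) (e 1) (e 2) (e 3)" "[a, b, c, d]"] by (simp add: numeral_eq_Suc)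

lemma E2_add: "E2 f ==> E2 g ==> E2 (%e. f e + g e)"
proof (rule E2_app2[of "(+)"])
 have r: "rec_nat y (%i r. Suc r) x = x + y" for x y :: nat by (induction x) auto
 have "E2 (%e. rec_nat (e 1) (%i r. Suc r) (e 0))"
  by (rule E2_rec[where B = "%e. e 0 + e 1"]) (auto intro: E2_var E2_Suc bnd_add bnd_var simp: r)
 then show "E2 (%e. e 0 + e 1)" by (simp add: r)
qed

lemma E2_mult: "E2 f ==> E2 g ==> E2 (%e. f e * g e)"
proof (rule E2_app2[of "(*)"])
 have r: "rec_nat 0 (%i r. r + y) x = x * y" for x y :: nat by (induction x) auto
 have "E2 (%e. rec_nat 0 (%i r. r + e 1) (e 0))"
  by (rule E2_rec[where B = "%e. e 0 * e 1"])
   (auto intro: E2_var E2_const E2_add bnd_mult bnd_var simp: r)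
 then show "E2 (%e. e 0 * e 1)" by (simp add: r)
qed

lemma E2_pred: "E2 f ==> E2 (%e. f e - 1)"
proof (rule E2_app1[of "%x. x - 1"])
 have r: "rec_nat 0 (%i r. i) x = x - 1" for x :: nat by (cases x) auto
 have "E2 (%e. rec_nat 0 (%i r. i) (e 0))"
  by (rule E2_rec[where B = "%e. e 0"]) (auto intro: E2_var E2_const bnd_var simp: r)
 then show "E2 (%e. e 0 - 1)" by (simp add: r)
qed

lemma E2_diff: "E2 f ==> E2 g ==> E2 (%e. f e - g e)"
proof (rule E2_app2[of "(-)"])
 have r: "rec_nat x (%i r. r - 1) y = x - y" for x y :: nat by (induction y) auto
 have "E2 (%e. rec_nat (e 0) (%i r. r - 1) (e 1))"
  by (rule E2_rec[where B = "%e. e 0"]) (auto intro: E2_var E2_pred[simplified] bnd_var simp: r[simplified])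
 then show "E2 (%e. e 0 - e 1)" by (simp add: r[simplified])
qed

definition E2p :: "((nat => nat) => bool) => bool" where
 "E2p P \<longleftrightarrow> E2 (%e. of_bool (P e))"

lemma E2p_le: assumes "E2 f" "E2 g" shows "E2p (%e. f e <= g e)"
proof -
 have "E2 (%e. 1 - (f e - g e))" by (intro E2_diff E2_const assms)
 moreover have "1 - (f e - g e) = of_bool (f e <= g e)" for e by (auto simp: of_bool_def)
 ultimately show ?thesis by (simp add: E2p_def)
qed

lemma E2p_not: assumes "E2p P" shows "E2p (%e. ~ P e)"
proof -
 have "E2 (%e. 1 - of_bool (P e))" using assms unfolding E2p_def by (intro E2_diff E2_const)
 moreover have "1 - of_bool (P e) = (of_bool (~ P e) :: nat)" for e by auto
 ultimately show ?thesis by (simp add: E2p_def)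
qed

lemma E2p_conj: assumes "E2p P" "E2p Q" shows "E2p (%e. P e & Q e)"
proof -
 have "E2 (%e. of_bool (P e) * of_bool (Q e))" using assms unfolding E2p_def by (intro E2_mult)
 then show ?thesis by (simp add: E2p_def of_bool_conj)
qed

lemma E2p_disj: "E2p P ==> E2p Q ==> E2p (%e. P e \<or> Q e)"
 using E2p_not[OF E2p_conj[OF E2p_not[of P] E2p_not[of Q]]] by simp

lemma E2p_imp: assumes "E2p P" "E2p Q" shows "E2p (%e. P e --> Q e)"
proof -
 have "(%e. P e --> Q e) = (%e. ~ P e \<or> Q e)" by auto
 then show ?thesis using E2p_disj[OF E2p_not] assms by simp
qed

lemma E2p_iff: assumes "E2p P" "E2p Q" shows "E2p (%e. P e = Q e)"
proof -
 have "(%e. P e = Q e) = (%e. (P e --> Q e) & (Q e --> P e))" by auto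
 then show ?thesis using E2p_conj E2p_imp assms by presburger
qed

lemma E2p_less: "E2 f ==> E2 g ==> E2p (%e. f e < g e)"
 using E2p_not[OF E2p_le[of g f]] by (simp add: not_le)

lemma E2p_eq: "E2 f ==> E2 g ==> E2p (%e. f e = g e)"
 using E2p_conj[OF E2p_le[of f g] E2p_le[of g f]] by (simp add: eq_iff)

lemma E2p_const: "E2p (%e. c)"
 by (simp add: E2p_def E2_const)

lemma E2_if: assumes "E2p P" "E2 f" "E2 g" shows "E2 (%e. if P e then f e else g e)"
proof -
 have "E2 (%e. of_bool (P e) * f e + (1 - of_bool (P e)) * g e)"
  using assms unfolding E2p_def by (intro E2_add E2_mult E2_diff E2_const)
 moreover have "of_bool (P e) * f e + (1 - of_bool (P e)) * g e = (if P e then f e else g e)" for e by simp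
 ultimately show ?thesis by simp
qed

lemma E2p_if: "E2p P ==> E2p Q ==> E2p R ==> E2p (%e. if P e then Q e else R e)"
 using E2_if[of P "%e. of_bool (Q e)" "%e. of_bool (R e)"] by (simp add: E2p_def if_distrib[of of_bool])

lemma E2_of_bool: "E2p P ==> E2 (%e. of_bool (P e))"
 by (simp add: E2p_def)

lemma E2_shift: "E2 f ==> E2 (%e. f (%i. e (Suc i)))"
 by (rule E2_ren)

lemma E2_shift2: "E2 f ==> E2 (%e. f (%i. e (Suc (Suc i))))"
 by (rule E2_ren)

lemma E2p_ex:
 assumes "E2 t" "E2p (%e. P (e 0) (%i. e (Suc i)))"
 shows "E2p (%e. \<exists>x<t e. P x e)"
proof -
 let ?r = "%e. rec_nat 0 (%i r. if r = 1 \<or> P i e then 1 else (0::nat))"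
 have r: "?r e n = of_bool (\<exists>x<n. P x e)" for e n
  by (induction n) (auto simp: less_Suc_eq)
 have 1: "E2p (%e. P (e 0) (%i. e (Suc (Suc i))))"
  using assms(2) unfolding E2p_def by (rule E2_inst)  (auto intro: E2_var)
 have "E2 (%e. rec_nat 0 (%i r. if r = 1 \<or> P i e then 1 else 0) (t e))"
  by (rule E2_rec[where B = "%_. 1"])
   (auto intro!: E2_const E2_if E2p_disj E2p_eq E2_var bnd_const assms(1) 1[simplified] simp: r[simplified])
 then show ?thesis by (simp add: E2p_def r[simplified])
qed

lemma E2p_all:
 assumes "E2 t" "E2p (%e. P (e 0) (%i. e (Suc i)))"
 shows "E2p (%e. \<forall>x<t e. P x e)"
 using E2p_not[OF E2p_ex[OF assms(1) E2p_not[OF assms(2)]]] by simp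

definition mu :: "nat => (nat => bool) => nat" where
 "mu t P = (LEAST i. i = t \<or> P i)"

lemma mu_le: "mu t P <= t"
 unfolding mu_def by (rule Least_le) simp

lemma mu_cases: "mu t P = t \<or> P (mu t P)"
 unfolding mu_def by (rule LeastI[of _ t]) simp

lemma mu_least: "i < mu t P ==> ~ P i"
 unfolding mu_def using not_less_Least by blast

lemma mu_eqI: "P x ==> x <= t ==> (!!i. i < x ==> ~ P i) ==> mu t P = x"
 unfolding mu_def by (rule Least_equality) (auto simp: not_less[symmetric])

lemma mu_eq_bound: "(!!i. i < t ==> ~ P i) ==> mu t P = t"
 unfolding mu_def by (rule Least_equality) (auto simp: not_less[symmetric])

lemma E2_mu:
 assumes "E2 t" "E2p (%e. P (e 0) (%i. e (Suc i)))"
 shows "E2 (%e. mu (t e) (%x. P x e))"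
proof -
 let ?r = "%e. rec_nat 0 (%i r. if r = i & ~ P i e then Suc i else r)"
 have r: "?r e n = mu n (%x. P x e)" for e n
 proof (induction n)
  case (Suc n)
  show ?case
  proof (cases "mu n (%x. P x e) = n & ~ P n e")
   case True
   then have "mu (Suc n) (%x. P x e) = Suc n"
   using mu_least[of _ n "%x. P x e"] by (intro mu_eq_bound) (auto simp: less_Suc_eq)
   then show ?thesis using True Suc by simp
  next
   case False
   then have "P (mu n (%x. P x e)) e" using mu_cases[of n "%x. P x e"] by auto
   then have "mu (Suc n) (%x. P x e) = mu n (%x. P x e)"
   using mu_le[of n "%x. P x e"] mu_least[of _ n "%x. P x e"] le_SucI by (intro mu_eqI) auto
   then show ?thesis using False Suc by auto
  qed
 qed (simp add: mu_eq_bound)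
 have 1: "E2p (%e. P (e 0) (%i. e (Suc (Suc i))))"
  using assms(2) unfolding E2p_def by (rule E2_inst)  (auto intro: E2_var)
 have "E2 (%e. rec_nat 0 (%i r. if r = i & ~ P i e then Suc i else r) (t e))"
  by (rule E2_rec[where B = t])
   (auto intro!: E2_const E2_if E2p_conj E2p_not E2p_eq E2_var E2_Suc E2_bnd assms(1) 1[simplified]
   simp: r intro: le_trans[OF mu_le])
 then show ?thesis by (simp add: r)
qed

lemma E2_div: "E2 f ==> E2 g ==> E2 (%e. f e div g e)"
proof (rule E2_app2[of "(div)"])
 have m: "x div y = (if y = 0 then 0 else mu x (%q. x < Suc q * y))" for x y :: nat
 proof (cases "y = 0")
  case False
  have "mu x (%q. x < Suc q * y) = x div y"
  proof (rule mu_eqI)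
   show "x < Suc (x div y) * y" using False dividend_less_times_div[of y x] by (simp add: mult.commute)
   show "~ x < Suc i * y" if "i < x div y" for i
   using that False by (metis Suc_leI less_eq_div_iff_mult_less_eq neq0_conv not_less)
  qed simp
  then show ?thesis using False by simp
 qed simp
 have "E2 (%e. if e 1 = 0 then 0 else mu (e 0) (%q. e 0 < Suc q * e 1))"
  by (intro E2_if E2p_eq E2_var E2_const E2_mu E2p_less E2_mult E2_Suc)
 then show "E2 (%e. e 0 div e 1)" by (subst m)
qed

lemma E2_mod: "E2 f ==> E2 g ==> E2 (%e. f e mod g e)"
 using E2_diff[of f "%e. f e div g e * g e"] E2_mult[OF E2_div[of f g]]
 by (simp add: minus_div_mult_eq_mod)

lemma E2_min: "E2 f ==> E2 g ==> E2 (%e. min (f e) (g e))"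
 unfolding min_def by (intro E2_if E2p_le)

text \<open>Dividing repeatedly by \<open>b\<close> avoids the power \<open>b ^ i\<close>, which
  need not be polynomially bounded.\<close>

lemma E2_div_power: "E2 b ==> E2 x ==> E2 i ==> E2 (%e. x e div b e ^ i e)"
proof (rule E2_app3[of "%b x i. x div b ^ i"])
 have r: "rec_nat x (%i r. r div b) i = x div b ^ i" for x b i :: nat
  by (induction i) (auto simp: div_mult2_eq[symmetric] mult.commute)
 have "E2 (%e. rec_nat (e 1) (%i r. r div e 0) (e 2))"
  by (rule E2_rec[where B = "%e. e 1"]) (auto intro!: E2_var E2_div bnd_var simp: r)
 then show "E2 (%e. e 1 div e 0 ^ e 2)" by (simp add: r)
qed

definition dg :: "nat => nat => nat => nat" where
 "dg b x i = x div b ^ i mod b"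

lemma E2_dg: "E2 b ==> E2 x ==> E2 i ==> E2 (%e. dg (b e) (x e) (i e))"
 unfolding dg_def by (intro E2_mod E2_div_power)

lemma E2p_bit: "E2 x ==> E2 i ==> E2p (%e. bit (x e) (i e))"
 using E2p_eq[OF E2_mod[OF E2_div_power[OF E2_const[of 2], of x i] E2_const[of 2]] E2_const[of 1]]
 by (simp add: bit_iff_odd odd_iff_mod_2_eq_one)

text \<open>Powers of two, capped so that their definition respects the polynomial bound.\<close>

definition cpow :: "nat => nat => nat" where
 "cpow Y n = rec_nat 1 (%i r. min (2 * r) (Suc Y)) n"

lemma cpow_eq: "2 ^ n <= Suc Y ==> cpow Y n = 2 ^ n"
 unfolding cpow_def by (induction n) auto

lemma cpow_le: "cpow Y n <= Suc Y"
 unfolding cpow_def by (cases n) auto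

lemma E2_cpow: "E2 y ==> E2 n ==> E2 (%e. cpow (y e) (n e))"
proof (rule E2_app2[of cpow])
 have "E2 (%e. rec_nat 1 (%i r. min (2 * r) (Suc (e 0))) (e 1))"
  using cpow_le unfolding cpow_def
  by (intro E2_rec[where B = "%e. Suc (e 0)"]) (auto intro!: E2_var E2_const E2_min E2_mult E2_Suc bnd_Suc bnd_var)
 then show "E2 (%e. cpow (e 0) (e 1))" by (simp add: cpow_def)
qed

lemmas E2_intros = E2_var E2_const E2_Suc E2_add E2_mult E2_diff E2_div E2_mod E2_min E2_if E2_mu
 E2_dg E2p_bit E2_cpow E2p_le E2p_less E2p_eq E2p_not E2p_conj E2p_disj E2p_imp E2p_iff E2p_if E2p_const
 E2p_ex E2p_all E2_of_bool

lemma E2p_app2: "E2p (%e. f (e 0) (e 1)) ==> E2 a ==> E2 b ==> E2p (%e. f (a e) (b e))"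
 unfolding E2p_def by (rule E2_app2[of "%x y. of_bool (f x y)"])

lemma E2p_inst: "E2p (%e. f (e 0) (%i. e (Suc i))) ==> E2 t ==> (!!i. E2 (s i)) ==> E2p (%e. f (t e) (%i. s i e))"
 unfolding E2p_def by (rule E2_inst[of "%x e. of_bool (f x e)"])

lemma E2p_inst2:
 "E2p (%e. f (e 0) (e 1) (%i. e (Suc (Suc i)))) ==> E2 t ==> E2 u ==> (!!i. E2 (s i)) ==> E2p (%e. f (t e) (u e) (%i. s i e))"
 unfolding E2p_def by (rule E2_inst2[of "%x y e. of_bool (f x y e)"])

section \<open>Savitch's theorem by traversing an and-or tree\<close>

section \<open>Evaluating and-or trees and reachability in little space\<close>

text \<open>A complete binary tree, disjunctive at the levels in \<open>q\<close> and conjunctive at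
  the others; the node \<open>x\<close> of height \<open>r\<close> has the \<open>2 ^ r\<close>
  leaves starting with number \<open>2 ^ r * x\<close>.\<close>

fun tree :: "(nat => bool) => (nat => bool) => nat => nat => bool" where
 "tree q P 0 x = P x"
| "tree q P (Suc r) x = (if q r then tree q P r (2 * x) \<or> tree q P r (2 * x + 1)
   else tree q P r (2 * x) & tree q P r (2 * x + 1))"

text \<open>The leaves are visited from left to right. After \<open>l\<close> leaves, bit \<open>j\<close> of the state is, for
 every bit \<open>j\<close> set in \<open>l\<close>, the value of the last completed subtree of height \<open>j\<close>; a new leaf is
 merged with these values like a carry in binary counting.\<close>

definition carry :: "(nat => bool) => nat => bool => nat => nat" where
 "carry q S b z = rec_nat (of_bool b) (%j t. of_bool (if q j then bit S j \<or> t = 1 else bit S j & t = 1)) z"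

definition visit :: "nat => nat => (nat => bool) => (nat => bool) => nat => nat => nat" where
 "visit Y R q P l S = (let z = mu R (%j. ~ bit l j) in
   min Y (carry q S (P l) z * cpow Y z + cpow Y (Suc z) * (S div 2 ^ Suc z)))"

definition tree_state :: "nat => nat => (nat => bool) => (nat => bool) => nat => nat" where
 "tree_state Y R q P n = rec_nat 0 (visit Y R q P) n"

definition tree_eval :: "nat => nat => (nat => bool) => (nat => bool) => bool" where
 "tree_eval Y R q P \<longleftrightarrow> bit (tree_state Y R q P (cpow Y R)) R"

lemma carry_le: "carry q S b z <= 1"
 unfolding carry_def by (cases z) auto

lemma bit_add_mult:
 fixes a m q j :: nat
 assumes "a < 2 ^ m"
 shows "bit (a + 2 ^ m * q) j = (if j < m then bit a j else bit q (j - m))"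
proof (cases "j < m")
 case True
 then obtain d where m: "m = Suc (j + d)" using less_iff_Suc_add by auto
 have "a + 2 ^ m * q = a + 2 ^ j * (2 * (2 ^ d * q))" by (simp add: m power_add mult_ac)
 then have "(a + 2 ^ m * q) div 2 ^ j = 2 * (2 ^ d * q) + a div 2 ^ j"
  by (simp only: div_mult_self2 power_not_zero numeral_neq_zero not_False_eq_True)
 then show ?thesis using True by (simp add: bit_iff_odd)
next
 case False
 then obtain d where j: "j = m + d" using le_Suc_ex not_less by blast
 have "(a + 2 ^ m * q) div 2 ^ j = (a + 2 ^ m * q) div 2 ^ m div 2 ^ d" by (simp add: j power_add div_mult2_eq)
 also have "(a + 2 ^ m * q) div 2 ^ m = q" using assms by simp
 finally show ?thesis using False by (simp add: bit_iff_odd j)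
qed

lemma trailing_ones:
 assumes "!!j. j < z ==> bit l j" "~ bit (l::nat) z"
 shows "l = 2 ^ z - 1 + 2 ^ Suc z * (l div 2 ^ Suc z)"
proof (rule bit_eqI)
 fix j
 have "bit (2 ^ z - 1 + 2 ^ Suc z * (l div 2 ^ Suc z)) j =
   (if j < Suc z then bit (2 ^ z - 1 :: nat) j else bit (l div 2 ^ Suc z) (j - Suc z))"
  by (rule bit_add_mult) (simp add: less_imp_diff_less)
 also have "\<dots> = bit l j"
 proof (cases "j < Suc z")
  case True
  moreover have "bit (2 ^ z - 1 :: nat) j = (j < z)"
   using bit_mask_iff[of z j, where 'a = nat] by (simp add: mask_eq_exp_minus_1)
  ultimately show ?thesis using assms by (cases "j = z") auto
 next
  case False
  then show ?thesis using bit_drop_bit_eq[of "Suc z" l] by (simp add: drop_bit_eq_div)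
 qed
 finally show "bit l j = bit (2 ^ z - 1 + 2 ^ Suc z * (l div 2 ^ Suc z)) j" by simp
qed

lemma tree_eval_correct:
 assumes Y: "2 ^ Suc R <= Y"
 shows "tree_eval Y R q P \<longleftrightarrow> tree q P R 0"
proof -
 \<comment> \<open>For a set bit \<open>j\<close> of \<open>l\<close>, the leaf \<open>l\<close>
   lies below the right child number \<open>l div 2 ^ j\<close> of height \<open>j\<close>; the
   index in the invariant is that of its completed left sibling.\<close>
 have main: "l <= 2 ^ R ==> tree_state Y R q P l < 2 ^ Suc R & (ALL j. bit l j -->
   bit (tree_state Y R q P l) j = tree q P j (2 * (l div 2 ^ Suc j)))" for l
 proof (induction l)
  case 0
  then show ?case by (simp add: tree_state_def)
 next
  case (Suc l)
  define S where "S = tree_state Y R q P l"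
  have S: "S < 2 ^ Suc R" "!!j. bit l j ==> bit S j = tree q P j (2 * (l div 2 ^ Suc j))"
   using Suc by (auto simp: S_def)
  \<comment> \<open>The trailing ones of \<open>l\<close> are the heights at which the new leaf
    completes a right child; the carry stops at the first zero bit.\<close>
  define z where "z = mu R (%j. ~ bit l j)"
  have lR: "~ bit l R" using Suc.prems by (simp add: bit_iff_odd)
  have zR: "z <= R" unfolding z_def by (rule mu_le)
  have z: "~ bit l z" using mu_cases[of R "%j. ~ bit l j"] lR by (auto simp: z_def)
  have ones: "bit l j" if "j < z" for j using mu_least[of j R "%j. ~ bit l j"] that by (auto simp: z_def)
  define u where "u = l div 2 ^ Suc z"
  have l: "l = 2 ^ z - 1 + 2 ^ Suc z * u" unfolding u_def using trailing_ones[OF ones z] .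
  then have l': "Suc l = 2 ^ z + 2 ^ Suc z * u" by simp
  have c: "carry q S (P l) i = of_bool (tree q P i (l div 2 ^ i))" if "i <= z" for i
   using that
  proof (induction i)
   case (Suc i)
   have o: "bit l i" using ones Suc.prems by simp
   have e: "l div 2 ^ i = 2 * (l div 2 ^ Suc i) + 1"
   using o odd_two_times_div_two_succ[of "l div 2 ^ i"] div_mult2_eq[of l "2 ^ i" 2]
   by (simp add: bit_iff_odd mult.commute[of 2])
   have "carry q S (P l) i = of_bool (tree q P i (2 * (l div 2 ^ Suc i) + 1))" using Suc e by simp
   moreover have "carry q S (P l) (Suc i) =
   of_bool (if q i then bit S i \<or> carry q S (P l) i = 1 else bit S i & carry q S (P l) i = 1)"
   by (simp add: carry_def)
   ultimately show ?case using S(2)[OF o] by simp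
  qed (simp add: carry_def)
  define t where "t = tree q P z (l div 2 ^ z)"
  have lz: "l div 2 ^ z = 2 * u"
  proof -
   have "l = (2 ^ z - 1) + 2 ^ z * (2 * u)" using l by (simp add: mult_ac)
   then show ?thesis by (simp only: div_mult_self2 power_not_zero numeral_neq_zero not_False_eq_True) simp
  qed
  define S' where "S' = of_bool t * 2 ^ z + 2 ^ Suc z * (S div 2 ^ Suc z)"
  have b0: "of_bool t * 2 ^ z < (2::nat) ^ Suc z" by simp
  have bS: "bit S' j = (if j < Suc z then bit (of_bool t * 2 ^ z :: nat) j else bit S j)" for j
   unfolding S'_def bit_add_mult[OF b0] using bit_drop_bit_eq[of "Suc z" S] by (simp add: drop_bit_eq_div)
  have S'l: "S' < 2 ^ Suc R"
  proof -
   have "S div 2 ^ Suc z < 2 ^ (R - z)"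
   using S(1) zR by (intro less_mult_imp_div_less) (simp flip: power_add power_Suc)
   then have "2 ^ Suc z * (S div 2 ^ Suc z + 1) <= (2::nat) ^ Suc z * 2 ^ (R - z)" by (intro mult_le_mono2) simp
   also have "\<dots> = 2 ^ Suc R" using zR by (simp flip: power_add)
   finally have "2 ^ Suc z * (S div 2 ^ Suc z) + 2 ^ Suc z <= (2::nat) ^ Suc R"
   by (simp only: add_mult_distrib2 mult_1_right)
   then show ?thesis using b0 unfolding S'_def by linarith
  qed
  have "2 ^ Suc z <= (2::nat) ^ Suc R" "2 ^ z <= (2::nat) ^ Suc R" using zR by (intro power_increasing; simp)+
  then have pw: "cpow Y z = 2 ^ z" "cpow Y (Suc z) = 2 ^ Suc z" using Y by (intro cpow_eq; linarith)+
  have eq: "tree_state Y R q P (Suc l) = S'"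
  proof -
   have "tree_state Y R q P (Suc l) = visit Y R q P l S" by (simp add: tree_state_def S_def)
   also have "\<dots> = min Y S'" unfolding visit_def Let_def z_def[symmetric] using c[of z] pw
   by (simp add: S'_def t_def)
   also have "\<dots> = S'" using S'l Y by simp
   finally show ?thesis .
  qed
  have "bit S' j = tree q P j (2 * (Suc l div 2 ^ Suc j))" if "bit (Suc l) j" for j
  proof -
   have bl: "bit (Suc l) j = (if j < Suc z then j = z else bit u (j - Suc z))"
   unfolding l' using bit_add_mult[of "2 ^ z" "Suc z" u j] by (simp add: bit_exp_iff del: power_Suc)
   show ?thesis
   proof (cases "j < Suc z")
   case True
   then have j: "j = z" using bl that by auto
   have "Suc l div 2 ^ Suc z = u" unfolding l' by simp
   then show ?thesis using j bS[of z] by (simp add: t_def lz bit_iff_odd del: power_Suc)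
   next
   case False
   then obtain d where d: "j = Suc z + d" using le_Suc_ex not_less by blast
   have "Suc l div 2 ^ Suc z = u" unfolding l' by simp
   then have "Suc l div 2 ^ Suc j = l div 2 ^ Suc j"
   unfolding u_def d by (metis add_Suc_right div_mult2_eq power_add)
   moreover have "bit l j" using False bl that l bit_add_mult[of "2 ^ z - 1" "Suc z" u j]
   by (simp add: less_imp_diff_less del: power_Suc)
   ultimately show ?thesis using False bS[of j] S(2)[of j] by simp
   qed
  qed
  then show ?case using eq S'l by simp
 qed
 have "2 ^ R <= Suc Y" using Y by simp
 then have "cpow Y R = 2 ^ R" by (rule cpow_eq)
 then show ?thesis using main[of "2 ^ R"] by (simp add: tree_eval_def bit_exp_iff)
qed

lemma E2p_tree_eval:
 assumes "E2 Y" "E2 R" and q: "E2p (%e. q (e 0) (%i. e (Suc i)))" and P: "E2p (%e. P (e 0) (%i. e (Suc i)))"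
 shows "E2p (%e. tree_eval (Y e) (R e) (%r. q r e) (%l. P l e))"
proof -
 have le: "tree_state (Y e) (R e) (%r. q r e) (%l. P l e) i <= Y e" for e i
  by (cases i) (auto simp: tree_state_def visit_def Let_def)
 have "E2 (%e. carry (%r. q r (%i. e (Suc (Suc (Suc i))))) (e 2) (P (e 1) (%i. e (Suc (Suc (Suc i))))) (e 0))"
  unfolding carry_def
  by (rule E2_rec[where B = "%_. 1"])
   (use carry_le in \<open>auto intro!: E2_intros bnd_const E2p_inst[OF q] E2p_inst[OF P] simp: carry_def\<close>)
 then have c: "E2 (%e. carry (%r. q r (s e)) (S e) (P (l e) (s e)) (z e))"
  if "E2 z" "E2 l" "E2 S" "!!i. E2 (%e. s e i)" for z l S s
  using E2_sub[of _ "%i. case i of 0 => z | Suc 0 => l | Suc (Suc 0) => S | Suc (Suc (Suc j)) => %e. s e j"] that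
  by (fastforce split: nat.splits simp: numeral_2_eq_2)
 have v: "E2 (%e. visit (Y (%i. e (Suc (Suc i)))) (R (%i. e (Suc (Suc i)))) (%r. q r (%i. e (Suc (Suc i))))
   (%l. P l (%i. e (Suc (Suc i)))) (e 0) (e 1))"
  unfolding visit_def Let_def
  by (intro E2_intros c E2_shift2 assms E2_div_power)
 have "E2 (%e. tree_state (Y e) (R e) (%r. q r e) (%l. P l e) (cpow (Y e) (R e)))"
  unfolding tree_state_def
  by (rule E2_rec[where B = Y])
   (use le in \<open>auto intro!: E2_cpow E2_const assms E2_bnd v[simplified] simp: tree_state_def\<close>)
 then show ?thesis unfolding tree_eval_def by (intro E2p_bit assms)
qed

text \<open>Savitch's recursion on the midpoint of a path of length at most
  \<open>2 ^ k\<close>.\<close>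

fun reach_in :: "(nat => nat => bool) => nat => nat => nat => nat => bool" where
 "reach_in E s 0 x y \<longleftrightarrow> x = y \<or> E x y"
| "reach_in E s (Suc k) x y \<longleftrightarrow> (\<exists>m<2 ^ s. reach_in E s k x m & reach_in E s k m y)"

definition edges :: "(nat => nat => bool) => nat => (nat \<times> nat) set" where
 "edges E s = {(x, y). x < 2 ^ s & y < 2 ^ s & E x y}"

lemma reach_in_rtrancl: "reach_in E s k x y ==> x < 2 ^ s ==> y < 2 ^ s ==> (x, y) \<in> (edges E s)\<^sup>*"
 by (induction k arbitrary: x y) (auto simp: edges_def intro: rtrancl_trans)

lemma rtrancl_reach_in:
 "(x, y) \<in> edges E s ^^ n ==> n <= 2 ^ k ==> x < 2 ^ s ==> y < 2 ^ s ==> reach_in E s k x y"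
proof (induction k arbitrary: x y n)
 case 0
 then have "n = 0 \<or> n = 1" by auto
 then show ?case using 0 by (auto simp: edges_def)
next
 case (Suc k)
 obtain a b where ab: "n = a + b" "a <= 2 ^ k" "b <= 2 ^ k"
  using Suc.prems(2) by (intro that[of "min n (2 ^ k)" "n - 2 ^ k"]) auto
 obtain m where m: "(x, m) \<in> edges E s ^^ a" "(m, y) \<in> edges E s ^^ b"
  using Suc.prems(1) unfolding ab(1) relpow_add by auto
 have "m < 2 ^ s"
 proof (cases b)
  case 0
  then show ?thesis using m Suc.prems by simp
 next
  case (Suc b')
  then obtain c where "(m, c) \<in> edges E s" using m(2) by (meson relpow_Suc_D2)
  then show ?thesis by (simp add: edges_def)
 qed
 then show ?case using Suc.IH[OF m(1) ab(2)] Suc.IH[OF m(2) ab(3)] Suc.prems by auto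
qed

text \<open>A path can be shortened to at most as many steps as there are edges, and there are at
  most \<open>2 ^ (2 * s)\<close> of them.\<close>

lemma reach_in_iff:
 assumes "x < 2 ^ s" "y < 2 ^ s"
 shows "reach_in E s (2 * s) x y \<longleftrightarrow> (x, y) \<in> (edges E s)\<^sup>*"
proof
 assume "(x, y) \<in> (edges E s)\<^sup>*"
 have sub: "edges E s \<subseteq> {..<2 ^ s} \<times> {..<2 ^ s}" by (auto simp: edges_def)
 then have fin: "finite (edges E s)" by (rule finite_subset) simp
 have "card (edges E s) <= card ({..<2 ^ s :: nat} \<times> {..<2 ^ s :: nat})" by (rule card_mono[OF _ sub]) simp
 also have "\<dots> = 2 ^ (2 * s)" by (simp add: card_cartesian_product mult_2 power_add)
 finally obtain n where "(x, y) \<in> edges E s ^^ n" "n <= 2 ^ (2 * s)"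
  using \<open>(x, y) \<in> (edges E s)\<^sup>*\<close> rtrancl_finite_eq_relpow[OF fin] by auto
 then show "reach_in E s (2 * s) x y" using rtrancl_reach_in assms by blast
qed (use reach_in_rtrancl assms in blast)

text \<open>A leaf of the tree lists, in base \<open>2 ^ Suc s\<close>, a midpoint (the high bits, chosen existentially)
 and the half of the path to look at (the low bit, chosen universally) for every level.\<close>

definition leaf_src :: "nat => nat => nat => nat => nat" where
 "leaf_src D n x i = (let l = mu n (%l. odd (dg D i l)) in if l = n then x else dg D i l div 2)"

definition leaf_tgt :: "nat => nat => nat => nat => nat" where
 "leaf_tgt D n y i = (let l = mu n (%l. even (dg D i l)) in if l = n then y else dg D i l div 2)"

lemma dg_0: "d < D ==> dg D (D * i + d) 0 = d"
 by (simp add: dg_def)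

lemma dg_Suc: "d < D ==> dg D (D * i + d) (Suc l) = dg D i l"
 by (simp add: dg_def div_mult2_eq)

lemma mu_Suc: "mu (Suc n) P = (if P 0 then 0 else Suc (mu n (%l. P (Suc l))))"
proof (cases "P 0")
 case True
 then show ?thesis by (auto intro: mu_eqI)
next
 case False
 show ?thesis
 proof (cases "mu n (%l. P (Suc l)) = n")
  case True
  then have "~ P i" if "i < Suc n" for i
   using mu_least[of _ n "%l. P (Suc l)"] False that by (cases i) auto
  then show ?thesis using True False by (simp add: mu_eq_bound)
 next
  case neq: False
  then have "P (Suc (mu n (%l. P (Suc l))))" using mu_cases[of n "%l. P (Suc l)"] by auto
  moreover have "~ P i" if "i < Suc (mu n (%l. P (Suc l)))" for i
   using mu_least[of _ n "%l. P (Suc l)"] False that by (cases i) auto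
  ultimately show ?thesis using False mu_le[of n "%l. P (Suc l)"] by (auto intro!: mu_eqI)
 qed
qed

text \<open>The lowest digit is the last round of the recursion. Choosing the second half (odd)
  makes the midpoint the source, choosing the first half makes it the target; the other endpoint is
  inherited from earlier rounds.\<close>

lemma leaf_Suc:
 assumes "d < D"
 shows "leaf_src D (Suc n) x (D * i + d) = (if odd d then d div 2 else leaf_src D n x i)"
  "leaf_tgt D (Suc n) y (D * i + d) = (if even d then d div 2 else leaf_tgt D n y i)"
 by (auto simp: leaf_src_def leaf_tgt_def mu_Suc dg_0[OF assms] dg_Suc[OF assms] Let_def)

text \<open>Savitch's recursion flattened into a tree: each of the \<open>2 * s\<close> rounds takes
  \<open>s\<close> disjunctive levels for the bits of the midpoint and one conjunctive level for the
  choice of the half.\<close>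

definition reach_eval :: "nat => nat => (nat => nat => bool) => nat => nat => bool" where
 "reach_eval Y s E x y \<longleftrightarrow> tree_eval Y (2 * s * Suc s) (%r. r mod Suc s ~= 0)
   (%l. let u = leaf_src (cpow Y (Suc s)) (2 * s) x l; v = leaf_tgt (cpow Y (Suc s)) (2 * s) y l in u = v \<or> E u v)"

lemma tree_or:
 assumes "!!j. j < r ==> q (h + j)"
 shows "tree q P (h + r) i \<longleftrightarrow> (\<exists>m<2 ^ r. tree q P h (2 ^ r * i + m))"
 using assms
proof (induction r arbitrary: i)
 case (Suc r)
 have "tree q P (h + Suc r) i \<longleftrightarrow> tree q P (h + r) (2 * i) \<or> tree q P (h + r) (2 * i + 1)"
  using Suc.prems[of r] by simp
 also have "\<dots> \<longleftrightarrow> (\<exists>m<2 ^ r. tree q P h (2 ^ Suc r * i + m)) \<or> (\<exists>m<2 ^ r. tree q P h (2 ^ Suc r * i + (2 ^ r + m)))"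
  using Suc by (simp add: algebra_simps)
 also have "\<dots> \<longleftrightarrow> (\<exists>m<2 ^ Suc r. tree q P h (2 ^ Suc r * i + m))"
 proof safe
  fix m assume "m < 2 ^ Suc r" "tree q P h (2 ^ Suc r * i + m)"
   "~ (\<exists>m<2 ^ r. tree q P h (2 ^ Suc r * i + (2 ^ r + m)))"
  moreover from this have "m < 2 ^ r" by (metis add_diff_inverse_nat less_diff_conv2 mult_2 not_less power_Suc nat_add_left_cancel_less)
  ultimately show "\<exists>m<2 ^ r. tree q P h (2 ^ Suc r * i + m)" by blast
 next
  fix m :: nat assume "m < 2 ^ r" "tree q P h (2 ^ Suc r * i + m)"
  moreover from this have "m < 2 ^ Suc r" by simp
  ultimately show "\<exists>m<2 ^ Suc r. tree q P h (2 ^ Suc r * i + m)" by blast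
 next
  fix m :: nat assume m: "m < 2 ^ r" "tree q P h (2 ^ Suc r * i + (2 ^ r + m))"
  then have "2 ^ r + m < 2 ^ Suc r" by simp
  then show "\<exists>m<2 ^ Suc r. tree q P h (2 ^ Suc r * i + m)" using m(2) by blast
 qed
 finally show ?case .
qed simp

lemma reach_eval_correct:
 assumes Y: "2 ^ Suc (2 * s * Suc s) <= Y" and "x < 2 ^ s" "y < 2 ^ s"
 shows "reach_eval Y s E x y \<longleftrightarrow> (x, y) \<in> (edges E s)\<^sup>*"
proof -
 define D :: nat where "D = 2 ^ Suc s"
 define k where "k = 2 * s"
 define q where "q = (%r. r mod Suc s ~= 0)"
 define P where "P = (%l. reach_in E s 0 (leaf_src D k x l) (leaf_tgt D k y l))"
 have "s <= 2 * s * Suc s" by simp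
 then have "(2::nat) ^ Suc s <= 2 ^ Suc (2 * s * Suc s)" by (intro power_increasing) auto
 then have cp: "cpow Y (Suc s) = D" unfolding D_def using Y by (intro cpow_eq) linarith
 \<comment> \<open>Induction on the number \<open>j\<close> of rounds still to come; the digits of
   \<open>i\<close> record the \<open>k - j\<close> rounds already made.\<close>
 have "tree q P (j * Suc s) i = reach_in E s j (leaf_src D (k - j) x i) (leaf_tgt D (k - j) y i)" if "j <= k" for i j
  using that
 proof (induction j arbitrary: i)
  case 0
  then show ?case by (simp add: P_def)
 next
  case (Suc j)
  define h where "h = j * Suc s"
  have qh: "~ q h" unfolding q_def h_def by (metis mod_mult_self2_is_0)
  have q': "q (Suc h + l)" if "l < s" for l
  proof -
   have "Suc h + l = Suc l + j * Suc s" by (simp add: h_def)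
   then show ?thesis unfolding q_def using that by (metis Suc_mono mod_less mod_mult_self1 nat.distinct(1))
  qed
  have kj: "k - j = Suc (k - Suc j)" using Suc.prems by simp
  have half: "tree q P h (2 * (2 ^ s * i + m) + b) = reach_in E s j
   (if odd b then m else leaf_src D (k - Suc j) x i) (if even b then m else leaf_tgt D (k - Suc j) y i)"
   if "m < 2 ^ s" "b < 2" for m b
  proof -
   have d: "2 * m + b < D" using that by (simp add: D_def)
   have e: "2 * (2 ^ s * i + m) + b = D * i + (2 * m + b)" by (simp add: D_def algebra_simps)
   have "tree q P h (2 * (2 ^ s * i + m) + b) = reach_in E s j
   (leaf_src D (Suc (k - Suc j)) x (D * i + (2 * m + b))) (leaf_tgt D (Suc (k - Suc j)) y (D * i + (2 * m + b)))"
   unfolding e h_def using Suc.IH[of "D * i + (2 * m + b)"] Suc.prems unfolding kj by simp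
   moreover have "odd (2 * m + b) = odd b" "even (2 * m + b) = even b" "(2 * m + b) div 2 = m" using that(2) by auto
   ultimately show ?thesis unfolding leaf_Suc[OF d] by simp
  qed
  have "Suc j * Suc s = Suc h + s" by (simp add: h_def)
  then have "tree q P (Suc j * Suc s) i = tree q P (Suc h + s) i" by (simp only:)
  also have "\<dots> = (\<exists>m<2 ^ s. tree q P (Suc h) (2 ^ s * i + m))" using q' by (rule tree_or)
  also have "\<dots> = (\<exists>m<2 ^ s. tree q P h (2 * (2 ^ s * i + m) + 0) & tree q P h (2 * (2 ^ s * i + m) + 1))"
   using qh by simp
  also have "\<dots> = (\<exists>m<2 ^ s. reach_in E s j (leaf_src D (k - Suc j) x i) m & reach_in E s j m (leaf_tgt D (k - Suc j) y i))"
   using half[of _ 0] half[of _ 1] by auto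
  finally show ?case by simp
 qed
 from this[of k 0] have t: "tree q P (k * Suc s) 0 = reach_in E s k x y"
  by (simp add: leaf_src_def leaf_tgt_def mu_def)
 have "reach_eval Y s E x y = tree_eval Y (k * Suc s) q P"
  unfolding reach_eval_def cp by (simp add: q_def P_def k_def Let_def)
 also have "\<dots> = tree q P (k * Suc s) 0" using Y by (intro tree_eval_correct) (simp add: k_def)
 finally show ?thesis using t reach_in_iff[OF assms(2,3)] by (simp add: k_def)
qed

lemma E2_leaf:
 "E2 D ==> E2 n ==> E2 x ==> E2 i ==> E2 (%e. leaf_src (D e) (n e) (x e) (i e))"
 "E2 D ==> E2 n ==> E2 x ==> E2 i ==> E2 (%e. leaf_tgt (D e) (n e) (x e) (i e))"
proof -
 have "E2 (%e. leaf_src (e 0) (e 1) (e 2) (e 3))"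
  unfolding leaf_src_def Let_def odd_iff_mod_2_eq_one by (intro E2_intros)
 then show "E2 D ==> E2 n ==> E2 x ==> E2 i ==> E2 (%e. leaf_src (D e) (n e) (x e) (i e))"
  by (rule E2_app4)
 have "E2 (%e. leaf_tgt (e 0) (e 1) (e 2) (e 3))"
  unfolding leaf_tgt_def Let_def even_iff_mod_2_eq_zero by (intro E2_intros)
 then show "E2 D ==> E2 n ==> E2 x ==> E2 i ==> E2 (%e. leaf_tgt (D e) (n e) (x e) (i e))"
  by (rule E2_app4)
qed

lemma E2p_reach_eval:
 assumes "E2 Y" "E2 s" "E2 x" "E2 y" and E: "E2p (%e. E (e 0) (e 1) (%i. e (Suc (Suc i))))"
 shows "E2p (%e. reach_eval (Y e) (s e) (%u v. E u v e) (x e) (y e))"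
 unfolding reach_eval_def Let_def
 by (intro E2p_tree_eval E2_intros E2_leaf E2_shift assms E2p_inst2[OF E])

section \<open>From definability to space bounds\<close>

section \<open>Definable predicates decide languages in little space\<close>

lemma sm_code: "sm n (x ## (%_. 0)) <= 2 + x"
 unfolding sm_def by (cases n) (auto simp: sum.lessThan_Suc_shift simp del: sum.lessThan_Suc)

lemma code_less: "code w < 2 ^ Suc (length w)"
 by (induction w) auto

lemma code_ge: "2 ^ length w <= code w"
 by (induction w) auto

text \<open>The argument \<open>2 ^ b\<close> is a yardstick: evaluated at it and at
  \<open>code w\<close>, a predicate of the class meets only values polynomial in both, that is, of
  O(length w + b) digits. The yardstick itself is computed by repeated doubling, a recursion outside
  the class.\<close>

theorem E2_dspace:
 assumes D: "E2p (%e. D (e 1) (e 0))" and b: "E2 (%e. b (e 0))"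
  and L: "!!w. D (code w) (2 ^ b (code w)) \<longleftrightarrow> w \<in> L"
  and bd: "!!w. length w + b (code w) <= d * s (length w) + d"
 shows "L \<in> dspace s"
proof -
 obtain q nq where q: "closed_pr nq q" "!!e. eval q e = b (e 0)" "bnd (peak q)" using b by (auto simp: E2_def)
 obtain t nt where t: "closed_pr nt t" "!!e. eval t e = e 1 + e 1" "bnd (peak t)"
  using E2_add[OF E2_var[of 1] E2_var[of 1]] by (auto simp: E2_def)
 obtain p np where p: "closed_pr np p" "!!e. eval p e = of_bool (D (e 1) (e 0))" "bnd (peak p)"
  using D by (auto simp: E2p_def E2_def)
 define X where "X = PRec q (PSuc PZero) t"
 have r: "rec_nat (Suc 0) (%i r. r + r) i = 2 ^ i" for i by (induction i) auto
 have X: "eval X e = 2 ^ b (e 0)" for e by (simp add: X_def q t r)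
 obtain n1 k1 where 1: "!!e. peak q e <= sm n1 e ^ k1" using q(3) by (auto simp: bnd_def)
 obtain n2 k2 where 2: "!!e. peak t e <= sm n2 e ^ k2" using t(3) by (auto simp: bnd_def)
 obtain n3 k3 where 3: "!!e. peak p e <= sm n3 e ^ k3" using p(3) by (auto simp: bnd_def)
 define k where "k = k1 + k2 + k3 + 1"
 define m where "m = nq + nt + np + 2"
 have peak: "peak (PLet X p) (code w ## (%_. 0)) < 2 ^ (k * (length w + b (code w) + 5))" for w
 proof -
  let ?e = "code w ## (%_. 0)" and ?Y = "2 ^ b (code w) :: nat"
  let ?M = "2 + code w + 2 * ?Y"
  have M: "?M \<ge> 2" by simp
  have pw: "x <= ?M ^ k" if "x <= y ^ l" "y <= ?M" "l <= k" for x y l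
  proof -
   have "y ^ l <= ?M ^ l" using that by (intro power_mono) auto
   also have "\<dots> \<le> ?M ^ k" using that by (intro power_increasing) auto
   finally show ?thesis using that(1) by simp
  qed
  have "peak q ?e <= ?M ^ k"
   by (rule pw[OF 1]) (use sm_code[of n1 "code w"] in \<open>auto simp: k_def\<close>)
  moreover have "1 <= ?M ^ k" by simp
  moreover have "peak t (i ## 2 ^ i ## ?e) <= ?M ^ k" if "i < b (code w)" for i
  proof (rule pw[OF 2])
   have "sm n2 (i ## 2 ^ i ## ?e) <= sm (Suc (Suc n2)) (i ## 2 ^ i ## ?e)" by (rule sm_mono) simp
   also have "\<dots> = i + 2 ^ i + sm n2 ?e"
   unfolding sm_def by (simp add: sum.lessThan_Suc_shift del: sum.lessThan_Suc)
   also have "\<dots> \<le> 2 ^ i + 2 ^ i + (2 + code w)" using sm_code less_exp[of i] by (intro add_mono) auto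
   also have "\<dots> \<le> ?M" using power_increasing[OF less_imp_le[OF that], of "2::nat"] by linarith
   finally show "sm n2 (i ## 2 ^ i ## ?e) <= ?M" .
  qed (simp add: k_def)
  ultimately have pX: "peak X ?e <= ?M ^ k"
   unfolding X_def peak.simps by (intro Max.boundedI) (auto simp: q t r)
  have pp: "peak p (?Y ## ?e) <= ?M ^ k"
  proof (rule pw[OF 3])
   have "sm n3 (?Y ## ?e) <= sm (Suc n3) (?Y ## ?e)" by (rule sm_mono) simp
   also have "\<dots> = ?Y + sm n3 ?e"
   unfolding sm_def by (simp add: sum.lessThan_Suc_shift del: sum.lessThan_Suc)
   also have "\<dots> \<le> ?M" using sm_code[of n3 "code w"] by simp
   finally show "sm n3 (?Y ## ?e) <= ?M" .
  qed (simp add: k_def)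
  have M2: "?M < 2 ^ (length w + b (code w) + 5)"
  proof -
   have "(2::nat) ^ Suc (length w) <= 2 ^ (length w + b (code w) + 1)" "2 * ?Y <= 2 ^ (length w + b (code w) + 1)"
   "(2::nat) <= 2 ^ (length w + b (code w) + 1)"
   by (auto intro: power_increasing simp: power_add)
   then have "?M < 3 * 2 ^ (length w + b (code w) + 1) + 1" using code_less[of w] by linarith
   also have "\<dots> \<le> 2 ^ (length w + b (code w) + 5)" by (simp add: power_add)
   finally show ?thesis .
  qed
  have "peak (PLet X p) ?e <= ?M ^ k" using pX pp X by simp
  also have "\<dots> < (2 ^ (length w + b (code w) + 5)) ^ k" by (rule power_strict_mono[OF M2]) (auto simp: k_def)
  also have "\<dots> = 2 ^ (k * (length w + b (code w) + 5))" by (simp only: power_mult[symmetric] mult.commute)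
  finally show ?thesis .
 qed
 show ?thesis
 proof (rule pr_dspace[where p = "PLet X p" and m = m and H = "%w. k * (length w + b (code w) + 5)" and d = "k * (d + 5)"])
  show "closed_pr (Suc m) (PLet X p)"
   using closed_pr_mono[OF q(1)] closed_pr_mono[OF t(1)] closed_pr_mono[OF p(1)] by (simp add: X_def m_def)
  show "(eval (PLet X p) (code w ## (%_. 0)) ~= 0) = (w \<in> L)" for w using L[of w] by (simp add: X p)
  show "peak (PLet X p) (code w ## (%_. 0)) < 2 ^ (k * (length w + b (code w) + 5))" for w by (rule peak)
  show "code w < 2 ^ (k * (length w + b (code w) + 5))" for w
  proof -
   have "Suc (length w) <= k * (length w + b (code w) + 5)" by (simp add: k_def)
   then have "(2::nat) ^ Suc (length w) <= 2 ^ (k * (length w + b (code w) + 5))" by (intro power_increasing) auto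
   then show ?thesis using code_less[of w] by linarith
  qed
  show "k * (length w + b (code w) + 5) <= k * (d + 5) * s (length w) + k * (d + 5)" for w
  proof -
   have "length w + b (code w) + 5 <= (d + 5) * s (length w) + (d + 5)" using bd[of w] by (simp add: algebra_simps)
   then have "k * (length w + b (code w) + 5) <= k * ((d + 5) * s (length w) + (d + 5))" by (rule mult_le_mono2)
   then show ?thesis by (simp add: algebra_simps)
  qed
 qed
qed

section \<open>Parsing by guessing positions, and the local law of truth vectors\<close>

section \<open>Reading encodings\<close>

lemma bit_code: "bit (code w) i \<longleftrightarrow> (if i < length w then w ! i else i = length w)"
proof (induction w arbitrary: i)
 case (Cons b w)
 then show ?case by (cases i) (auto simp: bit_0 bit_Suc)
next
 case Nil
 then show ?case using bit_1_iff[of i, where 'a = nat] by simp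
qed

text \<open>The unary number written at position \<open>p\<close> of the word coded by
  \<open>W\<close>; \<open>nx\<close> is the position after its terminating zero.\<close>

definition tk :: "nat => nat => nat" where
 "tk W p = mu W (%k. ~ bit W (p + k))"

definition nx :: "nat => nat => nat" where
 "nx W p = p + tk W p + 1"

definition lg :: "nat => nat" where
 "lg W = mu W (%i. W div 2 ^ i <= 1)"

lemma lg_code: "lg (code w) = length w"
 unfolding lg_def
proof (rule mu_eqI)
 show "code w div 2 ^ length w <= 1"
  using code_less[of w] by (simp add: less_mult_imp_div_less less_Suc_eq_le[symmetric] del: less_Suc_eq_le)
 show "length w <= code w" using code_ge[of w] less_exp[of "length w"] by linarith
 show "~ code w div 2 ^ i <= 1" if "i < length w" for i
 proof -
  have "2 * 2 ^ i <= (2::nat) ^ length w" using that power_increasing[of "Suc i" "length w" "2::nat"] by simp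
  then have "2 * 2 ^ i <= code w" using code_ge[of w] by linarith
  then have "2 <= code w div 2 ^ i" by (simp add: less_eq_div_iff_mult_less_eq)
  then show ?thesis by simp
 qed
qed

lemma nx_gt: "p < nx W p"
 by (simp add: nx_def)

lemma tk_prop: "~ bit (code w) (p + tk (code w) p)"
proof -
 have "code w < 2 ^ code w" by (rule less_exp)
 also have "\<dots> \<le> 2 ^ (p + code w)" by (rule power_increasing) auto
 finally have "~ bit (code w) (p + code w)" by (simp add: bit_iff_odd)
 then show ?thesis using mu_cases[of "code w" "%k. ~ bit (code w) (p + k)"] unfolding tk_def by metis
qed

lemma read_nat:
 assumes "drop p w = enc_nat k @ r"
 shows "tk (code w) p = k" "drop (nx (code w) p) w = r" "nx (code w) p <= length w" "p < length w"
proof -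
 have len: "length w - p = k + 1 + length r" using arg_cong[OF assms, of length] by (simp add: enc_nat_def)
 have lt: "p + k < length w" using len by linarith
 have nth: "w ! (p + i) = (enc_nat k @ r) ! i" if "p + i < length w" for i
  using that arg_cong[OF assms, of "%l. l ! i"] by (simp add: nth_drop)
 have bits: "bit (code w) (p + i)" if "i < k" for i
  using nth[of i] that lt by (simp add: bit_code enc_nat_def nth_append)
 have zero: "~ bit (code w) (p + k)"
  using nth[of k] lt by (simp add: bit_code enc_nat_def nth_append)
 have "p + k < 2 ^ (p + k)" by (rule less_exp)
 also have "\<dots> \<le> 2 ^ length w" using len by (intro power_increasing) auto
 also have "\<dots> \<le> code w" by (rule code_ge)
 finally have "k <= code w" by simp
 then show t: "tk (code w) p = k" unfolding tk_def using bits zero by (intro mu_eqI) auto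
 have "nx (code w) p = (k + 1) + p" by (simp add: nx_def t)
 then have "drop (nx (code w) p) w = drop (k + 1) (drop p w)" by simp
 then show "drop (nx (code w) p) w = r" unfolding assms by (simp add: enc_nat_def)
 show "nx (code w) p <= length w" "p < length w" using len by (simp_all add: nx_def t)
qed

lemma read_nat_conv:
 assumes "nx (code w) p <= length w"
 shows "drop p w = enc_nat (tk (code w) p) @ drop (nx (code w) p) w"
proof -
 let ?k = "tk (code w) p"
 have len: "p + ?k < length w" using assms by (simp add: nx_def)
 have "w ! (p + i)" if "i < ?k" for i
  using mu_least[of i "code w" "%k. ~ bit (code w) (p + k)"] that len
  unfolding tk_def[symmetric] by (auto simp: bit_code split: if_splits)
 then have 1: "take ?k (drop p w) = replicate ?k True"
  using len by (intro nth_equalityI) auto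
 have 2: "drop p w ! ?k = False" using tk_prop[of w p] len by (simp add: bit_code)
 have "drop p w = take ?k (drop p w) @ drop p w ! ?k # drop (Suc ?k) (drop p w)"
  using len by (intro id_take_nth_drop) simp
 also have "\<dots> = enc_nat ?k @ drop (nx (code w) p) w"
  using 1 2 by (simp add: enc_nat_def nx_def add.commute add.left_commute)
 finally show ?thesis .
qed

text \<open>Any finite table is the digit sequence of some number, so that guessing a table is a
  bounded quantifier over numbers.\<close>

lemma ex_digits: "\<exists>x<b ^ m. \<forall>i<m. dg b x i = f i" if "!!i. i < m ==> f i < b"
 using that
proof (induction m arbitrary: f)
 case (Suc m)
 obtain x where x: "x < b ^ m" "\<forall>i<m. dg b x i = f (Suc i)" using Suc.IH[of "%i. f (Suc i)"] Suc.prems by auto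
 have f0: "f 0 < b" using Suc.prems by simp
 have "b * x + f 0 < b * (x + 1)" using f0 by simp
 also have "\<dots> \<le> b * b ^ m" using x(1) by (intro mult_le_mono2) simp
 finally have "b * x + f 0 < b ^ Suc m" by simp
 moreover have "dg b (b * x + f 0) i = f i" if "i < Suc m" for i
  using that x(2) f0 by (cases i) (auto simp: dg_0 dg_Suc)
 ultimately show ?case by blast
qed simp

lemma ex_bits: "\<exists>x<(2::nat) ^ m. ALL i. bit x i \<longleftrightarrow> i < m & P i"
proof -
 have "of_bool (P i) < (2::nat)" for i by (simp add: of_bool_def)
 then obtain x where x: "x < 2 ^ m" "\<forall>i<m. dg 2 x i = of_bool (P i)" using ex_digits[of m "%i. of_bool (P i)" 2] by auto
 have "bit x i \<longleftrightarrow> i < m & P i" for i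
 proof (cases "i < m")
  case True
  then show ?thesis using x(2) by (auto simp: dg_def bit_iff_odd odd_iff_mod_2_eq_one)
 next
  case False
  then have "x < 2 ^ i" using x(1) power_increasing[of m i "2::nat"] by linarith
  then show ?thesis using False by (simp add: bit_iff_odd)
 qed
 then show ?thesis using x(1) by blast
qed

text \<open>\<open>K\<close> marks positions at which a base formula starts, and \<open>N\<close> holds the end positions.\<close>

definition en :: "nat => nat => nat => nat" where
 "en W N p = dg (lg W + 1) N p"

text \<open>Each marked position is related only to the starts and ends of its immediate
  subformulas, so checking a guessed parse takes no recursion. \<open>C\<close> is the set of
  admissible atom codes.\<close>

definition base_ok :: "nat set => nat => nat => nat => bool" where
 "base_ok C W K N \<longleftrightarrow> (\<forall>p<lg W. bit K p --> p < en W N p & en W N p <= lg W & nx W p < lg W &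
  (tk W p = 0 & tk W (nx W p) \<in> C & nx W (nx W p) = en W N p \<or>
   (tk W p = 1 \<or> tk W p = 4) & bit K (nx W p) & en W N (nx W p) = en W N p \<or>
   (tk W p = 2 \<or> tk W p = 3 \<or> tk W p = 5) & bit K (nx W p) & en W N (nx W p) < lg W &
   bit K (en W N (nx W p)) & en W N (en W N (nx W p)) = en W N p))"

definition plus_ok :: "nat => nat => nat => nat => nat => bool" where
 "plus_ok W K N KP NP \<longleftrightarrow> (\<forall>p<lg W. bit KP p --> p < en W NP p & en W NP p <= lg W & nx W p < lg W &
  (tk W p < 4 & bit K (nx W p) & en W N (nx W p) = en W NP p \<or>
   (tk W p = 4 \<or> tk W p = 5) & bit KP (nx W p) & en W NP (nx W p) < lg W &
   bit KP (en W NP (nx W p)) & en W NP (en W NP (nx W p)) = en W NP p \<or>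
   tk W p = 6 & bit KP (nx W p) & en W NP (nx W p) = en W NP p))"

lemma en_le: "en W N p <= lg W"
 by (simp add: en_def dg_def less_Suc_eq_le[symmetric] del: less_Suc_eq_le)

locale word =
 fixes w :: "bool list" and c :: "'a::finite => nat"
 assumes inj: "inj c"
begin

abbreviation "W \<equiv> code w"
abbreviation "n \<equiv> length w"

definition base_at :: "nat => 'a ppltl => nat => bool" where
 "base_at p fm j \<longleftrightarrow> j <= n & drop p w = enc_ppltl c fm @ drop j w"

definition plus_at :: "nat => 'a ppltl plus => nat => bool" where
 "plus_at p \<Psi> j \<longleftrightarrow> j <= n & drop p w = enc_plus (enc_ppltl c) \<Psi> @ drop j w"

lemma drop_eq: "drop j w = drop j' w ==> j <= n ==> j' <= n ==> j = j'"
 by (metis diff_diff_cancel length_drop)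

lemma base_at_unique: "base_at p fm j ==> base_at p fm' j' ==> fm = fm' & j = j'"
 unfolding base_at_def using prefix_freeD[OF prefix_free_enc_ppltl[OF inj]] drop_eq by metis

lemma plus_at_unique: "plus_at p \<Psi> j ==> plus_at p \<Psi>' j' ==> \<Psi> = \<Psi>' & j = j'"
 unfolding plus_at_def using prefix_freeD[OF prefix_free_enc_plus[OF prefix_free_enc_ppltl[OF inj]]] drop_eq by metis

lemma enc_ppltl_nonempty: "enc_ppltl c fm ~= []"
 by (cases fm) (auto simp: enc_nat_def)

lemma enc_plus_nonempty: "enc_plus (enc_ppltl c) \<Psi> ~= []"
 by (cases \<Psi>) (auto simp: enc_nat_def)

lemma base_at_less: assumes a: "base_at p fm j" shows "p < j"
proof -
 have "n - p = length (enc_ppltl c fm) + (n - j)"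
  using arg_cong[of _ _ length] a unfolding base_at_def by (metis length_append length_drop)
 moreover have "0 < length (enc_ppltl c fm)" using enc_ppltl_nonempty by simp
 moreover have "j <= n" using a by (simp add: base_at_def)
 ultimately show ?thesis by linarith
qed

lemma plus_at_less: assumes a: "plus_at p \<Psi> j" shows "p < j"
proof -
 have "n - p = length (enc_plus (enc_ppltl c) \<Psi>) + (n - j)"
  using arg_cong[of _ _ length] a unfolding plus_at_def by (metis length_append length_drop)
 moreover have "0 < length (enc_plus (enc_ppltl c) \<Psi>)" using enc_plus_nonempty by simp
 moreover have "j <= n" using a by (simp add: plus_at_def)
 ultimately show ?thesis by linarith
qed

end

text \<open>Both logics share one local law: with \<open>v\<close> the truth vector at the neighbouring position (the
 previous one for past formulas, the next one for future formulas) and \<open>a\<close> the letter read, \<open>v'\<close> is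
 the truth vector at the current position.\<close>

definition loc :: "nat => nat => nat => nat => nat => nat => bool" where
 "loc W K N v' v a \<longleftrightarrow> v' div 2 ^ lg W = 0 & (\<forall>p<lg W. bit v' p = (bit K p &
   (tk W p = 0 & bit a (tk W (nx W p)) \<or> tk W p = 1 & ~ bit v' (nx W p) \<or>
   tk W p = 2 & bit v' (nx W p) & bit v' (en W N (nx W p)) \<or>
   tk W p = 3 & (bit v' (nx W p) \<or> bit v' (en W N (nx W p))) \<or>
   tk W p = 4 & bit v (nx W p) \<or>
   tk W p = 5 & (bit v' (en W N (nx W p)) \<or> bit v' (nx W p) & bit v p))))"

text \<open>Solves the equations of \<open>loc\<close> by recursion: subformulas start further to
  the right. The guard before the call at \<open>en\<close> makes the decrease hold for arbitrary
  \<open>N\<close>.\<close>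

function lb :: "nat => nat => nat => nat => nat => nat => bool" where
 "lb W K N v a p = (if p < lg W & bit K p then
   let x = lb W K N v a (nx W p); y = (if p < en W N (nx W p) then lb W K N v a (en W N (nx W p)) else False) in
   (tk W p = 0 & bit a (tk W (nx W p)) \<or> tk W p = 1 & ~ x \<or> tk W p = 2 & x & y \<or>
   tk W p = 3 & (x \<or> y) \<or> tk W p = 4 & bit v (nx W p) \<or> tk W p = 5 & (y \<or> x & bit v p))
   else False)"
 by pat_completeness auto
termination
 by (relation "measure (%(W, K, N, v, a, p). lg W - p)") (use nx_gt in \<open>auto intro!: diff_less_mono2\<close>)

declare lb.simps [simp del]

lemma loc_unique:
 assumes ok: "base_ok C W K N" and "loc W K N v' v a" "p < lg W"
 shows "bit v' p = lb W K N v a p"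
 using assms(3)
proof (induction "lg W - p" arbitrary: p rule: less_induct)
 case less
 show ?case
 proof (cases "bit K p")
  case False
  then show ?thesis using assms(2) less.prems by (subst lb.simps) (simp add: loc_def)
 next
  case True
  have nxp: "p < nx W p" "nx W p < lg W" using nx_gt ok True less.prems by (auto simp: base_ok_def)
  then have 1: "bit v' (nx W p) = lb W K N v a (nx W p)" by (intro less) auto
  have 2: "p < en W N (nx W p) & bit v' (en W N (nx W p)) = lb W K N v a (en W N (nx W p))"
   if "tk W p = 2 \<or> tk W p = 3 \<or> tk W p = 5"
  proof -
   have *: "bit K (nx W p)" "en W N (nx W p) < lg W" using that ok True less.prems by (auto simp: base_ok_def)
   then have "nx W p < en W N (nx W p)" using ok nxp by (auto simp: base_ok_def)
   then show ?thesis using * nxp by (auto intro!: less)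
  qed
  have "bit v' p = (tk W p = 0 & bit a (tk W (nx W p)) \<or> tk W p = 1 & ~ bit v' (nx W p) \<or>
   tk W p = 2 & bit v' (nx W p) & bit v' (en W N (nx W p)) \<or>
   tk W p = 3 & (bit v' (nx W p) \<or> bit v' (en W N (nx W p))) \<or>
   tk W p = 4 & bit v (nx W p) \<or>
   tk W p = 5 & (bit v' (en W N (nx W p)) \<or> bit v' (nx W p) & bit v p))"
   using assms(2) less.prems True unfolding loc_def by blast
  moreover have "lb W K N v a p =
   (let x = lb W K N v a (nx W p); y = (if p < en W N (nx W p) then lb W K N v a (en W N (nx W p)) else False) in
   (tk W p = 0 & bit a (tk W (nx W p)) \<or> tk W p = 1 & ~ x \<or> tk W p = 2 & x & y \<or>
   tk W p = 3 & (x \<or> y) \<or> tk W p = 4 & bit v (nx W p) \<or> tk W p = 5 & (y \<or> x & bit v p)))"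
   using True less.prems by (subst lb.simps) simp
  ultimately show ?thesis
   by (cases "tk W p = 2 \<or> tk W p = 3 \<or> tk W p = 5") (auto simp: Let_def 1 2)
 qed
qed

lemma bit_small: "(v::nat) div 2 ^ n = 0 ==> n <= p ==> ~ bit v p"
 by (metis bit_iff_odd div_mult2_eq div_0 even_zero le_Suc_ex power_add)

lemma loc_exists:
 assumes ok: "base_ok C W K N"
 shows "EX v'. loc W K N v' v a"
proof -
 obtain v' where v': "v' < (2::nat) ^ lg W" "ALL p. bit v' p \<longleftrightarrow> p < lg W & lb W K N v a p"
  using ex_bits[of "lg W" "lb W K N v a"] by (elim exE conjE)
 have "bit v' p = (bit K p &
   (tk W p = 0 & bit a (tk W (nx W p)) \<or> tk W p = 1 & ~ bit v' (nx W p) \<or>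
   tk W p = 2 & bit v' (nx W p) & bit v' (en W N (nx W p)) \<or>
   tk W p = 3 & (bit v' (nx W p) \<or> bit v' (en W N (nx W p))) \<or>
   tk W p = 4 & bit v (nx W p) \<or>
   tk W p = 5 & (bit v' (en W N (nx W p)) \<or> bit v' (nx W p) & bit v p)))" if p: "p < lg W" for p
 proof (cases "bit K p")
  case False
  then show ?thesis using v'(2) by (simp add: lb.simps[of W K N v a p])
 next
  case True
  have nxp: "p < nx W p" "nx W p < lg W" using nx_gt ok True p by (auto simp: base_ok_def)
  have 2: "p < en W N (nx W p) & en W N (nx W p) < lg W" if "tk W p = 2 \<or> tk W p = 3 \<or> tk W p = 5"
  proof -
   have *: "bit K (nx W p)" "en W N (nx W p) < lg W" using that ok True p by (auto simp: base_ok_def)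
   then have "nx W p < en W N (nx W p)" using ok nxp by (auto simp: base_ok_def)
   then show ?thesis using * nxp by auto
  qed
  have "bit v' p = (let x = lb W K N v a (nx W p); y = (if p < en W N (nx W p) then lb W K N v a (en W N (nx W p)) else False) in
   (tk W p = 0 & bit a (tk W (nx W p)) \<or> tk W p = 1 & ~ x \<or> tk W p = 2 & x & y \<or>
   tk W p = 3 & (x \<or> y) \<or> tk W p = 4 & bit v (nx W p) \<or> tk W p = 5 & (y \<or> x & bit v p)))"
   using True p v'(2)[rule_format, of p] by (subst (asm) lb.simps) simp
  moreover have "bit v' (nx W p) = lb W K N v a (nx W p)" using v'(2) nxp by simp
  moreover have "bit v' (en W N (nx W p)) = lb W K N v a (en W N (nx W p))"
   if "tk W p = 2 \<or> tk W p = 3 \<or> tk W p = 5" using v'(2) 2[OF that] by simp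
  ultimately show ?thesis using 2 True
   by (cases "tk W p = 2 \<or> tk W p = 3 \<or> tk W p = 5") (auto simp: Let_def)
 qed
 then show ?thesis using v'(1) unfolding loc_def by (intro exI[of _ v']) auto
qed

definition lam :: "nat => nat => nat => nat => nat => nat" where
 "lam W K N a v = (SOME v'. loc W K N v' v a)"

lemma loc_lam: "base_ok C W K N ==> loc W K N (lam W K N a v) v a"
 unfolding lam_def using loc_exists by (metis someI_ex)

text \<open>For a correct parse, \<open>loc\<close> is the graph of a function: every bit is
  determined by bits further right, the neighbouring vector and the letter.\<close>

lemma loc_iff_lam:
 assumes "base_ok C W K N"
 shows "loc W K N v' v a \<longleftrightarrow> v' = lam W K N a v"
proof
 assume l: "loc W K N v' v a"
 note m = loc_lam[OF assms, of a v]
 show "v' = lam W K N a v"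
 proof (rule bit_eqI)
  fix p
  show "bit v' p = bit (lam W K N a v) p"
   using loc_unique[OF assms l, of p] loc_unique[OF assms m, of p] bit_small[of v' "lg W" p]
   bit_small[of "lam W K N a v" "lg W" p] l m by (cases "p < lg W") (auto simp: loc_def)
 qed
qed (use loc_lam[OF assms] in auto)

lemma lam_less: "base_ok C W K N ==> lam W K N a v < 2 ^ lg W"
 using loc_lam[of C W K N a v] by (auto simp: loc_def div_eq_0_iff)

section \<open>Time reversal between LTLf and PPLTL\<close>

section \<open>Past formulas and reversal\<close>

lemma ppltl_holds_append: "i < length t ==> ppltl_holds (t @ u) i fm = ppltl_holds t i fm"
proof (induction fm arbitrary: i)
 case (SinceP fm fn2)
 then show ?case by (auto simp: SinceP.IH order.strict_trans1)
qed (auto simp: nth_append)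

lemma since_unfold: "ppltl_holds t i (SinceP fm fn2) \<longleftrightarrow> ppltl_holds t i fn2 \<or>
  (ppltl_holds t i fm & 1 <= i & ppltl_holds t (i - 1) (SinceP fm fn2))" (is "?L \<longleftrightarrow> ?R")
proof
 assume ?L
 then obtain j where j: "j <= i" "ppltl_holds t j fn2" "ALL k. j < k & k <= i --> ppltl_holds t k fm" by auto
 show ?R
 proof (cases "j = i")
  case False
  then have "1 <= i" "j <= i - 1" using j(1) by auto
  then show ?thesis using j False by (auto intro!: exI[of _ j])
 qed (use j in auto)
next
 assume ?R
 then show ?L
 proof (elim disjE conjE)
  assume a: "ppltl_holds t i fm" "1 <= i" "ppltl_holds t (i - 1) (SinceP fm fn2)"
  then obtain j where j: "j <= i - 1" "ppltl_holds t j fn2" "ALL k. j < k & k <= i - 1 --> ppltl_holds t k fm" by auto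
  have "ppltl_holds t k fm" if "j < k" "k <= i" for k
   using that j(3) a(1) by (cases "k = i") auto
  then show ?L using j(1,2) a(2) by (auto intro!: exI[of _ j])
 qed auto
qed

fun mir :: "'a ltlf => 'a ppltl" where
 "mir (AtomF p) = AtomP p"
| "mir (NotF fm) = NotP (mir fm)"
| "mir (AndF fm fn2) = AndP (mir fm) (mir fn2)"
| "mir (OrF fm fn2) = OrP (mir fm) (mir fn2)"
| "mir (NextF fm) = YesterdayP (mir fm)"
| "mir (UntilF fm fn2) = SinceP (mir fm) (mir fn2)"

fun rim :: "'a ppltl => 'a ltlf" where
 "rim (AtomP p) = AtomF p"
| "rim (NotP fm) = NotF (rim fm)"
| "rim (AndP fm fn2) = AndF (rim fm) (rim fn2)"
| "rim (OrP fm fn2) = OrF (rim fm) (rim fn2)"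
| "rim (YesterdayP fm) = NextF (rim fm)"
| "rim (SinceP fm fn2) = UntilF (rim fm) (rim fn2)"

lemma mir_rim [simp]: "mir (rim fm) = fm"
 by (induction fm) auto

lemma rim_mir [simp]: "rim (mir fm) = fm"
 by (induction fm) auto

text \<open>Corresponding constructors of the two logics carry the same number. The LTLf problems
  thereby become problems about PPLTL syntax under the semantics \<open>rev_lang\<close>.\<close>

lemma enc_mir: "enc_ppltl c (mir fm) = enc_ltlf c fm"
 by (induction fm) auto

text \<open>Reversal exchanges next with yesterday and until with since; the strong operators match
  at the two ends of the trace.\<close>

lemma holds_mir: "i < length t ==> ltlf_holds t i fm = ppltl_holds (rev t) (length t - 1 - i) (mir fm)"
proof (induction fm arbitrary: i)
 case (NextF fm)
 then show ?case by (auto simp: NextF.IH diff_diff_add)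
next
 case (UntilF fm fn2)
 show ?case (is "?L = ?R")
 proof
  assume ?L
  then obtain j where j: "i <= j" "j < length t" "ltlf_holds t j fn2" "ALL k. i <= k & k < j --> ltlf_holds t k fm" by auto
  have "ppltl_holds (rev t) k (mir fm)" if "length t - 1 - j < k" "k <= length t - 1 - i" for k
  proof -
   have "i <= length t - 1 - k" "length t - 1 - k < j" using that UntilF.prems j(1,2) by auto
   then have "ltlf_holds t (length t - 1 - k) fm" using j(4) by blast
   moreover have "length t - 1 - (length t - 1 - k) = k" "length t - 1 - k < length t" using that UntilF.prems by auto
   ultimately show ?thesis using UntilF.IH(1) by metis
  qed
  moreover have "ppltl_holds (rev t) (length t - 1 - j) (mir fn2)" using j UntilF.IH(2) by auto
  ultimately show ?R using j(1) by (auto intro!: exI[of _ "length t - 1 - j"])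
 next
  assume ?R
  then obtain j where j: "j <= length t - 1 - i" "ppltl_holds (rev t) j (mir fn2)"
   "ALL k. j < k & k <= length t - 1 - i --> ppltl_holds (rev t) k (mir fm)" by auto
  have "ltlf_holds t k fm" if "i <= k" "k < length t - 1 - j" for k
  proof -
   have "j < length t - 1 - k" "length t - 1 - k <= length t - 1 - i" "k < length t" using that by auto
   then show ?thesis using j(3) UntilF.IH(1)[of k] by blast
  qed
  moreover have "length t - 1 - (length t - 1 - j) = j" "length t - 1 - j < length t" using j(1) UntilF.prems by auto
  moreover from this have "ltlf_holds t (length t - 1 - j) fn2" using j(2) UntilF.IH(2) by metis
  ultimately show ?L using j(1) UntilF.prems by (auto intro!: exI[of _ "length t - 1 - j"])
 qed
qed (auto simp: rev_nth)

definition rev_lang :: "'a ppltl => 'a fin_trace set" where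
 "rev_lang fm = {t. rev t \<in> ppltl_lang fm}"

lemma ltlf_lang_mir: "ltlf_lang fm = rev_lang (mir fm)"
 using holds_mir[of 0] by (auto simp: ltlf_lang_def rev_lang_def ppltl_lang_def)

section \<open>Correctness of the parse, and automata whose states are truth vectors or tables of
  them\<close>

section \<open>Deterministic automata on truth vectors\<close>

context word begin

lemma lgW [simp]: "lg W = n"
 by (rule lg_code)

lemma drop_enc_nat: "drop p w = enc_nat k @ r \<longleftrightarrow> tk W p = k & nx W p <= n & drop (nx W p) w = r"
 using read_nat[of p w k r] read_nat_conv[of w p] by auto

lemma drop_split: "drop p w = x @ y ==> \<exists>i\<le>n. drop i w = y & drop p w = x @ drop i w"
proof -
 assume a: "drop p w = x @ y"
 then have "y = drop (p + length x) w" by (metis append_eq_conv_conj drop_drop add.commute)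
 then show ?thesis using a by (cases "p + length x <= n") (auto intro: exI[of _ n] exI[of _ "p + length x"])
qed

lemma base_at2: "(j <= n & drop q w = enc_ppltl c fm @ enc_ppltl c fn2 @ drop j w) \<longleftrightarrow> (EX i. base_at q fm i & base_at i fn2 j)"
proof
 assume a: "j <= n & drop q w = (enc_ppltl c) fm @ (enc_ppltl c) fn2 @ drop j w"
 then obtain i where "i <= n" "drop q w = (enc_ppltl c) fm @ drop i w" "drop i w = (enc_ppltl c) fn2 @ drop j w"
  using drop_split[of q "(enc_ppltl c) fm" "(enc_ppltl c) fn2 @ drop j w"] by auto
 then show "EX i. base_at q fm i & base_at i fn2 j" using a by (auto simp: base_at_def intro!: exI[of _ i])
qed (auto simp: base_at_def)

lemma plus_at2: "(j <= n & drop q w = enc_plus (enc_ppltl c) fm @ enc_plus (enc_ppltl c) fn2 @ drop j w) \<longleftrightarrow>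
  (EX i. plus_at q fm i & plus_at i fn2 j)"
proof
 assume a: "j <= n & drop q w = (enc_plus (enc_ppltl c)) fm @ (enc_plus (enc_ppltl c)) fn2 @ drop j w"
 then obtain i where "i <= n" "drop q w = (enc_plus (enc_ppltl c)) fm @ drop i w" "drop i w = (enc_plus (enc_ppltl c)) fn2 @ drop j w"
  using drop_split[of q "(enc_plus (enc_ppltl c)) fm" "(enc_plus (enc_ppltl c)) fn2 @ drop j w"] by auto
 then show "EX i. plus_at q fm i & plus_at i fn2 j" using a by (auto simp: plus_at_def intro!: exI[of _ i])
qed (auto simp: plus_at_def)

lemma base_at_simps:
 "base_at p (AtomP a) j \<longleftrightarrow> j <= n & tk W p = 0 & nx W p <= n & tk W (nx W p) = c a & nx W (nx W p) <= n & nx W (nx W p) = j"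
 "base_at p (NotP fm) j \<longleftrightarrow> tk W p = 1 & nx W p <= n & base_at (nx W p) fm j"
 "base_at p (YesterdayP fm) j \<longleftrightarrow> tk W p = 4 & nx W p <= n & base_at (nx W p) fm j"
 "base_at p (AndP fm fn2) j \<longleftrightarrow> tk W p = 2 & nx W p <= n & (EX i. base_at (nx W p) fm i & base_at i fn2 j)"
 "base_at p (OrP fm fn2) j \<longleftrightarrow> tk W p = 3 & nx W p <= n & (EX i. base_at (nx W p) fm i & base_at i fn2 j)"
 "base_at p (SinceP fm fn2) j \<longleftrightarrow> tk W p = 5 & nx W p <= n & (EX i. base_at (nx W p) fm i & base_at i fn2 j)"
proof -
 have "drop q w = drop j w \<longleftrightarrow> q = j" if "q <= n" "j <= n" for q
  using drop_eq[OF _ that] by blast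
 note eq = this[of "nx W (nx W p)"]
 show "base_at p (AtomP a) j \<longleftrightarrow> j <= n & tk W p = 0 & nx W p <= n & tk W (nx W p) = c a & nx W (nx W p) <= n & nx W (nx W p) = j"
  unfolding base_at_def enc_ppltl.simps append_assoc drop_enc_nat using eq by blast
 note seq = base_at2[of j "nx W p" fm fn2]
 show "base_at p (AndP fm fn2) j \<longleftrightarrow> tk W p = 2 & nx W p <= n & (EX i. base_at (nx W p) fm i & base_at i fn2 j)"
  unfolding seq[symmetric] unfolding base_at_def enc_ppltl.simps append_assoc drop_enc_nat by argo
 show "base_at p (OrP fm fn2) j \<longleftrightarrow> tk W p = 3 & nx W p <= n & (EX i. base_at (nx W p) fm i & base_at i fn2 j)"
  unfolding seq[symmetric] unfolding base_at_def enc_ppltl.simps append_assoc drop_enc_nat by argo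
 show "base_at p (SinceP fm fn2) j \<longleftrightarrow> tk W p = 5 & nx W p <= n & (EX i. base_at (nx W p) fm i & base_at i fn2 j)"
  unfolding seq[symmetric] unfolding base_at_def enc_ppltl.simps append_assoc drop_enc_nat by argo
qed (unfold base_at_def enc_ppltl.simps append_assoc drop_enc_nat, argo+)

lemma plus_at_simps:
 "plus_at p (AllQ fm) j \<longleftrightarrow> tk W p = 0 & nx W p <= n & base_at (nx W p) fm j"
 "plus_at p (ExQ fm) j \<longleftrightarrow> tk W p = 1 & nx W p <= n & base_at (nx W p) fm j"
 "plus_at p (InfQ fm) j \<longleftrightarrow> tk W p = 2 & nx W p <= n & base_at (nx W p) fm j"
 "plus_at p (CofinQ fm) j \<longleftrightarrow> tk W p = 3 & nx W p <= n & base_at (nx W p) fm j"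
 "plus_at p (OrQ \<Psi> \<Psi>') j \<longleftrightarrow> tk W p = 4 & nx W p <= n & (EX i. plus_at (nx W p) \<Psi> i & plus_at i \<Psi>' j)"
 "plus_at p (AndQ \<Psi> \<Psi>') j \<longleftrightarrow> tk W p = 5 & nx W p <= n & (EX i. plus_at (nx W p) \<Psi> i & plus_at i \<Psi>' j)"
 "plus_at p (NotQ \<Psi>) j \<longleftrightarrow> tk W p = 6 & nx W p <= n & plus_at (nx W p) \<Psi> j"
proof -
 note seq = plus_at2[of j "nx W p" \<Psi> \<Psi>']
 show "plus_at p (OrQ \<Psi> \<Psi>') j \<longleftrightarrow> tk W p = 4 & nx W p <= n & (EX i. plus_at (nx W p) \<Psi> i & plus_at i \<Psi>' j)"
  unfolding seq[symmetric] unfolding plus_at_def enc_plus.simps append_assoc drop_enc_nat by argo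
 show "plus_at p (AndQ \<Psi> \<Psi>') j \<longleftrightarrow> tk W p = 5 & nx W p <= n & (EX i. plus_at (nx W p) \<Psi> i & plus_at i \<Psi>' j)"
  unfolding seq[symmetric] unfolding plus_at_def enc_plus.simps append_assoc drop_enc_nat by argo
qed (unfold base_at_def plus_at_def enc_plus.simps append_assoc drop_enc_nat, argo+)

lemma base_at_le: "base_at p fm j ==> j <= n"
 by (simp add: base_at_def)

lemma plus_at_le: "plus_at p fm j ==> j <= n"
 by (simp add: plus_at_def)

text \<open>Induction from the right end of the word: the conditions at a marked position refer to
  marked positions further right, where formulas are already known to start.\<close>

lemma base_ok_sound:
 assumes ok: "base_ok (range c) W K N"
 shows "bit K p ==> p < n ==> \<exists>fm. base_at p fm (en W N p)"
proof (induction "n - p" arbitrary: p rule: less_induct)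
 case less
 let ?c = "nx W p" and ?e = "en W N p"
 have c: "p < ?c" "?c < n" using nx_gt ok less.prems by (auto simp: base_ok_def)
 have e: "?e <= n" using en_le[of W N p] by simp
 have ch: "\<exists>fm. base_at q fm (en W N q)" if "bit K q" "p < q" "q < n" for q
  using that less by auto
 have "tk W p = 0 & tk W ?c \<in> range c & nx W ?c = ?e \<or>
   (tk W p = 1 \<or> tk W p = 4) & bit K ?c & en W N ?c = ?e \<or>
   (tk W p = 2 \<or> tk W p = 3 \<or> tk W p = 5) & bit K ?c & en W N ?c < n &
   bit K (en W N ?c) & en W N (en W N ?c) = ?e"
  using ok less.prems unfolding base_ok_def by fastforce
 then consider (a) a where "tk W p = 0" "tk W ?c = c a" "nx W ?c = ?e"
  | (u) "tk W p = 1 \<or> tk W p = 4" "bit K ?c" "en W N ?c = ?e"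
  | (b) "tk W p = 2 \<or> tk W p = 3 \<or> tk W p = 5" "bit K ?c" "en W N ?c < n"
   "bit K (en W N ?c)" "en W N (en W N ?c) = ?e" by auto
 then show ?case
 proof cases
  case a
  then have "base_at p (AtomP a) ?e" using c e by (auto simp: base_at_simps)
  then show ?thesis by blast
 next
  case u
  then obtain fm where "base_at ?c fm ?e" using ch[of ?c] c by auto
  then have "base_at p (NotP fm) ?e \<or> base_at p (YesterdayP fm) ?e" using u(1) c by (auto simp: base_at_simps)
  then show ?thesis by blast
 next
  case b
  obtain fm where fm: "base_at ?c fm (en W N ?c)" using ch[of ?c] c b by auto
  then have "?c < en W N ?c" by (rule base_at_less)
  then obtain fn2 where "base_at (en W N ?c) fn2 ?e" using ch[of "en W N ?c"] c b by auto
  then have "base_at p (AndP fm fn2) ?e \<or> base_at p (OrP fm fn2) ?e \<or> base_at p (SinceP fm fn2) ?e"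
   using b(1) c fm by (auto simp: base_at_simps)
  then show ?thesis by blast
 qed
qed

lemma plus_ok_sound:
 assumes ok: "base_ok (range c) W K N" "plus_ok W K N KP NP"
 shows "bit KP p ==> p < n ==> \<exists>\<Psi>. plus_at p \<Psi> (en W NP p)"
proof (induction "n - p" arbitrary: p rule: less_induct)
 case less
 let ?c = "nx W p" and ?e = "en W NP p"
 have c: "p < ?c" "?c < n" using nx_gt ok(2) less.prems by (auto simp: plus_ok_def)
 have ch: "\<exists>fm. plus_at q fm (en W NP q)" if "bit KP q" "p < q" "q < n" for q
  using that less by auto
 have "tk W p < 4 & bit K ?c & en W N ?c = ?e \<or>
   tk W p = 6 & bit KP ?c & en W NP ?c = ?e \<or>
   (tk W p = 4 \<or> tk W p = 5) & bit KP ?c & en W NP ?c < n &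
   bit KP (en W NP ?c) & en W NP (en W NP ?c) = ?e"
  using ok(2) less.prems unfolding plus_ok_def by fastforce
 then consider (q) "tk W p = 0 \<or> tk W p = 1 \<or> tk W p = 2 \<or> tk W p = 3" "bit K ?c" "en W N ?c = ?e"
  | (u) "tk W p = 6" "bit KP ?c" "en W NP ?c = ?e"
  | (b) "tk W p = 4 \<or> tk W p = 5" "bit KP ?c" "en W NP ?c < n"
   "bit KP (en W NP ?c)" "en W NP (en W NP ?c) = ?e" by linarith
 then show ?case
 proof cases
  case q
  then obtain fm where "base_at ?c fm ?e" using base_ok_sound[OF ok(1), of ?c] c by auto
  then have "plus_at p (AllQ fm) ?e \<or> plus_at p (ExQ fm) ?e \<or> plus_at p (InfQ fm) ?e \<or> plus_at p (CofinQ fm) ?e"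
   using q(1) c by (auto simp: plus_at_simps)
  then show ?thesis by blast
 next
  case u
  then obtain fm where "plus_at ?c fm ?e" using ch[of ?c] c by auto
  then have "plus_at p (NotQ fm) ?e" using u(1) c by (auto simp: plus_at_simps)
  then show ?thesis by blast
 next
  case b
  obtain fm where fm: "plus_at ?c fm (en W NP ?c)" using ch[of ?c] c b by auto
  then have "?c < en W NP ?c" by (rule plus_at_less)
  then obtain fn2 where "plus_at (en W NP ?c) fn2 ?e" using ch[of "en W NP ?c"] c b by auto
  then have "plus_at p (AndQ fm fn2) ?e \<or> plus_at p (OrQ fm fn2) ?e"
   using b(1) c fm by (auto simp: plus_at_simps)
  then show ?thesis by blast
 qed
qed

text \<open>The intended guess marks exactly the positions where some formula starts; the end
  positions are unique because the encodings are prefix-free.\<close>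

lemma parse_exists:
 shows "\<exists>K<2 ^ n. \<exists>N<(n + 1) ^ n. \<exists>KP<2 ^ n. \<exists>NP<(n + 1) ^ n. base_ok (range c) W K N & plus_ok W K N KP NP &
  (\<forall>p<n. \<forall>\<Psi> j. plus_at p \<Psi> j --> bit KP p & en W NP p = j)"
proof -
 obtain K where K: "K < (2::nat) ^ n" "ALL p. bit K p \<longleftrightarrow> p < n & (\<exists>fm j. base_at p fm j)"
  using ex_bits[of n "%p. \<exists>fm j. base_at p fm j"] by (elim exE conjE)
 obtain KP where KP: "KP < (2::nat) ^ n" "ALL p. bit KP p \<longleftrightarrow> p < n & (\<exists>\<Psi> j. plus_at p \<Psi> j)"
  using ex_bits[of n "%p. \<exists>\<Psi> j. plus_at p \<Psi> j"] by (elim exE conjE)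
 define f where "f p = (if \<exists>fm j. base_at p fm j then THE j. \<exists>fm. base_at p fm j else 0)" for p
 define g where "g p = (if \<exists>fm j. plus_at p fm j then THE j. \<exists>fm. plus_at p fm j else 0)" for p
 have f: "f p = j" if "base_at p fm j" for p fm j
  using that base_at_unique unfolding f_def by (auto intro!: the_equality)
 have g: "g p = j" if "plus_at p fm j" for p fm j
  using that plus_at_unique unfolding g_def by (auto intro!: the_equality)
 have "f p < n + 1" for p using f base_at_le[of p] by (cases "\<exists>fm j. base_at p fm j") (force, simp add: f_def)
 then have "\<exists>x<(n + 1) ^ n. \<forall>i<n. dg (n + 1) x i = f i" by (intro ex_digits) auto
 then obtain N where N: "N < (n + 1) ^ n" "\<forall>p<n. dg (n + 1) N p = f p" by blast
 have "g p < n + 1" for p using g plus_at_le[of p] by (cases "\<exists>fm j. plus_at p fm j") (force, simp add: g_def)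
 then have "\<exists>x<(n + 1) ^ n. \<forall>i<n. dg (n + 1) x i = g i" by (intro ex_digits) auto
 then obtain NP where NP: "NP < (n + 1) ^ n" "\<forall>p<n. dg (n + 1) NP p = g p" by blast
 have enN: "en W N p = j" if "base_at p fm j" "p < n" for p fm j using N f that by (simp add: en_def)
 have enNP: "en W NP p = j" if "plus_at p fm j" "p < n" for p fm j using NP g that by (simp add: en_def)
 have lt: "p < n" if "base_at p fm j" for p fm j using base_at_less[OF that] base_at_le[OF that] by simp
 have ltP: "p < n" if "plus_at p fm j" for p fm j using plus_at_less[OF that] plus_at_le[OF that] by simp
 have "base_ok (range c) W K N"
  unfolding base_ok_def lgW
 proof (intro allI impI)
  fix p assume p: "p < n" "bit K p"
  then obtain fm j where at: "base_at p fm j" using K by auto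
  have j: "en W N p = j" "p < j" "j <= n" using enN[OF at p(1)] base_at_less[OF at] base_at_le[OF at] by auto
  have ch: "bit K q & en W N q = i & q < n" if "base_at q fn2 i" for q fn2 i using K enN lt that by blast
  show "p < en W N p & en W N p <= n & nx W p < n &
   (tk W p = 0 & tk W (nx W p) \<in> range c & nx W (nx W p) = en W N p \<or>
   (tk W p = 1 \<or> tk W p = 4) & bit K (nx W p) & en W N (nx W p) = en W N p \<or>
   (tk W p = 2 \<or> tk W p = 3 \<or> tk W p = 5) & bit K (nx W p) & en W N (nx W p) < n &
   bit K (en W N (nx W p)) & en W N (en W N (nx W p)) = en W N p)"
  proof (cases fm)
   case (AtomP a)
   then have at': "tk W p = 0" "tk W (nx W p) = c a" "nx W (nx W p) = j" using at by (auto simp: base_at_simps)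
   have "nx W p < nx W (nx W p)" by (rule nx_gt)
   then show ?thesis using at' j by auto
  qed (use at j in \<open>auto simp: base_at_simps dest!: ch\<close>)
 qed
 moreover have "plus_ok W K N KP NP"
  unfolding plus_ok_def lgW
 proof (intro allI impI)
  fix p assume p: "p < n" "bit KP p"
  then obtain fm j where at: "plus_at p fm j" using KP by auto
  have j: "en W NP p = j" "p < j" "j <= n" using enNP[OF at p(1)] plus_at_less[OF at] plus_at_le[OF at] by auto
  have ch: "bit K q & en W N q = i & q < n" if "base_at q fn2 i" for q fn2 i using K enN lt that by blast
  have chP: "bit KP q & en W NP q = i & q < n" if "plus_at q fn2 i" for q fn2 i using KP enNP ltP that by blast
  show "p < en W NP p & en W NP p <= n & nx W p < n &
   (tk W p < 4 & bit K (nx W p) & en W N (nx W p) = en W NP p \<or>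
   (tk W p = 4 \<or> tk W p = 5) & bit KP (nx W p) & en W NP (nx W p) < n &
   bit KP (en W NP (nx W p)) & en W NP (en W NP (nx W p)) = en W NP p \<or>
   tk W p = 6 & bit KP (nx W p) & en W NP (nx W p) = en W NP p)"
   using at j by (cases fm) (auto simp: plus_at_simps dest!: ch chP)
 qed
 moreover have "bit KP p & en W NP p = j" if "plus_at p \<Psi> j" for p \<Psi> j using that KP enNP ltP by blast
 ultimately show ?thesis using K(1) KP(1) N(1) NP(1) by blast
qed

end

definition trP :: "nat => nat => nat => nat => nat => nat => bool" where
 "trP W K N s a s' \<longleftrightarrow> loc W K N s' s a"

definition iniP :: "nat => nat => bool" where
 "iniP W s \<longleftrightarrow> s = 0"

definition outP :: "nat => nat => nat" where
 "outP W s = s"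

text \<open>For future formulas the state after reading \<open>u\<close> is the table of the map that sends the truth
 vector at the position following \<open>u\<close> to the truth vector at the first position.\<close>

definition trL :: "nat => nat => nat => nat => nat => nat => bool" where
 "trL W K N F a F' \<longleftrightarrow> (\<forall>v<cpow W (lg W). \<forall>v'<cpow W (lg W). loc W K N v' v a -->
   dg (cpow W (lg W)) F' v = dg (cpow W (lg W)) F v')"

definition iniL :: "nat => nat => bool" where
 "iniL W F \<longleftrightarrow> (\<forall>v<cpow W (lg W). dg (cpow W (lg W)) F v = v)"

text \<open>The vector 0 stands for the missing position after the end: there strong next fails and
  until reduces to its second argument.\<close>

definition outL :: "nat => nat => nat" where
 "outL W F = dg (cpow W (lg W)) F 0"

context word begin

lemma cpow_W [simp]: "cpow W n = 2 ^ n"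
 using code_ge[of w] by (intro cpow_eq) simp

definition lset :: "nat => 'a set" where
 "lset a = {x. bit a (c x)}"

definition vec :: "nat => nat => nat list => nat" where
 "vec K N as = fold (lam W K N) as 0"

lemma vec_snoc: "vec K N (as @ [a]) = lam W K N a (vec K N as)"
 by (simp add: vec_def)

lemma lam_bit:
 assumes "base_ok C W K N" "bit K p" "p < n"
 shows "bit (lam W K N a v) p = (tk W p = 0 & bit a (tk W (nx W p)) \<or> tk W p = 1 & ~ bit (lam W K N a v) (nx W p) \<or>
   tk W p = 2 & bit (lam W K N a v) (nx W p) & bit (lam W K N a v) (en W N (nx W p)) \<or>
   tk W p = 3 & (bit (lam W K N a v) (nx W p) \<or> bit (lam W K N a v) (en W N (nx W p))) \<or>
   tk W p = 4 & bit v (nx W p) \<or>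
   tk W p = 5 & (bit (lam W K N a v) (en W N (nx W p)) \<or> bit (lam W K N a v) (nx W p) & bit v p))"
 using loc_lam[OF assms(1), of a v] assms(2,3) unfolding loc_def lgW by blast

lemma child1:
 assumes "base_ok C W K N" "bit K p" "p < n" "tk W p = 1 \<or> tk W p = 4"
 shows "bit K (nx W p)" "nx W p < n"
 using assms by (auto simp: base_ok_def)

lemma child2:
 assumes ok: "base_ok (range c) W K N" and "bit K p" "p < n" "tk W p = 2 \<or> tk W p = 3 \<or> tk W p = 5"
  and at: "base_at (nx W p) fm i"
 shows "bit K (nx W p)" "nx W p < n" "en W N (nx W p) = i" "bit K i" "i < n"
proof -
 show 1: "bit K (nx W p)" "nx W p < n" using assms by (auto simp: base_ok_def)
 then show 2: "en W N (nx W p) = i" using base_ok_sound[OF ok] base_at_unique[OF at] by blast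
 have "(tk W p = 2 \<or> tk W p = 3 \<or> tk W p = 5) --> en W N (nx W p) < n & bit K (en W N (nx W p))"
  using ok[unfolded base_ok_def lgW, rule_format, OF assms(3,2)] by (elim conjE disjE) simp_all
 then show "bit K i" "i < n" using assms(4) 2 by auto
qed

text \<open>The update law is the one-step unfolding of the past operators
  (\<open>since_unfold\<close>), and the initial vector 0 expresses that nothing precedes the first
  position.\<close>

lemma vec_correct:
 assumes ok: "base_ok (range c) W K N"
 shows "bit K p ==> p < n ==> base_at p fm j ==> as ~= [] ==>
  bit (vec K N as) p \<longleftrightarrow> ppltl_holds (map lset as) (length as - 1) fm"
proof (induction fm arbitrary: p j as)
 case (AtomP x)
 obtain bs a where as: "as = bs @ [a]" using AtomP.prems(4) by (cases as rule: rev_cases) auto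
 show ?case using AtomP.prems lam_bit[OF ok AtomP.prems(1,2), of a "vec K N bs"]
  by (auto simp: base_at_simps as vec_snoc lset_def nth_append)
next
 case (NotP fm)
 obtain bs a where as: "as = bs @ [a]" using NotP.prems(4) by (cases as rule: rev_cases) auto
 have at: "tk W p = 1" "base_at (nx W p) fm j" using NotP.prems(3) by (auto simp: base_at_simps)
 note ch = child1[OF ok NotP.prems(1,2)]
 show ?case using NotP.IH[OF ch at(2) NotP.prems(4)] at lam_bit[OF ok NotP.prems(1,2), of a "vec K N bs"]
  by (simp add: as vec_snoc)
next
 case (AndP fm fn2)
 obtain bs a where as: "as = bs @ [a]" using AndP.prems(4) by (cases as rule: rev_cases) auto
 obtain i where at: "tk W p = 2" "base_at (nx W p) fm i" "base_at i fn2 j" using AndP.prems(3) by (auto simp: base_at_simps)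
 note ch = child2[OF ok AndP.prems(1,2) _ at(2)]
 have 1: "bit K (nx W p)" "nx W p < n" "en W N (nx W p) = i" "bit K i" "i < n" using ch at(1) by auto
 show ?case using AndP.IH(1)[OF 1(1,2) at(2) AndP.prems(4)] AndP.IH(2)[OF 1(4,5) at(3) AndP.prems(4)] at(1) 1(3)
   lam_bit[OF ok AndP.prems(1,2), of a "vec K N bs"]
  by (simp add: as vec_snoc)
next
 case (OrP fm fn2)
 obtain bs a where as: "as = bs @ [a]" using OrP.prems(4) by (cases as rule: rev_cases) auto
 obtain i where at: "tk W p = 3" "base_at (nx W p) fm i" "base_at i fn2 j" using OrP.prems(3) by (auto simp: base_at_simps)
 note ch = child2[OF ok OrP.prems(1,2) _ at(2)]
 have 1: "bit K (nx W p)" "nx W p < n" "en W N (nx W p) = i" "bit K i" "i < n" using ch at(1) by auto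
 show ?case using OrP.IH(1)[OF 1(1,2) at(2) OrP.prems(4)] OrP.IH(2)[OF 1(4,5) at(3) OrP.prems(4)] at(1) 1(3)
   lam_bit[OF ok OrP.prems(1,2), of a "vec K N bs"]
  by (simp add: as vec_snoc)
next
 case (YesterdayP fm)
 obtain bs a where as: "as = bs @ [a]" using YesterdayP.prems(4) by (cases as rule: rev_cases) auto
 have at: "tk W p = 4" "base_at (nx W p) fm j" using YesterdayP.prems(3) by (auto simp: base_at_simps)
 note ch = child1[OF ok YesterdayP.prems(1,2)]
 have 1: "bit (vec K N as) p = bit (vec K N bs) (nx W p)"
  using at(1) lam_bit[OF ok YesterdayP.prems(1,2), of a "vec K N bs"] by (simp add: as vec_snoc)
 show ?case
 proof (cases "bs = []")
  case True
  then show ?thesis using 1 by (simp add: as vec_def)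
 next
  case False
  then show ?thesis using YesterdayP.IH[OF ch at(2) False] at(1) 1
   ppltl_holds_append[of "length bs - 1" "map lset bs" "[lset a]" fm]
   by (cases "length bs") (auto simp: as)
 qed
next
 case (SinceP fm fn2)
 obtain i where at: "tk W p = 5" "base_at (nx W p) fm i" "base_at i fn2 j" using SinceP.prems(3) by (auto simp: base_at_simps)
 note ch = child2[OF ok SinceP.prems(1,2) _ at(2)]
 have 1: "bit K (nx W p)" "nx W p < n" "en W N (nx W p) = i" "bit K i" "i < n" using ch at(1) by auto
 show ?case using SinceP.prems(4)
 proof (induction as rule: rev_induct)
  case (snoc a bs)
  have as: "bs @ [a] ~= []" by simp
  have rec: "bit (vec K N (bs @ [a])) p \<longleftrightarrow> ppltl_holds (map lset (bs @ [a])) (length bs) fn2 \<or>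
   ppltl_holds (map lset (bs @ [a])) (length bs) fm & bit (vec K N bs) p"
   using SinceP.IH(1)[OF 1(1,2) at(2) as] SinceP.IH(2)[OF 1(4,5) at(3) as] at(1) 1(3)
   lam_bit[OF ok SinceP.prems(1,2), of a "vec K N bs"]
   by (simp add: vec_snoc)
  show ?case
  proof (cases "bs = []")
   case True
   then show ?thesis using rec since_unfold[of "map lset (bs @ [a])" 0 fm fn2]
   by (simp add: vec_def del: ppltl_holds.simps(6))
  next
   case False
   then have IH: "bit (vec K N bs) p = ppltl_holds (map lset (bs @ [a])) (length bs - 1) (SinceP fm fn2)"
   using snoc.IH ppltl_holds_append[of "length bs - 1" "map lset bs" "[lset a]" "SinceP fm fn2"] by simp
   then show ?thesis using rec False since_unfold[of "map lset (bs @ [a])" "length bs" fm fn2]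
   by (simp add: Suc_le_eq del: ppltl_holds.simps(6))
  qed
 qed simp
qed

text \<open>What the emptiness test needs of an automaton for all marked base formulas at once:
  every word has a run with states below \<open>SB\<close>, and every run, whatever the size of its
  states, reports after \<open>t\<close> letters which formulas hold of the prefix of length
  \<open>t\<close>.\<close>

definition machine :: "(nat => nat => nat => bool) => (nat => bool) => (nat => nat) => nat =>
  ('a ppltl => 'a fin_trace set) => nat => bool" where
 "machine Tr ini out SB L K \<longleftrightarrow>
  (\<forall>al. \<exists>sg. ini (sg 0) & (ALL t. sg t < SB & Tr (sg t) (al t) (sg (Suc t)))) &
  (\<forall>al sg. ini (sg 0) --> (ALL t. Tr (sg t) (al t) (sg (Suc t))) -->
   (\<forall>t>0. \<forall>p<n. \<forall>fm j. bit K p --> base_at p fm j -->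
   (bit (out (sg t)) p \<longleftrightarrow> map (lset \<circ> al) [0..<t] \<in> L fm)))"

lemma machine_P:
 assumes ok: "base_ok (range c) W K N"
 shows "machine (trP W K N) (iniP W) (outP W) (2 ^ n) ppltl_lang K"
 unfolding machine_def
proof (intro conjI allI impI)
 fix al :: "nat => nat"
 have "vec K N as < 2 ^ n" for as
  using lam_less[OF ok] by (cases as rule: rev_cases) (auto simp: vec_snoc, simp add: vec_def)
 then show "\<exists>sg. iniP W (sg 0) & (ALL t. sg t < 2 ^ n & trP W K N (sg t) (al t) (sg (Suc t)))"
  by (intro exI[of _ "%t. vec K N (map al [0..<t])"])
   (auto simp: iniP_def trP_def loc_iff_lam[OF ok] vec_snoc, simp add: vec_def)
next
 fix al sg :: "nat => nat" and t p :: nat and fm j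
 assume a: "iniP W (sg 0)" "ALL t. trP W K N (sg t) (al t) (sg (Suc t))" "0 < t" "p < n" "bit K p" "base_at p fm j"
 have "sg t = vec K N (map al [0..<t])" for t :: nat
  using a(1,2) by (induction t) (auto simp: iniP_def trP_def loc_iff_lam[OF ok] vec_snoc, simp add: vec_def)
 then show "bit (outP W (sg t)) p = (map (lset \<circ> al) [0..<t] \<in> ppltl_lang fm)"
  using vec_correct[OF ok a(5,4,6), of "map al [0..<t]"] a(3) by (simp add: outP_def ppltl_lang_def)
qed

text \<open>The table after reading \<open>u\<close> composes the letter maps, the last letter being
  applied first; evaluated at 0 it is the vector of the reversed prefix. With \<open>2 ^ n\<close>
  entries of \<open>n\<close> bits, the number of states is doubly exponential.\<close>

lemma machine_L:
 assumes ok: "base_ok (range c) W K N"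
 shows "machine (trL W K N) (iniL W) (outL W) ((2 ^ n) ^ (2 ^ n)) rev_lang K"
 unfolding machine_def
proof (intro conjI allI impI)
 fix al :: "nat => nat"
 define f where "f t v = foldr (lam W K N) (map al [0..<t]) v" for t v :: nat
 have less: "foldr (lam W K N) as v < 2 ^ n" if "v < 2 ^ n" for as v
  using lam_less[OF ok] that by (cases as) auto
 have "\<exists>x<(2 ^ n) ^ (2 ^ n). \<forall>v<2 ^ n. dg (2 ^ n) x v = f t v" for t :: nat
  by (rule ex_digits) (auto simp: f_def less)
 then obtain sg where sg: "sg t < (2 ^ n) ^ (2 ^ n)" "\<forall>v<2 ^ n. dg (2 ^ n) (sg t) v = f t v" for t by metis
 have "trL W K N (sg t) (al t) (sg (Suc t))" for t
  using sg(2) by (auto simp: trL_def loc_iff_lam[OF ok] f_def)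
 moreover have "iniL W (sg 0)" using sg(2) by (auto simp: iniL_def f_def)
 ultimately show "\<exists>sg. iniL W (sg 0) & (ALL t. sg t < (2 ^ n) ^ (2 ^ n) & trL W K N (sg t) (al t) (sg (Suc t)))"
  using sg(1) by blast
next
 fix al sg :: "nat => nat" and t p :: nat and fm j
 assume a: "iniL W (sg 0)" "ALL t. trL W K N (sg t) (al t) (sg (Suc t))" "0 < t" "p < n" "bit K p" "base_at p fm j"
 have "\<forall>v<2 ^ n. dg (2 ^ n) (sg t) v = foldr (lam W K N) (map al [0..<t]) v" for t :: nat
 proof (induction t)
  case 0
  then show ?case using a(1) by (simp add: iniL_def)
 next
  case (Suc t)
  have "dg (2 ^ n) (sg (Suc t)) v = dg (2 ^ n) (sg t) (lam W K N (al t) v)" if "v < 2 ^ n" for v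
   using a(2)[rule_format, of t] that lam_less[OF ok] by (auto simp: trL_def loc_iff_lam[OF ok])
  then show ?case using Suc lam_less[OF ok] by auto
 qed
 then have "outL W (sg t) = vec K N (rev (map al [0..<t]))"
  by (simp add: outL_def vec_def foldr_conv_fold)
 then show "bit (outL W (sg t)) p = (map (lset \<circ> al) [0..<t] \<in> rev_lang fm)"
  using vec_correct[OF ok a(5,4,6), of "rev (map al [0..<t])"] a(3)
  by (simp add: rev_lang_def ppltl_lang_def rev_map)
qed

end

section \<open>Lassos with accumulated observations\<close>

section \<open>Lassos\<close>

definition seen :: "(nat => 'x) => ('x => nat set) => nat => nat => nat set" where
 "seen u ob i j = (\<Union>t \<in> {i<..j}. ob (u t))"

text \<open>Keeping the observations made so far in the node turns a statement about what is seen on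
  a path into plain reachability.\<close>

definition acc_step :: "('x => 'x => bool) => ('x => nat set) => 'x \<times> nat set => 'x \<times> nat set => bool" where
 "acc_step E ob = (%(x, A) (y, B). E x y & B = A \<union> ob y)"

lemma seen_path:
 assumes "ALL t. E (u t) (u (Suc t))"
 shows "i <= j ==> (acc_step E ob)\<^sup>*\<^sup>* (u i, A) (u j, A \<union> seen u ob i j)"
proof (induction "j - i" arbitrary: j)
 case 0
 then show ?case by (simp add: seen_def)
next
 case (Suc m)
 then obtain j' where j: "j = Suc j'" "i <= j'" by (cases j) auto
 have "{i<..j} = insert j {i<..j'}" using j by auto
 then have "acc_step E ob (u j', A \<union> seen u ob i j') (u j, A \<union> seen u ob i j)"
  using assms j by (auto simp: acc_step_def seen_def)
 then show ?case using Suc j by (metis diff_Suc_Suc Suc_diff_le diff_Suc_1 rtranclp.rtrancl_into_rtrancl)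
qed

lemma path_seen:
 assumes "(acc_step E ob)\<^sup>*\<^sup>* (x, A) (y, B)"
 shows "EX u m. u 0 = x & u m = y & (\<forall>t<m. E (u t) (u (Suc t))) & B = A \<union> seen u ob 0 m"
 using assms
proof (induction "(y, B)" arbitrary: y B rule: rtranclp_induct)
 case base
 then show ?case by (intro exI[of _ "%_. x"] exI[of _ 0]) (simp add: seen_def)
next
 case (step z)
 obtain z1 B1 where z: "z = (z1, B1)" by fastforce
 obtain u m where u: "u 0 = x" "u m = z1" "\<forall>t<m. E (u t) (u (Suc t))" "B1 = A \<union> seen u ob 0 m"
  using step z by blast
 define u' where "u' = u(Suc m := y)"
 have e: "E z1 y" "B = B1 \<union> ob y" using step(2) z by (auto simp: acc_step_def)
 have "{0<..Suc m} = insert (Suc m) {0<..m}" by auto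
 then have "seen u' ob 0 (Suc m) = ob y \<union> seen u ob 0 m" by (auto simp: seen_def u'_def)
 then show ?case using u e by (intro exI[of _ u'] exI[of _ "Suc m"]) (auto simp: u'_def less_Suc_eq)
qed

text \<open>Time 0 is left out because it belongs to the empty prefix, over which the quantifiers do
  not range.\<close>

definition ever :: "(nat => 'x) => ('x => nat set) => nat set" where
 "ever u ob = {i. \<exists>t>0. i \<in> ob (u t)}"

definition often :: "(nat => 'x) => ('x => nat set) => nat set" where
 "often u ob = {i. infinite {t. i \<in> ob (u t)}}"

lemma infinite_unbounded: "infinite (S :: nat set) \<longleftrightarrow> (ALL m. \<exists>n>m. n \<in> S)"
 by (auto simp: finite_nat_set_iff_bounded_le not_le)

text \<open>Some state \<open>x\<close> recurs. Cutting at an occurrence of \<open>x\<close> after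
  the last observation that is made only finitely often, and again after every recurring one has
  been made once more, leaves a loop that observes exactly \<open>often u ob\<close>.\<close>

theorem lasso_from_run:
 assumes run: "ALL t. E (u t) (u (Suc t))" and fin: "finite (range u)" and ob: "!!x. ob x \<subseteq> {..<N}"
  and ne: "!!x. ob x ~= {}"
 shows "EX x A. (acc_step E ob)\<^sup>*\<^sup>* (u 0, {}) (x, A) & (acc_step E ob)\<^sup>*\<^sup>* (x, {}) (x, often u ob) &
   often u ob ~= {} & ever u ob = A \<union> often u ob"
proof -
 obtain x where x: "infinite {t. u t = x}"
  using inf_img_fin_domE[of u UNIV] fin by (auto simp: vimage_def)
 have "finite (\<Union>i \<in> {..<N} - often u ob. {t. i \<in> ob (u t)})" by (auto simp: often_def)
 then obtain T where T: "\<forall>t \<in> (\<Union>i \<in> {..<N} - often u ob. {t. i \<in> ob (u t)}). t < T"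
  using finite_nat_set_iff_bounded by blast
 have after: "ob (u t) \<subseteq> often u ob" if "T <= t" for t using T ob that by (force simp: not_less[symmetric])
 obtain m where m: "T < m" "u m = x" using x unfolding infinite_unbounded by auto
 have "\<exists>t>m. i \<in> ob (u t)" if "i \<in> often u ob" for i
  using that unfolding often_def infinite_unbounded by auto
 then obtain g where g: "g i > m & i \<in> ob (u (g i))" if "i \<in> often u ob" for i by metis
 have so: "often u ob \<subseteq> {..<N}"
 proof
  fix i assume "i \<in> often u ob"
  then show "i \<in> {..<N}" using g ob by blast
 qed
 then have "finite (g ` often u ob)" using finite_subset by blast
 then obtain M where M: "\<forall>t \<in> g ` often u ob. t < M" using finite_nat_set_iff_bounded by blast
 obtain m' where m': "max M m < m'" "u m' = x" using x unfolding infinite_unbounded by (auto dest: spec[of _ "max M m"])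
 have s2: "seen u ob m m' = often u ob"
 proof
  show "seen u ob m m' \<subseteq> often u ob" unfolding seen_def by (intro UN_least after) (use m(1) in auto)
  show "often u ob \<subseteq> seen u ob m m'"
  proof
   fix i assume i: "i \<in> often u ob"
   then have "m < g i" "g i < M" "i \<in> ob (u (g i))" using g M by auto
   then show "i \<in> seen u ob m m'" using m'(1) by (auto simp: seen_def)
  qed
 qed
 have "ob (u m') \<subseteq> often u ob" using after[of m'] m'(1) m(1) by auto
 then have "often u ob ~= {}" using ne[of "u m'"] by auto
 moreover have "ever u ob = seen u ob 0 m \<union> often u ob"
 proof
  show "ever u ob \<subseteq> seen u ob 0 m \<union> often u ob"
  proof
   fix i assume "i \<in> ever u ob"
   then obtain t where t: "0 < t" "i \<in> ob (u t)" by (auto simp: ever_def)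
   then show "i \<in> seen u ob 0 m \<union> often u ob" using after[of t] m(1) by (cases "t <= m") (auto simp: seen_def)
  qed
  show "seen u ob 0 m \<union> often u ob \<subseteq> ever u ob"
  proof
   fix i assume "i \<in> seen u ob 0 m \<union> often u ob"
   then show "i \<in> ever u ob"
   proof
   assume "i \<in> often u ob"
   then show ?thesis using g[of i] by (auto simp: ever_def intro!: exI[of _ "g i"])
   qed (auto simp: ever_def seen_def)
  qed
 qed
 ultimately show ?thesis
  using seen_path[where E = E and u = u, OF run, of 0 m ob "{}"] seen_path[where E = E and u = u, OF run, of m m' ob "{}"] m m' s2
  by (intro exI[of _ x] exI[of _ "seen u ob 0 m"]) auto
qed

theorem run_from_lasso:
 assumes 1: "(acc_step E ob)\<^sup>*\<^sup>* (x0, {}) (x, A)" and 2: "(acc_step E ob)\<^sup>*\<^sup>* (x, {}) (x, I)" and I: "I ~= {}"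
 shows "EX u. u 0 = x0 & (ALL t. E (u t) (u (Suc t))) & often u ob = I & ever u ob = A \<union> I"
proof -
 obtain f m where f: "f 0 = x0" "f m = x" "\<forall>t<m. E (f t) (f (Suc t))" "A = seen f ob 0 m"
  using path_seen[OF 1] by auto
 obtain g k where g: "g 0 = x" "g k = x" "\<forall>t<k. E (g t) (g (Suc t))" "I = seen g ob 0 k"
  using path_seen[OF 2] by auto
 \<comment> \<open>Nonemptiness of \<open>I\<close> excludes the loop of length 0.\<close>
 have k: "0 < k" using g(4) I by (cases k) (auto simp: seen_def)
 \<comment> \<open>The loop is entered at \<open>g 1\<close>, since \<open>g 0\<close> is the last
   state of the stem.\<close>
 define u where "u t = (if t <= m then f t else g (Suc ((t - m - 1) mod k)))" for t
 have per: "u (m + t) = (if t mod k = 0 then x else g (t mod k))" if pos: "0 < t" for t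
 proof -
  obtain s where s: "t = Suc s" using pos gr0_conv_Suc by blast
  have "Suc (s mod k) = k & t mod k = 0 \<or> Suc (s mod k) = t mod k & t mod k ~= 0"
   using k by (auto simp: s mod_Suc)
  then show ?thesis using g(2) by (auto simp: u_def s)
 qed
 have per': "u (m + t) = g (t mod k)" for t
  using per[of t] g(1) f(2) by (cases "t = 0") (auto simp: u_def)
 have step: "E (u t) (u (Suc t))" for t
 proof (cases "t < m")
  case True
  then show ?thesis using f by (simp add: u_def)
 next
  case False
  then obtain s where s: "t = m + s" using le_Suc_ex not_less by blast
  have "u (Suc t) = g (Suc (s mod k))"
  proof (cases "Suc (s mod k) = k")
   case True
   then show ?thesis using per'[of "Suc s"] g(1,2) s by (simp add: mod_Suc)
  next
   case False
   then show ?thesis using per'[of "Suc s"] s by (simp add: mod_Suc)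
  qed
  then show ?thesis using per'[of s] g(3) k s by simp
 qed
 have obI: "ob (u (m + t)) \<subseteq> I" if "0 < t" for t
 proof -
  have "u (m + t) = g (if t mod k = 0 then k else t mod k)" using per[OF that] g(2) by simp
  moreover have "0 < (if t mod k = 0 then k else t mod k)" "(if t mod k = 0 then k else t mod k) <= k"
   using k by (auto intro: less_imp_le)
  ultimately show ?thesis unfolding g(4) seen_def by auto
 qed
 have Isub: "\<exists>s>t. i \<in> ob (u s)" if iI: "i \<in> I" for i t
 proof -
  obtain r where r: "0 < r" "r <= k" "i \<in> ob (g r)" using iI g(4) by (auto simp: seen_def)
  have "g r = g (r mod k)" using r g(1,2) by (cases "r = k") auto
  then have "u (m + (r + k * Suc t)) = g r" by (simp add: per' del: mult_Suc_right)
  moreover have "Suc t <= k * Suc t" using k by (cases k) auto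
  then have "m + (r + k * Suc t) > t" using r(1) by linarith
  ultimately show ?thesis using r(3) by metis
 qed
 have "often u ob = I"
 proof
  show "often u ob \<subseteq> I"
  proof
   fix i assume "i \<in> often u ob"
   then obtain t where "t > m" "i \<in> ob (u t)" by (auto simp: often_def infinite_unbounded)
   then show "i \<in> I" using obI[of "t - m"] by auto
  qed
  show "I \<subseteq> often u ob" using Isub by (auto simp: often_def infinite_unbounded)
 qed
 moreover have "ever u ob = A \<union> I"
 proof
  show "ever u ob \<subseteq> A \<union> I"
  proof
   fix i assume "i \<in> ever u ob"
   then obtain t where t: "t > 0" "i \<in> ob (u t)" by (auto simp: ever_def)
   show "i \<in> A \<union> I"
   proof (cases "t <= m")
   case True
   then show ?thesis using t f(4) by (auto simp: u_def seen_def)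
   next
   case False
   then show ?thesis using t obI[of "t - m"] by auto
   qed
  qed
  show "A \<union> I \<subseteq> ever u ob"
  proof
   fix i assume "i \<in> A \<union> I"
   then show "i \<in> ever u ob"
   proof
   assume "i \<in> A"
   then obtain t where "0 < t" "t <= m" "i \<in> ob (f t)" using f(4) by (auto simp: seen_def)
   then show ?thesis by (auto simp: ever_def u_def intro!: exI[of _ t])
   qed (use Isub[of i 0] in \<open>auto simp: ever_def\<close>)
  qed
 qed
 moreover have "u 0 = x0" using f(1) by (simp add: u_def)
 ultimately show ?thesis using step by blast
qed

section \<open>Acceptance and the emptiness test\<close>

section \<open>The emptiness test\<close>

text \<open>Bit \<open>i\<close> of \<open>A\<close> or \<open>I\<close> records that the base
  formula at \<open>i\<close> was seen to hold, bit \<open>lg W + i\<close> that it was seen to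
  fail; \<open>A\<close> belongs to the stem and \<open>I\<close> to the loop. The quantifiers
  become: never seen false, seen true, seen true in the loop, not seen false in the loop.
  \<open>P\<close> collects the truth values of the outer formulas.\<close>

definition acc_ok :: "nat => nat => nat => nat => nat => nat => bool" where
 "acc_ok W KP NP A I P \<longleftrightarrow> (\<forall>p<lg W. bit KP p --> bit P p = (
   tk W p = 0 & ~ (bit A (lg W + nx W p) \<or> bit I (lg W + nx W p)) \<or>
   tk W p = 1 & (bit A (nx W p) \<or> bit I (nx W p)) \<or>
   tk W p = 2 & bit I (nx W p) \<or>
   tk W p = 3 & ~ bit I (lg W + nx W p) \<or>
   tk W p = 4 & (bit P (nx W p) \<or> bit P (en W NP (nx W p))) \<or>
   tk W p = 5 & bit P (nx W p) & bit P (en W NP (nx W p)) \<or>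
   tk W p = 6 & ~ bit P (nx W p)))"

definition edge :: "(nat => nat => nat => bool) => (nat => nat => nat => bool) => (nat => nat) => nat => nat => nat => nat => nat => bool" where
 "edge Tr TT out n AB \<beta> x y \<longleftrightarrow> (\<exists>a<AB. Tr (dg \<beta> x 0) a (dg \<beta> y 0) & TT (dg \<beta> x 1) a (dg \<beta> y 1)) &
   (\<forall>i<n. (bit (dg \<beta> y 2) i = (bit (dg \<beta> x 2) i \<or> bit (out (dg \<beta> y 0)) i)) &
   (bit (dg \<beta> y 2) (n + i) = (bit (dg \<beta> x 2) (n + i) \<or> ~ bit (out (dg \<beta> y 0)) i)))"

text \<open>A node is a number whose three digits in base \<open>2 ^ l\<close> are an automaton state, a state of the
 transition system, and the set of truth values observed so far.\<close>

definition lasso :: "(nat => nat => nat => bool) => (nat => bool) => (nat => nat) => (nat => bool) =>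
  (nat => nat => nat => bool) => nat => nat => nat => nat => nat => nat => bool => bool" where
 "lasso Tr ini out TI TT AB W KP NP l Y b \<longleftrightarrow>
  (\<exists>x0<cpow Y (3 * l). \<exists>x1<cpow Y (3 * l). \<exists>x2<cpow Y (3 * l). \<exists>x3<cpow Y (3 * l). \<exists>P<Y.
   ini (dg (cpow Y l) x0 0) & TI (dg (cpow Y l) x0 1) & (\<forall>i<2 * lg W. ~ bit (dg (cpow Y l) x0 2) i) &
   reach_eval Y (3 * l) (%x y. edge Tr TT out (lg W) AB (cpow Y l) x y) x0 x1 &
   dg (cpow Y l) x2 0 = dg (cpow Y l) x1 0 & dg (cpow Y l) x2 1 = dg (cpow Y l) x1 1 &
   (\<forall>i<2 * lg W. ~ bit (dg (cpow Y l) x2 2) i) &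
   reach_eval Y (3 * l) (%x y. edge Tr TT out (lg W) AB (cpow Y l) x y) x2 x3 &
   dg (cpow Y l) x3 0 = dg (cpow Y l) x2 0 & dg (cpow Y l) x3 1 = dg (cpow Y l) x2 1 &
   (\<exists>i<2 * lg W. bit (dg (cpow Y l) x3 2) i) &
   acc_ok W KP NP (dg (cpow Y l) x1 2) (dg (cpow Y l) x3 2) P & bit P 0 = b)"

lemma infinite_nat_shift: "infinite {n. P n} \<longleftrightarrow> infinite {n. n > 0 & P (n::nat)}"
proof -
 have "{n. P n} \<subseteq> insert 0 {n. n > 0 & P n}" by auto
 moreover have "{n. n > 0 & P n} \<subseteq> {n. P n}" by auto
 ultimately show ?thesis by (meson finite_insert infinite_super)
qed

lemma prefix_inj: "inj (%n. map ta [0..<n])"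
 by (rule injI) (metis length_map length_upt diff_zero)

lemma prefixes_image: "prefixes ta \<inter> Z = (%n. map ta [0..<n]) ` {n. n > 0 & map ta [0..<n] \<in> Z}"
 "prefixes ta - Z = (%n. map ta [0..<n]) ` {n. n > 0 & map ta [0..<n] \<notin> Z}"
 by (auto simp: prefixes_def)

lemma quantifiers_iff:
 "ta \<in> all_prefixes Z \<longleftrightarrow> (\<forall>n>0. map ta [0..<n] \<in> Z)"
 "ta \<in> some_prefix Z \<longleftrightarrow> (\<exists>n>0. map ta [0..<n] \<in> Z)"
 "ta \<in> inf_many_prefixes Z \<longleftrightarrow> infinite {n. n > 0 & map ta [0..<n] \<in> Z}"
 "ta \<in> cofin_many_prefixes Z \<longleftrightarrow> ~ infinite {n. n > 0 & map ta [0..<n] \<notin> Z}"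
proof -
 have "finite ((%n. map ta [0..<n]) ` S) \<longleftrightarrow> finite S" for S
  using prefix_inj[of ta] by (metis finite_imageD finite_imageI inj_on_subset subset_UNIV)
 then show "ta \<in> inf_many_prefixes Z \<longleftrightarrow> infinite {n. n > 0 & map ta [0..<n] \<in> Z}"
  "ta \<in> cofin_many_prefixes Z \<longleftrightarrow> ~ infinite {n. n > 0 & map ta [0..<n] \<notin> Z}"
  unfolding inf_many_prefixes_def cofin_many_prefixes_def prefixes_image by simp_all
qed (auto simp: all_prefixes_def some_prefix_def prefixes_def)

context word begin

definition obs :: "(nat => nat) => nat \<times> nat => nat set" where
 "obs out x = {i. i < n & bit (out (fst x)) i} \<union> {n + i | i. i < n & ~ bit (out (fst x)) i}"

lemma obs_iff: "p < n ==> p \<in> obs out x \<longleftrightarrow> bit (out (fst x)) p"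
 "p < n ==> n + p \<in> obs out x \<longleftrightarrow> ~ bit (out (fst x)) p"
 by (auto simp: obs_def)

text \<open>Each quantifier only asks whether a base formula holds, or fails, at some or at
  infinitely many lengths, and this is what \<open>ever\<close> and \<open>often\<close>
  record.\<close>

lemma acc_ok_iff:
 assumes ok: "base_ok (range c) W K N" "plus_ok W K N KP NP"
  and ever: "!!i. i < 2 * n ==> (bit A i \<or> bit I i) \<longleftrightarrow> i \<in> ever u (obs out)"
  and often: "!!i. i < 2 * n ==> bit I i \<longleftrightarrow> i \<in> often u (obs out)"
  and out: "!!t p fm j. t > 0 ==> p < n ==> bit K p ==> base_at p fm j ==>
   bit (out (fst (u t))) p \<longleftrightarrow> map ta [0..<t] \<in> L fm"
  and P: "acc_ok W KP NP A I P"
 shows "p < n ==> bit KP p ==> plus_at p \<Psi> j ==> bit P p \<longleftrightarrow> ta \<in> plus_lang L \<Psi>"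
proof -
 have q: "(\<exists>t>0. map ta [0..<t] \<in> L fm) \<longleftrightarrow> bit A p \<or> bit I p"
  "(\<forall>t>0. map ta [0..<t] \<in> L fm) \<longleftrightarrow> ~ (bit A (n + p) \<or> bit I (n + p))"
  "infinite {t. t > 0 & map ta [0..<t] \<in> L fm} \<longleftrightarrow> bit I p"
  "infinite {t. t > 0 & map ta [0..<t] \<notin> L fm} \<longleftrightarrow> bit I (n + p)"
  if "bit K p" "p < n" "base_at p fm j" for p fm j
 proof -
  have p: "p < 2 * n" "n + p < 2 * n" using that by auto
  note o = out[OF _ that(2,1,3)]
  have ob: "p \<in> obs out (u t) \<longleftrightarrow> bit (out (fst (u t))) p" "n + p \<in> obs out (u t) \<longleftrightarrow> ~ bit (out (fst (u t))) p" for t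
   by (rule obs_iff[OF that(2)])+
  show "(\<exists>t>0. map ta [0..<t] \<in> L fm) \<longleftrightarrow> bit A p \<or> bit I p"
   unfolding ever[OF p(1)] ever_def mem_Collect_eq using o ob by blast
  show "(\<forall>t>0. map ta [0..<t] \<in> L fm) \<longleftrightarrow> ~ (bit A (n + p) \<or> bit I (n + p))"
   unfolding ever[OF p(2)] ever_def mem_Collect_eq using o ob by blast
  have "{t. t > 0 & map ta [0..<t] \<in> L fm} = {t. t > 0 & p \<in> obs out (u t)}"
   "{t. t > 0 & map ta [0..<t] \<notin> L fm} = {t. t > 0 & n + p \<in> obs out (u t)}"
   using o ob by auto
  then show "infinite {t. t > 0 & map ta [0..<t] \<in> L fm} \<longleftrightarrow> bit I p"
   "infinite {t. t > 0 & map ta [0..<t] \<notin> L fm} \<longleftrightarrow> bit I (n + p)"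
   unfolding often[OF p(1)] often[OF p(2)] often_def using infinite_nat_shift[of "%t. _ \<in> obs out (u t)"] by simp_all
 qed
 show "p < n ==> bit KP p ==> plus_at p \<Psi> j ==> bit P p \<longleftrightarrow> ta \<in> plus_lang L \<Psi>"
 proof (induction \<Psi> arbitrary: p j)
  case (AllQ fm)
  have at: "tk W p = 0" "base_at (nx W p) fm j" using AllQ.prems by (auto simp: plus_at_simps)
  have "bit K (nx W p) & nx W p < n" using ok(2)[unfolded plus_ok_def lgW, rule_format, OF AllQ.prems(1,2)] at(1) by auto
  then show ?case using at P[unfolded acc_ok_def lgW, rule_format, OF AllQ.prems(1,2)] q[of "nx W p" fm j]
   by (simp add: quantifiers_iff)
 next
  case (ExQ fm)
  have at: "tk W p = 1" "base_at (nx W p) fm j" using ExQ.prems by (auto simp: plus_at_simps)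
  have "bit K (nx W p) & nx W p < n" using ok(2)[unfolded plus_ok_def lgW, rule_format, OF ExQ.prems(1,2)] at(1) by auto
  then show ?case using at P[unfolded acc_ok_def lgW, rule_format, OF ExQ.prems(1,2)] q[of "nx W p" fm j]
   by (simp add: quantifiers_iff)
 next
  case (InfQ fm)
  have at: "tk W p = 2" "base_at (nx W p) fm j" using InfQ.prems by (auto simp: plus_at_simps)
  have "bit K (nx W p) & nx W p < n" using ok(2)[unfolded plus_ok_def lgW, rule_format, OF InfQ.prems(1,2)] at(1) by auto
  then show ?case using at P[unfolded acc_ok_def lgW, rule_format, OF InfQ.prems(1,2)] q(3)[of "nx W p" fm j]
   by (simp add: quantifiers_iff)
 next
  case (CofinQ fm)
  have at: "tk W p = 3" "base_at (nx W p) fm j" using CofinQ.prems by (auto simp: plus_at_simps)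
  have "bit K (nx W p) & nx W p < n" using ok(2)[unfolded plus_ok_def lgW, rule_format, OF CofinQ.prems(1,2)] at(1) by auto
  then show ?case using at P[unfolded acc_ok_def lgW, rule_format, OF CofinQ.prems(1,2)] q(4)[of "nx W p" fm j]
   by (simp add: quantifiers_iff)
 next
  case (NotQ \<Psi>)
  have at: "tk W p = 6" "plus_at (nx W p) \<Psi> j" using NotQ.prems by (auto simp: plus_at_simps)
  have "bit KP (nx W p) & nx W p < n" using ok(2)[unfolded plus_ok_def lgW, rule_format, OF NotQ.prems(1,2)] at(1) by auto
  then show ?case using at P[unfolded acc_ok_def lgW, rule_format, OF NotQ.prems(1,2)] NotQ.IH[of "nx W p" j] by simp
 next
  case (OrQ \<Psi> \<Psi>')
  obtain i where at: "tk W p = 4" "plus_at (nx W p) \<Psi> i" "plus_at i \<Psi>' j" using OrQ.prems by (auto simp: plus_at_simps)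
  have k: "bit KP (nx W p) & nx W p < n & en W NP (nx W p) < n & bit KP (en W NP (nx W p))"
   using ok(2)[unfolded plus_ok_def lgW, rule_format, OF OrQ.prems(1,2)] at(1) by auto
  then have "en W NP (nx W p) = i" using plus_ok_sound[OF ok] plus_at_unique[OF at(2)] by blast
  then show ?case using at k P[unfolded acc_ok_def lgW, rule_format, OF OrQ.prems(1,2)] OrQ.IH(1)[OF _ _ at(2)] OrQ.IH(2)[OF _ _ at(3)]
   by simp
 next
  case (AndQ \<Psi> \<Psi>')
  obtain i where at: "tk W p = 5" "plus_at (nx W p) \<Psi> i" "plus_at i \<Psi>' j" using AndQ.prems by (auto simp: plus_at_simps)
  have k: "bit KP (nx W p) & nx W p < n & en W NP (nx W p) < n & bit KP (en W NP (nx W p))"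
   using ok(2)[unfolded plus_ok_def lgW, rule_format, OF AndQ.prems(1,2)] at(1) by auto
  then have "en W NP (nx W p) = i" using plus_ok_sound[OF ok] plus_at_unique[OF at(2)] by blast
  then show ?case using at k P[unfolded acc_ok_def lgW, rule_format, OF AndQ.prems(1,2)] AndQ.IH(1)[OF _ _ at(2)] AndQ.IH(2)[OF _ _ at(3)]
   by simp
 qed
qed

text \<open>The bits are filled in from the right, as subformulas start further right.\<close>

lemma acc_ok_exists:
 assumes ok: "plus_ok W K N KP NP"
 shows "\<exists>P<2 ^ n. acc_ok W KP NP A I P"
proof -
 have step: "\<exists>P<(2::nat) ^ n. \<forall>p<n. n - m <= p --> bit KP p --> bit P p = (
   tk W p = 0 & ~ (bit A (lg W + nx W p) \<or> bit I (lg W + nx W p)) \<or>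
   tk W p = 1 & (bit A (nx W p) \<or> bit I (nx W p)) \<or>
   tk W p = 2 & bit I (nx W p) \<or>
   tk W p = 3 & ~ bit I (lg W + nx W p) \<or>
   tk W p = 4 & (bit P (nx W p) \<or> bit P (en W NP (nx W p))) \<or>
   tk W p = 5 & bit P (nx W p) & bit P (en W NP (nx W p)) \<or>
   tk W p = 6 & ~ bit P (nx W p))" (is "\<exists>P<_. \<forall>p<n. _ --> _ --> bit P p = ?R P p") if "m <= n" for m
  using that
 proof (induction m)
  case 0
  then show ?case by (intro exI[of _ 0]) auto
 next
  case (Suc m)
  then obtain P where P: "P < 2 ^ n" "\<forall>p<n. n - m <= p --> bit KP p --> bit P p = ?R P p" by auto
  define r where "r = n - Suc m"
  obtain P' where P': "P' < (2::nat) ^ n" "ALL p. bit P' p \<longleftrightarrow> p < n & (if p = r then ?R P r else bit P p)"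
   using ex_bits[of n "%p. if p = r then ?R P r else bit P p"] by (elim exE conjE)
  have small: "~ bit P p" if "n <= p" for p using bit_small[of P n p] P(1) that by simp
  have same: "bit P' p = bit P p" if "p ~= r" for p using P'(2) small[of p] that by (cases "p < n") auto
  have RR: "?R P' p = ?R P p" if p: "p < n" "r <= p" "bit KP p" for p
  proof -
   have 1: "bit P' (nx W p) = bit P (nx W p)" using nx_gt[of p W] p by (intro same) auto
   have "bit P' (en W NP (nx W p)) = bit P (en W NP (nx W p))" if "tk W p = 4 \<or> tk W p = 5"
   proof -
   have "bit KP (nx W p) & nx W p < n"
   using ok[unfolded plus_ok_def lgW, rule_format, OF p(1,3)] that by auto
   then have "nx W p < en W NP (nx W p)" using ok[unfolded plus_ok_def lgW] by blast
   then show ?thesis using nx_gt[of p W] p by (intro same) auto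
   qed
   then show ?thesis unfolding 1 by auto
  qed
  have "bit P' p = ?R P' p" if p: "p < n" "n - Suc m <= p" "bit KP p" for p
  proof (cases "p = r")
   case True
   then show ?thesis using RR[of p] P'(2) p by (simp add: r_def)
  next
   case False
   then show ?thesis using RR[of p] P(2) same[of p] p by (simp add: r_def)
  qed
  then show ?case using P'(1) by blast
 qed
 then show ?thesis unfolding acc_ok_def using step[of n] by simp
qed

text \<open>Edges between numbers correspond to \<open>acc_step\<close> under the decoding of three
  digits, which reaches every triple that occurs on a path. The lasso theorems then replace the
  search for a trace by two reachability tests; \<open>b\<close> selects traces inside or outside
  the language.\<close>

lemma lasso_correct:
 assumes ok: "base_ok (range c) W K N" "plus_ok W K N KP NP"
  and root: "0 < n" "bit KP 0" "plus_at 0 \<Psi> j"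
  and mach: "machine Tr ini out SB L K" and SB: "SB <= 2 ^ l" "2 * n <= l"
  and T: "!!q. TI q ==> q < 2 ^ l" "!!q a q'. TT q a q' ==> q' < 2 ^ l"
  and Y: "2 ^ Suc (2 * (3 * l) * Suc (3 * l)) <= Y"
 shows "lasso Tr ini out TI TT AB W KP NP l Y b \<longleftrightarrow>
  (\<exists>al rh. TI (rh 0) & (ALL t. al t < AB & TT (rh t) (al t) (rh (Suc t))) & (lset \<circ> al \<in> plus_lang L \<Psi>) = b)"
proof -
 define \<beta> where "\<beta> = (2::nat) ^ l"
 have le: "3 * l <= 2 * (3 * l) * Suc (3 * l)" by simp
 have pw: "2 ^ i <= Y" if "i <= Suc (2 * (3 * l) * Suc (3 * l))" for i
  using Y power_increasing[OF that, of "2::nat"] by linarith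
 have cp: "cpow Y l = \<beta>" "cpow Y (3 * l) = 2 ^ (3 * l)"
  unfolding \<beta>_def using pw[of l] pw[of "3 * l"] le by (auto intro!: cpow_eq)
 have \<beta>3: "2 ^ (3 * l) = \<beta> ^ 3" by (simp add: \<beta>_def power_mult mult.commute[of 3])
 have \<beta>0: "0 < \<beta>" by (simp add: \<beta>_def)
 have dgl: "dg \<beta> x i < \<beta>" for x i using \<beta>0 by (simp add: dg_def)
 define E where "E = (%(s, q) (s', q'). s < \<beta> & s' < \<beta> & q < \<beta> & q' < \<beta> & (\<exists>a<AB. Tr s a s' & TT q a q'))"
 define ob where "ob = obs out"
 define e where "e = (%x y. edge Tr TT out n AB \<beta> x y)"
 define dec where "dec x = ((dg \<beta> x 0, dg \<beta> x 1), {i. i < 2 * n & bit (dg \<beta> x 2) i})" for x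
 have reach: "reach_eval Y (3 * l) e x y \<longleftrightarrow> (x, y) \<in> (edges e (3 * l))\<^sup>*" if "x < 2 ^ (3 * l)" "y < 2 ^ (3 * l)" for x y
  using Y that by (intro reach_eval_correct)
 have split: "i < 2 * n \<longleftrightarrow> i < n \<or> (\<exists>k<n. i = n + k)" for i by (auto simp: nat_le_iff_add not_less intro: exI[of _ "i - n"])
 have estep: "acc_step E ob (dec x) (dec y)" if "e x y" for x y
  using that dgl unfolding e_def edge_def acc_step_def dec_def E_def ob_def obs_def by (auto simp: split)
 have path: "(acc_step E ob)\<^sup>*\<^sup>* (dec x) (dec y)" if "(x, y) \<in> (edges e (3 * l))\<^sup>*" for x y
  using that
 proof (induction rule: rtrancl_induct)
  case (step y z)
  then show ?case using estep by (auto simp: edges_def intro: rtranclp.rtrancl_into_rtrancl)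
 qed auto
 have mk: "\<exists>x<2 ^ (3 * l). dec x = ((s, q), A)" if "s < \<beta>" "q < \<beta>" "A \<subseteq> {..<2 * n}" for s q A
 proof -
  obtain a where a: "a < (2::nat) ^ (2 * n)" "ALL i. bit a i \<longleftrightarrow> i < 2 * n & i \<in> A"
   using ex_bits[of "2 * n" "%i. i \<in> A"] by (elim exE conjE)
  have "(2::nat) ^ (2 * n) \<le> \<beta>" unfolding \<beta>_def using SB(2) by (intro power_increasing) auto
  then have "\<exists>x<\<beta> ^ 3. \<forall>i<3. dg \<beta> x i = [s, q, a] ! i"
   using that a(1) by (intro ex_digits) (auto simp: less_Suc_eq numeral_3_eq_3)
  then obtain x where "x < \<beta> ^ 3" "dg \<beta> x 0 = s" "dg \<beta> x 1 = q" "dg \<beta> x 2 = a" by (auto simp: numeral_3_eq_3 numeral_2_eq_2)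
  then show ?thesis using a(2) that(3) by (intro exI[of _ x]) (auto simp: dec_def \<beta>3)
 qed
 have conv: "\<exists>y<2 ^ (3 * l). dec y = Z & (x, y) \<in> (edges e (3 * l))\<^sup>*"
  if "(acc_step E ob)\<^sup>*\<^sup>* (dec x) Z" "x < 2 ^ (3 * l)" for x Z
  using that
 proof (induction rule: rtranclp_induct)
  case base
  then show ?case by auto
 next
  case (step Z Z')
  obtain y where y: "y < 2 ^ (3 * l)" "dec y = Z" "(x, y) \<in> (edges e (3 * l))\<^sup>*" using step by auto
  obtain s q A where Z': "Z' = ((s, q), A)" by (metis surj_pair)
  have st: "acc_step E ob (dec y) ((s, q), A)" using step(2) y(2) Z' by simp
  then have sub: "A \<subseteq> {..<2 * n}" "s < \<beta>" "q < \<beta>"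
   by (auto simp: acc_step_def dec_def E_def ob_def obs_def)
  obtain z where z: "z < 2 ^ (3 * l)" "dec z = ((s, q), A)" using mk[OF sub(2,3,1)] by blast
  have d: "s = dg \<beta> z 0" "q = dg \<beta> z 1" "A = {i. i < 2 * n & bit (dg \<beta> z 2) i}" using z(2) by (auto simp: dec_def)
  have "A = {i. i < 2 * n & bit (dg \<beta> y 2) i} \<union> ob (s, q)" using st by (auto simp: acc_step_def dec_def)
  then have bits: "i < 2 * n ==> bit (dg \<beta> z 2) i \<longleftrightarrow> bit (dg \<beta> y 2) i \<or> i \<in> ob (s, q)" for i unfolding d(3) by auto
  have "e y z" unfolding e_def edge_def
  proof (intro conjI allI impI)
   show "\<exists>a<AB. Tr (dg \<beta> y 0) a (dg \<beta> z 0) & TT (dg \<beta> y 1) a (dg \<beta> z 1)"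
   using st d by (auto simp: acc_step_def dec_def E_def)
   fix i assume i: "i < n"
   show "bit (dg \<beta> z 2) i = (bit (dg \<beta> y 2) i \<or> bit (out (dg \<beta> z 0)) i)"
   using bits[of i] i obs_iff(1)[OF i, of out "(s, q)"] by (simp add: ob_def d(1))
   show "bit (dg \<beta> z 2) (n + i) = (bit (dg \<beta> y 2) (n + i) \<or> ~ bit (out (dg \<beta> z 0)) i)"
   using bits[of "n + i"] i obs_iff(2)[OF i, of out "(s, q)"] by (simp add: ob_def d(1))
  qed
  then have "(y, z) \<in> edges e (3 * l)" using y z by (simp add: edges_def)
  then show ?case using y(3) z Z' by (auto intro: rtrancl_into_rtrancl)
 qed
 have out: "bit (out (fst (u t))) p \<longleftrightarrow> map (lset \<circ> al) [0..<t] \<in> L fm"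
  if "ini (fst (u 0))" "ALL t. Tr (fst (u t)) (al t) (fst (u (Suc t)))" "t > 0" "p < n" "bit K p" "base_at p fm j"
  for u :: "nat => nat \<times> nat" and al t p fm j
  using mach[unfolded machine_def, THEN conjunct2, rule_format, of "fst \<circ> u" al t p fm j] that by simp
 show ?thesis
 proof
  assume "lasso Tr ini out TI TT AB W KP NP l Y b"
  then obtain x0 x1 x2 x3 P where x: "x0 < 2 ^ (3 * l)" "x1 < 2 ^ (3 * l)" "x2 < 2 ^ (3 * l)" "x3 < 2 ^ (3 * l)"
   and i: "ini (dg \<beta> x0 0)" "TI (dg \<beta> x0 1)" "\<forall>i<2 * n. ~ bit (dg \<beta> x0 2) i"
   and r: "reach_eval Y (3 * l) e x0 x1" "reach_eval Y (3 * l) e x2 x3"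
   and x2: "dg \<beta> x2 0 = dg \<beta> x1 0" "dg \<beta> x2 1 = dg \<beta> x1 1" "\<forall>i<2 * n. ~ bit (dg \<beta> x2 2) i"
   and x3: "dg \<beta> x3 0 = dg \<beta> x2 0" "dg \<beta> x3 1 = dg \<beta> x2 1" "\<exists>i<2 * n. bit (dg \<beta> x3 2) i"
   and P: "acc_ok W KP NP (dg \<beta> x1 2) (dg \<beta> x3 2) P" "bit P 0 = b"
   unfolding lasso_def cp lgW e_def by blast
  define A I where "A = {i. i < 2 * n & bit (dg \<beta> x1 2) i}" and "I = {i. i < 2 * n & bit (dg \<beta> x3 2) i}"
  let ?x0 = "(dg \<beta> x0 0, dg \<beta> x0 1)" and ?x1 = "(dg \<beta> x1 0, dg \<beta> x1 1)"
  have "dec x0 = (?x0, {})" "dec x1 = (?x1, A)" "dec x2 = (?x1, {})" "dec x3 = (?x1, I)"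
   using i x2 x3 by (auto simp: dec_def A_def I_def)
  then have "(acc_step E ob)\<^sup>*\<^sup>* (?x0, {}) (?x1, A)" "(acc_step E ob)\<^sup>*\<^sup>* (?x1, {}) (?x1, I)"
   using path r reach x by metis+
  moreover have "I ~= {}" using x3 by (auto simp: I_def)
  ultimately obtain u where u: "u 0 = ?x0" "ALL t. E (u t) (u (Suc t))" "often u ob = I" "ever u ob = A \<union> I"
   using run_from_lasso by metis
  have "\<exists>a<AB. Tr (fst (u t)) a (fst (u (Suc t))) & TT (snd (u t)) a (snd (u (Suc t)))" for t
   using u(2)[rule_format, of t] by (auto simp: E_def split: prod.splits)
  then obtain al where al: "al t < AB" "Tr (fst (u t)) (al t) (fst (u (Suc t)))" "TT (snd (u t)) (al t) (snd (u (Suc t)))" for t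
   by metis
  have "bit P 0 \<longleftrightarrow> lset \<circ> al \<in> plus_lang L \<Psi>"
  proof (rule acc_ok_iff[OF ok _ _ _ P(1) root])
   show "i < 2 * n ==> (bit (dg \<beta> x1 2) i \<or> bit (dg \<beta> x3 2) i) = (i \<in> ever u (obs out))" for i
   using u(4) by (auto simp: ob_def A_def I_def)
   show "i < 2 * n ==> bit (dg \<beta> x3 2) i = (i \<in> often u (obs out))" for i
   using u(3) by (auto simp: ob_def I_def)
   show "bit (out (fst (u t))) p = (map (lset \<circ> al) [0..<t] \<in> L fm)"
   if "0 < t" "p < n" "bit K p" "base_at p fm j" for t p fm j
   using out[of u al t p fm j] u(1) i al(2) that by simp
  qed
  then show "\<exists>al rh. TI (rh 0) & (ALL t. al t < AB & TT (rh t) (al t) (rh (Suc t))) & (lset \<circ> al \<in> plus_lang L \<Psi>) = b"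
   using al u(1) i P(2) by (intro exI[of _ al] exI[of _ "snd \<circ> u"]) auto
 next
  assume "\<exists>al rh. TI (rh 0) & (ALL t. al t < AB & TT (rh t) (al t) (rh (Suc t))) & (lset \<circ> al \<in> plus_lang L \<Psi>) = b"
  then obtain al rh where rh: "TI (rh 0)" "!!t. al t < AB" "!!t. TT (rh t) (al t) (rh (Suc t))" "(lset \<circ> al \<in> plus_lang L \<Psi>) = b" by blast
  obtain sg where sg: "ini (sg 0)" "!!t. sg t < SB" "!!t. Tr (sg t) (al t) (sg (Suc t))"
   using mach unfolding machine_def by metis
  define u where "u t = (sg t, rh t)" for t
  have rh\<beta>: "rh t < \<beta>" for t using T(1)[OF rh(1)] T(2)[OF rh(3)] by (cases t) (simp_all add: \<beta>_def)
  have sg\<beta>: "sg t < \<beta>" for t using sg(2)[of t] SB(1) by (simp add: \<beta>_def)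
  have E: "ALL t. E (u t) (u (Suc t))" using sg(3) rh(2,3) rh\<beta> sg\<beta> by (simp add: E_def u_def) blast
  have "range u \<subseteq> {..<\<beta>} \<times> {..<\<beta>}" using rh\<beta> sg\<beta> by (auto simp: u_def)
  then have "finite (range u)" by (rule finite_subset) simp
  moreover have "ob x \<subseteq> {..<2 * n}" for x by (auto simp: ob_def obs_def)
  moreover have "ob x ~= {}" for x using obs_iff[OF root(1), of out x] by (auto simp: ob_def)
  ultimately obtain y A where y: "(acc_step E ob)\<^sup>*\<^sup>* (u 0, {}) (y, A)"
   "(acc_step E ob)\<^sup>*\<^sup>* (y, {}) (y, often u ob)" "often u ob ~= {}" "ever u ob = A \<union> often u ob"
   using lasso_from_run[where E = E and u = u, OF E, of ob "2 * n"] by blast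
  obtain x0 where x0: "x0 < 2 ^ (3 * l)" "dec x0 = (u 0, {})" using mk[of "sg 0" "rh 0" "{}"] rh\<beta> sg\<beta> by (auto simp: u_def)
  obtain x1 where x1: "x1 < 2 ^ (3 * l)" "dec x1 = (y, A)" "(x0, x1) \<in> (edges e (3 * l))\<^sup>*"
   using conv[of x0] x0 y(1) by metis
  have y': "y = (dg \<beta> x1 0, dg \<beta> x1 1)" using x1(2) by (simp add: dec_def)
  obtain x2 where x2: "x2 < 2 ^ (3 * l)" "dec x2 = (y, {})" using mk[of "dg \<beta> x1 0" "dg \<beta> x1 1" "{}"] dgl y' by auto
  obtain x3 where x3: "x3 < 2 ^ (3 * l)" "dec x3 = (y, often u ob)" "(x2, x3) \<in> (edges e (3 * l))\<^sup>*"
   using conv[of x2] x2 y(2) by metis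
  obtain P where P: "P < 2 ^ n" "acc_ok W KP NP (dg \<beta> x1 2) (dg \<beta> x3 2) P" using acc_ok_exists[OF ok(2)] by blast
  have "bit P 0 \<longleftrightarrow> lset \<circ> al \<in> plus_lang L \<Psi>"
  proof (rule acc_ok_iff[OF ok _ _ _ P(2) root])
   show "i < 2 * n ==> bit (dg \<beta> x3 2) i = (i \<in> often u (obs out))" for i
   using x3(2) by (auto simp: ob_def dec_def)
   then show "i < 2 * n ==> (bit (dg \<beta> x1 2) i \<or> bit (dg \<beta> x3 2) i) = (i \<in> ever u (obs out))" for i
   using y(4) x1(2) by (auto simp: ob_def dec_def)
   show "bit (out (fst (u t))) p = (map (lset \<circ> al) [0..<t] \<in> L fm)"
   if "0 < t" "p < n" "bit K p" "base_at p fm j" for t p fm j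
   using out[of u al t p fm j] sg that by (simp add: u_def)
  qed
  then have b: "bit P 0 = b" using rh(4) by simp
  have 0: "ini (dg \<beta> x0 0)" "TI (dg \<beta> x0 1)" "\<forall>i<2 * n. ~ bit (dg \<beta> x0 2) i"
   using x0(2) sg(1) rh(1) by (auto simp: dec_def u_def)
  have 2: "dg \<beta> x2 0 = dg \<beta> x1 0" "dg \<beta> x2 1 = dg \<beta> x1 1" "\<forall>i<2 * n. ~ bit (dg \<beta> x2 2) i"
   using x2(2) y' by (auto simp: dec_def)
  have "dg \<beta> x3 0 = dg \<beta> x2 0" "dg \<beta> x3 1 = dg \<beta> x2 1" using x3(2) x2(2) by (auto simp: dec_def)
  moreover have "\<exists>i<2 * n. bit (dg \<beta> x3 2) i" using x3(2) y(3) by (auto simp: dec_def)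
  moreover have "n <= Suc (2 * (3 * l) * Suc (3 * l))" using SB(2) by simp
  then have "P < Y" using P(1) pw[of n] by linarith
  moreover have "reach_eval Y (3 * l) e x0 x1" "reach_eval Y (3 * l) e x2 x3" using reach x0 x1 x2 x3 by auto
  ultimately show "lasso Tr ini out TI TT AB W KP NP l Y b"
   unfolding lasso_def cp lgW e_def[symmetric] using 0 2 x0(1) x1(1) x2(1) x3(1) P(2) b by blast
 qed
qed

end

section \<open>Parsing transition systems\<close>

section \<open>Reading transition systems\<close>

definition nxs :: "nat => nat => nat => nat" where
 "nxs W p k = rec_nat p (%_ r. nx W r) k"

definition nt :: "nat => nat => nat" where
 "nt W t = nx W (nxs W (nx W (nx W t)) (tk W (nx W t)))"

definition trs :: "nat => nat => nat => nat" where
 "trs W t k = rec_nat t (%_ r. nt W r) k"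

definition trans_pos :: "nat => nat => nat" where
 "trans_pos W p = nxs W (nx W (nx W p)) (tk W (nx W p))"

definition ts_ini :: "nat => nat => nat => bool" where
 "ts_ini W p q \<longleftrightarrow> (\<exists>j<tk W (nx W p). q = tk W (nxs W (nx W (nx W p)) j))"

text \<open>Letters are numbers decoded by \<open>lset\<close>; a transition admits every number
  whose bits at the atom codes spell the listed letter. Running over the codes below
  \<open>m\<close> keeps the quantifier bounded.\<close>

definition tr_at :: "nat set => nat => nat => nat => nat => nat => nat => bool" where
 "tr_at C m W t q a q' \<longleftrightarrow> q = tk W t & q' = tk W (nxs W (nx W (nx W t)) (tk W (nx W t))) &
   (\<forall>x<m. x \<in> C --> bit a x = (\<exists>i<tk W (nx W t). tk W (nxs W (nx W (nx W t)) i) = x))"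

definition ts_tr :: "nat set => nat => nat => nat => nat => nat => nat => bool" where
 "ts_tr C m W p q a q' \<longleftrightarrow> (\<exists>j<tk W (trans_pos W p). tr_at C m W (trs W (nx W (trans_pos W p)) j) q a q')"

text \<open>A letter is encoded by the increasing list of its atom codes, so strict order and
  membership in \<open>C\<close> characterise the lists that occur.\<close>

definition tr_ok :: "nat set => nat => nat => nat => bool" where
 "tr_ok C W p t \<longleftrightarrow> tk W t < tk W p & tk W (nxs W (nx W (nx W t)) (tk W (nx W t))) < tk W p &
   (\<forall>i<tk W (nx W t). tk W (nxs W (nx W (nx W t)) i) \<in> C &
   (\<forall>j<i. tk W (nxs W (nx W (nx W t)) j) < tk W (nxs W (nx W (nx W t)) i)))"

definition ts_ok :: "nat set => nat => nat => bool" where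
 "ts_ok C W p \<longleftrightarrow> trs W (nx W (trans_pos W p)) (tk W (trans_pos W p)) = lg W &
   (\<forall>j<tk W (nx W p). tk W (nxs W (nx W (nx W p)) j) < tk W p) &
   (\<forall>j<tk W (trans_pos W p). tr_ok C W p (trs W (nx W (trans_pos W p)) j))"

lemma nxs_simps [simp]: "nxs W p 0 = p" "nxs W p (Suc k) = nx W (nxs W p k)"
 by (simp_all add: nxs_def)

lemma trs_simps [simp]: "trs W p 0 = p" "trs W p (Suc k) = nt W (trs W p k)"
 by (simp_all add: trs_def)

lemma nxs_ge: "p <= nxs W p k"
 by (induction k) (auto intro: le_trans less_imp_le[OF nx_gt])

lemma nt_gt: "t < nt W t"
 unfolding nt_def using nx_gt[of t W] nx_gt[of "nx W t" W] nxs_ge[of "nx W (nx W t)" W] nx_gt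
 by (meson le_less_trans less_le_trans less_trans)

context word begin

lemma list_at: "drop p w = enc_list enc_nat xs @ r \<longleftrightarrow>
  xs = map (%j. tk W (nxs W (nx W p) j)) [0..<tk W p] & nxs W (nx W p) (tk W p) <= n &
  drop (nxs W (nx W p) (tk W p)) w = r" (is "?L \<longleftrightarrow> ?R")
proof -
 have items: "drop p w = concat (map enc_nat xs) @ r & p <= n \<longleftrightarrow>
   xs = map (%j. tk W (nxs W p j)) [0..<length xs] & nxs W p (length xs) <= n & drop (nxs W p (length xs)) w = r" for p xs r
 proof (induction xs arbitrary: r rule: rev_induct)
  case Nil
  then show ?case by auto
 next
  case (snoc x xs)
  have "drop p w = concat (map enc_nat (xs @ [x])) @ r & p <= n \<longleftrightarrow>
   drop p w = concat (map enc_nat xs) @ enc_nat x @ r & p <= n" by simp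
  also have "\<dots> \<longleftrightarrow> xs = map (%j. tk W (nxs W p j)) [0..<length xs] & nxs W p (length xs) <= n &
   drop (nxs W p (length xs)) w = enc_nat x @ r" by (rule snoc)
  also have "\<dots> \<longleftrightarrow> xs @ [x] = map (%j. tk W (nxs W p j)) [0..<length (xs @ [x])] &
   nxs W p (length (xs @ [x])) <= n & drop (nxs W p (length (xs @ [x]))) w = r"
   unfolding drop_enc_nat using nx_gt[of "nxs W p (length xs)" W] by auto
  finally show ?case .
 qed
 have "?L \<longleftrightarrow> tk W p = length xs & nx W p <= n & drop (nx W p) w = concat (map enc_nat xs) @ r"
  unfolding enc_list_def append_assoc drop_enc_nat by simp
 also have "\<dots> \<longleftrightarrow> tk W p = length xs & (drop (nx W p) w = concat (map enc_nat xs) @ r & nx W p <= n)" by auto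
 also have "\<dots> \<longleftrightarrow> ?R" unfolding items by (auto dest: arg_cong[of _ _ length])
 finally show ?thesis .
qed

lemma letter_list: "(EX A. sorted_list_of_set (c ` A) = xs) \<longleftrightarrow> sorted_wrt (<) xs & set xs \<subseteq> range c"
proof
 assume "sorted_wrt (<) xs & set xs \<subseteq> range c"
 then have xs: "sorted xs" "distinct xs" "set xs \<subseteq> range c" by (auto simp: strict_sorted_iff)
 have "c ` {x. c x \<in> set xs} = set xs" using xs(3) by auto
 then show "EX A. sorted_list_of_set (c ` A) = xs"
  using sorted_list_of_set.idem_if_sorted_distinct[OF xs(1,2)] by metis
qed (auto simp: strict_sorted_iff)

lemma transition_at: "drop t w = enc_transition c (q, A, q') @ r \<longleftrightarrow>
  q = tk W t & sorted_list_of_set (c ` A) = map (%j. tk W (nxs W (nx W (nx W t)) j)) [0..<tk W (nx W t)] &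
  q' = tk W (nxs W (nx W (nx W t)) (tk W (nx W t))) & nt W t <= n & drop (nt W t) w = r"
proof -
 have 1: "nx W t <= n & nxs W (nx W (nx W t)) (tk W (nx W t)) <= n" if "nt W t <= n"
  using that nx_gt[of "nxs W (nx W (nx W t)) (tk W (nx W t))" W]
   nxs_ge[of "nx W (nx W t)" W "tk W (nx W t)"] nx_gt[of "nx W t" W] by (simp add: nt_def)
 have "drop t w = enc_transition c (q, A, q') @ r \<longleftrightarrow>
   drop t w = enc_nat q @ enc_list enc_nat (sorted_list_of_set (c ` A)) @ enc_nat q' @ r"
  by (simp add: enc_transition_def enc_letter_def)
 also have "\<dots> \<longleftrightarrow> tk W t = q & nx W t <= n &
  sorted_list_of_set (c ` A) = map (%j. tk W (nxs W (nx W (nx W t)) j)) [0..<tk W (nx W t)] &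
  nxs W (nx W (nx W t)) (tk W (nx W t)) <= n & tk W (nxs W (nx W (nx W t)) (tk W (nx W t))) = q' & nt W t <= n & drop (nt W t) w = r"
  unfolding drop_enc_nat list_at nt_def by blast
 finally show ?thesis using 1 by blast
qed

definition trans_of :: "nat => nat \<times> 'a set \<times> nat" where
 "trans_of t = (tk W t, {x. \<exists>i<tk W (nx W t). tk W (nxs W (nx W (nx W t)) i) = c x},
   tk W (nxs W (nx W (nx W t)) (tk W (nx W t))))"

lemma sorted_list_of_image_eq:
 assumes "sorted_list_of_set (c ` A) = xs"
 shows "A = {x. c x \<in> set xs}"
proof -
 have "c ` A = set xs" using assms by auto
 then have "c ` A = set xs" .
 then show ?thesis using inj by (auto dest: injD)
qed

lemma transition_at':
 assumes "drop t w = enc_transition c ta @ r"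
 shows "ta = trans_of t" "nt W t <= n" "drop (nt W t) w = r"
  "\<forall>i<tk W (nx W t). tk W (nxs W (nx W (nx W t)) i) \<in> range c &
   (\<forall>j<i. tk W (nxs W (nx W (nx W t)) j) < tk W (nxs W (nx W (nx W t)) i))"
proof -
 obtain q A q' where ta: "ta = (q, A, q')" by (metis surj_pair)
 let ?xs = "map (%j. tk W (nxs W (nx W (nx W t)) j)) [0..<tk W (nx W t)]"
 have a: "q = tk W t" "sorted_list_of_set (c ` A) = ?xs"
  "q' = tk W (nxs W (nx W (nx W t)) (tk W (nx W t)))" "nt W t <= n" "drop (nt W t) w = r"
  using assms unfolding ta transition_at by auto
 show "ta = trans_of t" using a(1,3) sorted_list_of_image_eq[OF a(2)] by (auto simp: ta trans_of_def image_iff eq_commute[of "c _"])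
 show "nt W t <= n" "drop (nt W t) w = r" by fact+
 have "sorted_wrt (<) ?xs & set ?xs \<subseteq> range c" using a(2) letter_list by blast
 then show "\<forall>i<tk W (nx W t). tk W (nxs W (nx W (nx W t)) i) \<in> range c &
   (\<forall>j<i. tk W (nxs W (nx W (nx W t)) j) < tk W (nxs W (nx W (nx W t)) i))"
  unfolding sorted_wrt_iff_nth_less by auto
qed

lemma transition_at_conv:
 assumes "nt W t <= n" "\<forall>i<tk W (nx W t). tk W (nxs W (nx W (nx W t)) i) \<in> range c &
   (\<forall>j<i. tk W (nxs W (nx W (nx W t)) j) < tk W (nxs W (nx W (nx W t)) i))"
 shows "drop t w = enc_transition c (trans_of t) @ drop (nt W t) w"
proof -
 let ?xs = "map (%j. tk W (nxs W (nx W (nx W t)) j)) [0..<tk W (nx W t)]"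
 have "sorted_wrt (<) ?xs & set ?xs \<subseteq> range c" using assms(2) by (auto simp: sorted_wrt_iff_nth_less)
 then obtain A where "sorted_list_of_set (c ` A) = ?xs" using letter_list by blast
 then have "drop t w = enc_transition c (tk W t, A, tk W (nxs W (nx W (nx W t)) (tk W (nx W t)))) @ drop (nt W t) w"
  unfolding transition_at using assms(1) by simp
 then show ?thesis using transition_at'(1) by metis
qed

lemma transitions_read:
 "drop t w = concat (map (enc_transition c) ts) @ r ==> t <= n ==>
  (\<forall>j<length ts. ts ! j = trans_of (trs W t j) &
   (\<forall>i<tk W (nx W (trs W t j)). tk W (nxs W (nx W (nx W (trs W t j))) i) \<in> range c &
   (\<forall>k<i. tk W (nxs W (nx W (nx W (trs W t j))) k) < tk W (nxs W (nx W (nx W (trs W t j))) i)))) &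
  trs W t (length ts) <= n & drop (trs W t (length ts)) w = r"
proof (induction ts arbitrary: r rule: rev_induct)
 case (snoc ta ts)
 have "drop (trs W t (length ts)) w = enc_transition c ta @ r"
  using snoc.IH[of "enc_transition c ta @ r"] snoc.prems by simp
 note * = transition_at'[OF this]
 show ?case using snoc.IH[of "enc_transition c ta @ r"] snoc.prems * by (auto simp: nth_append less_Suc_eq)
qed auto

lemma transitions_conv:
 "trs W t m <= n ==> (\<forall>j<m. \<forall>i<tk W (nx W (trs W t j)). tk W (nxs W (nx W (nx W (trs W t j))) i) \<in> range c &
   (\<forall>k<i. tk W (nxs W (nx W (nx W (trs W t j))) k) < tk W (nxs W (nx W (nx W (trs W t j))) i))) ==>
  drop t w = concat (map (enc_transition c) (map (%j. trans_of (trs W t j)) [0..<m])) @ drop (trs W t m) w"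
proof (induction m)
 case (Suc m)
 have "trs W t m <= n" using Suc.prems(1) nt_gt[of "trs W t m" W] by simp
 then show ?case using Suc transition_at_conv[of "trs W t m"] by simp
qed simp

lemma ts_read:
 assumes T: "drop p w = enc_ts c T" "wf_ts T" and m: "range c \<subseteq> {..<m}"
 shows "ts_ok (range c) W p" "ts_ini W p q \<longleftrightarrow> q \<in> set (initials T)"
  "ts_tr (range c) m W p q a q' \<longleftrightarrow> (q, lset a, q') \<in> set (transitions T)"
proof -
 have "drop p w = enc_nat (num_states T) @ enc_list enc_nat (initials T) @ enc_list (enc_transition c) (transitions T) @ []"
  using T(1) by (simp add: enc_ts_def)
 then have 1: "tk W p = num_states T" "initials T = map (%j. tk W (nxs W (nx W (nx W p)) j)) [0..<tk W (nx W p)]"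
   "drop (trans_pos W p) w = enc_list (enc_transition c) (transitions T) @ []"
  unfolding drop_enc_nat list_at trans_pos_def by blast+
 then have 2: "tk W (trans_pos W p) = length (transitions T)" "nx W (trans_pos W p) <= n"
  "drop (nx W (trans_pos W p)) w = concat (map (enc_transition c) (transitions T)) @ []"
  unfolding enc_list_def append_assoc drop_enc_nat by blast+
 let ?t = "nx W (trans_pos W p)"
 note 3 = transitions_read[OF 2(3,2)]
 have set: "set (transitions T) = {trans_of (trs W ?t j) | j. j < tk W (trans_pos W p)}"
  using 3 2(1) by (auto simp: set_conv_nth) metis+
 have "n <= trs W ?t (length (transitions T))" using 3 by simp
 then have last: "trs W ?t (length (transitions T)) = n" using 3 by simp
 show "ts_ini W p q \<longleftrightarrow> q \<in> set (initials T)" unfolding 1(2) ts_ini_def by auto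
 show "ts_ok (range c) W p"
  unfolding ts_ok_def
 proof (intro conjI allI impI)
  show "trs W ?t (tk W (trans_pos W p)) = lg W" using last 2(1) by simp
  show "tk W (nxs W (nx W (nx W p)) j) < tk W p" if "j < tk W (nx W p)" for j
   using T(2) that unfolding wf_ts_def 1(1) 1(2) by (auto simp: image_subset_iff)
  fix j assume j: "j < tk W (trans_pos W p)"
  then have "trans_of (trs W ?t j) \<in> set (transitions T)" unfolding set by blast
  then have "trans_of (trs W ?t j) \<in> {..<num_states T} \<times> UNIV \<times> {..<num_states T}" using T(2) by (auto simp: wf_ts_def)
  then show "tr_ok (range c) W p (trs W ?t j)" using 3 2(1) j by (simp add: tr_ok_def trans_of_def 1(1))
 qed
 have "(q, lset a, q') = trans_of t \<longleftrightarrow> tr_at (range c) m W t q a q'" for t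
 proof -
  have "(\<forall>x<m. x \<in> range c --> bit a x = (\<exists>i<tk W (nx W t). tk W (nxs W (nx W (nx W t)) i) = x)) \<longleftrightarrow>
   (ALL y. bit a (c y) = (\<exists>i<tk W (nx W t). tk W (nxs W (nx W (nx W t)) i) = c y))"
  proof -
   have "(\<forall>x<m. x \<in> range c --> Q x) \<longleftrightarrow> (ALL y. Q (c y))" for Q using m by auto
   then show ?thesis .
  qed
  then show ?thesis by (auto simp: tr_at_def trans_of_def lset_def)
 qed
 then show "ts_tr (range c) m W p q a q' \<longleftrightarrow> (q, lset a, q') \<in> set (transitions T)"
  unfolding set ts_tr_def by auto
qed

lemma ts_conv:
 assumes "ts_ok (range c) W p"
 shows "EX T. wf_ts T & drop p w = enc_ts c T"
proof -
 let ?u = "trans_pos W p" let ?t = "nx W ?u"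
 define T where "T = \<lparr>num_states = tk W p, initials = map (%j. tk W (nxs W (nx W (nx W p)) j)) [0..<tk W (nx W p)],
   transitions = map (%j. trans_of (trs W ?t j)) [0..<tk W ?u]\<rparr>"
 have ok: "trs W ?t (tk W ?u) = n" "\<forall>j<tk W (nx W p). tk W (nxs W (nx W (nx W p)) j) < tk W p"
  "\<forall>j<tk W ?u. tr_ok (range c) W p (trs W ?t j)" using assms by (auto simp: ts_ok_def)
 have trs_ge: "x <= trs W x k" for x k
  by (induction k) (auto intro: le_trans less_imp_le[OF nt_gt])
 have le: "?t <= n" using trs_ge[of ?t "tk W ?u"] ok(1) by simp
 have le': "?u <= n" using nx_gt[of ?u W] le by simp
 have le'': "nx W p <= n" using nxs_ge[of "nx W (nx W p)" W "tk W (nx W p)"] nx_gt[of "nx W p" W] le'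
  by (simp add: trans_pos_def)
 have "drop ?t w = concat (map (enc_transition c) (transitions T)) @ drop (trs W ?t (tk W ?u)) w"
  using transitions_conv[of ?t "tk W ?u"] ok by (simp add: T_def tr_ok_def)
 then have "drop ?u w = enc_list (enc_transition c) (transitions T)"
  using drop_enc_nat[of ?u "tk W ?u" "concat (map (enc_transition c) (transitions T))"] le ok(1)
  by (simp add: enc_list_def T_def)
 then have "drop (nx W p) w = enc_list enc_nat (initials T) @ enc_list (enc_transition c) (transitions T)"
  unfolding list_at using le' by (simp add: T_def trans_pos_def)
 then have "drop p w = enc_ts c T"
  unfolding enc_ts_def drop_enc_nat using le'' by (simp add: T_def)
 moreover have "wf_ts T" using ok(2,3) by (auto simp: wf_ts_def T_def tr_ok_def trans_of_def)
 ultimately show ?thesis by blast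
qed

end

section \<open>The complete test as a definable predicate\<close>

section \<open>Definability of the emptiness test\<close>

lemma E2_app5: "E2 (%e. f (e 0) (e 1) (e 2) (e 3) (e 4)) ==> E2 a ==> E2 b ==> E2 c ==> E2 d ==> E2 g ==>
  E2 (%e. f (a e) (b e) (c e) (d e) (g e))"
 using E2_args[of "%e. f (e 0) (e 1) (e 2) (e 3) (e 4)" "[a, b, c, d, g]"] by (simp add: numeral_eq_Suc)

lemma E2_app6: "E2 (%e. f (e 0) (e 1) (e 2) (e 3) (e 4) (e 5)) ==> E2 a ==> E2 b ==> E2 c ==> E2 d ==> E2 g ==> E2 h ==>
  E2 (%e. f (a e) (b e) (c e) (d e) (g e) (h e))"
 using E2_args[of "%e. f (e 0) (e 1) (e 2) (e 3) (e 4) (e 5)" "[a, b, c, d, g, h]"] by (simp add: numeral_eq_Suc)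

lemma E2p_app3: "E2p (%e. f (e 0) (e 1) (e 2)) ==> E2 a ==> E2 b ==> E2 c ==> E2p (%e. f (a e) (b e) (c e))"
 unfolding E2p_def by (rule E2_app3[of "%x y z. of_bool (f x y z)"])

lemma E2p_app5: "E2p (%e. f (e 0) (e 1) (e 2) (e 3) (e 4)) ==> E2 a ==> E2 b ==> E2 c ==> E2 d ==> E2 g ==>
  E2p (%e. f (a e) (b e) (c e) (d e) (g e))"
 unfolding E2p_def by (rule E2_app5[of "%x y z u v. of_bool (f x y z u v)"])

lemma E2p_app6: "E2p (%e. f (e 0) (e 1) (e 2) (e 3) (e 4) (e 5)) ==> E2 a ==> E2 b ==> E2 c ==> E2 d ==> E2 g ==> E2 h ==>
  E2p (%e. f (a e) (b e) (c e) (d e) (g e) (h e))"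
 unfolding E2p_def by (rule E2_app6[of "%x y z u v w. of_bool (f x y z u v w)"])

lemma E2p_mem: "finite C ==> E2 f ==> E2p (%e. f e \<in> C)"
proof (induction C rule: finite_induct)
 case (insert x F)
 have "E2p (%e. f e = x \<or> f e \<in> F)" by (intro E2p_disj E2p_eq E2_const insert)
 then show ?case by simp
qed (simp add: E2p_const)

lemma E2_tk: "E2 W ==> E2 p ==> E2 (%e. tk (W e) (p e))"
 by (rule E2_app2[of tk]) (unfold tk_def, intro E2_intros)

lemma E2_nx: "E2 W ==> E2 p ==> E2 (%e. nx (W e) (p e))"
 unfolding nx_def by (intro E2_intros E2_tk)

lemma E2_lg: "E2 W ==> E2 (%e. lg (W e))"
 by (rule E2_app1[of lg]) (unfold lg_def, intro E2_intros E2_div_power)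

lemma E2_en: "E2 W ==> E2 N ==> E2 p ==> E2 (%e. en (W e) (N e) (p e))"
 unfolding en_def by (intro E2_intros E2_lg)

lemma nx_le: "nx W p <= p + (W + 1)"
 using mu_le[of W] by (simp add: nx_def tk_def)

lemma nxs_le: "nxs W p k <= p + k * (W + 1)"
proof (induction k)
 case (Suc k)
 then show ?case using nx_le[of W "nxs W p k"] by simp
qed simp

lemma nt_le: "nt W t <= t + (W + 3) * (W + 1)"
proof -
 have "nt W t <= nxs W (nx W (nx W t)) (tk W (nx W t)) + (W + 1)" unfolding nt_def by (rule nx_le)
 also have "\<dots> \<le> nx W (nx W t) + tk W (nx W t) * (W + 1) + (W + 1)" using nxs_le by simp
 also have "\<dots> \<le> t + (W + 1) + (W + 1) + W * (W + 1) + (W + 1)"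
 proof -
  have "tk W (nx W t) * (W + 1) <= W * (W + 1)" using mu_le by (intro mult_le_mono1) (simp add: tk_def)
  then show ?thesis using nx_le[of W t] nx_le[of W "nx W t"] by linarith
 qed
 finally show ?thesis by (simp add: algebra_simps)
qed

lemma trs_le: "trs W t k <= t + k * ((W + 3) * (W + 1))"
proof (induction k)
 case (Suc k)
 then show ?case using nt_le[of W "trs W t k"] by simp
qed simp

lemma E2_nxs: "E2 W ==> E2 p ==> E2 k ==> E2 (%e. nxs (W e) (p e) (k e))"
proof (rule E2_app3[of nxs])
 have "E2 (%e. rec_nat (e 1) (%i r. nx (e 0) r) (e 2))"
 proof (rule E2_rec[where B = "%e. e 1 + e 2 * (e 0 + 1)"])
  show "rec_nat (e 1) (%i r. nx (e 0) r) i <= e 1 + e 2 * (e 0 + 1)" if "i <= e 2" for i e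
   using nxs_le[of "e 0" "e 1" i] mult_le_mono1[OF that, of "e 0 + 1"] unfolding nxs_def by linarith
 qed (intro E2_intros E2_nx bnd_add bnd_mult bnd_var bnd_const)+
 then show "E2 (%e. nxs (e 0) (e 1) (e 2))" by (simp add: nxs_def)
qed

lemma E2_nt: "E2 W ==> E2 t ==> E2 (%e. nt (W e) (t e))"
 unfolding nt_def by (intro E2_nx E2_nxs E2_tk)

lemma E2_trs: "E2 W ==> E2 p ==> E2 k ==> E2 (%e. trs (W e) (p e) (k e))"
proof (rule E2_app3[of trs])
 have "E2 (%e. rec_nat (e 1) (%i r. nt (e 0) r) (e 2))"
 proof (rule E2_rec[where B = "%e. e 1 + e 2 * ((e 0 + 3) * (e 0 + 1))"])
  show "rec_nat (e 1) (%i r. nt (e 0) r) i <= e 1 + e 2 * ((e 0 + 3) * (e 0 + 1))" if "i <= e 2" for i e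
   using trs_le[of "e 0" "e 1" i] mult_le_mono1[OF that, of "(e 0 + 3) * (e 0 + 1)"] unfolding trs_def by linarith
 qed (intro E2_intros E2_nt bnd_add bnd_mult bnd_var bnd_const)+
 then show "E2 (%e. trs (e 0) (e 1) (e 2))" by (simp add: trs_def)
qed

lemma E2_trans_pos: "E2 W ==> E2 t ==> E2 (%e. trans_pos (W e) (t e))"
 unfolding trans_pos_def by (intro E2_nx E2_nxs E2_tk)

lemmas E2_more = E2_intros E2_tk E2_nx E2_lg E2_en E2_nxs E2_nt E2_trs E2_trans_pos E2_div_power E2p_mem

lemma E2p_base_ok: "finite C ==> E2p (%e. base_ok C (e 0) (e 1) (e 2))"
 unfolding base_ok_def by (intro E2_more)

lemma E2p_plus_ok: "E2p (%e. plus_ok (e 0) (e 1) (e 2) (e 3) (e 4))"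
 unfolding plus_ok_def by (intro E2_more)

lemma E2p_loc: "E2p (%e. loc (e 0) (e 1) (e 2) (e 3) (e 4) (e 5))"
 unfolding loc_def by (intro E2_more)

lemma E2p_acc_ok: "E2p (%e. acc_ok (e 0) (e 1) (e 2) (e 3) (e 4) (e 5))"
 unfolding acc_ok_def by (intro E2_more)

lemma E2p_trP: "E2p (%e. trP (e 0) (e 1) (e 2) (e 3) (e 4) (e 5))"
 unfolding trP_def by (intro E2p_app6[OF E2p_loc] E2_more)

lemma E2p_trL: "E2p (%e. trL (e 0) (e 1) (e 2) (e 3) (e 4) (e 5))"
 unfolding trL_def by (intro E2p_app6[OF E2p_loc] E2_more)

lemma E2p_iniP: "E2p (%e. iniP (e 0) (e 1))"
 unfolding iniP_def by (intro E2_more)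

lemma E2p_iniL: "E2p (%e. iniL (e 0) (e 1))"
 unfolding iniL_def by (intro E2_more)

lemma E2_outP: "E2 (%e. outP (e 0) (e 1))"
 unfolding outP_def by (intro E2_more)

lemma E2_outL: "E2 (%e. outL (e 0) (e 1))"
 unfolding outL_def by (intro E2_more)

lemma E2p_ts_ini: "E2p (%e. ts_ini (e 0) (e 1) (e 2))"
 unfolding ts_ini_def by (intro E2_more)

lemma E2p_tr_at: "finite C ==> E2p (%e. tr_at C m (e 0) (e 1) (e 2) (e 3) (e 4))"
 unfolding tr_at_def by (intro E2_more)

lemma E2p_ts_tr: "finite C ==> E2p (%e. ts_tr C m (e 0) (e 1) (e 2) (e 3) (e 4))"
 unfolding ts_tr_def by (intro E2p_app5[OF E2p_tr_at] E2_more)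

lemma E2p_tr_ok: "finite C ==> E2p (%e. tr_ok C (e 0) (e 1) (e 2))"
 unfolding tr_ok_def by (intro E2_more)

lemma E2p_ts_ok: "finite C ==> E2p (%e. ts_ok C (e 0) (e 1))"
 unfolding ts_ok_def by (intro E2p_app3[OF E2p_tr_ok] E2_more)

text \<open>A parse is guessed and a lasso is sought whose trace has truth value \<open>b\<close>.
  Comparing the answer with \<open>b\<close> yields satisfiability for \<open>b\<close> true (there
  is a trace inside) and validity or model checking for \<open>b\<close> false (there is none
  outside).\<close>

definition dec :: "nat set => nat => (nat => nat => nat => nat => nat => nat => bool) => (nat => nat => bool) => (nat => nat => nat) =>
  (nat => nat) => (nat => nat => bool) => (nat => nat => nat => bool) => (nat => nat => nat => nat => nat => bool) =>
  bool => nat => nat => bool" where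
 "dec C AB Tr ini out l ok TI TT b W Y \<longleftrightarrow> (\<exists>K<Y. \<exists>N<Y. \<exists>KP<Y. \<exists>NP<Y. base_ok C W K N & plus_ok W K N KP NP &
   0 < lg W & bit KP 0 & ok W (en W NP 0) &
   lasso (%s a s'. Tr W K N s a s') (%s. ini W s) (%s. out W s) (%q. TI W (en W NP 0) q)
   (%q a q'. TT W (en W NP 0) q a q') AB W KP NP (l W) Y b = b)"

lemma E2p_dec:
 assumes "finite C" and Tr: "E2p (%e. Tr (e 0) (e 1) (e 2) (e 3) (e 4) (e 5))"
  and ini: "E2p (%e. ini (e 0) (e 1))" and out: "E2 (%e. out (e 0) (e 1))" and l: "E2 (%e. l (e 0))"
  and ok: "E2p (%e. ok (e 0) (e 1))" and TI: "E2p (%e. TI (e 0) (e 1) (e 2))"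
  and TT: "E2p (%e. TT (e 0) (e 1) (e 2) (e 3) (e 4))"
 shows "E2p (%e. dec C AB Tr ini out l ok TI TT b (e 1) (e 0))"
 unfolding dec_def lasso_def edge_def
 by (intro E2p_app3[OF E2p_base_ok] E2p_app5[OF E2p_plus_ok] E2p_app6[OF E2p_acc_ok] E2p_reach_eval
   E2p_app6[OF Tr] E2p_app2[OF ini] E2_app2[OF out] E2_app1[OF l] E2p_app2[OF ok] E2p_app3[OF TI] E2p_app5[OF TT]
   E2_more assms)

section \<open>Membership in EXPSPACE and PSPACE\<close>

section \<open>Membership\<close>

context word begin

lemma dec_correct:
 assumes mach: "!!K N. base_ok (range c) W K N ==> machine (Tr W K N) (ini W) (out W) SB L K"
  and l: "SB <= 2 ^ l W" "2 * n <= l W"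
  and T: "!!j q. ok W j ==> TI W j q ==> q < 2 ^ l W" "!!j q a q'. ok W j ==> TT W j q a q' ==> q' < 2 ^ l W"
  and Y: "2 ^ Suc (2 * (3 * l W) * Suc (3 * l W)) <= Y"
 shows "dec (range c) AB Tr ini out l ok TI TT b W Y \<longleftrightarrow> (\<exists>\<Psi> j. plus_at 0 \<Psi> j & ok W j &
  (\<exists>al rh. TI W j (rh 0) & (ALL t. al t < AB & TT W j (rh t) (al t) (rh (Suc t))) & (lset \<circ> al \<in> plus_lang L \<Psi>) = b) = b)"
proof
 assume "dec (range c) AB Tr ini out l ok TI TT b W Y"
 then obtain K N KP NP where d: "base_ok (range c) W K N" "plus_ok W K N KP NP" "0 < n" "bit KP 0" "ok W (en W NP 0)"
   "lasso (Tr W K N) (ini W) (out W) (TI W (en W NP 0)) (TT W (en W NP 0)) AB W KP NP (l W) Y b = b"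
  unfolding dec_def lgW by blast
 obtain \<Psi> where \<Psi>: "plus_at 0 \<Psi> (en W NP 0)" using plus_ok_sound[OF d(1,2,4,3)] by blast
 show "\<exists>\<Psi> j. plus_at 0 \<Psi> j & ok W j &
  (\<exists>al rh. TI W j (rh 0) & (ALL t. al t < AB & TT W j (rh t) (al t) (rh (Suc t))) & (lset \<circ> al \<in> plus_lang L \<Psi>) = b) = b"
  using trans[OF lasso_correct[where AB = AB and b = b and TI = "TI W (en W NP 0)" and TT = "TT W (en W NP 0)",
   OF d(1-4) \<Psi> mach[OF d(1)] l T[OF d(5)] Y, symmetric] d(6)] d(5) \<Psi>
  by (intro exI[of _ \<Psi>] exI[of _ "en W NP 0"] conjI)
next
 assume "\<exists>\<Psi> j. plus_at 0 \<Psi> j & ok W j &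
  (\<exists>al rh. TI W j (rh 0) & (ALL t. al t < AB & TT W j (rh t) (al t) (rh (Suc t))) & (lset \<circ> al \<in> plus_lang L \<Psi>) = b) = b"
 then obtain \<Psi> j where \<Psi>: "plus_at 0 \<Psi> j" "ok W j" and eq: "(\<exists>al rh. TI W j (rh 0) & (ALL t. al t < AB &
   TT W j (rh t) (al t) (rh (Suc t))) & (lset \<circ> al \<in> plus_lang L \<Psi>) = b) = b" by blast
 have n: "0 < n" using plus_at_less[OF \<Psi>(1)] plus_at_le[OF \<Psi>(1)] by linarith
 obtain K N KP NP where k: "K < 2 ^ n" "N < (n + 1) ^ n" "KP < 2 ^ n" "NP < (n + 1) ^ n"
  "base_ok (range c) W K N" "plus_ok W K N KP NP" "\<forall>p<n. \<forall>\<Psi> j. plus_at p \<Psi> j --> bit KP p & en W NP p = j"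
  using parse_exists by blast
 have r: "bit KP 0" "en W NP 0 = j" using k(7) n \<Psi>(1) by blast+
 have "n * n <= 2 * (3 * l W) * Suc (3 * l W)"
 proof -
  have "n * n <= (3 * l W) * Suc (3 * l W)" using l(2) by (intro mult_le_mono) auto
  then show ?thesis by simp
 qed
 moreover have "n <= n * n" by (cases n) auto
 ultimately have e: "n <= Suc (2 * (3 * l W) * Suc (3 * l W))" "n * n <= Suc (2 * (3 * l W) * Suc (3 * l W))" by linarith+
 have Y2: "2 ^ n <= Y" using Y power_increasing[OF e(1), of "2::nat"] by linarith
 \<comment> \<open>The end positions are \<open>n\<close> digits in base \<open>n + 1\<close>, so
   their table has at most \<open>n * n\<close> bits and lies below the yardstick.\<close>
 have "(n + 1) ^ n <= (2 ^ n) ^ n" using less_exp[of n] by (intro power_mono) (auto simp: Suc_le_eq)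
 also have "\<dots> = 2 ^ (n * n)" by (simp add: power_mult)
 also have "\<dots> \<le> Y" using Y power_increasing[OF e(2), of "2::nat"] by linarith
 finally have Y3: "(n + 1) ^ n <= Y" .
 have "lasso (Tr W K N) (ini W) (out W) (TI W j) (TT W j) AB W KP NP (l W) Y b = b"
  by (rule trans[OF lasso_correct[where AB = AB and b = b and TI = "TI W j" and TT = "TT W j", OF k(5,6) n r(1) \<Psi>(1) mach[OF k(5)] l T[OF \<Psi>(2)] Y] eq])
 then show "dec (range c) AB Tr ini out l ok TI TT b W Y"
  unfolding dec_def lgW using k(5,6) n r \<Psi>(2) less_le_trans[OF k(1) Y2] less_le_trans[OF k(2) Y3]
   less_le_trans[OF k(3) Y2] less_le_trans[OF k(4) Y3]
  by (intro exI[of _ K] exI[of _ N] exI[of _ KP] exI[of _ NP] conjI) simp_all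
qed

lemma lset_surj:
 assumes "range c \<subseteq> {..<m}"
 shows "\<exists>a<2 ^ m. lset a = A"
proof -
 obtain a where "a < (2::nat) ^ m" "ALL i. bit a i \<longleftrightarrow> i < m & i \<in> c ` A"
  using ex_bits[of m "%i. i \<in> c ` A"] by (elim exE conjE)
 then show ?thesis using assms inj by (intro exI[of _ a]) (auto simp: lset_def inj_image_mem_iff)
qed

lemma trace_surj:
 assumes "range c \<subseteq> {..<m}"
 shows "\<exists>al. (ALL t. al t < 2 ^ m) & lset \<circ> al = ta"
proof -
 have "ALL t. \<exists>a<2 ^ m. lset a = ta t" using lset_surj[OF assms] by blast
 then obtain al where "ALL t. al t < 2 ^ m & lset (al t) = ta t" by metis
 then show ?thesis by (intro exI[of _ al]) auto
qed

lemma plus_at_whole: "plus_at 0 \<Psi> n \<longleftrightarrow> w = enc_plus (enc_ppltl c) \<Psi>"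
 by (simp add: plus_at_def)

text \<open>Both problems use the trivial transition system with the single state 0 and all letters
  allowed, and the formula has to fill the whole word (\<open>j = n\<close>).\<close>

lemma sat_val_iff:
 assumes m: "range c \<subseteq> {..<m}"
 shows "(\<exists>\<Psi> j. plus_at 0 \<Psi> j & j = n & (\<exists>al rh. rh 0 = (0::nat) &
   (ALL t. al t < 2 ^ m & (rh t = 0 & rh (Suc t) = 0)) & (lset \<circ> al \<in> plus_lang L \<Psi>) = b) = b) \<longleftrightarrow>
  w \<in> (if b then satisfiability (enc_plus (enc_ppltl c)) (plus_lang L) else validity (enc_plus (enc_ppltl c)) (plus_lang L))"
proof -
 have "(\<exists>al rh. rh 0 = (0::nat) & (ALL t. al t < 2 ^ m & (rh t = 0 & rh (Suc t) = 0)) & (lset \<circ> al \<in> plus_lang L \<Psi>) = b) \<longleftrightarrow>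
   (\<exists>ta. (ta \<in> plus_lang L \<Psi>) = b)" for \<Psi>
 proof
  assume "\<exists>ta. (ta \<in> plus_lang L \<Psi>) = b"
  then obtain ta where ta: "(ta \<in> plus_lang L \<Psi>) = b" by blast
  obtain al where "ALL t. al t < 2 ^ m" "lset \<circ> al = ta" using trace_surj[OF m] by blast
  then show "\<exists>al rh. rh 0 = (0::nat) & (ALL t. al t < 2 ^ m & (rh t = 0 & rh (Suc t) = 0)) & (lset \<circ> al \<in> plus_lang L \<Psi>) = b"
   using ta by (intro exI[of _ al] exI[of _ "%_. 0"]) auto
 qed blast
 then show ?thesis by (cases b) (auto simp: plus_at_whole satisfiability_def validity_def)
qed

lemma mc_iff:
 assumes m: "range c \<subseteq> {..<m}"
 shows "(\<exists>\<Psi> j. plus_at 0 \<Psi> j & ts_ok (range c) W j & (\<exists>al rh. ts_ini W j (rh 0) &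
   (ALL t. al t < 2 ^ m & ts_tr (range c) m W j (rh t) (al t) (rh (Suc t))) & (lset \<circ> al \<in> plus_lang L \<Psi>) = False) = False) \<longleftrightarrow>
  w \<in> model_checking c (enc_plus (enc_ppltl c)) (plus_lang L)"
proof -
 have run: "(\<exists>al rh. ts_ini W j (rh 0) & (ALL t. al t < 2 ^ m & ts_tr (range c) m W j (rh t) (al t) (rh (Suc t))) &
   (lset \<circ> al \<in> plus_lang L \<Psi>) = False) \<longleftrightarrow> ~ generated_traces T \<subseteq> plus_lang L \<Psi>"
  if T: "drop j w = enc_ts c T" "wf_ts T" for T \<Psi> j
 proof
  assume "\<exists>al rh. ts_ini W j (rh 0) & (ALL t. al t < 2 ^ m & ts_tr (range c) m W j (rh t) (al t) (rh (Suc t))) &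
   (lset \<circ> al \<in> plus_lang L \<Psi>) = False"
  then obtain al rh where a: "rh 0 \<in> set (initials T)" "ALL t. (rh t, lset (al t), rh (Suc t)) \<in> set (transitions T)"
   "lset \<circ> al \<notin> plus_lang L \<Psi>" unfolding ts_read[OF T m] by blast
  then have "lset \<circ> al \<in> generated_traces T" by (auto simp: generated_traces_def)
  then show "~ generated_traces T \<subseteq> plus_lang L \<Psi>" using a(3) by blast
 next
  assume "~ generated_traces T \<subseteq> plus_lang L \<Psi>"
  then obtain ta rh where ta: "ta \<notin> plus_lang L \<Psi>" "rh 0 \<in> set (initials T)" "ALL t. (rh t, ta t, rh (Suc t)) \<in> set (transitions T)"
   by (auto simp: generated_traces_def)
  obtain al where "ALL t. al t < 2 ^ m" "lset \<circ> al = ta" using trace_surj[OF m] by blast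
  then show "\<exists>al rh. ts_ini W j (rh 0) & (ALL t. al t < 2 ^ m & ts_tr (range c) m W j (rh t) (al t) (rh (Suc t))) &
   (lset \<circ> al \<in> plus_lang L \<Psi>) = False"
   unfolding ts_read[OF T m] using ta by (intro exI[of _ al] exI[of _ rh]) auto
 qed
 show ?thesis
 proof
  assume "\<exists>\<Psi> j. plus_at 0 \<Psi> j & ts_ok (range c) W j & (\<exists>al rh. ts_ini W j (rh 0) &
   (ALL t. al t < 2 ^ m & ts_tr (range c) m W j (rh t) (al t) (rh (Suc t))) & (lset \<circ> al \<in> plus_lang L \<Psi>) = False) = False"
  then obtain \<Psi> j where p: "plus_at 0 \<Psi> j" "ts_ok (range c) W j" "~ (\<exists>al rh. ts_ini W j (rh 0) &
   (ALL t. al t < 2 ^ m & ts_tr (range c) m W j (rh t) (al t) (rh (Suc t))) & (lset \<circ> al \<in> plus_lang L \<Psi>) = False)" by blast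
  obtain T where T: "wf_ts T" "drop j w = enc_ts c T" using ts_conv[OF p(2)] by blast
  have "w = enc_plus (enc_ppltl c) \<Psi> @ enc_ts c T" using p(1) T(2) by (simp add: plus_at_def)
  moreover have "generated_traces T \<subseteq> plus_lang L \<Psi>" using run[OF T(2,1)] p(3) by blast
  ultimately show "w \<in> model_checking c (enc_plus (enc_ppltl c)) (plus_lang L)"
   using T(1) unfolding model_checking_def by blast
 next
  assume "w \<in> model_checking c (enc_plus (enc_ppltl c)) (plus_lang L)"
  then obtain \<Psi> T where T: "w = enc_plus (enc_ppltl c) \<Psi> @ enc_ts c T" "wf_ts T" "generated_traces T \<subseteq> plus_lang L \<Psi>"
   unfolding model_checking_def by blast
  define j where "j = length (enc_plus (enc_ppltl c) \<Psi>)"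
  have d: "drop j w = enc_ts c T" "plus_at 0 \<Psi> j" unfolding plus_at_def j_def by (simp_all add: T(1))
  then show "\<exists>\<Psi> j. plus_at 0 \<Psi> j & ts_ok (range c) W j & (\<exists>al rh. ts_ini W j (rh 0) &
   (ALL t. al t < 2 ^ m & ts_tr (range c) m W j (rh t) (al t) (rh (Suc t))) & (lset \<circ> al \<in> plus_lang L \<Psi>) = False) = False"
   using run[OF d(1) T(2)] ts_read(1)[OF d(1) T(2) m] T(3) by blast
 qed
qed

lemma ts_bound:
 assumes ok: "ts_ok (range c) W j" and m: "range c \<subseteq> {..<m}"
 shows "ts_ini W j q ==> q < 2 ^ (n + 1)" "ts_tr (range c) m W j q a q' ==> q' < 2 ^ (n + 1)"
proof -
 obtain T where T: "drop j w = enc_ts c T" "wf_ts T" using ts_conv[OF ok] by blast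
 have "num_states T <= length (enc_ts c T)" by (simp add: enc_ts_def enc_nat_def)
 also have "\<dots> \<le> n" using T(1) by (metis diff_le_self length_drop)
 also have "n < 2 ^ n" by (rule less_exp)
 finally have "num_states T <= 2 ^ (n + 1)" by simp
 then show "ts_ini W j q ==> q < 2 ^ (n + 1)" "ts_tr (range c) m W j q a q' ==> q' < 2 ^ (n + 1)"
  unfolding ts_read[OF T m] using T(2) by (fastforce simp: wf_ts_def)+
qed

end

text \<open>A node has \<open>3 * l\<close> bits, so Savitch's tree has height
  \<open>2 * (3 * l) * Suc (3 * l)\<close>; this fixes the yardstick and makes the space quadratic
  in \<open>l\<close>.\<close>

theorem membership:
 fixes c :: "'a::finite => nat" and L :: "'a ppltl => 'a fin_trace set"
 assumes inj: "inj c"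
  and Tr: "E2p (%e. Tr (e 0) (e 1) (e 2) (e 3) (e 4) (e 5))"
  and ini: "E2p (%e. ini (e 0) (e 1))" and out: "E2 (%e. out (e 0) (e 1))" and l: "E2 (%e. l (e 0))"
  and mach: "!!w K N. base_ok (range c) (code w) K N ==>
   word.machine w c (Tr (code w) K N) (ini (code w)) (out (code w)) (SB w) L K"
  and SB: "!!w. SB w <= 2 ^ l (code w)" "!!w. 2 * length w + 1 <= l (code w)"
  and s: "!!w. length w + Suc (2 * (3 * l (code w)) * Suc (3 * l (code w))) <= d * s (length w) + d"
 shows "satisfiability (enc_plus (enc_ppltl c)) (plus_lang L) \<in> dspace s"
  "validity (enc_plus (enc_ppltl c)) (plus_lang L) \<in> dspace s"
  "model_checking c (enc_plus (enc_ppltl c)) (plus_lang L) \<in> dspace s"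
proof -
 define m where "m = Suc (Max (range c))"
 have m: "range c \<subseteq> {..<m}" by (auto simp: m_def less_Suc_eq_le)
 have fin: "finite (range c)" by simp
 have l2: "2 * length w <= l (code w)" for w using SB(2)[of w] by simp
 have word: "word c" using inj by unfold_locales
 have eb: "E2 (%e. Suc (2 * (3 * l (e 0)) * Suc (3 * l (e 0))))" by (intro E2_more E2_app1[OF l])
 have sv: "(if b then satisfiability (enc_plus (enc_ppltl c)) (plus_lang L) else validity (enc_plus (enc_ppltl c)) (plus_lang L)) \<in> dspace s" for b
 proof (rule E2_dspace[where D = "%W Y. dec (range c) (2 ^ m) Tr ini out l (%W j. j = lg W) (%W j q. q = 0) (%W j q a q'. q = 0 & q' = 0) b W Y"
   and b = "%W. Suc (2 * (3 * l W) * Suc (3 * l W))", OF _ eb _ s])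
  show "E2p (%e. dec (range c) (2 ^ m) Tr ini out l (%W j. j = lg W) (%W j q. q = 0) (%W j q a q'. q = 0 & q' = 0) b (e 1) (e 0))"
   by (intro E2p_dec fin Tr ini out l E2_more)
  fix w
  interpret word w c using inj by unfold_locales
  show "dec (range c) (2 ^ m) Tr ini out l (%W j. j = lg W) (%W j q. q = 0) (%W j q a q'. q = 0 & q' = 0) b (code w)
   (2 ^ Suc (2 * (3 * l (code w)) * Suc (3 * l (code w)))) \<longleftrightarrow>
   w \<in> (if b then satisfiability (enc_plus (enc_ppltl c)) (plus_lang L) else validity (enc_plus (enc_ppltl c)) (plus_lang L))"
   unfolding sat_val_iff[OF m, symmetric]
   by (rule dec_correct[where SB = "SB w" and ok = "%W j. j = lg W" and TI = "%W j q. q = 0" and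
   TT = "%W j q a q'. q = 0 & q' = 0" and Tr = Tr and ini = ini and out = out and l = l and L = L, OF mach[of w] SB(1)[of w] l2[of w] _ _ order_refl, unfolded lgW]) simp_all
 qed
 from sv[of True] sv[of False] show "satisfiability (enc_plus (enc_ppltl c)) (plus_lang L) \<in> dspace s"
  "validity (enc_plus (enc_ppltl c)) (plus_lang L) \<in> dspace s" by simp_all
 show "model_checking c (enc_plus (enc_ppltl c)) (plus_lang L) \<in> dspace s"
 proof (rule E2_dspace[where D = "%W Y. dec (range c) (2 ^ m) Tr ini out l (ts_ok (range c)) ts_ini (ts_tr (range c) m) False W Y"
   and b = "%W. Suc (2 * (3 * l W) * Suc (3 * l W))", OF _ eb _ s])
  show "E2p (%e. dec (range c) (2 ^ m) Tr ini out l (ts_ok (range c)) ts_ini (ts_tr (range c) m) False (e 1) (e 0))"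
   by (intro E2p_dec fin Tr ini out l E2p_ts_ok E2p_ts_ini E2p_ts_tr)
  fix w
  interpret word w c using inj by unfold_locales
  have "(2::nat) ^ (n + 1) <= 2 ^ l W" using SB(2)[of w] by (intro power_increasing) auto
  then have T: "ts_ok (range c) W j ==> ts_ini W j q ==> q < 2 ^ l W"
   "ts_ok (range c) W j ==> ts_tr (range c) m W j q a q' ==> q' < 2 ^ l W" for j q a q'
   using ts_bound[OF _ m] by (meson order_less_le_trans)+
  show "dec (range c) (2 ^ m) Tr ini out l (ts_ok (range c)) ts_ini (ts_tr (range c) m) False (code w)
   (2 ^ Suc (2 * (3 * l (code w)) * Suc (3 * l (code w)))) \<longleftrightarrow> w \<in> model_checking c (enc_plus (enc_ppltl c)) (plus_lang L)"
   unfolding mc_iff[OF m, symmetric]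
   by (rule dec_correct[where SB = "SB w" and Tr = Tr and ini = ini and out = out and l = l and L = L and ok = "ts_ok (range c)"
   and TI = ts_ini and TT = "ts_tr (range c) m", OF mach[of w] SB(1)[of w] l2[of w] T order_refl])
 qed
qed

lemma enc_plus_map: "enc_plus e (map_plus f \<Psi>) = enc_plus (e \<circ> f) \<Psi>"
 by (induction \<Psi>) auto

lemma plus_lang_map: "plus_lang L (map_plus f \<Psi>) = plus_lang (L \<circ> f) \<Psi>"
 by (induction \<Psi>) auto

lemma ltlf_plus_mir:
 "enc_ltlf_plus c \<Psi> = enc_plus (enc_ppltl c) (map_plus mir \<Psi>)" "ltlf_plus_lang \<Psi> = plus_lang rev_lang (map_plus mir \<Psi>)"
 by (simp_all add: enc_ltlf_plus_def ltlf_plus_lang_def enc_plus_map plus_lang_map comp_def enc_mir ltlf_lang_mir[abs_def])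

lemma map_plus_mir_rim: "map_plus mir (map_plus rim \<Psi>) = \<Psi>"
 by (simp add: plus.map_comp comp_def plus.map_ident)

lemma ltlf_problems:
 "satisfiability (enc_ltlf_plus c) ltlf_plus_lang = satisfiability (enc_plus (enc_ppltl c)) (plus_lang rev_lang)"
 "validity (enc_ltlf_plus c) ltlf_plus_lang = validity (enc_plus (enc_ppltl c)) (plus_lang rev_lang)"
 "model_checking c (enc_ltlf_plus c) ltlf_plus_lang = model_checking c (enc_plus (enc_ppltl c)) (plus_lang rev_lang)"
proof -
 have ex: "(\<exists>\<Psi>. P (map_plus mir \<Psi>)) = (\<exists>\<Psi>. P \<Psi>)" for P :: "'a ppltl plus => bool"
  by (metis map_plus_mir_rim)
 show "satisfiability (enc_ltlf_plus c) ltlf_plus_lang = satisfiability (enc_plus (enc_ppltl c)) (plus_lang rev_lang)"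
  unfolding satisfiability_def ltlf_plus_mir
  by (rule set_eqI, unfold mem_Collect_eq, rule ex[of "%\<Psi>. _ = enc_plus (enc_ppltl c) \<Psi> & plus_lang rev_lang \<Psi> ~= {}"])
 show "validity (enc_ltlf_plus c) ltlf_plus_lang = validity (enc_plus (enc_ppltl c)) (plus_lang rev_lang)"
  unfolding validity_def ltlf_plus_mir
  by (rule set_eqI, unfold mem_Collect_eq, rule ex[of "%\<Psi>. _ = enc_plus (enc_ppltl c) \<Psi> & plus_lang rev_lang \<Psi> = UNIV"])
 show "model_checking c (enc_ltlf_plus c) ltlf_plus_lang = model_checking c (enc_plus (enc_ppltl c)) (plus_lang rev_lang)"
  unfolding model_checking_def ltlf_plus_mir
  by (rule set_eqI, unfold mem_Collect_eq,
   rule ex[of "%\<Psi>. EX T. _ = enc_plus (enc_ppltl c) \<Psi> @ enc_ts c T & wf_ts T & generated_traces T \<subseteq> plus_lang rev_lang \<Psi>"])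
qed

text \<open>A table has \<open>2 ^ n\<close> entries of \<open>n\<close> bits, so \<open>l\<close>
  is of the order of \<open>n * 2 ^ n\<close>, and its square is at most a constant times
  \<open>2 ^ (n ^ 2)\<close>.\<close>

theorem ltlf_membership:
 fixes c :: "'a::finite => nat"
 assumes inj: "inj c"
 shows "satisfiability (enc_ltlf_plus c) (ltlf_plus_lang :: 'a ltlf_plus => _) \<in> EXPSPACE"
  "validity (enc_ltlf_plus c) (ltlf_plus_lang :: 'a ltlf_plus => _) \<in> EXPSPACE"
  "model_checking c (enc_ltlf_plus c) (ltlf_plus_lang :: 'a ltlf_plus => _) \<in> EXPSPACE"
proof -
 have s: "length w + Suc (2 * (3 * l) * Suc (3 * l)) <= 1600 * 2 ^ (length w ^ 2) + 1600"
  if "l = (2 * length w + 1) * 2 ^ length w" for w :: "bool list" and l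
 proof -
  let ?n = "length w"
  have l4: "l <= 2 * 2 ^ (2 * ?n)"
  proof -
   have "2 * ?n + 1 <= 2 * 2 ^ ?n" using less_exp[of ?n] by linarith
   then have "l <= 2 * 2 ^ ?n * 2 ^ ?n" unfolding that by (rule mult_le_mono1)
   moreover have "2 * 2 ^ ?n * 2 ^ ?n = 2 * (2::nat) ^ (2 * ?n)" by (simp add: power_add mult_2[of ?n])
   ultimately show ?thesis by (simp only:)
  qed
  have sq: "l * l <= 4 * 2 ^ (4 * ?n)"
   using mult_le_mono[OF l4 l4] by (simp add: power_add[symmetric])
  \<comment> \<open>This inequality says that the square of \<open>?n - 2\<close>, taken over the
    integers, is not negative.\<close>
  have "4 * ?n <= ?n ^ 2 + 4"
  proof (cases "?n <= 2")
   case True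
   then have "?n = 0 \<or> ?n = 1 \<or> ?n = 2" by arith
   then show ?thesis by auto
  next
   case False
   show ?thesis
   proof (cases "?n = 3")
   case n4: False
   then have "4 * ?n <= ?n * ?n" using False by (intro mult_le_mono1) auto
   then show ?thesis unfolding power2_eq_square by linarith
   qed simp
  qed
  then have "(2::nat) ^ (4 * ?n) <= 2 ^ (?n ^ 2 + 4)" by (intro power_increasing) auto
  then have p: "(2::nat) ^ (4 * ?n) <= 16 * 2 ^ (?n ^ 2)" by (simp add: power_add)
  have "?n <= l" "1 <= l" unfolding that by (auto simp: add_mult_distrib trans_le_add1)
  then have "l <= l * l" "?n <= l * l" by (auto intro: le_trans)
  moreover have "?n + Suc (2 * (3 * l) * Suc (3 * l)) = ?n + 18 * (l * l) + 6 * l + 1" by (simp add: algebra_simps)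
  ultimately have "?n + Suc (2 * (3 * l) * Suc (3 * l)) <= 25 * (l * l) + 1" by linarith
  also have "\<dots> \<le> 1600 * 2 ^ (?n ^ 2) + 1" using sq p by linarith
  finally show ?thesis by linarith
 qed
 have l: "E2 (%e. (2 * lg (e 0) + 1) * cpow (e 0) (lg (e 0)))" by (intro E2_more)
 have lw: "(2 * lg (code w) + 1) * cpow (code w) (lg (code w)) = (2 * length w + 1) * 2 ^ length w" for w
  using code_ge[of w] by (simp add: lg_code cpow_eq)
 have mach: "word.machine w c (trL (code w) K N) (iniL (code w)) (outL (code w)) ((2 ^ length w) ^ (2 ^ length w)) rev_lang K"
  if "base_ok (range c) (code w) K N" for w K N
  using word.machine_L[OF word.intro[OF inj] that] .
 have SB: "(2 ^ length w) ^ (2 ^ length w) <= (2::nat) ^ ((2 * length w + 1) * 2 ^ length w)" for w :: "bool list"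
  unfolding power_mult[symmetric] by (intro power_increasing mult_le_mono1) auto
 have ge: "2 * length w + 1 <= (2 * length w + 1) * 2 ^ length w" for w :: "bool list"
  using mult_le_mono2[of 1 "2 ^ length w" "2 * length w + 1"] by simp
 let ?l = "%W. (2 * lg W + 1) * cpow W (lg W)"
 have 1: "(2 ^ length w) ^ (2 ^ length w) <= (2::nat) ^ ?l (code w)" for w unfolding lw by (rule SB)
 have 2: "2 * length w + 1 <= ?l (code w)" for w unfolding lw by (rule ge)
 have 3: "length w + Suc (2 * (3 * ?l (code w)) * Suc (3 * ?l (code w))) <= 1600 * 2 ^ (length w ^ 2) + 1600" for w
  by (rule s) (rule lw)
 note M = membership[where Tr = trL and ini = iniL and out = outL and l = ?l and L = rev_lang and d = 1600 and
  SB = "%w. (2 ^ length w) ^ (2 ^ length w)" and s = "%n. 2 ^ (n ^ 2)", OF inj E2p_trL E2p_iniL E2_outL l mach 1 2 3]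
 have "dspace (%n. 2 ^ (n ^ 2)) \<subseteq> EXPSPACE" by (auto simp: EXPSPACE_def)
 then show "satisfiability (enc_ltlf_plus c) (ltlf_plus_lang :: 'a ltlf_plus => _) \<in> EXPSPACE"
  "validity (enc_ltlf_plus c) (ltlf_plus_lang :: 'a ltlf_plus => _) \<in> EXPSPACE"
  "model_checking c (enc_ltlf_plus c) (ltlf_plus_lang :: 'a ltlf_plus => _) \<in> EXPSPACE"
  unfolding ltlf_problems using M by blast+
qed

theorem ppltl_membership:
 fixes c :: "'a::finite => nat"
 assumes inj: "inj c"
 shows "satisfiability (enc_ppltl_plus c) (ppltl_plus_lang :: 'a ppltl_plus => _) \<in> PSPACE"
  "validity (enc_ppltl_plus c) (ppltl_plus_lang :: 'a ppltl_plus => _) \<in> PSPACE"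
  "model_checking c (enc_ppltl_plus c) (ppltl_plus_lang :: 'a ppltl_plus => _) \<in> PSPACE"
proof -
 have s: "length w + Suc (2 * (3 * l) * Suc (3 * l)) <= 300 * length w ^ 2 + 300"
  if "l = 2 * length w + 1" for w :: "bool list" and l
 proof -
  let ?n = "length w"
  have "?n <= ?n ^ 2" by (cases ?n) (auto simp: power2_eq_square)
  moreover have "?n + Suc (2 * (3 * l) * Suc (3 * l)) = 72 * ?n ^ 2 + 85 * ?n + 25"
   unfolding that by (simp add: algebra_simps power2_eq_square)
  ultimately show ?thesis by linarith
 qed
 have l: "E2 (%e. 2 * lg (e 0) + 1)" by (intro E2_more)
 have lw: "2 * lg (code w) + 1 = 2 * length w + 1" for w by (simp add: lg_code)
 have mach: "word.machine w c (trP (code w) K N) (iniP (code w)) (outP (code w)) (2 ^ length w) ppltl_lang K"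
  if "base_ok (range c) (code w) K N" for w K N
  using word.machine_P[OF word.intro[OF inj] that] .
 have SB: "(2::nat) ^ length w <= 2 ^ (2 * length w + 1)" for w :: "bool list" by (intro power_increasing) auto
 let ?l = "%W. 2 * lg W + 1"
 have 1: "(2::nat) ^ length w <= 2 ^ ?l (code w)" for w unfolding lw by (rule SB)
 have 2: "2 * length w + 1 <= ?l (code w)" for w unfolding lw by simp
 have 3: "length w + Suc (2 * (3 * ?l (code w)) * Suc (3 * ?l (code w))) <= 300 * length w ^ 2 + 300" for w
  by (rule s) (rule lw)
 note M = membership[where Tr = trP and ini = iniP and out = outP and l = ?l and L = ppltl_lang and d = 300 and
  SB = "%w. 2 ^ length w" and s = "%n. n ^ 2", OF inj E2p_trP E2p_iniP E2_outP l mach 1 2 3]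
 have "dspace (%n. n ^ 2) \<subseteq> PSPACE" by (auto simp: PSPACE_def)
 then show "satisfiability (enc_ppltl_plus c) (ppltl_plus_lang :: 'a ppltl_plus => _) \<in> PSPACE"
  "validity (enc_ppltl_plus c) (ppltl_plus_lang :: 'a ppltl_plus => _) \<in> PSPACE"
  "model_checking c (enc_ppltl_plus c) (ppltl_plus_lang :: 'a ppltl_plus => _) \<in> PSPACE"
  unfolding enc_ppltl_plus_def ppltl_plus_lang_def using M by blast+
qed

section \<open>Accepting computations as infinite sequences with local constraints\<close>

section \<open>Computations as tilings\<close>

text \<open>A letter describes one cell of a configuration: whether it starts a row; the phase (0, 1, 2 for
 the blank, input and blank parts of the initial row, 3 for later rows); the control state and all
 scanned symbols, repeated in every cell of the row; and for each tape the symbol in the cell and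
 the direction of the head (0: to the right, 1: here, 2: to the left).\<close>

record letter =
 lr :: bool
 lph :: nat
 lq :: nat
 lss :: "nat list"
 lcs :: "(nat \<times> nat) list"

abbreviation "sy a i \<equiv> fst (lcs a ! i)"
abbreviation "di a i \<equiv> snd (lcs a ! i)"

locale tiles =
 fixes M :: tm
 assumes wf: "wf_tm M"
begin

abbreviation "kt \<equiv> num_tapes M"

definition valid :: "letter => bool" where
 "valid a \<longleftrightarrow> lph a < 4 & lq a < num_control M & length (lss a) = kt & set (lss a) \<subseteq> {..<num_symbols M} &
   length (lcs a) = kt & set (lcs a) \<subseteq> {..<num_symbols M} \<times> {..<3}"

text \<open>Conditions on one letter. At a row start all heads are further right, and
  \<open>hor\<close> puts them to the left of the last cell, so a tiling cannot describe a
  computation that leaves its width.\<close>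

definition single :: "letter => bool" where
 "single a \<longleftrightarrow> (\<forall>i<kt. di a i = 1 --> sy a i = lss a ! i) & (lr a --> (\<forall>i<kt. di a i = 0)) &
   (lph a ~= 3 --> lq a = start M & (\<forall>i<kt. i ~= 0 \<or> lph a ~= 1 --> sy a i = 0)) &
   (lph a = 0 --> (\<forall>i<kt. di a i = 0))"

text \<open>Rows are laid end to end, so the right neighbour of the last cell of a row is the first
  cell of the next. Inside a row the flags of a tape pass from 0 through a single 1 to 2, the phases
  of the initial row never decrease, and all heads start on the first cell after phase 0.\<close>

definition hor :: "letter => letter => bool" where
 "hor a b \<longleftrightarrow> (if lr b then lph b = 3 & (\<forall>i<kt. di a i = 2)
   else lq a = lq b & lss a = lss b &
   (\<forall>i<kt. (di a i, di b i) \<in> {(0, 0), (0, 1), (1, 2), (2, 2)}) &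
   (lph a, lph b) \<in> {(0, 0), (0, 1), (0, 2), (1, 1), (1, 2), (2, 2), (3, 3)} &
   (lph a = 0 & lph b ~= 0 --> (\<forall>i<kt. di b i = 1)))"

definition next_act :: "letter => nat \<times> (nat \<times> move) list" where
 "next_act a = (if lq a = accept M \<or> lq a = reject M then (lq a, idle (lss a)) else trans M (lq a) (lss a))"

text \<open>Every cell of a row carries the state and all scanned symbols, so the action can be read
  off anywhere. A head moving right is passed from \<open>a\<close> to \<open>d\<close>, one moving
  left from \<open>b\<close> to \<open>c\<close>.\<close>

definition ver :: "letter => letter => letter => letter => bool" where
 "ver a b c d \<longleftrightarrow> lq c = fst (next_act a) &
   (\<forall>i<kt. sy c i = (if di a i = 1 then fst (snd (next_act a) ! i) else sy a i) &
   (di a i = 1 & snd (snd (next_act a) ! i) = Stay --> di c i = 1) &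
   (di a i = 1 & snd (snd (next_act a) ! i) = MoveRight --> di d i = 1) &
   (di b i = 1 & snd (snd (next_act a) ! i) = MoveLeft --> di c i = 1))"

definition local_ok :: "letter => letter => letter => letter => bool" where
 "local_ok a b c d \<longleftrightarrow> single a & hor a b & ver a b c d"

definition tiling :: "bool list => nat => (nat => letter) => bool" where
 "tiling w W x \<longleftrightarrow> (ALL p. valid (x p)) & (ALL p. lr (x p) \<longleftrightarrow> W dvd p) &
   (ALL p. local_ok (x p) (x (p + 1)) (x (p + W)) (x (p + W + 1))) &
   (EX p. lph (x p) = 0 & (\<forall>i<length w. lph (x (p + 1 + i)) = 1 & sy (x (p + 1 + i)) 0 = bit_symbol (w ! i)) &
   lph (x (p + 1 + length w)) = 2) &
   (EX p. lq (x p) = accept M)"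

definition good_config :: "config => bool" where
 "good_config cf \<longleftrightarrow> fst cf < num_control M & length (snd cf) = kt &
   (\<forall>i<kt. ALL z. snd (snd cf ! i) z < num_symbols M)"

lemma kt_pos: "0 < kt"
 using wf by (simp add: wf_tm_def)

lemma scanned_less: "good_config (q, ts) ==> set (map scanned ts) \<subseteq> {..<num_symbols M}"
proof -
 assume g: "good_config (q, ts)"
 have "scanned (ts ! i) < num_symbols M" if "i < kt" for i
  using g that by (cases "ts ! i") (force simp: good_config_def scanned_def)
 then have i: "map scanned ts ! i < num_symbols M" if "i < length (map scanned ts)" for i
  using g that by (simp add: good_config_def)
 show ?thesis
 proof
  fix s assume "s \<in> set (map scanned ts)"
  then show "s \<in> {..<num_symbols M}" using i unfolding in_set_conv_nth lessThan_iff by blast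
 qed
qed

lemma trans_wf:
 assumes "good_config (q, ts)" "trans M q (map scanned ts) = (q', as)"
 shows "q' < num_control M" "length as = kt" "\<forall>i<kt. fst (as ! i) < num_symbols M"
proof -
 have "q < num_control M" "length (map scanned ts) = kt" using assms(1) by (auto simp: good_config_def)
 then have *: "case trans M q (map scanned ts) of (q', as) => q' < num_control M & length as = kt &
   (\<forall>(s, m) \<in> set as. s < num_symbols M)"
  using wf[unfolded wf_tm_def, THEN conjunct2, THEN conjunct2, THEN conjunct2, THEN conjunct2, THEN conjunct2,
   THEN conjunct2, THEN spec, THEN spec, THEN mp] scanned_less[OF assms(1)] by simp
 then show "q' < num_control M" and len: "length as = kt" unfolding assms(2) by simp_all
 have "\<forall>(s, m) \<in> set as. s < num_symbols M" using * unfolding assms(2) by simp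
 then have "fst a < num_symbols M" if "a \<in> set as" for a using that by (cases a) auto
 then show "\<forall>i<kt. fst (as ! i) < num_symbols M" using len by simp
qed

text \<open>The action actually performed, idle after halting.\<close>

definition acts :: "config => nat \<times> (nat \<times> move) list" where
 "acts cf = (if halted M cf then (fst cf, idle (map scanned (snd cf))) else trans M (fst cf) (map scanned (snd cf)))"

lemma step_acts: "step M cf = (fst (acts cf), map2 act (snd (acts cf)) (snd cf))"
 by (cases cf) (auto simp: step_def acts_def act_idle split: prod.splits)

lemma acts_wf:
 assumes "good_config cf"
 shows "fst (acts cf) < num_control M" "length (snd (acts cf)) = kt" "i < kt ==> fst (snd (acts cf) ! i) < num_symbols M"
proof -
 obtain q ts where cf: "cf = (q, ts)" by fastforce
 obtain q' as where tr: "trans M q (map scanned ts) = (q', as)" by fastforce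
 have len: "length ts = kt" "q < num_control M" using assms by (auto simp: good_config_def cf)
 have sc: "\<forall>i<kt. scanned (ts ! i) < num_symbols M" using scanned_less[of q ts] assms len by (force simp: cf)
 note t = trans_wf[OF assms[unfolded cf] tr]
 show "fst (acts cf) < num_control M" "length (snd (acts cf)) = kt"
  using t len tr by (auto simp: acts_def cf idle_def)
 show "i < kt ==> fst (snd (acts cf) ! i) < num_symbols M"
  using t len tr sc by (auto simp: acts_def cf idle_def)
qed

lemma good_run: "good_config (run M w t)"
proof (induction t)
 case 0
 have "(input_tape w # replicate (kt - 1) (0, %_. 0)) ! i = (if i = 0 then input_tape w else (0, %_. 0))"
  if "i < kt" for i using that by (cases i) auto
 then show ?case using wf by (auto simp: run_def init_config_def good_config_def wf_tm_def input_tape_def bit_symbol_def)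
next
 case (Suc t)
 have "run M w (Suc t) = step M (run M w t)" by (simp add: run_def)
 moreover have "snd (map2 act (snd (acts (run M w t))) (snd (run M w t)) ! i) z =
   (if z = fst (snd (run M w t) ! i) then fst (snd (acts (run M w t)) ! i) else snd (snd (run M w t) ! i) z)"
  if "i < kt" for i z
  using that acts_wf(2)[OF Suc] Suc by (simp add: good_config_def act_def split_beta)
 ultimately show ?case using acts_wf[OF Suc] Suc by (simp add: step_acts good_config_def)
qed

definition hd_pos :: "bool list => nat => nat => int" where
 "hd_pos w t i = fst (snd (run M w t) ! i)"

definition cell :: "bool list => nat => nat => int => nat" where
 "cell w t i z = snd (snd (run M w t) ! i) z"

definition mv :: "bool list => nat => nat => move" where
 "mv w t i = snd (snd (acts (run M w t)) ! i)"

lemma run_Suc: "run M w (Suc t) = step M (run M w t)"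
 by (simp add: run_def)

lemma len_run: "length (snd (run M w t)) = kt"
 using good_run by (simp add: good_config_def)

lemma hd_pos_Suc: "i < kt ==> hd_pos w (Suc t) i = move_head (mv w t i) (hd_pos w t i)"
 using acts_wf(2)[OF good_run[of w t]] len_run[of w t]
 by (auto simp: hd_pos_def mv_def run_Suc step_acts act_def split: prod.splits)

lemma cell_Suc: "i < kt ==> cell w (Suc t) i z =
  (if z = hd_pos w t i then fst (snd (acts (run M w t)) ! i) else cell w t i z)"
 using acts_wf(2)[OF good_run[of w t]] len_run[of w t]
 by (auto simp: hd_pos_def cell_def run_Suc step_acts act_def split: prod.splits)

lemma hd_pos_0: "i < kt ==> hd_pos w 0 i = 0"
 by (cases i) (auto simp: hd_pos_def run_def init_config_def input_tape_def)

lemma cell_0: "i < kt ==> cell w 0 i z =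
  (if i = 0 & 0 <= z & z < int (length w) then bit_symbol (w ! nat z) else 0)"
 by (cases i) (auto simp: cell_def run_def init_config_def input_tape_def)

lemma scanned_run: "i < kt ==> map scanned (snd (run M w t)) ! i = cell w t i (hd_pos w t i)"
 using len_run[of w t] by (auto simp: scanned_def cell_def hd_pos_def split: prod.splits)

text \<open>A head moves by at most one cell at a time, so it has scanned everything between its
  start and its present position; few scanned cells keep it near the origin.\<close>

lemma head_bound:
 assumes "i < kt" "!!t. card (scanned_cells M w t) <= B"
 shows "\<bar>hd_pos w t i\<bar> < int B"
proof -
 have fin: "finite (scanned_cells M w t)" for t
 proof -
  have "scanned_cells M w t = (%(i, t'). (i, fst (snd (run M w t') ! i))) ` ({..<kt} \<times> {..t})"
   by (auto simp: scanned_cells_def)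
  then show ?thesis by simp
 qed
 have mid: "ALL z. (0 <= z & z <= hd_pos w t i \<or> hd_pos w t i <= z & z <= 0) --> (i, z) \<in> scanned_cells M w t"
 proof (induction t)
  case 0
  then show ?case using assms(1) hd_pos_0[OF assms(1), of w] by (auto simp: scanned_cells_def hd_pos_def)
 next
  case (Suc t)
  have sub: "scanned_cells M w t \<subseteq> scanned_cells M w (Suc t)" by (fastforce simp: scanned_cells_def)
  have now: "(i, hd_pos w (Suc t) i) \<in> scanned_cells M w (Suc t)"
   using assms(1) by (auto simp: scanned_cells_def hd_pos_def)
  have "hd_pos w (Suc t) i \<in> {hd_pos w t i - 1, hd_pos w t i, hd_pos w t i + 1}"
   using hd_pos_Suc[OF assms(1), of w t] by (cases "mv w t i") auto
  then have "z = hd_pos w (Suc t) i \<or> (0 <= z & z <= hd_pos w t i \<or> hd_pos w t i <= z & z <= 0)"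
   if "0 <= z & z <= hd_pos w (Suc t) i \<or> hd_pos w (Suc t) i <= z & z <= 0" for z using that by auto
  then show ?case using Suc sub now by blast
 qed
 have "Pair i ` (if 0 <= hd_pos w t i then {0..hd_pos w t i} else {hd_pos w t i..0}) \<subseteq> scanned_cells M w t"
  using mid by auto
 then have "card (Pair i ` (if 0 <= hd_pos w t i then {0..hd_pos w t i} else {hd_pos w t i..0})) <= B"
  using assms(2)[of t] card_mono[OF fin] le_trans by blast
 moreover have "card (Pair i ` A) = card A" for A :: "int set" by (intro card_image) (auto simp: inj_on_def)
 ultimately show ?thesis by (auto split: if_splits)
qed

definition dir :: "int => int => nat" where
 "dir z h = (if z < h then 0 else if z = h then 1 else 2)"

definition tile :: "bool list => nat => nat => nat => letter" where
 "tile w ofs t j = \<lparr>lr = (j = 0), lph = (if 0 < t then 3 else if j < ofs then 0 else if j < ofs + length w then 1 else 2),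
   lq = fst (run M w t), lss = map scanned (snd (run M w t)),
   lcs = map (%i. (cell w t i (int j - int ofs), dir (int j - int ofs) (hd_pos w t i))) [0..<kt]\<rparr>"

lemma next_act_tile: "next_act (tile w ofs t j) = acts (run M w t)"
 by (simp add: next_act_def acts_def tile_def halted_def)

lemma tile_simps [simp]:
 "lr (tile w ofs t j) = (j = 0)" "lq (tile w ofs t j) = fst (run M w t)"
 "lph (tile w ofs t j) = (if 0 < t then 3 else if j < ofs then 0 else if j < ofs + length w then 1 else 2)"
 "lss (tile w ofs t j) = map scanned (snd (run M w t))"
 "i < kt ==> sy (tile w ofs t j) i = cell w t i (int j - int ofs)"
 "i < kt ==> di (tile w ofs t j) i = dir (int j - int ofs) (hd_pos w t i)"
 by (simp_all add: tile_def)

lemma div_mod_Suc: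
 assumes "0 < (W::nat)"
 shows "(p + 1) mod W = 0 & (p + 1) div W = Suc (p div W) & p mod W = W - 1 \<or>
  (p + 1) mod W = Suc (p mod W) & (p + 1) div W = p div W & Suc (p mod W) < W"
 using assms mod_less_divisor[OF assms, of p] by (auto simp: mod_Suc div_Suc)

text \<open>The space-time diagram of the run, tape cell 0 being put into column
  \<open>B + 1\<close> so that no head comes to a border. A halted configuration is repeated
  forever.\<close>

theorem tiling_exists:
 assumes B: "!!t. card (scanned_cells M w t) <= B" and W: "2 * B + length w + 10 <= W" and acc: "fst (run M w t0) = accept M"
 shows "EX x. tiling w W x"
proof -
 define ofs where "ofs = B + 1"
 define x where "x p = tile w ofs (p div W) (p mod W)" for p
 have W0: "0 < W" "ofs + length w + B < W" "0 < ofs" using W by (auto simp: ofs_def)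
 have hb: "\<bar>hd_pos w t i\<bar> < int B" if "i < kt" for t i using head_bound[OF that B] .
 have val: "valid (x p)" for p
 proof -
  have *: "good_config (run M w (p div W))" by (rule good_run)
  have "set (map scanned (snd (run M w (p div W)))) \<subseteq> {..<num_symbols M}"
   using scanned_less[of "fst (run M w (p div W))" "snd (run M w (p div W))"] * by simp
  then show ?thesis
   using * by (auto simp: valid_def x_def tile_def good_config_def cell_def dir_def)
 qed
 have sing: "single (x p)" for p
 proof -
  have "int (p mod W) - int ofs < hd_pos w (p div W) i" if "p mod W = 0" "i < kt" for i
   using hb[OF that(2), of "p div W"] that(1) by (simp add: ofs_def)
  moreover have "dir z h = 1 \<longleftrightarrow> z = h" "dir z h = 0 \<longleftrightarrow> z < h" for z h by (auto simp: dir_def)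
  ultimately show ?thesis unfolding single_def x_def
   using scanned_run[of _ w "p div W"] hd_pos_0 by (auto simp: cell_0 run_def init_config_def)
 qed
 have hor: "hor (x p) (x (p + 1))" for p
  using div_mod_Suc[OF W0(1), of p]
 proof
  assume a: "(p + 1) mod W = 0 & (p + 1) div W = Suc (p div W) & p mod W = W - 1"
  have "dir (int (p mod W) - int ofs) (hd_pos w (p div W) i) = 2" if "i < kt" for i
   using hb[OF that, of "p div W"] a W0 by (auto simp: dir_def ofs_def)
  then show ?thesis using a by (simp add: hor_def x_def)
 next
  assume a: "(p + 1) mod W = Suc (p mod W) & (p + 1) div W = p div W & Suc (p mod W) < W"
  have ds: "(dir z h, dir z' h) \<in> {(0, 0), (0, 1), (1, 2), (2, 2)}" if "z' = z + 1" for z z' h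
   unfolding that by (auto simp: dir_def)
  have "(dir (int (p mod W) - int ofs) h, dir (int (Suc (p mod W)) - int ofs) h) \<in> {(0, 0), (0, 1), (1, 2), (2, 2)}" for h
   by (rule ds) simp
  then show ?thesis using a hd_pos_0 W0(3)
   unfolding hor_def x_def by (auto simp: dir_def)
 qed
 have ver: "ver (x p) (x (p + 1)) (x (p + W)) (x (p + W + 1))" for p
 proof -
  let ?t = "p div W" and ?j = "p mod W"
  have c: "x (p + W) = tile w ofs (Suc ?t) ?j" using W0(1) div_add_self2[of W p] by (simp add: x_def)
  have act: "next_act (x p) = acts (run M w ?t)" by (simp add: x_def next_act_tile)
  have d1: "dir z h = Suc 0 \<longleftrightarrow> z = h" for z h by (auto simp: dir_def)
  have main: "(di (x p) i = 1 \<longleftrightarrow> int ?j - int ofs = hd_pos w ?t i) & (di (x (p + W)) i = 1 \<longleftrightarrow> int ?j - int ofs = hd_pos w (Suc ?t) i) &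
   (di (x (p + 1)) i = 1 --> hd_pos w ?t i = int ?j + 1 - int ofs) &
   (hd_pos w (Suc ?t) i = int ?j + 1 - int ofs --> di (x (p + W + 1)) i = 1)" if i: "i < kt" for i
   using div_mod_Suc[OF W0(1), of p]
  proof
   assume a: "(p + 1) mod W = Suc (p mod W) & (p + 1) div W = p div W & Suc (p mod W) < W"
   have e: "p + W + 1 = (p + 1) + W" by simp
   have "(p + W + 1) div W = Suc ?t" "(p + W + 1) mod W = Suc ?j"
   unfolding e using a div_add_self2[of W "p + 1"] mod_add_self2[of "p + 1" W] W0(1) by linarith+
   then show ?thesis using a i c by (auto simp: x_def d1)
  next
   assume a: "(p + 1) mod W = 0 & (p + 1) div W = Suc (p div W) & p mod W = W - 1"
   have "hd_pos w (Suc ?t) i ~= int ?j + 1 - int ofs" using hb[OF i, of "Suc ?t"] a W0 by (auto simp: ofs_def)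
   moreover have "di (x (p + 1)) i ~= 1" using a i hb[OF i, of "Suc ?t"] by (auto simp: x_def d1 ofs_def)
   ultimately show ?thesis using a i c by (auto simp: x_def d1)
  qed
  show ?thesis unfolding ver_def act
  proof (intro conjI allI impI)
   show "lq (x (p + W)) = fst (acts (run M w ?t))" by (simp add: c run_Suc step_acts)
   fix i assume i: "i < kt"
   have m: "mv w ?t i = snd (snd (acts (run M w ?t)) ! i)" by (simp add: mv_def)
   note h = hd_pos_Suc[OF i, of w ?t]
   show "sy (x (p + W)) i = (if di (x p) i = 1 then fst (snd (acts (run M w ?t)) ! i) else sy (x p) i)"
   using main[OF i] i by (simp add: c cell_Suc) (simp add: x_def)
   show "di (x (p + W)) i = 1" if "di (x p) i = 1 & snd (snd (acts (run M w ?t)) ! i) = Stay"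
   using main[OF i] that h by (simp add: m)
   show "di (x (p + W + 1)) i = 1" if "di (x p) i = 1 & snd (snd (acts (run M w ?t)) ! i) = MoveRight"
   using main[OF i] that h by (simp add: m)
   show "di (x (p + W)) i = 1" if "di (x (p + 1)) i = 1 & snd (snd (acts (run M w ?t)) ! i) = MoveLeft"
   using main[OF i] that h by (simp add: m)
  qed
 qed
 have ini: "lph (x B) = 0 & (\<forall>i<length w. lph (x (B + 1 + i)) = 1 & sy (x (B + 1 + i)) 0 = bit_symbol (w ! i)) &
   lph (x (B + 1 + length w)) = 2"
  using W kt_pos by (auto simp: x_def ofs_def cell_0)
 have "lq (x (t0 * W)) = accept M" using acc W0(1) by (simp add: x_def)
 moreover have "lr (x p) \<longleftrightarrow> W dvd p" for p by (auto simp: x_def)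
 ultimately have "tiling w W x" unfolding tiling_def local_ok_def using val sing hor ver ini by blast
 then show ?thesis by blast
qed

text \<open>Induction on the rows: a flag 1 fixes all flags of its row, \<open>ver\<close> says
  where it stands in the next row, and the copies of state and scanned symbols agree along a row, so
  row \<open>t\<close> is the configuration at time \<open>t\<close>.\<close>

theorem tiling_accepts:
 assumes T: "tiling w W x" and W: "0 < W"
 shows "EX t. fst (run M w t) = accept M"
proof -
 have val: "valid (x p)" and r: "lr (x p) \<longleftrightarrow> W dvd p" and sing: "single (x p)" and hor: "hor (x p) (x (p + 1))"
  and ver: "ver (x p) (x (p + 1)) (x (p + W)) (x (p + W + 1))" for p
  using T by (auto simp: tiling_def local_ok_def)
 obtain p0 where p0: "lph (x p0) = 0" "\<forall>i<length w. lph (x (p0 + 1 + i)) = 1 & sy (x (p0 + 1 + i)) 0 = bit_symbol (w ! i)"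
  "lph (x (p0 + 1 + length w)) = 2" using T by (auto simp: tiling_def)
 let ?n = "length w" and ?O = "p0 + 1"
 \<comment> \<open>A row start after position 0 has phase 3, so the stretch of phases 0 to 2 around
   \<open>p0\<close> lies in the first row.\<close>
 have norow: "~ W dvd p" if "lph (x p) ~= 3" "0 < p" for p
  using hor[of "p - 1"] r[of p] that by (auto simp: hor_def)
 have before: "lph (x p) = 0" if "p <= p0" for p
  using that
 proof (induction rule: inc_induct)
  case (step p)
  then have "~ lr (x (Suc p))" using norow[of "Suc p"] r by auto
  then show ?case using hor[of p] step by (auto simp: hor_def)
 qed (rule p0)
 have mid: "lph (x p) = 1" if "?O <= p" "p < ?O + ?n" for p
  using p0(2)[rule_format, of "p - ?O"] that by auto
 have upto: "lph (x p) ~= 3" if "p <= ?O + ?n" for p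
  using before[of p] mid[of p] p0(3) that by (cases "p <= p0"; cases "p = ?O + ?n") auto
 have OW: "?O + ?n < W"
 proof (rule ccontr)
  assume "~ ?O + ?n < W"
  then show False using norow[of W] upto[of W] W by auto
 qed
 have after: "lph (x p) = 2" if "?O + ?n <= p" "p < W" for p
  using that
 proof (induction rule: dec_induct)
  case (step p)
  then have "~ lr (x (Suc p))" using r[of "Suc p"] by (auto dest: dvd_imp_le)
  then show ?case using hor[of p] step by (auto simp: hor_def)
 qed (use p0(3) in simp)
 text \<open>Within a row, the direction flags are determined by the position of a head.\<close>
 have row_right: "di (x (t * W + j)) i = 2" if "di (x (t * W + j0)) i = 1" "j0 < j" "j < W" "i < kt" for t j j0 i
  using that(2,3)
 proof (induction j)
  case (Suc j)
  have "~ W dvd (t * W + Suc j)" using Suc.prems W by (metis dvd_add_right_iff dvd_imp_le dvd_triv_right not_le zero_less_Suc)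
  then have h: "(di (x (t * W + j)) i, di (x (t * W + Suc j)) i) \<in> {(0, 0), (0, 1), (1, 2), (2, 2)}"
   using hor[of "t * W + j"] r that(4) by (auto simp: hor_def)
  show ?case using Suc h that(1) by (cases "j = j0") auto
 qed simp
 have row_left: "di (x (t * W + j)) i = 0" if "di (x (t * W + j0)) i = 1" "j < j0" "j0 < W" "i < kt" for t j j0 i
  using less_imp_le[OF that(2)] that(2)
 proof (induction rule: inc_induct)
  case (step j)
  have "~ W dvd (t * W + Suc j)" using step.hyps that(3) W by (metis Suc_leI dvd_add_right_iff dvd_imp_le dvd_triv_right le_less_trans not_le zero_less_Suc)
  then have h: "(di (x (t * W + j)) i, di (x (t * W + Suc j)) i) \<in> {(0, 0), (0, 1), (1, 2), (2, 2)}"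
   using hor[of "t * W + j"] r that(4) by (auto simp: hor_def)
  show ?case using step h that(1) by (cases "Suc j = j0") auto
 qed simp
 have row_const: "lq (x (t * W + j)) = lq (x (t * W)) & lss (x (t * W + j)) = lss (x (t * W))" if "j < W" for t j
  using that
 proof (induction j)
  case (Suc j)
  have "~ W dvd (t * W + Suc j)" using Suc.prems W by (metis dvd_add_right_iff dvd_imp_le dvd_triv_right not_le zero_less_Suc)
  then show ?case using hor[of "t * W + j"] r Suc by (auto simp: hor_def)
 qed simp
 have d1: "dir z h = 1 \<longleftrightarrow> z = h" for z h by (auto simp: dir_def)
 define row where "row t \<longleftrightarrow> (\<forall>j<W. lq (x (t * W + j)) = fst (run M w t) &
   (\<forall>i<kt. sy (x (t * W + j)) i = cell w t i (int j - int ?O) &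
   di (x (t * W + j)) i = dir (int j - int ?O) (hd_pos w t i)))" for t
 have dirs: "di (x (t * W + j)) i = dir (int j - int ?O) h"
  if "di (x (t * W + j0)) i = 1" "int j0 - int ?O = h" "j0 < W" "j < W" "i < kt" for t j j0 i h
 proof (cases j j0 rule: linorder_cases)
  case less
  then have "int j - int ?O < h" using that(2) by linarith
  then show ?thesis using row_left[OF that(1) less that(3,5)] by (simp add: dir_def)
 next
  case equal
  then show ?thesis using that by (simp add: dir_def)
 next
  case greater
  then have "h < int j - int ?O" using that(2) by linarith
  then show ?thesis using row_right[OF that(1) greater that(4,5)] by (simp add: dir_def)
 qed
 have "row t" for t
 proof (induction t)
  case 0
  have start: "di (x ?O) i = 1" if "i < kt" for i
  proof -
   have "lph (x ?O) ~= 0" using mid[of ?O] p0(3) by (cases "?n = 0") auto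
   moreover have "~ lr (x ?O)" using OW r[of ?O] by (auto dest: dvd_imp_le)
   ultimately show ?thesis using hor[of p0] p0(1) that by (auto simp: hor_def)
  qed
  show ?case unfolding row_def
  proof (intro allI impI conjI)
   fix j assume j: "j < W"
   have ph: "lph (x j) = (if j < ?O then 0 else if j < ?O + ?n then 1 else 2)"
   using before[of j] mid[of j] after[of j] j by auto
   then have "lph (x j) ~= 3" by auto
   then have s: "lq (x j) = start M" "!!i. i < kt ==> i ~= 0 \<or> lph (x j) ~= 1 ==> sy (x j) i = 0"
   using sing[of j] by (auto simp: single_def)
   show "lq (x (0 * W + j)) = fst (run M w 0)" using s(1) by (simp add: run_def init_config_def)
   fix i assume i: "i < kt"
   show "di (x (0 * W + j)) i = dir (int j - int ?O) (hd_pos w 0 i)"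
   using dirs[of 0 ?O i "hd_pos w 0 i" j] start[OF i] OW j i hd_pos_0[OF i] by simp
   show "sy (x (0 * W + j)) i = cell w 0 i (int j - int ?O)"
   proof (cases "i = 0 & ?O <= j & j < ?O + ?n")
   case True
   then have "sy (x j) 0 = bit_symbol (w ! (j - ?O))" using p0(2)[rule_format, of "j - ?O"] by auto
   moreover have "nat (int j - int ?O) = j - ?O" using True by auto
   ultimately show ?thesis using True i by (simp add: cell_0)
   next
   case False
   then have "sy (x j) i = 0" using s(2)[OF i] ph by (auto split: if_splits)
   then show ?thesis using False i by (auto simp: cell_0)
   qed
  qed
 next
  case (Suc t)
  have R: "lq (x (t * W + j)) = fst (run M w t)" "i < kt ==> sy (x (t * W + j)) i = cell w t i (int j - int ?O)"
   "i < kt ==> di (x (t * W + j)) i = dir (int j - int ?O) (hd_pos w t i)" if "j < W" for i j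
   using Suc that by (auto simp: row_def)
  \<comment> \<open>The border cells carry the flags 0 and 2, so the head is strictly inside the row
    and its next position is still in it.\<close>
  have range: "0 < hd_pos w t i + int ?O & hd_pos w t i + int ?O < int W - 1" if i: "i < kt" for i
  proof -
   have "di (x (t * W)) i = 0" using sing[of "t * W"] r i by (auto simp: single_def)
   then have "0 - int ?O < hd_pos w t i" using R(3)[of 0 i] W i by (auto simp: dir_def split: if_splits)
   moreover have "lr (x (t * W + (W - 1) + 1))" using r W by (simp add: add.assoc)
   then have "di (x (t * W + (W - 1))) i = 2" using hor[of "t * W + (W - 1)"] i by (auto simp: hor_def)
   then have "hd_pos w t i < int (W - 1) - int ?O" using R(3)[of "W - 1" i] W i by (auto simp: dir_def split: if_splits)
   ultimately show ?thesis using W by auto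
  qed
  have ss: "lss (x (t * W + j)) = map scanned (snd (run M w t))" if j: "j < W" for j
  proof (rule nth_equalityI)
   show "length (lss (x (t * W + j))) = length (map scanned (snd (run M w t)))"
   using val by (simp add: valid_def len_run)
   fix i assume "i < length (lss (x (t * W + j)))"
   then have i: "i < kt" using val by (simp add: valid_def)
   define j0 where "j0 = nat (hd_pos w t i + int ?O)"
   have j0: "j0 < W" "int j0 - int ?O = hd_pos w t i" using range[OF i] by (auto simp: j0_def)
   have "di (x (t * W + j0)) i = 1" "sy (x (t * W + j0)) i = cell w t i (hd_pos w t i)"
   using R(2,3)[OF j0(1) i] j0(2) by (auto simp: dir_def)
   then have "lss (x (t * W + j0)) ! i = cell w t i (hd_pos w t i)" using sing[of "t * W + j0"] i by (auto simp: single_def)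
   then show "lss (x (t * W + j)) ! i = map scanned (snd (run M w t)) ! i"
   using row_const[OF j, of t] row_const[OF j0(1), of t] scanned_run[OF i] by simp
  qed
  have na: "next_act (x (t * W + j)) = acts (run M w t)" if "j < W" for j
   using R(1)[OF that] ss[OF that] by (simp add: next_act_def acts_def halted_def)
  have V: "lq (x (Suc t * W + j)) = fst (acts (run M w t))"
   "i < kt ==> sy (x (Suc t * W + j)) i = (if int j - int ?O = hd_pos w t i then fst (snd (acts (run M w t)) ! i) else cell w t i (int j - int ?O))"
   "i < kt ==> int j - int ?O = hd_pos w t i ==> mv w t i = Stay ==> di (x (Suc t * W + j)) i = 1"
   "i < kt ==> int j - int ?O = hd_pos w t i ==> mv w t i = MoveRight ==> di (x (Suc t * W + Suc j)) i = 1"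
   "i < kt ==> Suc j < W ==> int (Suc j) - int ?O = hd_pos w t i ==> mv w t i = MoveLeft ==> di (x (Suc t * W + j)) i = 1"
   if j: "j < W" for i j
  proof -
   have e: "t * W + j + W = Suc t * W + j" "t * W + j + W + 1 = Suc t * W + Suc j" "t * W + j + 1 = t * W + Suc j" by auto
   note v = ver[of "t * W + j", unfolded e ver_def na[OF j]]
   show "lq (x (Suc t * W + j)) = fst (acts (run M w t))" using v by blast
   assume i: "i < kt"
   note vi = v[THEN conjunct2, THEN spec, THEN mp, OF i]
   have di: "(di (x (t * W + j)) i = 1) = (int j - int ?O = hd_pos w t i)" unfolding R(3)[OF j i] d1 ..
   show "sy (x (Suc t * W + j)) i = (if int j - int ?O = hd_pos w t i then fst (snd (acts (run M w t)) ! i) else cell w t i (int j - int ?O))"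
   using vi[THEN conjunct1] unfolding di R(2)[OF j i] .
   show "int j - int ?O = hd_pos w t i ==> mv w t i = Stay ==> di (x (Suc t * W + j)) i = 1"
   using vi[THEN conjunct2, THEN conjunct1] di by (simp add: mv_def)
   show "int j - int ?O = hd_pos w t i ==> mv w t i = MoveRight ==> di (x (Suc t * W + Suc j)) i = 1"
   using vi[THEN conjunct2, THEN conjunct2, THEN conjunct1] di by (simp add: mv_def)
   assume j': "Suc j < W"
   have di': "(di (x (t * W + Suc j)) i = 1) = (int (Suc j) - int ?O = hd_pos w t i)" unfolding R(3)[OF j' i] d1 ..
   show "int (Suc j) - int ?O = hd_pos w t i ==> mv w t i = MoveLeft ==> di (x (Suc t * W + j)) i = 1"
   using vi[THEN conjunct2, THEN conjunct2, THEN conjunct2] di' by (simp add: mv_def)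
  qed
  show ?case unfolding row_def
  proof (intro allI impI conjI)
   fix j assume j: "j < W"
   show "lq (x (Suc t * W + j)) = fst (run M w (Suc t))" using V(1)[OF j] by (simp add: run_Suc step_acts)
   fix i assume i: "i < kt"
   show "sy (x (Suc t * W + j)) i = cell w (Suc t) i (int j - int ?O)" using V(2)[OF j i] i by (simp add: cell_Suc)
   define j0 where "j0 = nat (hd_pos w t i + int ?O)"
   have j0: "0 < j0" "Suc j0 < W" "int j0 - int ?O = hd_pos w t i" using range[OF i] by (auto simp: j0_def)
   have "\<exists>j1<W. di (x (Suc t * W + j1)) i = 1 & int j1 - int ?O = hd_pos w (Suc t) i"
   proof (cases "mv w t i")
   case MoveLeft
   then have "di (x (Suc t * W + (j0 - 1))) i = 1" using V(5)[of "j0 - 1" i] j0 i by auto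
   then show ?thesis using j0 hd_pos_Suc[OF i, of w t] MoveLeft by (intro exI[of _ "j0 - 1"]) auto
   next
   case Stay
   then show ?thesis using V(3)[of j0 i] j0 i hd_pos_Suc[OF i, of w t] by (intro exI[of _ j0]) auto
   next
   case MoveRight
   then show ?thesis using V(4)[of j0 i] j0 i hd_pos_Suc[OF i, of w t] by (intro exI[of _ "Suc j0"]) auto
   qed
   then show "di (x (Suc t * W + j)) i = dir (int j - int ?O) (hd_pos w (Suc t) i)"
   using dirs[OF _ _ _ j i] by blast
  qed
 qed
 moreover obtain p where "lq (x p) = accept M" using T by (auto simp: tiling_def)
 ultimately have R: "row (p div W)" "lq (x p) = accept M" by blast+
 have "lq (x (p div W * W + p mod W)) = fst (run M w (p div W))"
  using R(1) mod_less_divisor[OF W, of p] unfolding row_def by blast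
 then have "fst (run M w (p div W)) = accept M" using R(2) by simp
 then show ?thesis by blast
qed

end

section \<open>Printing strings in polynomial time\<close>

section \<open>Generating strings in polynomial time\<close>

text \<open>Output programs all of whose loops are bounded by unary counters or the input. A
  reduction printed by such a program is computable in polynomial time, so no reduction needs a
  machine of its own.\<close>

datatype gen = Lit "bool list" | Cat gen gen | For gen | Top gen | Inp bool "bool => bool list"

text \<open>\<open>Top\<close> repeats \<open>N\<close> times; \<open>For\<close> lets the current counter run from its value \<open>m\<close> down to 1.\<close>

fun out :: "gen => nat => nat => bool list => bool list" where
 "out (Lit us) N m w = us"
| "out (Cat g h) N m w = out g N m w @ out h N m w"
| "out (For g) N m w = concat (map (%i. out g N i w) (rev [1..<Suc m]))"
| "out (Top g) N m w = concat (replicate N (out g N m w))"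
| "out (Inp d f) N m w = concat (map f (if d then rev w else w))"

fun depth :: "gen => nat" where
 "depth (Lit us) = 0"
| "depth (Cat g h) = max (depth g) (depth h)"
| "depth (For g) = 2 + depth g"
| "depth (Top g) = 2 + depth g"
| "depth (Inp d f) = 2"

fun tg :: "gen => nat => nat" where
 "tg (Lit us) S = 4 * length us + 1"
| "tg (Cat g h) S = Suc (tg g S + tg h S)"
| "tg (For g) S = S * (tg g S + 40) + 40"
| "tg (Top g) S = S * (tg g S + 40) + 40"
| "tg (Inp d f) S = S * (4 * length (f True) + 4 * length (f False) + 40) + 40"

lemma tg_poly: "EX a e. ALL S. tg g S <= a * (S + 1) ^ e"
proof (induction g)
 case (Lit us)
 then show ?case by (intro exI[of _ "4 * length us + 1"] exI[of _ 0]) simp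
next
 case (Cat g h)
 then obtain a e a' e' where *: "ALL S. tg g S <= a * (S + 1) ^ e" "ALL S. tg h S <= a' * (S + 1) ^ e'" by blast
 have "tg (Cat g h) S <= (a + a' + 1) * (S + 1) ^ (e + e')" for S
 proof -
  have "a * (S + 1) ^ e <= a * (S + 1) ^ (e + e')" by (intro mult_le_mono2 power_increasing) auto
  moreover have "a' * (S + 1) ^ e' <= a' * (S + 1) ^ (e + e')" by (intro mult_le_mono2 power_increasing) auto
  moreover have "1 <= (S + 1) ^ (e + e')" by simp
  ultimately have "tg (Cat g h) S <= a * (S + 1) ^ (e + e') + a' * (S + 1) ^ (e + e') + (S + 1) ^ (e + e')"
   unfolding tg.simps using *[THEN spec, of S] by linarith
  also have "\<dots> = (a + a' + 1) * (S + 1) ^ (e + e')" by (simp only: add_mult_distrib mult_1)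
  finally show ?thesis .
 qed
 then show ?case by blast
next
 case (For g)
 then obtain a e where *: "ALL S. tg g S <= a * (S + 1) ^ e" by blast
 have "tg (For g) S <= (a + 40) * (S + 1) ^ (e + 1)" for S
 proof -
  have "40 * 1 <= 40 * (S + 1) ^ e" by (intro mult_le_mono2) simp
  then have "tg g S + 40 <= (a + 40) * (S + 1) ^ e" using *[THEN spec, of S] unfolding add_mult_distrib by linarith
  then have "S * (tg g S + 40) + 40 <= S * ((a + 40) * (S + 1) ^ e) + (a + 40) * (S + 1) ^ e"
   by (intro add_mono mult_le_mono2) auto
  then show ?thesis by (simp add: algebra_simps)
 qed
 then show ?case by blast
next
 case (Top g)
 then obtain a e where *: "ALL S. tg g S <= a * (S + 1) ^ e" by blast
 have "tg (Top g) S <= (a + 40) * (S + 1) ^ (e + 1)" for S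
 proof -
  have "40 * 1 <= 40 * (S + 1) ^ e" by (intro mult_le_mono2) simp
  then have "tg g S + 40 <= (a + 40) * (S + 1) ^ e" using *[THEN spec, of S] unfolding add_mult_distrib by linarith
  then have "S * (tg g S + 40) + 40 <= S * ((a + 40) * (S + 1) ^ e) + (a + 40) * (S + 1) ^ e"
   by (intro add_mono mult_le_mono2) auto
  then show ?thesis by (simp add: algebra_simps)
 qed
 then show ?case by blast
next
 case (Inp d f)
 then show ?case
  by (intro exI[of _ "4 * length (f True) + 4 * length (f False) + 40"] exI[of _ 1] allI) (simp add: algebra_simps)
qed

abbreviation "syms us \<equiv> map bit_symbol us"

lemma syms_range: "set (syms us) \<subseteq> {1, 2}" "set (rev (syms us)) \<subseteq> {1, 2}" "set (replicate m 1) \<subseteq> {1, 2::nat}"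
 by (auto simp: bit_symbol_def)

locale gen_machine =
 fixes k :: nat and bot :: "nat => int"
begin

sublocale stack_machine k bot "%_. True" .

lemma ex_eq: "ex p sg T sg' ==> sg' = sg'' ==> T <= T' ==> ex p sg T' sg''"
 using ex_weaken by blast

definition put :: "nat => nat => prog" where
 "put r s = (if r = k then emit s else push r s)"

lemma ex_put: "r <= k ==> 0 < s ==> ex (put r s) sg 3 (sg(r := s # sg r))"
 using ex_emit[where s = s and sg = sg] ex_push[of r s sg] by (auto simp: put_def intro: ex_weaken)

fun puts :: "nat => bool list => prog" where
 "puts r [] = skip"
| "puts r (b # us) = put r (bit_symbol b) ;; puts r us"

lemma ex_puts: "r <= k ==> ex (puts r us) sg (4 * length us + 1) (sg(r := rev (syms us) @ sg r))"
proof (induction us arbitrary: sg)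
 case Nil
 then show ?case using ex_skip[of sg] by simp
next
 case (Cons b us)
 have 1: "ex (put r (bit_symbol b)) sg 3 (sg(r := bit_symbol b # sg r))"
  using Cons by (intro ex_put) (auto simp: bit_symbol_def)
 show ?case unfolding puts.simps by (rule ex_eq[OF ex_seq[OF 1 Cons.IH[OF Cons.prems]]]) (auto simp: fun_eq_iff)
qed

definition copy :: "nat => nat => nat => prog" where
 "copy r a t = unload r t ;; Loop t {1, 2} (Cond t {2} (pop t ;; push r 2 ;; push a 2) (pop t ;; push r 1 ;; push a 1))"

lemma ex_split:
 assumes "t < k" "r < k" "a < k" "t ~= r" "t ~= a" "r ~= a" "set (sg t) \<subseteq> {1, 2}"
 shows "ex (Loop t {1, 2} (Cond t {2} (pop t ;; push r 2 ;; push a 2) (pop t ;; push r 1 ;; push a 1))) sg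
  (12 * length (sg t) + 1) (sg(t := [], r := rev (sg t) @ sg r, a := rev (sg t) @ sg a))"
 using assms(7)
proof (induction "sg t" arbitrary: sg)
 case Nil
 show ?case using assms(1)
  by (intro ex_eq[OF ex_loopF[of sg t "{1, 2}"]]) (auto simp: fun_eq_iff simp flip: Nil.hyps)
next
 case (Cons x l)
 have st: "sg t = x # l" using Cons.hyps(2) by simp
 have x: "x = 1 \<or> x = 2" using Cons.prems st by auto
 let ?sg1 = "sg(t := l)" and ?sg2 = "sg(t := l, r := x # sg r)" and ?sg3 = "sg(t := l, r := x # sg r, a := x # sg a)"
 have 1: "ex (pop t) sg 1 ?sg1" using st assms(1) by (intro ex_pop) auto
 have 2: "ex (push r x) ?sg1 3 ?sg2" using ex_push[of r x ?sg1] assms x by auto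
 have 3: "ex (push a x) ?sg2 3 ?sg3" using ex_push[of a x ?sg2] assms x by auto
 have 4: "ex (Cond t {2} (pop t ;; push r 2 ;; push a 2) (pop t ;; push r 1 ;; push a 1)) sg 10 ?sg3"
  using ex_condT[of sg t "{2}", OF _ assms(1) ex_seq[OF 1 ex_seq[OF 2 3]]]
   ex_condF[of sg t "{2}", OF _ assms(1) ex_seq[OF 1 ex_seq[OF 2 3]]] x st by auto
 have 5: "ex (Loop t {1, 2} (Cond t {2} (pop t ;; push r 2 ;; push a 2) (pop t ;; push r 1 ;; push a 1))) ?sg3
   (12 * length l + 1) (?sg3(t := [], r := rev (?sg3 t) @ ?sg3 r, a := rev (?sg3 t) @ ?sg3 a))"
  using Cons.hyps(1)[of ?sg3] Cons.prems assms st by auto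
 have "?sg3(t := [], r := rev (?sg3 t) @ ?sg3 r, a := rev (?sg3 t) @ ?sg3 a) =
   sg(t := [], r := rev (sg t) @ sg r, a := rev (sg t) @ sg a)"
  using assms st by (auto simp: fun_eq_iff)
 then show ?case using ex_loopT'[of sg t "{1,2}", OF _ assms(1) 4 5, of "12 * length (sg t) + 1"] x st by simp
qed

lemma ex_copy:
 assumes "t < k" "r < k" "a < k" "t ~= r" "t ~= a" "r ~= a" "set (sg r) \<subseteq> {1, 2}" "sg t = []" "sg a = []"
 shows "ex (copy r a t) sg (20 * length (sg r) + 3) (sg(a := sg r))"
proof -
 let ?sg1 = "sg(r := [], t := rev (sg r))"
 have 1: "ex (unload r t) sg (8 * length (sg r) + 1) ?sg1"
  using ex_unload[of r t sg] assms by auto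
 have 2: "ex (Loop t {1, 2} (Cond t {2} (pop t ;; push r 2 ;; push a 2) (pop t ;; push r 1 ;; push a 1))) ?sg1
   (12 * length (?sg1 t) + 1) (?sg1(t := [], r := rev (?sg1 t) @ ?sg1 r, a := rev (?sg1 t) @ ?sg1 a))"
  using assms by (intro ex_split) auto
 have "?sg1(t := [], r := rev (?sg1 t) @ ?sg1 r, a := rev (?sg1 t) @ ?sg1 a) = sg(a := sg r)"
  using assms by (auto simp: fun_eq_iff)
 then show ?thesis unfolding copy_def using ex_seq'[OF 1 2, of "20 * length (sg r) + 3"] assms(4) by simp
qed

lemma ex_count:
 assumes f: "f < k" and F: "!!j. F j f = replicate j (1::nat)"
  and B: "!!j. j < m ==> ex B (F (Suc j)) T (G j)" and G: "!!j. j < m ==> G j f = replicate (Suc j) 1"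
   "!!j. j < m ==> (G j)(f := replicate j 1) = F j"
 shows "ex (Loop f (-{0}) (B ;; pop f)) (F m) (m * (T + 4) + 1) (F 0)"
 using B G
proof (induction m)
 case 0
 then show ?case using ex_loopF[of "F 0" f "-{0}"] F[of 0] f by simp
next
 case (Suc m)
 have 1: "ex B (F (Suc m)) T (G m)" using Suc.prems by simp
 have e: "(G m)(f := replicate m 1) = F m" by (rule Suc.prems(3)) simp
 have "ex (pop f) (G m) 1 ((G m)(f := replicate m 1))"
  by (rule ex_pop[OF f, where x = 1]) (simp_all add: Suc.prems(2))
 then have 2: "ex (pop f) (G m) 1 (F m)" unfolding e .
 have 3: "ex (Loop f (-{0}) (B ;; pop f)) (F m) (m * (T + 4) + 1) (F 0)" using Suc by simp
 show ?case using F[of "Suc m"] f by (intro ex_loopT'[OF _ f ex_seq[OF 1 2] 3]) auto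
qed

text \<open>Register \<open>tr\<close> holds \<open>N\<close> and register \<open>r\<close> the current counter, both in unary; registers 2 and 3
 hold the input and its reverse; the output goes to register \<open>o\<close>, and the registers from \<open>f\<close> on are
 empty.\<close>

fun cg :: "nat => nat => gen => nat => nat => prog" where
 "cg q tr (Lit us) r f = puts q us"
| "cg q tr (Cat g h) r f = cg q tr g r f ;; cg q tr h r f"
| "cg q tr (For g) r f = copy r f (f + 1) ;; Loop f (-{0}) (cg q tr g f (f + 2) ;; pop f)"
| "cg q tr (Top g) r f = copy tr f (f + 1) ;; Loop f (-{0}) (cg q tr g r (f + 2) ;; pop f)"
| "cg q tr (Inp d fn) r f = copy (if d then 3 else 2) f (f + 1) ;;
   Loop f {1, 2} (Cond f {2} (pop f ;; puts q (fn True)) (pop f ;; puts q (fn False)))"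

lemma ex_inp:
 assumes "f < k" "q <= k" "q ~= f" "sg f = syms v"
 shows "ex (Loop f {1, 2} (Cond f {2} (pop f ;; puts q (fn True)) (pop f ;; puts q (fn False)))) sg
  (length v * (4 * length (fn True) + 4 * length (fn False) + 10) + 1)
  (sg(f := [], q := rev (syms (concat (map fn v))) @ sg q))"
 using assms(4)
proof (induction v arbitrary: sg)
 case Nil
 show ?case using assms(1,3)
  by (intro ex_eq[OF ex_loopF[of sg f "{1, 2}"]]) (auto simp: fun_eq_iff Nil)
next
 case (Cons b v)
 let ?sg1 = "sg(f := syms v)" and ?sg2 = "sg(f := syms v, q := rev (syms (fn b)) @ sg q)"
 have 1: "ex (pop f) sg 1 ?sg1" using Cons.prems assms(1) by (intro ex_pop) auto
 have 2: "ex (puts q (fn b)) ?sg1 (4 * length (fn b) + 1) ?sg2" using ex_puts[of q "fn b" ?sg1] assms by simp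
 have 3: "ex (Cond f {2} (pop f ;; puts q (fn True)) (pop f ;; puts q (fn False))) sg (4 * length (fn b) + 4) ?sg2"
 proof (cases b)
  case True
  then have b: "b = True" by simp
  then have "sg f = 2 # syms v" using Cons.prems by (auto simp: bit_symbol_def)
  then show ?thesis unfolding b
   by (intro ex_eq[OF ex_condT[of sg f "{2}", OF _ assms(1) ex_seq[OF 1 2[unfolded b]]]]) auto
 next
  case False
  then have b: "b = False" by simp
  then have "sg f = 1 # syms v" using Cons.prems by (auto simp: bit_symbol_def)
  then show ?thesis unfolding b
   by (intro ex_eq[OF ex_condF[of sg f "{2}", OF _ assms(1) ex_seq[OF 1 2[unfolded b]]]]) auto
 qed
 have 4: "ex (Loop f {1, 2} (Cond f {2} (pop f ;; puts q (fn True)) (pop f ;; puts q (fn False)))) ?sg2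
  (length v * (4 * length (fn True) + 4 * length (fn False) + 10) + 1)
  (?sg2(f := [], q := rev (syms (concat (map fn v))) @ ?sg2 q))" using assms(3) by (intro Cons.IH) auto
 have "?sg2(f := [], q := rev (syms (concat (map fn v))) @ ?sg2 q) = sg(f := [], q := rev (syms (concat (map fn (b # v)))) @ sg q)"
  using assms(3) by (auto simp: fun_eq_iff)
 moreover have "1 + (4 * length (fn b) + 4) + (length v * (4 * length (fn True) + 4 * length (fn False) + 10) + 1) \<le>
   length (b # v) * (4 * length (fn True) + 4 * length (fn False) + 10) + 1"
  by (cases b) (auto simp: algebra_simps)
 moreover have "top (sg f) \<in> {1, 2}" using Cons.prems by (auto simp: bit_symbol_def)
 ultimately show ?case using ex_loopT'[of sg f "{1, 2}", OF _ assms(1) 3 4,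
  of "length (b # v) * (4 * length (fn True) + 4 * length (fn False) + 10) + 1"] by (metis add_Suc plus_1_eq_Suc add_0)
qed

lemma cg_correct:
 assumes "f + depth g <= k" "tr < f" "r < f" "3 < f" "q = k \<or> q < f" "q ~= tr" "q ~= r" "q ~= 2" "q ~= 3"
  "sg tr = replicate N 1" "sg r = replicate m 1" "sg 2 = syms w" "sg 3 = rev (syms w)"
  "ALL i. f <= i & i < k --> sg i = []" "N <= S" "m <= S" "length w <= S"
 shows "ex (cg q tr g r f) sg (tg g S) (sg(q := rev (syms (out g N m w)) @ sg q))"
 using assms
proof (induction g arbitrary: r f sg m)
 case (Lit us)
 then have "q <= k" by auto
 then show ?case unfolding cg.simps by (rule ex_eq[OF ex_puts[of q us sg]]) auto
next
 case (Cat g h)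
 let ?sg1 = "sg(q := rev (syms (out g N m w)) @ sg q)"
 have 1: "ex (cg q tr g r f) sg (tg g S) ?sg1"
  by (rule Cat.IH(1)) (use Cat.prems in simp_all)
 have e: "ALL i. f <= i & i < k --> ?sg1 i = []" using Cat.prems(5,14) by auto
 have 2: "ex (cg q tr h r f) ?sg1 (tg h S) (?sg1(q := rev (syms (out h N m w)) @ ?sg1 q))"
  by (rule Cat.IH(2)) (use Cat.prems(1-13,15-17) e in simp_all)
 show ?case unfolding cg.simps by (rule ex_eq[OF ex_seq[OF 1 2]]) auto
next
 case (For g)
 let ?g = "%j. concat (map (%i. out g N i w) (rev [Suc j..<Suc m]))"
 define F where "F j = sg(f := replicate j 1, q := rev (syms (?g j)) @ sg q)" for j
 define G where "G j = (F (Suc j))(q := rev (syms (out g N (Suc j) w)) @ F (Suc j) q)" for j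
 have fk: "f + 1 < k" "f < k" using For.prems by auto
 have q: "q ~= f" "q ~= f + 1" using For.prems(1,5) by auto
 have "sg f = []" "sg (f + 1) = []" using For.prems(14) fk by auto
 then have "ex (copy r f (f + 1)) sg (20 * length (sg r) + 3) (sg(f := sg r))"
  using For.prems(3,11) fk syms_range by (intro ex_copy) auto
 moreover have "sg(f := sg r) = F m" using For.prems(11) q by (auto simp: F_def)
 ultimately have 1: "ex (copy r f (f + 1)) sg (20 * m + 3) (F m)" using For.prems(11) by simp
 have B: "ex (cg q tr g f (f + 2)) (F (Suc j)) (tg g S) (G j)" if j: "j < m" for j
  unfolding G_def
 proof (rule For.IH)
  have ne: "F (Suc j) z = sg z" if "z ~= f" "z ~= q" for z using that by (simp add: F_def)
  show "f + 2 + depth g <= k" using For.prems(1) by simp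
  show "q = k \<or> q < f + 2" using For.prems(5) by auto
  show "F (Suc j) tr = replicate N 1" using For.prems(2,6,10) ne by simp
  show "F (Suc j) f = replicate (Suc j) 1" using q by (simp add: F_def)
  show "F (Suc j) 2 = syms w" "F (Suc j) 3 = rev (syms w)" using For.prems(4,8,9,12,13) ne by auto
  show "ALL i. f + 2 <= i & i < k --> F (Suc j) i = []"
  proof (intro allI impI)
   fix i assume i: "f + 2 <= i & i < k"
   then have "i ~= q" "i ~= f" "sg i = []" using For.prems(5,14) by auto
   then show "F (Suc j) i = []" by (simp add: ne)
  qed
 qed (use For.prems(2,3,4,6,7,8,9,15,16,17) j q in simp_all)
 have up: "rev [Suc j..<Suc m] = rev [Suc (Suc j)..<Suc m] @ [Suc j]" if "j < m" for j
  using that by (simp add: upt_conv_Cons)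
 have 2: "ex (Loop f (-{0}) (cg q tr g f (f + 2) ;; pop f)) (F m) (m * (tg g S + 4) + 1) (F 0)"
 proof (rule ex_count[where G = G, OF fk(2) _ B])
  show "F j f = replicate j 1" for j using q by (simp add: F_def)
  show "G j f = replicate (Suc j) 1" for j using q by (simp add: F_def G_def)
  show "(G j)(f := replicate j 1) = F j" if "j < m" for j
   using q up[OF that] by (auto simp: F_def G_def fun_eq_iff simp del: upt_Suc)
 qed
 have "F 0 = sg(q := rev (syms (out (For g) N m w)) @ sg q)"
  using q \<open>sg f = []\<close> by (auto simp: F_def fun_eq_iff simp del: upt_Suc)
 moreover have "Suc (20 * m + 3 + (m * (tg g S + 4) + 1)) <= tg (For g) S"
 proof -
  have "m * (tg g S + 24) <= S * (tg g S + 40)" using For.prems(16) by (intro mult_le_mono) auto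
  then show ?thesis by (simp add: algebra_simps)
 qed
 ultimately show ?case using ex_seq'[OF 1 2] by (simp only: cg.simps)
next
 case (Top g)
 let ?o = "out g N m w"
 define F where "F j = sg(f := replicate j 1, q := rev (syms (concat (replicate (N - j) ?o))) @ sg q)" for j
 define G where "G j = (F (Suc j))(q := rev (syms ?o) @ F (Suc j) q)" for j
 have fk: "f + 1 < k" "f < k" using Top.prems by auto
 have q: "q ~= f" "q ~= f + 1" using Top.prems(1,5) by auto
 have "sg f = []" "sg (f + 1) = []" using Top.prems(14) fk by auto
 then have "ex (copy tr f (f + 1)) sg (20 * length (sg tr) + 3) (sg(f := sg tr))"
  using Top.prems(2,10) fk syms_range by (intro ex_copy) auto
 moreover have "sg(f := sg tr) = F N" using Top.prems(10) q by (auto simp: F_def)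
 ultimately have 1: "ex (copy tr f (f + 1)) sg (20 * N + 3) (F N)" using Top.prems(10) by simp
 have B: "ex (cg q tr g r (f + 2)) (F (Suc j)) (tg g S) (G j)" if j: "j < N" for j
  unfolding G_def
 proof (rule Top.IH)
  have ne: "F (Suc j) z = sg z" if "z ~= f" "z ~= q" for z using that by (simp add: F_def)
  show "f + 2 + depth g <= k" using Top.prems(1) by simp
  show "q = k \<or> q < f + 2" using Top.prems(5) by auto
  show "F (Suc j) tr = replicate N 1" using Top.prems(2,6,10) ne by simp
  show "F (Suc j) r = replicate m 1" using Top.prems(3,7,11) ne by simp
  show "F (Suc j) 2 = syms w" "F (Suc j) 3 = rev (syms w)" using Top.prems(4,8,9,12,13) ne by auto
  show "ALL i. f + 2 <= i & i < k --> F (Suc j) i = []"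
  proof (intro allI impI)
   fix i assume i: "f + 2 <= i & i < k"
   then have "i ~= q" "i ~= f" "sg i = []" using Top.prems(5,14) by auto
   then show "F (Suc j) i = []" by (simp add: ne)
  qed
 qed (use Top.prems(2,3,4,6,7,8,9,15,16,17) j q in simp_all)
 have up: "concat (replicate (N - j) ?o) = concat (replicate (N - Suc j) ?o) @ ?o" if "j < N" for j
 proof -
  have "N - j = Suc (N - Suc j)" using that by simp
  then have "replicate (N - j) ?o = replicate (N - Suc j) ?o @ [?o]" by (simp only: replicate_Suc replicate_append_same)
  then show ?thesis by simp
 qed
 have 2: "ex (Loop f (-{0}) (cg q tr g r (f + 2) ;; pop f)) (F N) (N * (tg g S + 4) + 1) (F 0)"
 proof (rule ex_count[where G = G, OF fk(2) _ B])
  show "F j f = replicate j 1" for j using q by (simp add: F_def)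
  show "G j f = replicate (Suc j) 1" for j using q by (simp add: F_def G_def)
  show "(G j)(f := replicate j 1) = F j" if "j < N" for j
   using q up[OF that] by (auto simp: F_def G_def fun_eq_iff)
 qed
 have "F 0 = sg(q := rev (syms (out (Top g) N m w)) @ sg q)"
  using q \<open>sg f = []\<close> by (auto simp: F_def fun_eq_iff)
 moreover have "Suc (20 * N + 3 + (N * (tg g S + 4) + 1)) <= tg (Top g) S"
 proof -
  have "N * (tg g S + 24) <= S * (tg g S + 40)" using Top.prems(15) by (intro mult_le_mono) auto
  then show ?thesis by (simp add: algebra_simps)
 qed
 ultimately show ?case using ex_seq'[OF 1 2] by (simp only: cg.simps)
next
 case (Inp d fn)
 define v where "v = (if d then rev w else w)"
 define z where "z = (if d then 3 else 2::nat)"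
 have z: "sg z = syms v" "z < f" "z ~= q" using Inp.prems by (auto simp: z_def v_def rev_map)
 have fk: "f + 1 < k" "f < k" using Inp.prems by auto
 have q: "q ~= f" "q <= k" using Inp.prems(1,5) by auto
 have e: "sg f = []" "sg (f + 1) = []" using Inp.prems(14) fk by auto
 then have 1: "ex (copy z f (f + 1)) sg (20 * length (sg z) + 3) (sg(f := sg z))"
  using z fk syms_range by (intro ex_copy) auto
 let ?T = "4 * length (fn True) + 4 * length (fn False)"
 have 2: "ex (Loop f {1, 2} (Cond f {2} (pop f ;; puts q (fn True)) (pop f ;; puts q (fn False)))) (sg(f := sg z))
  (length v * (?T + 10) + 1) ((sg(f := sg z))(f := [], q := rev (syms (concat (map fn v))) @ (sg(f := sg z)) q))"
  using fk q z by (intro ex_inp) auto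
 have "(sg(f := sg z))(f := [], q := rev (syms (concat (map fn v))) @ (sg(f := sg z)) q) =
   sg(q := rev (syms (out (Inp d fn) N m w)) @ sg q)"
  using q e by (auto simp: fun_eq_iff v_def)
 moreover have "Suc (20 * length (sg z) + 3 + (length v * (?T + 10) + 1)) <= tg (Inp d fn) S"
 proof -
  have "length v <= S" using Inp.prems(17) by (simp add: v_def)
  then have "length v * (?T + 30) <= S * (?T + 40)" by (intro mult_le_mono) auto
  then show ?thesis using z(1) by (simp add: algebra_simps)
 qed
 ultimately show ?case using ex_seq'[OF 1 2, of "tg (Inp d fn) S"] unfolding cg.simps z_def[symmetric] by metis
qed

lemma prog_ok_basic:
 "prog_ok (Suc k) 3 (pop r) \<longleftrightarrow> r <= k" "s < 3 ==> prog_ok (Suc k) 3 (push r s) \<longleftrightarrow> r <= k" "prog_ok (Suc k) 3 skip"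
 "prog_ok (Suc k) 3 (unload r t) \<longleftrightarrow> r <= k & t <= k" "prog_ok (Suc k) 3 (copy r t u) \<longleftrightarrow> r <= k & t <= k & u <= k"
 "s < 3 ==> prog_ok (Suc k) 3 (put r s) \<longleftrightarrow> r <= k"
 by (auto simp: pop_def push_def skip_def unload_def copy_def put_def emit_def)

lemma prog_ok_puts: "r <= k ==> prog_ok (Suc k) 3 (puts r us)"
 by (induction us) (auto simp: prog_ok_basic bit_symbol_def)

lemma prog_ok_cg: "f + depth g <= k ==> q <= k ==> tr < f ==> r < f ==> 3 < f ==> prog_ok (Suc k) 3 (cg q tr g r f)"
 by (induction g arbitrary: r f) (auto simp: prog_ok_basic prog_ok_puts)

text \<open>Register 2 receives the word, 3 its reverse and 4 the number \<open>length w + c\<close>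
  in unary, a unary digit being the symbol of the bit \<open>False\<close>.\<close>

definition prelude :: "nat => prog" where
 "prelude c = unload 0 3 ;; copy 3 5 6 ;; unload 5 2 ;; copy 3 5 6 ;;
   Loop 5 {1, 2} (Cond 5 {2} (pop 5 ;; puts 4 [False]) (pop 5 ;; puts 4 [False])) ;; puts 4 (replicate c False)"

lemma ex_prelude:
 assumes k: "7 <= k"
 shows "ex (prelude c) ((%_. [])(0 := syms w)) (100 * (length w + c) + 100)
  ((%_. [])(2 := syms w, 3 := rev (syms w), 4 := replicate (length w + c) 1))"
proof -
 let ?n = "length w"
 let ?sg0 = "(%_. [])(0 := syms w) :: nat => nat list"
 let ?sg1 = "(%_. [])(3 := rev (syms w)) :: nat => nat list"
 let ?sg2 = "(%_. [])(3 := rev (syms w), 5 := rev (syms w)) :: nat => nat list"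
 let ?sg3 = "(%_. [])(2 := syms w, 3 := rev (syms w)) :: nat => nat list"
 let ?sg4 = "(%_. [])(2 := syms w, 3 := rev (syms w), 5 := rev (syms w)) :: nat => nat list"
 let ?sg5 = "(%_. [])(2 := syms w, 3 := rev (syms w), 4 := replicate ?n 1) :: nat => nat list"
 let ?sg6 = "(%_. [])(2 := syms w, 3 := rev (syms w), 4 := replicate (?n + c) 1) :: nat => nat list"
 have lit: "map (bit_symbol \<circ> (%_. False)) v = replicate (length v) 1" for v :: "bool list"
  by (induction v) (auto simp: bit_symbol_def)
 have 1: "ex (unload 0 3) ?sg0 (8 * ?n + 1) ?sg1"
  by (rule ex_eq[OF ex_unload[of 0 3 ?sg0]]) (use k syms_range in \<open>auto simp: fun_eq_iff bit_symbol_def\<close>)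
 have 2: "ex (copy 3 5 6) ?sg1 (20 * ?n + 3) ?sg2"
  by (rule ex_eq[OF ex_copy[of 6 3 5 ?sg1]]) (use k syms_range in \<open>auto simp: fun_eq_iff bit_symbol_def\<close>)
 have 3: "ex (unload 5 2) ?sg2 (8 * ?n + 1) ?sg3"
  by (rule ex_eq[OF ex_unload[of 5 2 ?sg2]]) (use k syms_range in \<open>auto simp: fun_eq_iff bit_symbol_def\<close>)
 have 4: "ex (copy 3 5 6) ?sg3 (20 * ?n + 3) ?sg4"
  by (rule ex_eq[OF ex_copy[of 6 3 5 ?sg3]]) (use k syms_range in \<open>auto simp: fun_eq_iff bit_symbol_def\<close>)
 have 5: "ex (Loop 5 {1, 2} (Cond 5 {2} (pop 5 ;; puts 4 [False]) (pop 5 ;; puts 4 [False]))) ?sg4 (?n * 18 + 1) ?sg5"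
  by (rule ex_eq[OF ex_inp[of 5 4 ?sg4 "rev w" "%_. [False]"]]) (use k in \<open>auto simp: fun_eq_iff lit[simplified] lit bit_symbol_def rev_map\<close>)
 have 6: "ex (puts 4 (replicate c False)) ?sg5 (4 * c + 1) ?sg6"
  by (rule ex_eq[OF ex_puts[of 4 "replicate c False" ?sg5]])
   (use k in \<open>auto simp: fun_eq_iff bit_symbol_def replicate_add add.commute[of ?n]\<close>)
 show ?thesis unfolding prelude_def
  by (rule ex_weaken[OF ex_seq[OF 1 ex_seq[OF 2 ex_seq[OF 3 ex_seq[OF 4 ex_seq[OF 5 6]]]]]]) simp
qed

lemma prog_ok_prelude: "7 <= k ==> prog_ok (Suc k) 3 (prelude c)"
 by (simp add: prelude_def prog_ok_basic prog_ok_puts bit_symbol_def)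

end

fun pow_gen :: "nat => gen" where
 "pow_gen 0 = Lit [False]"
| "pow_gen (Suc e) = Top (pow_gen e)"

lemma out_pow_gen: "out (pow_gen e) N m w = replicate (N ^ e) False"
proof (induction e)
 case (Suc e)
 have "concat (replicate i (replicate j x)) = replicate (i * j) x" for i j :: nat and x :: bool
  by (induction i) (auto simp: replicate_add)
 then show ?case using Suc by simp
qed simp

text \<open>The loop bound \<open>(length w + c) ^ e\<close> is itself printed in unary by
  \<open>pow_gen\<close>, into register 1, and then serves \<open>g\<close> both as \<open>N\<close>
  and as the current counter \<open>m\<close>.\<close>

theorem gen_poly_time:
 "poly_time_computable (%w. out g ((length w + c) ^ e) ((length w + c) ^ e) w)"
proof -
 let ?N = "%w. (length w + c) ^ e"
 define k where "k = 7 + depth g + depth (pow_gen e)"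
 define P where "P = gen_machine.prelude k c ;; gen_machine.cg k 1 4 (pow_gen e) 4 5 ;; gen_machine.cg k k 1 g 1 5"
 obtain a1 e1 where t1: "ALL S. tg (pow_gen e) S <= a1 * (S + 1) ^ e1" using tg_poly by blast
 obtain a2 e2 where t2: "ALL S. tg g S <= a2 * (S + 1) ^ e2" using tg_poly by blast
 have run: "\<exists>t\<le>100 * (length w + c) + 102 + tg (pow_gen e) (length w + c) + tg g (?N w + length w). EX ts'.
   bs (%_. True) P (input_tape w # replicate k (0, %_. 0)) t ts' & has_output (0, ts') (out g (?N w) (?N w) w)" for w
 proof -
  interpret gen_machine k "%r. if r = 0 then int (length w) else 0" .
  let ?ts = "input_tape w # replicate k (0, %_. 0)"
  let ?sg1 = "(%_. [])(2 := syms w, 3 := rev (syms w), 4 := replicate (length w + c) 1) :: nat => nat list"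
  let ?sg2 = "?sg1(1 := replicate (?N w) 1)"
  let ?sg3 = "?sg2(k := rev (syms (out g (?N w) (?N w) w)))"
  have k7: "7 <= k" by (simp add: k_def)
  have rep: "rep ?ts ((%_. [])(0 := syms w))" using k7 by (intro rep_init) auto
  have 2: "ex (cg 1 4 (pow_gen e) 4 5) ?sg1 (tg (pow_gen e) (length w + c))
   (?sg1(1 := rev (syms (out (pow_gen e) (length w + c) (length w + c) w)) @ ?sg1 1))"
   by (rule cg_correct) (auto simp: k_def)
  have e2: "?sg1(1 := rev (syms (out (pow_gen e) (length w + c) (length w + c) w)) @ ?sg1 1) = ?sg2"
   by (simp add: out_pow_gen bit_symbol_def)
  have 3: "ex (cg k 1 g 1 5) ?sg2 (tg g (?N w + length w)) (?sg2(k := rev (syms (out g (?N w) (?N w) w)) @ ?sg2 k))"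
   by (rule cg_correct) (auto simp: k_def)
  have e3: "?sg2(k := rev (syms (out g (?N w) (?N w) w)) @ ?sg2 k) = ?sg3" using k7 by auto
  have "ex P ((%_. [])(0 := syms w)) (100 * (length w + c) + 102 + tg (pow_gen e) (length w + c) + tg g (?N w + length w)) ?sg3"
   unfolding P_def by (rule ex_weaken[OF ex_seq[OF ex_prelude[OF k7] ex_seq[OF 2[unfolded e2] 3[unfolded e3]]]]) simp
  then obtain t ts' where t: "t <= 100 * (length w + c) + 102 + tg (pow_gen e) (length w + c) + tg g (?N w + length w)"
   "bs HJ P ?ts t ts'" "rep ts' ?sg3" using rep unfolding ex_def by blast
  have "bs (%_. True) P ?ts t ts'" using t(2) by (induction rule: bs.induct) (blast intro: bs.intros)+
  moreover have "has_output (0, ts') (out g (?N w) (?N w) w)"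
  proof -
   have "length ts' = Suc k" "outp (ts' ! k) (rev (syms (out g (?N w) (?N w) w)))"
   using t(3) by (auto simp: rep_def)
   moreover from this have "last ts' = ts' ! k" by (metis diff_Suc_1 last_conv_nth length_0_conv nat.distinct(1))
   ultimately show ?thesis by (auto simp: has_output_def outp_def)
  qed
  ultimately show ?thesis using t(1) by blast
 qed
 define D where "D = 100 * (c + 1) + 102 + a1 * (c + 2) ^ e1 + a2 * (c + 3) ^ (e * e2 + e2)"
 define E where "E = 1 + e1 + (e * e2 + e2)"
 have bound: "100 * (n + c) + 102 + tg (pow_gen e) (n + c) + tg g ((n + c) ^ e + n) <= D * 2 ^ E * n ^ E + D * 2 ^ E" for n
 proof -
  have b1: "(n + c + 1) <= (c + 1) * (n + 1)" "(n + c + 1) <= (c + 2) * (n + 1)" by (simp_all add: add_mult_distrib)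
  have "100 * (n + c) + 102 <= (100 * (c + 1) + 102) * (n + 1) ^ E"
  proof -
   have "100 * (n + c) + 102 <= (100 * (c + 1) + 102) * (n + 1)" by (simp add: add_mult_distrib)
   also have "\<dots> \<le> (100 * (c + 1) + 102) * (n + 1) ^ E"
   using power_increasing[of 1 E "n + 1"] by (intro mult_le_mono2) (simp add: E_def)
   finally show ?thesis .
  qed
  moreover have "tg (pow_gen e) (n + c) <= a1 * (c + 2) ^ e1 * (n + 1) ^ E"
  proof -
   have "tg (pow_gen e) (n + c) <= a1 * (n + c + 1) ^ e1" using t1 by simp
   also have "\<dots> \<le> a1 * ((c + 2) * (n + 1)) ^ e1" by (intro mult_le_mono2 power_mono b1) simp
   also have "\<dots> = a1 * (c + 2) ^ e1 * (n + 1) ^ e1" by (simp only: power_mult_distrib mult.assoc)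
   also have "\<dots> \<le> a1 * (c + 2) ^ e1 * (n + 1) ^ E" by (intro mult_le_mono2 power_increasing) (auto simp: E_def)
   finally show ?thesis .
  qed
  moreover have "tg g ((n + c) ^ e + n) <= a2 * (c + 3) ^ (e * e2 + e2) * (n + 1) ^ E"
  proof -
   have b2: "n + c + 2 <= (c + 3) * (n + 1)" by (simp add: add_mult_distrib)
   have "(n + c) ^ e <= (n + c + 2) ^ e" "1 <= (n + c + 2) ^ e" by (auto intro: power_mono)
   then have "(n + c) ^ e + (n + 1) <= (n + c + 2) ^ e + (n + 1) * (n + c + 2) ^ e"
   using mult_le_mono2[OF \<open>1 <= (n + c + 2) ^ e\<close>, of "n + 1"] unfolding mult_1_right by (blast intro: add_mono)
   also have "\<dots> \<le> (n + c + 2) * (n + c + 2) ^ e" by (simp add: algebra_simps)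
   finally have le: "(n + c) ^ e + n + 1 <= (n + c + 2) ^ (e + 1)" by simp
   have "tg g ((n + c) ^ e + n) <= a2 * ((n + c) ^ e + n + 1) ^ e2" using t2 by simp
   also have "\<dots> \<le> a2 * ((n + c + 2) ^ (e + 1)) ^ e2" by (intro mult_le_mono2 power_mono le) simp
   also have "\<dots> = a2 * (n + c + 2) ^ (e * e2 + e2)" by (simp only: power_mult[symmetric] add_mult_distrib mult_1)
   also have "\<dots> \<le> a2 * ((c + 3) * (n + 1)) ^ (e * e2 + e2)" by (intro mult_le_mono2 power_mono b2) simp
   also have "\<dots> = a2 * (c + 3) ^ (e * e2 + e2) * (n + 1) ^ (e * e2 + e2)" by (simp only: power_mult_distrib mult.assoc)
   also have "\<dots> \<le> a2 * (c + 3) ^ (e * e2 + e2) * (n + 1) ^ E" by (intro mult_le_mono2 power_increasing) (auto simp: E_def)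
   finally show ?thesis .
  qed
  ultimately have "100 * (n + c) + 102 + tg (pow_gen e) (n + c) + tg g ((n + c) ^ e + n) <= D * (n + 1) ^ E"
   by (simp add: D_def add_mult_distrib)
  moreover have "(n + 1) ^ E <= 2 ^ E * n ^ E + 2 ^ E"
  proof (cases n)
   case (Suc n')
   then have "(n + 1) ^ E <= (2 * n) ^ E" by (intro power_mono) auto
   then show ?thesis by (simp add: power_mult_distrib)
  next
   case 0
   have "(1::nat) <= 2 ^ E" by simp
   then show ?thesis unfolding 0 by (simp add: trans_le_add2)
  qed
  then have "D * (n + 1) ^ E <= D * (2 ^ E * n ^ E + 2 ^ E)" by (rule mult_le_mono2)
  ultimately show ?thesis by (simp add: algebra_simps)
 qed
 have ok: "prog_ok (Suc k) 3 P"
  unfolding P_def prog_ok.simps by (intro conjI gen_machine.prog_ok_prelude gen_machine.prog_ok_cg) (auto simp: k_def)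
 show ?thesis
 proof (rule prog_poly_time[OF ok, of "D * 2 ^ E" E])
  fix w
  obtain t ts' where "t <= 100 * (length w + c) + 102 + tg (pow_gen e) (length w + c) + tg g (?N w + length w)"
   "bs (%_. True) P (input_tape w # replicate k (0, %_. 0)) t ts'" "has_output (0, ts') (out g (?N w) (?N w) w)"
   using run by blast
  then show "\<exists>t\<le>D * 2 ^ E * length w ^ E + D * 2 ^ E. EX ts'. bs (%_. True) P (input_tape w # replicate (Suc k - 1) (0, %_. 0)) t ts' &
   has_output (0, ts') (out g (?N w) (?N w) w)"
   using bound[of "length w"] by (intro exI[of _ t] conjI exI[of _ ts']) auto
 qed auto
qed

section \<open>Self-synchronising block codes over one atom\<close>

section \<open>Block codes\<close>

text \<open>One atom carries the code of the letter \<open>g\<close> of an alphabet of size \<open>A\<close>; two consecutive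
 occurrences of it mark the beginning of a code word.\<close>

definition cw :: "nat => nat => bool list" where
 "cw A g = map (%j. j < 2 \<or> j = g + 3) [0..<A + 4]"

lemma length_cw [simp]: "length (cw A g) = A + 4"
 by (simp add: cw_def)

lemma cw_nth: "j < A + 4 ==> cw A g ! j \<longleftrightarrow> j < 2 \<or> j = g + 3"
 by (simp add: cw_def)

definition blk :: "nat => (nat => bool) => nat => nat => bool" where
 "blk A y p g \<longleftrightarrow> (\<forall>j<A + 4. y (p + j) = cw A g ! j)"

definition coded :: "nat => (nat => bool) => (nat => nat) => bool" where
 "coded A y z \<longleftrightarrow> (ALL p. z p < A & blk A y ((A + 4) * p) (z p))"

lemma coded_exists:
 assumes "ALL p. z p < A"
 shows "coded A (%i. cw A (z (i div (A + 4))) ! (i mod (A + 4))) z"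
 unfolding coded_def blk_def
proof (intro allI conjI impI)
 show "z p < A" for p using assms by simp
 fix p j assume "j < A + 4"
 then have "((A + 4) * p + j) div (A + 4) = p" "((A + 4) * p + j) mod (A + 4) = j" by auto
 then show "cw A (z (((A + 4) * p + j) div (A + 4))) ! (((A + 4) * p + j) mod (A + 4)) = cw A (z p) ! j"
  by simp
qed

text \<open>A code word begins with 110, contains one further 1 and ends with 0, so two adjacent
  ones occur only at the beginning of a word, even across the border of two words. Hence every
  occurrence of a code word is aligned with the blocks.\<close>

lemma coded_blk_iff:
 assumes y: "coded A y z" and g: "g < A"
 shows "blk A y q g \<longleftrightarrow> (EX p. q = (A + 4) * p & z p = g)"
proof
 assume b: "blk A y q g"
 define p where "p = q div (A + 4)"
 define j where "j = q mod (A + 4)"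
 have q: "q = (A + 4) * p + j" "j < A + 4" by (auto simp: p_def j_def)
 have z: "z p < A" "blk A y ((A + 4) * p) (z p)" using y by (auto simp: coded_def)
 have bit: "y ((A + 4) * p + i) \<longleftrightarrow> i < 2 \<or> i = z p + 3" if "i < A + 4" for i
  using z(2) that by (auto simp: blk_def cw_nth)
 have own: "y (q + i) \<longleftrightarrow> i < 2 \<or> i = g + 3" if "i < A + 4" for i
  using b that by (auto simp: blk_def cw_nth)
 show "EX p. q = (A + 4) * p & z p = g"
 proof (cases "j = 0")
  case True
  then have "y ((A + 4) * p + (g + 3))" using own[of "g + 3"] q g by auto
  then have "z p = g" using bit[of "g + 3"] g by auto
  then show ?thesis using q True by auto
 next
  case False
  have 1: "j < 2 \<or> j = z p + 3" using bit[OF q(2)] own[of 0] q(1) by simp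
  have "y ((A + 4) * p + (j + 1))" using own[of 1] q(1) by (simp add: add.assoc)
  then show ?thesis using bit[of "j + 1"] 1 False z(1) by (cases "j + 1 < A + 4") auto
 qed
next
 assume "EX p. q = (A + 4) * p & z p = g"
 then show "blk A y q g" using y by (auto simp: coded_def)
qed

lemma coded_eqI:
 assumes Z: "\<exists>g<A. blk A y 0 g" and S: "!!q. \<exists>g<A. blk A y q g ==> \<exists>g<A. blk A y (q + (A + 4)) g"
 shows "EX z. coded A y z"
proof -
 have "\<exists>g<A. blk A y ((A + 4) * p) g" for p
 proof (induction p)
  case 0
  show ?case unfolding mult_0_right by (rule Z)
 next
  case (Suc p)
  show ?case unfolding mult_Suc_right add.commute[of "A + 4"] by (rule S[OF Suc])
 qed
 then obtain z where "ALL p. z p < A & blk A y ((A + 4) * p) (z p)" by metis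
 then show ?thesis by (auto simp: coded_def)
qed

section \<open>Reading blocks with past formulas\<close>

section \<open>Formulas over block codes\<close>

abbreviation "pre ta m \<equiv> map ta [0..<m]"

lemma plus_lang_quantifiers:
 "ta \<in> plus_lang ppltl_lang (AllQ fm) \<longleftrightarrow> (ALL i. ppltl_holds (pre ta (Suc i)) i fm)"
 "ta \<in> plus_lang ppltl_lang (ExQ fm) \<longleftrightarrow> (EX i. ppltl_holds (pre ta (Suc i)) i fm)"
proof -
 have 1: "(\<forall>n>0. P n) \<longleftrightarrow> (ALL i. P (Suc i))" and 2: "(\<exists>n>0. P n) \<longleftrightarrow> (EX i. P (Suc i))" for P :: "nat => bool"
  by (metis gr0_conv_Suc)+
 have 3: "pre ta (Suc i) \<in> ppltl_lang fm \<longleftrightarrow> ppltl_holds (pre ta (Suc i)) i fm" for i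
  by (simp add: ppltl_lang_def del: upt_Suc)
 show "ta \<in> plus_lang ppltl_lang (AllQ fm) \<longleftrightarrow> (ALL i. ppltl_holds (pre ta (Suc i)) i fm)"
  unfolding plus_lang.simps quantifiers_iff 1 3 ..
 show "ta \<in> plus_lang ppltl_lang (ExQ fm) \<longleftrightarrow> (EX i. ppltl_holds (pre ta (Suc i)) i fm)"
  unfolding plus_lang.simps quantifiers_iff 2 3 ..
qed

definition Ys :: "nat => 'a ppltl => 'a ppltl" where
 "Ys n fm = (YesterdayP ^^ n) fm"

lemma holds_Ys [simp]: "ppltl_holds t i (Ys n fm) \<longleftrightarrow> n <= i & ppltl_holds t (i - n) fm"
 unfolding Ys_def
proof (induction n arbitrary: i)
 case (Suc n)
 then show ?case by (cases i) simp_all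
qed simp

lemma enc_Ys: "enc_ppltl c (Ys n fm) = concat (replicate n (enc_nat 4)) @ enc_ppltl c fm"
 unfolding Ys_def by (induction n) auto

locale blocks =
 fixes p0 :: 'a and A :: nat
begin

abbreviation "bl \<equiv> A + 4"

definition TT :: "'a ppltl" where
 "TT = OrP (AtomP p0) (NotP (AtomP p0))"

lemma holds_TT [simp]: "ppltl_holds t i TT"
 by (simp add: TT_def)

definition lit :: "bool => 'a ppltl" where
 "lit x = (if x then AtomP p0 else NotP (AtomP p0))"

lemma holds_lit [simp]: "ppltl_holds t i (lit x) \<longleftrightarrow> (p0 \<in> t ! i) = x"
 by (simp add: lit_def)

fun OrL :: "'a ppltl list => 'a ppltl" where
 "OrL [] = NotP TT"
| "OrL (fm # l) = OrP fm (OrL l)"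

lemma holds_OrL [simp]: "ppltl_holds t i (OrL l) \<longleftrightarrow> (\<exists>fm\<in>set l. ppltl_holds t i fm)"
 by (induction l) auto

fun LT :: "bool list => 'a ppltl" where
 "LT [] = TT"
| "LT [x] = lit x"
| "LT (x # us) = AndP (lit x) (YesterdayP (LT us))"

lemma holds_LT: "us ~= [] ==> ppltl_holds t i (LT us) \<longleftrightarrow> length us <= Suc i & (\<forall>j<length us. (p0 \<in> t ! (i - j)) = us ! j)"
proof (induction us arbitrary: i rule: LT.induct)
 case (3 x v va)
 have *: "(\<forall>j<Suc n. Q j) \<longleftrightarrow> Q 0 & (\<forall>j<n. Q (Suc j))" for Q and n :: nat
  by (auto simp: less_Suc_eq_0_disj)
 show ?case using 3 by (cases i) (auto simp: *)
qed auto

definition Start :: "'a ppltl" where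
 "Start = NotP (YesterdayP TT)"

lemma holds_Start [simp]: "ppltl_holds t i Start \<longleftrightarrow> i = 0"
 by (auto simp: Start_def)

text \<open>Evaluated at the last position of a block and read backwards, hence the reversed code
  word.\<close>

definition LtP :: "nat => 'a ppltl" where
 "LtP g = LT (rev (cw A g))"

definition LS :: "nat list => 'a ppltl" where
 "LS gs = OrL (map LtP gs)"

lemma holds_LtP:
 assumes "i < m"
 shows "ppltl_holds (pre ta m) i (LtP g) \<longleftrightarrow> bl <= Suc i & blk A (%j. p0 \<in> ta j) (Suc i - bl) g"
proof -
 have e: "ppltl_holds (pre ta m) i (LtP g) \<longleftrightarrow> bl <= Suc i & (\<forall>j<bl. (p0 \<in> ta (i - j)) = rev (cw A g) ! j)"
 proof -
  have "rev (cw A g) ~= []" by (simp add: cw_def)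
  then show ?thesis using assms by (auto simp: LtP_def holds_LT)
 qed
 show ?thesis
 proof (cases "bl <= Suc i")
  case True
  have "(\<forall>j<bl. (p0 \<in> ta (i - j)) = rev (cw A g) ! j) \<longleftrightarrow> blk A (%j. p0 \<in> ta j) (Suc i - bl) g"
   unfolding blk_def
  proof (rule iffI; intro allI impI)
   fix j assume *: "\<forall>j<bl. (p0 \<in> ta (i - j)) = rev (cw A g) ! j" and j: "j < bl"
   have "(p0 \<in> ta (i - (bl - 1 - j))) = rev (cw A g) ! (bl - 1 - j)"
   by (rule *[rule_format]) simp
   moreover have "i - (bl - 1 - j) = Suc i - bl + j" "rev (cw A g) ! (bl - 1 - j) = cw A g ! j"
   using j True by (auto simp: rev_nth)
   ultimately show "(p0 \<in> ta (Suc i - bl + j)) = cw A g ! j" by metis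
  next
   fix j assume *: "\<forall>j<bl. (p0 \<in> ta (Suc i - bl + j)) = cw A g ! j" and j: "j < bl"
   have "(p0 \<in> ta (Suc i - bl + (bl - 1 - j))) = cw A g ! (bl - 1 - j)"
   by (rule *[rule_format]) simp
   moreover have "Suc i - bl + (bl - 1 - j) = i - j" "rev (cw A g) ! j = cw A g ! (bl - 1 - j)"
   using j True by (auto simp: rev_nth)
   ultimately show "(p0 \<in> ta (i - j)) = rev (cw A g) ! j" by metis
  qed
  then show ?thesis unfolding e by simp
 qed (simp add: e)
qed

abbreviation "pos p \<equiv> bl * Suc p - 1"

lemma holds_LtP_coded:
 assumes y: "coded A (%j. p0 \<in> ta j) z" and i: "i < m" and g: "g < A"
 shows "ppltl_holds (pre ta m) i (LtP g) \<longleftrightarrow> (EX p. i = pos p & z p = g)"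
 unfolding holds_LtP[OF i] coded_blk_iff[OF y g]
proof
 assume *: "bl <= Suc i & (EX p. Suc i - bl = bl * p & z p = g)"
 then obtain p where p: "Suc i - bl = bl * p" "z p = g" by blast
 then have "Suc i = bl * Suc p" using * unfolding mult_Suc_right by linarith
 then have "i = pos p" by linarith
 then show "EX p. i = pos p & z p = g" using p(2) by blast
next
 assume "EX p. i = pos p & z p = g"
 then show "bl <= Suc i & (EX p. Suc i - bl = bl * p & z p = g)" by (auto simp: algebra_simps)
qed

lemma pos_inj [simp]: "pos p = pos q \<longleftrightarrow> p = q"
proof
 assume "pos p = pos q"
 moreover have "0 < bl * Suc p" "0 < bl * Suc q" by simp_all
 ultimately have "bl * Suc p = bl * Suc q" by linarith
 then show "p = q" by simp
qed simp

lemma holds_LS_coded: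
 assumes "coded A (%j. p0 \<in> ta j) z" "i < m" "set gs \<subseteq> {..<A}"
 shows "ppltl_holds (pre ta m) i (LS gs) \<longleftrightarrow> (EX p. i = pos p & z p \<in> set gs)"
 using holds_LtP_coded[OF assms(1,2)] assms(3) by (auto simp: LS_def subset_iff)

lemma holds_Ys_pos: "ppltl_holds t (pos p) (Ys (bl * k) fm) \<longleftrightarrow> k <= p & ppltl_holds t (pos (p - k)) fm"
proof -
 have "bl * k <= pos p \<longleftrightarrow> k <= p"
 proof
  assume "bl * k <= pos p"
  moreover have "pos p < bl * Suc p" by simp
  ultimately have "bl * k < bl * Suc p" by linarith
  then show "k <= p" by (metis mult_less_cancel1 less_Suc_eq_le)
 next
  assume "k <= p"
  then have "bl * k <= bl * p" by simp
  then show "bl * k <= pos p" unfolding mult_Suc_right by linarith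
 qed
 moreover have "pos p - bl * k = pos (p - k)" if "k <= p"
  using that by (simp add: diff_mult_distrib2 Suc_diff_le[symmetric])
 ultimately show ?thesis by auto
qed

text \<open>A block at the very beginning, and a block right after each block.\<close>

definition WFP :: "'a ppltl" where
 "WFP = AndP (OrP (NotP (Ys (bl - 1) Start)) (LS [0..<A])) (OrP (NotP (Ys bl (LS [0..<A]))) (LS [0..<A]))"

lemma wfp_iff: "(ALL i. ppltl_holds (pre ta (Suc i)) i WFP) \<longleftrightarrow> (EX z. coded A (%j. p0 \<in> ta j) z)"
proof
 assume *: "ALL i. ppltl_holds (pre ta (Suc i)) i WFP"
 have L: "ppltl_holds (pre ta (Suc i)) j (LS [0..<A]) \<longleftrightarrow> bl <= Suc j & (\<exists>g<A. blk A (%j. p0 \<in> ta j) (Suc j - bl) g)"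
  if "j < Suc i" for i j using holds_LtP[OF that] by (auto simp: LS_def)
 show "EX z. coded A (%j. p0 \<in> ta j) z"
 proof (rule coded_eqI)
  show "\<exists>g<A. blk A (%j. p0 \<in> ta j) 0 g"
  proof -
   have "ppltl_holds (pre ta (Suc (bl - 1))) (bl - 1) (LS [0..<A])"
   using *[THEN spec, of "bl - 1"] unfolding WFP_def by (simp del: upt_Suc)
   then show ?thesis unfolding L[OF lessI] by simp
  qed
  show "\<exists>g<A. blk A (%j. p0 \<in> ta j) (q + bl) g" if "\<exists>g<A. blk A (%j. p0 \<in> ta j) q g" for q
  proof -
   let ?i = "q + bl + (bl - 1)"
   have "ppltl_holds (pre ta (Suc ?i)) (?i - bl) (LS [0..<A])"
   using that by (subst L) auto
   then have "ppltl_holds (pre ta (Suc ?i)) ?i (LS [0..<A])"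
   using *[THEN spec, of ?i] unfolding WFP_def by (simp del: upt_Suc)
   then show ?thesis unfolding L[OF lessI] by (simp add: ac_simps)
  qed
 qed
next
 assume "EX z. coded A (%j. p0 \<in> ta j) z"
 then obtain z where y: "coded A (%j. p0 \<in> ta j) z" by blast
 then have zA: "z p < A" for p by (simp add: coded_def)
 have L: "ppltl_holds (pre ta (Suc i)) j (LS [0..<A]) \<longleftrightarrow> (EX p. j = pos p)" if "j <= i" for i j
 proof -
  have "set [0..<A] \<subseteq> {..<A}" "z p \<in> set [0..<A]" for p using zA by auto
  then show ?thesis using holds_LS_coded[OF y, of j "Suc i" "[0..<A]"] that by (simp del: upt_Suc set_upt)
 qed
 show "ALL i. ppltl_holds (pre ta (Suc i)) i WFP"
 proof
  fix i
  have "EX p. i = pos p" if "bl - 1 <= i" "i - (bl - 1) = 0"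
   using that by (intro exI[of _ 0]) simp
  moreover have "EX p. i = pos p" if "bl <= i" "i - bl = pos p" for p
   using that by (intro exI[of _ "Suc p"]) simp
  ultimately show "ppltl_holds (pre ta (Suc i)) i WFP" by (auto simp: WFP_def L simp del: upt_Suc)
 qed
qed

end

section \<open>Families of formulas whose encodings can be printed\<close>

section \<open>Generating formulas\<close>

text \<open>One output program prints the encodings of the whole family. In Polish notation each
  constructor only contributes a fixed string in front of its arguments, so the property is
  compositional.\<close>

definition genable :: "('a => nat) => (nat => nat => bool list => 'a ppltl) => bool" where
 "genable c F \<longleftrightarrow> (EX g. ALL N m w. enc_ppltl c (F N m w) = out g N m w)"

definition genable_plus :: "('a => nat) => (nat => nat => bool list => 'a ppltl plus) => bool" where
 "genable_plus c F \<longleftrightarrow> (EX g. ALL N m w. enc_ppltl_plus c (F N m w) = out g N m w)"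

lemma genable_const [simp, intro]: "genable c (%N m w. fm)"
 unfolding genable_def by (intro exI[of _ "Lit (enc_ppltl c fm)"]) simp

lemma genable_context:
 assumes "genable c F" "!!N m w. enc_ppltl c (H N m w) = us @ enc_ppltl c (F N m w)"
 shows "genable c H"
proof -
 obtain g where "ALL N m w. enc_ppltl c (F N m w) = out g N m w" using assms(1) by (auto simp: genable_def)
 then show ?thesis unfolding genable_def by (intro exI[of _ "Cat (Lit us) g"]) (simp add: assms(2))
qed

lemma genable_unary [intro]:
 assumes "genable c F"
 shows "genable c (%N m w. NotP (F N m w))" "genable c (%N m w. YesterdayP (F N m w))" "genable c (%N m w. Ys k (F N m w))"
 by (rule genable_context[OF assms], simp add: enc_Ys)+

lemma genable_binary [intro]:
 assumes "genable c F" "genable c H"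
 shows "genable c (%N m w. AndP (F N m w) (H N m w))" "genable c (%N m w. OrP (F N m w) (H N m w))"
  "genable c (%N m w. SinceP (F N m w) (H N m w))"
proof -
 obtain g h where "ALL N m w. enc_ppltl c (F N m w) = out g N m w" "ALL N m w. enc_ppltl c (H N m w) = out h N m w"
  using assms by (auto simp: genable_def)
 then have "ALL N m w. out (Cat (Lit us) (Cat g h)) N m w = us @ enc_ppltl c (F N m w) @ enc_ppltl c (H N m w)" for us by simp
 then show "genable c (%N m w. AndP (F N m w) (H N m w))" "genable c (%N m w. OrP (F N m w) (H N m w))"
  "genable c (%N m w. SinceP (F N m w) (H N m w))"
  unfolding genable_def by (metis enc_ppltl.simps)+
qed

lemma concat_replicate_mult: "concat (replicate (k * n) us) = concat (replicate n (concat (replicate k us)))"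
 by (induction n) (auto simp: replicate_add)

lemma concat_map_const: "concat (map (%_. us) xs) = concat (replicate (length xs) us)"
 by (induction xs) auto

lemma genable_Ys_mult [intro]:
 assumes "genable c F"
 shows "genable c (%N m w. Ys (k * N) (F N m w))" "genable c (%N m w. Ys (k * m) (F N m w))"
proof -
 obtain g where g: "ALL N m w. enc_ppltl c (F N m w) = out g N m w" using assms by (auto simp: genable_def)
 let ?u = "Lit (concat (replicate k (enc_nat 4)))"
 have "ALL N m w. enc_ppltl c (Ys (k * N) (F N m w)) = out (Cat (Top ?u) g) N m w"
  by (simp add: enc_Ys g concat_replicate_mult)
 then show "genable c (%N m w. Ys (k * N) (F N m w))" unfolding genable_def by blast
 have "ALL N m w. enc_ppltl c (Ys (k * m) (F N m w)) = out (Cat (For ?u) g) N m w"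
  by (simp add: enc_Ys g concat_replicate_mult concat_map_const del: upt_Suc)
 then show "genable c (%N m w. Ys (k * m) (F N m w))" unfolding genable_def by blast
qed

lemma genable_OrL [intro]:
 assumes "!!x. x \<in> set xs ==> genable c (F x)"
 shows "genable c (%N m w. blocks.OrL p0 (map (%x. F x N m w) xs))"
 using assms
proof (induction xs)
 case Nil
 show ?case unfolding list.map blocks.OrL.simps by (rule genable_const)
next
 case (Cons x xs)
 then show ?case unfolding list.map blocks.OrL.simps by (intro genable_binary) auto
qed

text \<open>A conjunction along successive places whose conjuncts depend on the number
  \<open>v\<close> of places still to come: this is what a counting-down loop prints.\<close>

fun chain :: "(nat => 'a ppltl) => nat => 'a ppltl => nat => 'a ppltl" where
 "chain F k fm 0 = fm"
| "chain F k fm (Suc v) = AndP (F (Suc v)) (Ys k (chain F k fm v))"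

lemma genable_chain [intro]:
 assumes "genable c F"
 shows "genable c (%N m w. chain (%v. F N v w) k fm m)"
proof -
 obtain g where g: "ALL N m w. enc_ppltl c (F N m w) = out g N m w" using assms by (auto simp: genable_def)
 let ?g = "Cat (For (Cat (Lit (enc_nat 2)) (Cat g (Lit (concat (replicate k (enc_nat 4))))))) (Lit (enc_ppltl c fm))"
 have "enc_ppltl c (chain (%v. F N v w) k fm m) = out ?g N m w" for N m w
  by (induction m) (simp_all add: g enc_Ys)
 then show ?thesis unfolding genable_def by blast
qed

fun ichain :: "(bool => 'a ppltl) => ('a ppltl => 'a ppltl) => 'a ppltl => bool list => 'a ppltl" where
 "ichain F k fm [] = fm"
| "ichain F k fm (x # v) = AndP (F x) (k (ichain F k fm v))"

lemma genable_ichain [intro]: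
 assumes "!!fm. enc_ppltl c (k fm) = us @ enc_ppltl c fm"
 shows "genable c (%N m w. ichain F k fm w)" "genable c (%N m w. ichain F k fm (rev w))"
proof -
 let ?g = "%d. Cat (Inp d (%x. enc_nat 2 @ enc_ppltl c (F x) @ us)) (Lit (enc_ppltl c fm))"
 have *: "enc_ppltl c (ichain F k fm v) = concat (map (%x. enc_nat 2 @ enc_ppltl c (F x) @ us) v) @ enc_ppltl c fm" for v
  by (induction v) (simp_all add: assms)
 have "ALL N m w. enc_ppltl c (ichain F k fm w) = out (?g False) N m w" "ALL N m w. enc_ppltl c (ichain F k fm (rev w)) = out (?g True) N m w"
  by (simp_all add: *)
 then show "genable c (%N m w. ichain F k fm w)" "genable c (%N m w. ichain F k fm (rev w))"
  unfolding genable_def by blast+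
qed

lemma genable_plus_quantifiers [intro]:
 assumes "genable c F"
 shows "genable_plus c (%N m w. AllQ (F N m w))" "genable_plus c (%N m w. ExQ (F N m w))"
proof -
 obtain g where "ALL N m w. enc_ppltl c (F N m w) = out g N m w" using assms by (auto simp: genable_def)
 then have "ALL N m w. out (Cat (Lit us) g) N m w = us @ enc_ppltl c (F N m w)" for us by simp
 then show "genable_plus c (%N m w. AllQ (F N m w))" "genable_plus c (%N m w. ExQ (F N m w))"
  unfolding genable_plus_def enc_ppltl_plus_def by (metis enc_plus.simps)+
qed

lemma genable_plus_and [intro]:
 assumes "genable_plus c F" "genable_plus c H"
 shows "genable_plus c (%N m w. AndQ (F N m w) (H N m w))"
proof -
 obtain g h where "ALL N m w. enc_ppltl_plus c (F N m w) = out g N m w" "ALL N m w. enc_ppltl_plus c (H N m w) = out h N m w"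
  using assms by (auto simp: genable_plus_def)
 then have "ALL N m w. enc_ppltl_plus c (AndQ (F N m w) (H N m w)) = out (Cat (Lit (enc_nat 5)) (Cat g h)) N m w"
  by (simp add: enc_ppltl_plus_def)
 then show ?thesis unfolding genable_plus_def by blast
qed

section \<open>PSPACE-hardness: tilings of polynomial width in PPLTL+\<close>

section \<open>Tilings as \<open>PPLTL\<^sup>+\<close> formulas\<close>

context tiles
begin

lemma finite_valid: "finite {a. valid a}"
proof (rule finite_subset)
 let ?S = "(UNIV :: bool set) \<times> {..<4::nat} \<times> {..<num_control M} \<times> {xs. set xs \<subseteq> {..<num_symbols M} & length xs = kt} \<times>
  {xs. set xs \<subseteq> {..<num_symbols M} \<times> {..<3::nat} & length xs = kt}"
 show "finite ((%(r, ph, q, ss, cs). \<lparr>lr = r, lph = ph, lq = q, lss = ss, lcs = cs\<rparr>) ` ?S)"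
  by (intro finite_imageI finite_cartesian_product finite_lists_length_eq) auto
 show "{a. valid a} \<subseteq> (%(r, ph, q, ss, cs). \<lparr>lr = r, lph = ph, lq = q, lss = ss, lcs = cs\<rparr>) ` ?S"
 proof
  fix a assume "a \<in> {a. valid a}"
  then show "a \<in> (%(r, ph, q, ss, cs). \<lparr>lr = r, lph = ph, lq = q, lss = ss, lcs = cs\<rparr>) ` ?S"
   by (intro image_eqI[of _ _ "(lr a, lph a, lq a, lss a, lcs a)"]) (auto simp: valid_def)
 qed
qed

definition ls :: "letter list" where
 "ls = (SOME l. set l = {a. valid a})"

lemma set_ls: "set ls = {a. valid a}"
 unfolding ls_def using finite_list[OF finite_valid] by (rule someI_ex)

abbreviation "G \<equiv> length ls"

definition sel :: "(letter => bool) => nat list" where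
 "sel P = filter (%g. P (ls ! g)) [0..<G]"

lemma set_sel: "set (sel P) = {g. g < G & P (ls ! g)}" "set (sel P) \<subseteq> {..<G}"
 by (auto simp: sel_def)

lemma tiling_numbered: "(EX x. tiling w W x) \<longleftrightarrow> (EX z. (ALL p. z p < G) & tiling w W (%p. ls ! z p))"
proof
 assume "EX x. tiling w W x"
 then obtain x where x: "tiling w W x" by blast
 then have "ALL p. x p \<in> set ls" by (simp add: set_ls tiling_def)
 then have "ALL p. EX g. g < G & x p = ls ! g" by (metis in_set_conv_nth)
 then obtain z where z: "ALL p. z p < G & x p = ls ! z p" by metis
 then have "x = (%p. ls ! z p)" by auto
 then show "EX z. (ALL p. z p < G) & tiling w W (%p. ls ! z p)" using x z by auto
qed blast

text \<open>The alphabet depends on the machine only, so this list of forbidden patterns contributes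
  a constant factor to the formulas.\<close>

definition bad :: "(nat \<times> nat \<times> nat \<times> nat) list" where
 "bad = filter (%(g1, g2, g3, g4). ~ local_ok (ls ! g1) (ls ! g2) (ls ! g3) (ls ! g4))
 (List.product [0..<G] (List.product [0..<G] (List.product [0..<G] [0..<G])))"

lemma set_bad: "(g1, g2, g3, g4) \<in> set bad \<longleftrightarrow> g1 < G & g2 < G & g3 < G & g4 < G &
  ~ local_ok (ls ! g1) (ls ! g2) (ls ! g3) (ls ! g4)"
 by (auto simp: bad_def)

end

context blocks
begin

definition ps :: "nat => nat" where
 "ps p = bl * Suc p - 1"

definition shift :: "nat => 'a ppltl => 'a ppltl" where
 "shift k fm = Ys (bl * k) fm"

lemma holds_shift [simp]: "ppltl_holds t (ps p) (shift k fm) \<longleftrightarrow> k <= p & ppltl_holds t (ps (p - k)) fm"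
 unfolding ps_def shift_def by (rule holds_Ys_pos)

lemma ps_eq [simp]: "ps p = ps q \<longleftrightarrow> p = q"
 unfolding ps_def by (rule pos_inj)

lemma ps_le [simp]: "ps p <= ps q \<longleftrightarrow> p <= q"
proof -
 have "0 < bl * Suc p" "0 < bl * Suc q" by simp_all
 then have "ps p <= ps q \<longleftrightarrow> bl * Suc p <= bl * Suc q" unfolding ps_def by linarith
 also have "\<dots> \<longleftrightarrow> p <= q" by (metis Suc_le_mono mult_le_cancel1 zero_less_Suc add_Suc_right numeral_eq_Suc)
 finally show ?thesis .
qed

lemma ps_start: "bl - 1 <= ps p & ps p - (bl - 1) = 0 \<longleftrightarrow> p = 0"
proof -
 have "ps 0 = bl - 1" by (simp add: ps_def)
 then show ?thesis using ps_le[of 0 p] ps_le[of p 0] by auto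
qed

lemma genable_shift [intro]:
 assumes "genable c F"
 shows "genable c (%N m w. shift k (F N m w))" "genable c (%N m w. shift N (F N m w))" "genable c (%N m w. shift m (F N m w))"
 unfolding shift_def using assms by (intro genable_unary genable_Ys_mult; assumption)+

lemma holds_Lt:
 assumes "coded A (%j. p0 \<in> ta j) z" "i < m" "g < A"
 shows "ppltl_holds (pre ta m) i (LtP g) \<longleftrightarrow> (EX p. i = ps p & z p = g)"
 unfolding ps_def using holds_LtP_coded[OF assms] .

lemma holds_LS:
 assumes "coded A (%j. p0 \<in> ta j) z" "i < m" "set gs \<subseteq> {..<A}"
 shows "ppltl_holds (pre ta m) i (LS gs) \<longleftrightarrow> (EX p. i = ps p & z p \<in> set gs)"
 unfolding ps_def using holds_LS_coded[OF assms] .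

lemma holds_ichain_shift:
 assumes "coded A (%j. p0 \<in> ta j) z" "!!x. set (f x) \<subseteq> {..<A}" "set gs \<subseteq> {..<A}" "ps p < m"
 shows "ppltl_holds (pre ta m) (ps p) (ichain (%x. LS (f x)) (shift 1) (LS gs) v) \<longleftrightarrow>
  length v <= p & (\<forall>i<length v. z (p - i) \<in> set (f (v ! i))) & z (p - length v) \<in> set gs"
 using assms(4)
proof (induction v arbitrary: p)
 case Nil
 then show ?case using holds_LS[OF assms(1) Nil assms(3)] by simp
next
 case (Cons x v)
 have lt: "ps (p - 1) < m" using Cons.prems ps_le[of "p - 1" p] by linarith
 have *: "(\<forall>j<Suc n. Q j) \<longleftrightarrow> Q 0 & (\<forall>j<n. Q (Suc j))" for Q and n :: nat
  by (auto simp: less_Suc_eq_0_disj)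
 show ?case using Cons.IH[OF lt] holds_LS[OF assms(1) Cons.prems assms(2)] by (cases p) (auto simp: *)
qed

end

locale tile_blocks = tiles M for M +
 fixes p0 :: 'a
begin

sublocale blocks p0 "length (tiles.ls M)" .

text \<open>The width is polynomial, so the cell one row earlier can be addressed by nested
  yesterdays; no forbidden pattern may end at the present block.\<close>

definition locF :: "nat => 'a ppltl" where
 "locF N = NotP (OrL (map (%x. case x of (g1, g2, g3, g4) =>
   AndP (LtP g4) (AndP (shift 1 (LtP g3)) (shift N (AndP (LtP g2) (shift 1 (LtP g1)))))) bad))"

definition rowF :: "nat => 'a ppltl" where
 "rowF N = NotP (OrP (AndP (LS (sel lr)) (NotP (OrP (Ys (bl - 1) Start) (shift N (LS (sel lr))))))
   (AndP (LS (sel (%a. ~ lr a))) (OrP (Ys (bl - 1) Start) (shift N (LS (sel lr))))))"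

text \<open>The initial row is matched backwards from the cell after the input, hence
  \<open>rev w\<close>.\<close>

definition inpF :: "bool list => 'a ppltl" where
 "inpF w = AndP (LS (sel (%a. lph a = 2)))
   (shift 1 (ichain (%x. LS (sel (%a. lph a = 1 & sy a 0 = bit_symbol x))) (shift 1) (LS (sel (%a. lph a = 0))) (rev w)))"

definition formP :: "nat => bool list => 'a ppltl plus" where
 "formP N w = AndQ (AllQ WFP) (AndQ (AllQ (locF N)) (AndQ (AllQ (rowF N))
   (AndQ (ExQ (inpF w)) (ExQ (LS (sel (%a. lq a = accept M)))))))"

lemma genable_formP: "genable_plus c (%N m w. formP N w)"
proof -
 have "genable c (%N m w. case x of (g1, g2, g3, g4) =>
   AndP (LtP g4) (AndP (shift 1 (LtP g3)) (shift N (AndP (LtP g2) (shift 1 (LtP g1))))))" for x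
  by (cases x) (simp, intro genable_const genable_binary genable_shift)
 then have "genable c (%N m w. locF N)"
  unfolding locF_def by (intro genable_unary genable_OrL)
 moreover have "genable c (%N m w. rowF N)"
  unfolding rowF_def by (intro genable_const genable_unary(1) genable_binary genable_shift(2))
 moreover have "genable c (%N m w. inpF w)"
  unfolding inpF_def
  by (intro genable_const genable_binary genable_shift genable_ichain[where us = "concat (replicate (bl * 1) (enc_nat 4))"])
   (simp add: shift_def enc_Ys)
 ultimately show ?thesis unfolding formP_def by (intro genable_plus_and genable_plus_quantifiers genable_const)
qed

context
 fixes ta :: "nat => 'a set" and z :: "nat => nat"
 assumes y: "coded G (%j. p0 \<in> ta j) z"
begin

lemma zG: "z p < G"
 using y by (simp add: coded_def)

lemma holds_sel: "i < m ==> ppltl_holds (pre ta m) i (LS (sel P)) \<longleftrightarrow> (EX p. i = ps p & P (ls ! z p))"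
 using holds_LS[OF y _ set_sel(2)] zG by (auto simp: set_sel)

lemma holds_locF: "ppltl_holds (pre ta (Suc i)) i (locF W) \<longleftrightarrow>
  (ALL p. i = ps (p + W + 1) --> local_ok (ls ! z p) (ls ! z (p + 1)) (ls ! z (p + W)) (ls ! z (p + W + 1)))"
proof (cases "EX q. i = ps q")
 case False
 have "~ ppltl_holds (pre ta (Suc i)) i (LtP g)" if "g < G" for g using holds_Lt[OF y lessI that] False by blast
 then have "ppltl_holds (pre ta (Suc i)) i (locF W)" by (auto simp: locF_def set_bad simp del: upt_Suc)
 then show ?thesis using False by blast
next
 case True
 then obtain q where q: "i = ps q" by blast
 have L: "ppltl_holds (pre ta (Suc i)) (ps p) (LtP g) \<longleftrightarrow> z p = g" if "p <= q" "g < G" for p g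
  using holds_Lt[OF y _ that(2), of "ps p" "Suc i"] that(1) q by (simp add: less_Suc_eq_le del: upt_Suc)
 have E: "ppltl_holds (pre ta (Suc i)) i (case x of (g1, g2, g3, g4) =>
   AndP (LtP g4) (AndP (shift 1 (LtP g3)) (shift W (AndP (LtP g2) (shift 1 (LtP g1)))))) \<longleftrightarrow>
   1 <= q & W <= q & 1 <= q - W & (z (q - W - 1), z (q - W), z (q - 1), z q) = x" if "x \<in> set bad" for x
 proof -
  obtain g1 g2 g3 g4 where x: "x = (g1, g2, g3, g4)" by (cases x)
  then have "g1 < G" "g2 < G" "g3 < G" "g4 < G" using that by (auto simp: set_bad)
  then show ?thesis by (auto simp: x q L[unfolded q] simp del: upt_Suc)
 qed
 have "ppltl_holds (pre ta (Suc i)) i (locF W) \<longleftrightarrow>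
   ~ (1 <= q & W <= q & 1 <= q - W & (z (q - W - 1), z (q - W), z (q - 1), z q) \<in> set bad)"
  unfolding locF_def ppltl_holds.simps holds_OrL using E by auto
 also have "\<dots> \<longleftrightarrow> (ALL p. q = p + W + 1 --> local_ok (ls ! z p) (ls ! z (p + 1)) (ls ! z (p + W)) (ls ! z (p + W + 1)))"
 proof
  assume *: "~ (1 <= q & W <= q & 1 <= q - W & (z (q - W - 1), z (q - W), z (q - 1), z q) \<in> set bad)"
  show "ALL p. q = p + W + 1 --> local_ok (ls ! z p) (ls ! z (p + 1)) (ls ! z (p + W)) (ls ! z (p + W + 1))"
   using * zG by (auto simp: set_bad)
 next
  assume *: "ALL p. q = p + W + 1 --> local_ok (ls ! z p) (ls ! z (p + 1)) (ls ! z (p + W)) (ls ! z (p + W + 1))"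
  show "~ (1 <= q & W <= q & 1 <= q - W & (z (q - W - 1), z (q - W), z (q - 1), z q) \<in> set bad)"
  proof
   assume a: "1 <= q & W <= q & 1 <= q - W & (z (q - W - 1), z (q - W), z (q - 1), z q) \<in> set bad"
   then have "q = q - W - 1 + W + 1" "q - W - 1 + 1 = q - W" "q - W - 1 + W = q - 1" by auto
   then show False using *[THEN spec, of "q - W - 1"] a by (auto simp: set_bad simp del: One_nat_def diff_diff_left)
  qed
 qed
 finally show ?thesis by (simp add: q)
qed

lemma holds_rowF: "ppltl_holds (pre ta (Suc i)) i (rowF W) \<longleftrightarrow>
  (ALL q. i = ps q --> (lr (ls ! z q) \<longleftrightarrow> q = 0 \<or> W <= q & lr (ls ! z (q - W))))"
proof (cases "EX q. i = ps q")
 case False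
 then show ?thesis using holds_sel[OF lessI, of i] by (auto simp: rowF_def simp del: upt_Suc)
next
 case True
 then obtain q where q: "i = ps q" by blast
 have L: "ppltl_holds (pre ta (Suc i)) (ps p) (LS (sel P)) \<longleftrightarrow> P (ls ! z p)" if "p <= q" for p P
  using holds_sel[of "ps p" "Suc i"] that q by (simp add: less_Suc_eq_le del: upt_Suc)
 have S: "ppltl_holds (pre ta (Suc i)) (ps q) (Ys (bl - 1) Start) \<longleftrightarrow> q = 0"
  unfolding holds_Ys holds_Start by (rule ps_start)
 show ?thesis unfolding rowF_def ppltl_holds.simps q
  using S[unfolded q] L[unfolded q, of q] L[unfolded q, of "q - W"] by (auto simp del: upt_Suc holds_Ys)
qed

lemma holds_inpF: "ppltl_holds (pre ta (Suc i)) i (inpF w) \<longleftrightarrow>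
  (EX p. i = ps (p + 1 + length w) & lph (ls ! z p) = 0 &
   (\<forall>j<length w. lph (ls ! z (p + 1 + j)) = 1 & sy (ls ! z (p + 1 + j)) 0 = bit_symbol (w ! j)) &
   lph (ls ! z (p + 1 + length w)) = 2)"
proof (cases "EX q. i = ps q")
 case False
 then show ?thesis using holds_sel[OF lessI, of i] by (auto simp: inpF_def simp del: upt_Suc)
next
 case True
 then obtain q where q: "i = ps q" by blast
 let ?n = "length w"
 have lt: "ps (q - 1) < Suc i" using ps_le[of "q - 1" q] q by linarith
 have "ppltl_holds (pre ta (Suc i)) i (inpF w) \<longleftrightarrow> lph (ls ! z q) = 2 & 1 <= q & ?n <= q - 1 &
   (\<forall>j<?n. lph (ls ! z (q - 1 - j)) = 1 & sy (ls ! z (q - 1 - j)) 0 = bit_symbol (rev w ! j)) & lph (ls ! z (q - 1 - ?n)) = 0"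
  unfolding inpF_def ppltl_holds.simps q holds_shift
  using holds_ichain_shift[OF y set_sel(2) set_sel(2) lt, unfolded q] holds_sel[of "ps q" "Suc (ps q)"] zG
  by (auto simp: set_sel simp del: upt_Suc)
 also have "\<dots> \<longleftrightarrow> (EX p. q = p + 1 + ?n & lph (ls ! z p) = 0 &
   (\<forall>j<?n. lph (ls ! z (p + 1 + j)) = 1 & sy (ls ! z (p + 1 + j)) 0 = bit_symbol (w ! j)) & lph (ls ! z (p + 1 + ?n)) = 2)"
 proof -
  have re: "(\<forall>j<?n. R (p + ?n - j) (rev w ! j)) \<longleftrightarrow> (\<forall>j<?n. R (p + 1 + j) (w ! j))" for p R
  proof (intro iffI allI impI)
   fix j assume *: "\<forall>j<?n. R (p + ?n - j) (rev w ! j)" and j: "j < ?n"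
   have e: "p + ?n - (?n - 1 - j) = p + 1 + j" "rev w ! (?n - 1 - j) = w ! j" using j by (auto simp: rev_nth)
   have "R (p + ?n - (?n - 1 - j)) (rev w ! (?n - 1 - j))" by (rule *[rule_format]) (use j in simp)
   then show "R (p + 1 + j) (w ! j)" unfolding e .
  next
   fix j assume *: "\<forall>j<?n. R (p + 1 + j) (w ! j)" and j: "j < ?n"
   have e: "p + 1 + (?n - 1 - j) = p + ?n - j" "w ! (?n - 1 - j) = rev w ! j" using j by (auto simp: rev_nth)
   have "R (p + 1 + (?n - 1 - j)) (w ! (?n - 1 - j))" by (rule *[rule_format]) (use j in simp)
   then show "R (p + ?n - j) (rev w ! j)" unfolding e .
  qed
  show ?thesis
  proof (cases "1 <= q & ?n <= q - 1")
   case False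
   then show ?thesis by auto
  next
   case True
   then obtain p where p: "q = p + 1 + ?n" by (metis add.commute le_Suc_ex add.left_commute le_add_diff_inverse)
   have "(EX p'. q = p' + 1 + ?n & Q p') \<longleftrightarrow> Q p" for Q using p by auto
   then show ?thesis using re[of "%a b. lph (ls ! z a) = 1 & sy (ls ! z a) 0 = bit_symbol b" p] p by auto
  qed
 qed
 finally show ?thesis by (simp add: q)
qed

end

lemma dvd_rows:
 fixes W :: nat
 assumes W: "0 < W"
 shows "(ALL q. r q \<longleftrightarrow> q = 0 \<or> W <= q & r (q - W)) \<longleftrightarrow> (ALL q. r q \<longleftrightarrow> W dvd q)"
proof -
 have d: "W dvd q \<longleftrightarrow> q = 0 \<or> W <= q & W dvd (q - W)" for q
  using dvd_imp_le[of W q] by (cases "W <= q") (auto simp: dvd_minus_self)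
 show ?thesis
 proof
  assume *: "ALL q. r q \<longleftrightarrow> q = 0 \<or> W <= q & r (q - W)"
  have "r q \<longleftrightarrow> W dvd q" for q
  proof (induction q rule: less_induct)
   case (less q)
   have e: "r q \<longleftrightarrow> q = 0 \<or> W <= q & r (q - W)" "W dvd q \<longleftrightarrow> q = 0 \<or> W <= q & W dvd (q - W)"
   by (rule *[rule_format], rule d)
   have "q ~= 0 ==> r (q - W) \<longleftrightarrow> W dvd (q - W)" using less[of "q - W"] W by simp
   then show ?case by (subst e(1), subst e(2)) blast
  qed
  then show "ALL q. r q \<longleftrightarrow> W dvd q" by blast
 next
  assume "ALL q. r q \<longleftrightarrow> W dvd q"
  then have e: "r = (%q. W dvd q)" by auto
  show "ALL q. r q \<longleftrightarrow> q = 0 \<or> W <= q & r (q - W)" unfolding e by (intro allI d)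
 qed
qed

text \<open>\<open>WFP\<close> makes the trace a coded sequence of letters, and for such a trace
  each further conjunct is one clause of \<open>tiling\<close>.\<close>

theorem formP_satisfiable:
 assumes W: "0 < W"
 shows "plus_lang ppltl_lang (formP W w) ~= {} \<longleftrightarrow> (EX x. tiling w W x)"
proof -
 have *: "ta \<in> plus_lang ppltl_lang (formP W w) \<longleftrightarrow> tiling w W (%p. ls ! z p)" if y: "coded G (%j. p0 \<in> ta j) z" for ta z
 proof -
  have 1: "ta \<in> plus_lang ppltl_lang (AllQ WFP)" unfolding plus_lang_quantifiers wfp_iff using y by blast
  have 2: "ta \<in> plus_lang ppltl_lang (AllQ (locF W)) \<longleftrightarrow>
   (ALL p. local_ok (ls ! z p) (ls ! z (p + 1)) (ls ! z (p + W)) (ls ! z (p + W + 1)))"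
   unfolding plus_lang_quantifiers holds_locF[OF y] by blast
  have 3: "ta \<in> plus_lang ppltl_lang (AllQ (rowF W)) \<longleftrightarrow> (ALL p. lr (ls ! z p) \<longleftrightarrow> W dvd p)"
   unfolding plus_lang_quantifiers holds_rowF[OF y] dvd_rows[OF W, of "%p. lr (ls ! z p)", symmetric] by blast
  have 4: "ta \<in> plus_lang ppltl_lang (ExQ (inpF w)) \<longleftrightarrow> (EX p. lph (ls ! z p) = 0 &
   (\<forall>j<length w. lph (ls ! z (p + 1 + j)) = 1 & sy (ls ! z (p + 1 + j)) 0 = bit_symbol (w ! j)) &
   lph (ls ! z (p + 1 + length w)) = 2)"
   unfolding plus_lang_quantifiers holds_inpF[OF y] by blast
  have 5: "ta \<in> plus_lang ppltl_lang (ExQ (LS (sel (%a. lq a = accept M)))) \<longleftrightarrow> (EX p. lq (ls ! z p) = accept M)"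
   unfolding plus_lang_quantifiers holds_sel[OF y lessI] by blast
  have 6: "valid (ls ! z p)" for p using zG[OF y, of p] nth_mem[of "z p" ls] set_ls by auto
  show ?thesis unfolding formP_def plus_lang.simps(6) Int_iff 2 3 4 5 tiling_def using 1 6 by blast
 qed
 show ?thesis
 proof
  assume "plus_lang ppltl_lang (formP W w) ~= {}"
  then obtain ta where ta: "ta \<in> plus_lang ppltl_lang (formP W w)" by blast
  then have "ta \<in> plus_lang ppltl_lang (AllQ WFP)" by (simp add: formP_def)
  then obtain z where "coded G (%j. p0 \<in> ta j) z" unfolding plus_lang_quantifiers wfp_iff by blast
  then show "EX x. tiling w W x" using * ta by blast
 next
  assume "EX x. tiling w W x"
  then obtain z where z: "ALL p. z p < G" "tiling w W (%p. ls ! z p)" unfolding tiling_numbered by blast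
  define y where "y i = cw G (z (i div bl)) ! (i mod bl)" for i
  have "coded G y z" using coded_exists[OF z(1)] unfolding y_def .
  moreover have "y = (%j. p0 \<in> (if y j then {p0} else {}))" by auto
  ultimately have "coded G (%j. p0 \<in> (if y j then {p0} else {})) z" by simp
  then show "plus_lang ppltl_lang (formP W w) ~= {}" using *[of "%j. if y j then {p0} else {}" z] z(2) by blast
 qed
qed

end

section \<open>Reading blocks with future formulas on prefixes\<close>

section \<open>Tilings as \<open>LTLf\<^sup>+\<close> formulas\<close>

text \<open>By \<open>ltlf_problems\<close>, \<open>LTLf\<close> may be read as \<open>PPLTL\<close> on reversed prefixes; \<open>fh ta m i\<close> is truth
 at position \<open>i\<close> of the prefix of length \<open>m\<close> under this reading, where \<open>YesterdayP\<close> and \<open>SinceP\<close>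
 look forward.\<close>

definition fh :: "(nat => 'a set) => nat => nat => 'a ppltl => bool" where
 "fh ta m i fm = ppltl_holds (rev (pre ta m)) (m - 1 - i) fm"

lemma fh_bool [simp]:
 "fh ta m i (NotP fm) \<longleftrightarrow> ~ fh ta m i fm" "fh ta m i (AndP fm fn2) \<longleftrightarrow> fh ta m i fm & fh ta m i fn2"
 "fh ta m i (OrP fm fn2) \<longleftrightarrow> fh ta m i fm \<or> fh ta m i fn2"
 by (simp_all add: fh_def)

lemma fh_Ys: "i < m ==> fh ta m i (Ys n fm) \<longleftrightarrow> i + n < m & fh ta m (i + n) fm"
proof -
 assume "i < m"
 then have "n <= m - 1 - i \<longleftrightarrow> i + n < m" "m - 1 - i - n = m - 1 - (i + n)" by auto
 then show ?thesis unfolding fh_def holds_Ys by (simp only:)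
qed

lemma fh_Y: "i < m ==> fh ta m i (YesterdayP fm) \<longleftrightarrow> i + 1 < m & fh ta m (i + 1) fm"
 using fh_Ys[of i m ta 1 fm] by (simp add: Ys_def)

lemma fh_Since:
 assumes i: "i < m"
 shows "fh ta m i (SinceP fm fn2) \<longleftrightarrow> (EX j. i <= j & j < m & fh ta m j fn2 & (ALL k. i <= k & k < j --> fh ta m k fm))"
proof
 assume "fh ta m i (SinceP fm fn2)"
 then obtain j where j: "j <= m - 1 - i" "ppltl_holds (rev (pre ta m)) j fn2"
  "!!k. j < k ==> k <= m - 1 - i ==> ppltl_holds (rev (pre ta m)) k fm" by (auto simp: fh_def)
 have e: "m - 1 - (m - 1 - j) = j" using j(1) by auto
 have "fh ta m (m - 1 - j) fn2" unfolding fh_def e by (rule j(2))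
 moreover have "fh ta m k fm" if "i <= k" "k < m - 1 - j" for k
  unfolding fh_def using that by (intro j(3)) auto
 ultimately show "EX j. i <= j & j < m & fh ta m j fn2 & (ALL k. i <= k & k < j --> fh ta m k fm)"
  using i j(1) by (intro exI[of _ "m - 1 - j"]) auto
next
 assume "EX j. i <= j & j < m & fh ta m j fn2 & (ALL k. i <= k & k < j --> fh ta m k fm)"
 then obtain j where j: "i <= j" "j < m" "fh ta m j fn2" "!!k. i <= k ==> k < j ==> fh ta m k fm" by blast
 have "ppltl_holds (rev (pre ta m)) k fm" if "m - 1 - j < k" "k <= m - 1 - i" for k
 proof -
  have "m - 1 - (m - 1 - k) = k" using that by auto
  then show ?thesis using j(4)[of "m - 1 - k"] that j(2) unfolding fh_def by auto
 qed
 then show "fh ta m i (SinceP fm fn2)"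
  unfolding fh_def ppltl_holds.simps using j(1,3) by (intro exI[of _ "m - 1 - j"]) (auto simp: fh_def)
qed

lemma plus_lang_rev_quantifiers:
 "ta \<in> plus_lang rev_lang (AllQ fm) \<longleftrightarrow> (\<forall>m>0. fh ta m 0 fm)"
 "ta \<in> plus_lang rev_lang (ExQ fm) \<longleftrightarrow> (\<exists>m>0. fh ta m 0 fm)"
 unfolding plus_lang.simps quantifiers_iff by (auto simp: rev_lang_def ppltl_lang_def fh_def)

context blocks
begin

lemma fh_TT [simp]: "fh ta m i TT"
 by (simp add: fh_def)

lemma fh_OrL [simp]: "fh ta m i (OrL l) \<longleftrightarrow> (\<exists>fm\<in>set l. fh ta m i fm)"
 by (simp add: fh_def)

definition EvF :: "'a ppltl => 'a ppltl" where
 "EvF fm = SinceP TT fm"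

lemma fh_EvF: "i < m ==> fh ta m i (EvF fm) \<longleftrightarrow> (EX j. i <= j & j < m & fh ta m j fm)"
 by (simp add: EvF_def fh_Since)

definition LtF :: "nat => 'a ppltl" where
 "LtF g = LT (cw A g)"

definition LF :: "nat list => 'a ppltl" where
 "LF gs = OrL (map LtF gs)"

lemma fh_LtF:
 assumes i: "i < m"
 shows "fh ta m i (LtF g) \<longleftrightarrow> i + bl <= m & blk A (%j. p0 \<in> ta j) i g"
proof -
 have ne: "cw A g ~= []" by (simp add: cw_def)
 have nth: "rev (pre ta m) ! (m - 1 - i - j) = ta (i + j)" if "j < bl" "i + bl <= m" for j
  using that by (simp add: rev_nth)
 have "fh ta m i (LtF g) \<longleftrightarrow> i + bl <= m & (\<forall>j<bl. (p0 \<in> rev (pre ta m) ! (m - 1 - i - j)) = cw A g ! j)"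
 proof -
  have "bl <= Suc (m - 1 - i) \<longleftrightarrow> i + bl <= m" using i by auto
  then show ?thesis unfolding fh_def LtF_def holds_LT[OF ne] length_cw by (simp only:)
 qed
 then show ?thesis using nth by (auto simp: blk_def)
qed

text \<open>The block starting here ends the prefix. The end of the prefix is the marker on which
  the comparison of distant cells rests.\<close>

definition LastB :: "'a ppltl" where
 "LastB = Ys (bl - 1) (NotP (YesterdayP TT))"

lemma fh_LastB: "i < m ==> fh ta m i LastB \<longleftrightarrow> i + bl = m"
proof -
 assume i: "i < m"
 have "fh ta m i LastB \<longleftrightarrow> i + (bl - 1) < m & ~ (i + (bl - 1) + 1 < m)"
  unfolding LastB_def fh_Ys[OF i] fh_bool using fh_Y[of "i + (bl - 1)" m ta TT] by auto
 also have "\<dots> \<longleftrightarrow> i + bl = m" by auto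
 finally show ?thesis .
qed

text \<open>Formulas looking forward are evaluated at the first position of a block, whereas
  \<open>ps\<close> is the last one.\<close>

definition st :: "nat => nat" where
 "st p = bl * p"

lemma st_less [simp]: "st p < st q \<longleftrightarrow> p < q" "st p <= st q \<longleftrightarrow> p <= q" "st p = st q \<longleftrightarrow> p = q"
 by (simp_all add: st_def)

lemma st_0: "st 0 = 0"
 by (simp add: st_def)

lemma st_Suc: "st p + bl = st (p + 1)"
 by (simp add: st_def)

lemma st_next: "st p + 1 <= st q \<longleftrightarrow> p < q"
 by (metis Suc_eq_plus1 Suc_le_eq st_less(1))

lemma fh_shift: "st p < m ==> fh ta m (st p) (shift k fm) \<longleftrightarrow> st (p + k) < m & fh ta m (st (p + k)) fm"
 unfolding shift_def by (subst fh_Ys) (auto simp: st_def distrib_left)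

lemma fh_chain:
 "st p < m ==> fh ta m (st p) (chain F (bl * 1) TT v) \<longleftrightarrow> st (p + v) < m & (\<forall>j<v. fh ta m (st (p + j)) (F (v - j)))"
proof (induction v arbitrary: p)
 case (Suc v)
 have *: "(\<forall>j<Suc n. Q j) \<longleftrightarrow> Q 0 & (\<forall>j<n. Q (Suc j))" for Q and n :: nat
  by (auto simp: less_Suc_eq_0_disj)
 have "fh ta m (st p) (chain F (bl * 1) TT (Suc v)) \<longleftrightarrow>
   fh ta m (st p) (F (Suc v)) & st (p + 1) < m & fh ta m (st (p + 1)) (chain F (bl * 1) TT v)"
  using fh_shift[OF Suc.prems, of ta 1 "chain F (bl * 1) TT v"] by (simp add: shift_def)
 also have "\<dots> \<longleftrightarrow> fh ta m (st p) (F (Suc v)) & st (p + Suc v) < m & (\<forall>j<v. fh ta m (st (p + Suc j)) (F (v - j)))"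
 proof (cases "st (p + 1) < m")
  case True
  then show ?thesis using Suc.IH[OF True] by simp
 next
  case False
  moreover have "st (p + 1) <= st (p + Suc v)" by simp
  ultimately show ?thesis by linarith
 qed
 also have "\<dots> \<longleftrightarrow> st (p + Suc v) < m & (\<forall>j<Suc v. fh ta m (st (p + j)) (F (Suc v - j)))"
  unfolding * by auto
 finally show ?case .
qed simp

text \<open>A prefix may end inside a block, so a block is demanded only where enough positions
  remain, which is the purpose of the formulas \<open>Ys _ TT\<close>.\<close>

definition WFF :: "'a ppltl" where
 "WFF = AndP (NotP (AndP (Ys (bl - 1) TT) (NotP (LF [0..<A]))))
   (NotP (EvF (AndP (LF [0..<A]) (AndP (Ys (bl + bl - 1) TT) (NotP (Ys bl (LF [0..<A])))))))"

lemma wff_iff: "(\<forall>m>0. fh ta m 0 WFF) \<longleftrightarrow> (EX z. coded A (%j. p0 \<in> ta j) z)"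
proof
 assume *: "\<forall>m>0. fh ta m 0 WFF"
 let ?b = "%q. \<exists>g<A. blk A (%j. p0 \<in> ta j) q g"
 have L: "fh ta m i (LF [0..<A]) \<longleftrightarrow> i + bl <= m & ?b i" if "i < m" for i m
  using fh_LtF[OF that] by (auto simp: LF_def)
 have a: "fh ta m 0 (Ys (bl - 1) TT) ==> fh ta m 0 (LF [0..<A])"
  and c: "i < m ==> fh ta m i (LF [0..<A]) ==> fh ta m i (Ys (bl + bl - 1) TT) ==> fh ta m i (Ys bl (LF [0..<A]))"
  if m: "0 < m" for m i
  using *[rule_format, OF m] unfolding WFF_def fh_bool fh_EvF[OF m] by blast+
 show "EX z. coded A (%j. p0 \<in> ta j) z"
 proof (rule coded_eqI)
  have "fh ta bl 0 (Ys (bl - 1) TT)" by (simp add: fh_Ys)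
  then show "?b 0" using a[of bl] L[of 0 bl] by simp
  show "?b (q + bl)" if q: "?b q" for q
  proof -
   let ?m = "q + bl + bl"
   have m: "0 < ?m" "q < ?m" "q + bl <= ?m" "q + (bl + bl - 1) < ?m" by simp_all
   have "fh ta ?m q (LF [0..<A])" using L[OF m(2)] m(3) q by blast
   moreover have "fh ta ?m q (Ys (bl + bl - 1) TT)" unfolding fh_Ys[OF m(2)] using m(4) by simp
   ultimately have "fh ta ?m q (Ys bl (LF [0..<A]))" by (rule c[OF m(1,2)])
   then show ?thesis using fh_Ys[OF m(2)] L by blast
  qed
 qed
next
 assume "EX z. coded A (%j. p0 \<in> ta j) z"
 then obtain z where y: "coded A (%j. p0 \<in> ta j) z" by blast
 then have zA: "z p < A" for p by (simp add: coded_def)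
 have L: "fh ta m i (LF [0..<A]) \<longleftrightarrow> i + bl <= m & (EX p. i = bl * p)" if "i < m" for i m
  using fh_LtF[OF that] coded_blk_iff[OF y] zA by (auto simp: LF_def)
 show "\<forall>m>0. fh ta m 0 WFF"
 proof (intro allI impI)
  fix m :: nat assume m: "0 < m"
  have "fh ta m 0 (LF [0..<A])" if "fh ta m 0 (Ys (bl - 1) TT)"
   using that m by (auto simp: L fh_Ys)
  moreover have "fh ta m i (Ys bl (LF [0..<A]))"
   if i: "i < m" and hL: "fh ta m i (LF [0..<A])" and hY: "fh ta m i (Ys (bl + bl - 1) TT)" for i
  proof -
   obtain p where p: "i = bl * p" using hL L[OF i] by blast
   have "i + (bl + bl - 1) < m" using hY fh_Ys[OF i] by blast
   then have lt: "i + bl < m" "i + bl + bl <= m" by simp_all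
   have "i + bl = bl * (p + 1)" by (simp add: p)
   then show ?thesis using L[OF lt(1)] lt fh_Ys[OF i] by blast
  qed
  ultimately show "fh ta m 0 WFF" unfolding WFF_def fh_bool fh_EvF[OF m] by blast
 qed
qed

lemma fh_Lt:
 assumes y: "coded A (%j. p0 \<in> ta j) z" and i: "i < m" and g: "g < A"
 shows "fh ta m i (LtF g) \<longleftrightarrow> (EX p. i = st p & z p = g & st (p + 1) <= m)"
 unfolding fh_LtF[OF i] coded_blk_iff[OF y g] st_Suc[symmetric] by (auto simp: st_def)

lemma fh_Lt_st:
 assumes y: "coded A (%j. p0 \<in> ta j) z" and i: "st q < m" and g: "g < A"
 shows "fh ta m (st q) (LtF g) \<longleftrightarrow> z q = g & st (q + 1) <= m"
 using fh_Lt[OF assms] by auto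

lemma fh_LF:
 assumes y: "coded A (%j. p0 \<in> ta j) z" and i: "i < m" and g: "set gs \<subseteq> {..<A}"
 shows "fh ta m i (LF gs) \<longleftrightarrow> (EX p. i = st p & z p \<in> set gs & st (p + 1) <= m)"
 using fh_Lt[OF y i] g by (auto simp: LF_def subset_iff)

lemma st_lt: "st p < st (p + 1)" "st (p + 1) <= m ==> st p < m"
 using st_less(1)[of p "p + 1"] by linarith+

lemma pairs_iff:
 assumes y: "coded A (%j. p0 \<in> ta j) z" and prs: "set prs \<subseteq> {..<A} \<times> {..<A}"
  and sh: "!!m p fm. st p < m ==> fh ta m (st p) (sh fm) \<longleftrightarrow> st (p + d) < m & fh ta m (st (p + d)) fm"
 shows "(\<forall>m>0. fh ta m 0 (NotP (EvF (OrL (map (%x. AndP (LtF (fst x)) (sh (LtF (snd x)))) prs))))) \<longleftrightarrow>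
  (ALL q. (z q, z (q + d)) \<notin> set prs)"
proof -
 have *: "fh ta m 0 (EvF (OrL (map (%x. AndP (LtF (fst x)) (sh (LtF (snd x)))) prs))) \<longleftrightarrow>
   (EX q. st (q + 1) <= m & st (q + d + 1) <= m & (z q, z (q + d)) \<in> set prs)" if m: "0 < m" for m
 proof
  assume "fh ta m 0 (EvF (OrL (map (%x. AndP (LtF (fst x)) (sh (LtF (snd x)))) prs)))"
  then obtain j g g' where j: "j < m" "(g, g') \<in> set prs" "fh ta m j (LtF g)" "fh ta m j (sh (LtF g'))"
   unfolding fh_EvF[OF m] by auto
  have g: "g < A" "g' < A" using prs j(2) by auto
  obtain q where q: "j = st q" "z q = g" "st (q + 1) <= m" using fh_Lt[OF y j(1) g(1)] j(3) by blast
  have "st (q + d) < m" "fh ta m (st (q + d)) (LtF g')" using sh[of q m "LtF g'"] j(1,4) q(1) by auto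
  then have "z (q + d) = g'" "st (q + d + 1) <= m" using fh_Lt_st[OF y _ g(2)] by auto
  then show "EX q. st (q + 1) <= m & st (q + d + 1) <= m & (z q, z (q + d)) \<in> set prs" using q j(2) by blast
 next
  assume "EX q. st (q + 1) <= m & st (q + d + 1) <= m & (z q, z (q + d)) \<in> set prs"
  then obtain q where q: "st (q + 1) <= m" "st (q + d + 1) <= m" "(z q, z (q + d)) \<in> set prs" by blast
  have g: "z q < A" "z (q + d) < A" using prs q(3) by auto
  have lt: "st q < m" "st (q + d) < m" using q st_lt(2) by blast+
  have "fh ta m (st q) (AndP (LtF (z q)) (sh (LtF (z (q + d)))))"
   unfolding fh_bool sh[OF lt(1)] fh_Lt_st[OF y lt(1) g(1)] fh_Lt_st[OF y lt(2) g(2)] using lt q by auto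
  then show "fh ta m 0 (EvF (OrL (map (%x. AndP (LtF (fst x)) (sh (LtF (snd x)))) prs)))"
   unfolding fh_EvF[OF m] fh_OrL using q(3) lt(1) by (intro exI[of _ "st q"]) force
 qed
 have "\<exists>m>0. st (q + 1) <= m & st (q + d + 1) <= m" for q
  by (intro exI[of _ "st (q + d + 1)"]) (simp add: st_def)
 then show ?thesis unfolding fh_bool using * by meson
qed

text \<open>The second conjunct excludes the last block of the prefix: in \<open>vertF\<close> that
  is the cell to the right of the compared one, and a row starting there must not be
  counted.\<close>

definition rowsB :: "nat list => 'a ppltl" where
 "rowsB gs = AndP (LF gs) (shift 1 TT)"

definition oneF :: "nat list => 'a ppltl" where
 "oneF gs = AndP (YesterdayP (EvF (rowsB gs))) (NotP (YesterdayP (EvF (AndP (rowsB gs) (YesterdayP (EvF (rowsB gs)))))))"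

lemma fh_oneF:
 assumes y: "coded A (%j. p0 \<in> ta j) z" and gs: "set gs \<subseteq> {..<A}" and q: "st q < m"
 shows "fh ta m (st q) (oneF gs) \<longleftrightarrow> (\<exists>s>q. z s \<in> set gs & st (s + 1) < m) &
  ~ (\<exists>s>q. z s \<in> set gs & st (s + 1) < m & (\<exists>s'>s. z s' \<in> set gs & st (s' + 1) < m))"
proof -
 have B: "fh ta m i (rowsB gs) \<longleftrightarrow> (EX p. i = st p & z p \<in> set gs & st (p + 1) < m)" if i: "i < m" for i
 proof
  assume "fh ta m i (rowsB gs)"
  then obtain p where p: "i = st p" "z p \<in> set gs" "fh ta m i (shift 1 TT)"
   unfolding rowsB_def fh_bool fh_LF[OF y i gs] by blast
  then show "EX p. i = st p & z p \<in> set gs & st (p + 1) < m" using fh_shift[of p m ta 1 TT] i by blast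
 next
  assume "EX p. i = st p & z p \<in> set gs & st (p + 1) < m"
  then obtain p where p: "i = st p" "z p \<in> set gs" "st (p + 1) < m" by blast
  then show "fh ta m i (rowsB gs)"
   unfolding rowsB_def fh_bool fh_LF[OF y i gs] using fh_shift[of p m ta 1 TT] i less_imp_le[OF p(3)] fh_TT by blast
 qed
 have Y: "fh ta m (st p) (YesterdayP (EvF fm)) \<longleftrightarrow> (\<exists>s>p. st s < m & fh ta m (st s) fm)"
  if p: "st p < m" and sts: "!!i. i < m ==> fh ta m i fm ==> EX s. i = st s" for p fm
 proof -
  have "fh ta m (st p) (YesterdayP (EvF fm)) \<longleftrightarrow> st p + 1 < m & (EX j. st p + 1 <= j & j < m & fh ta m j fm)"
   using fh_Y[OF p] fh_EvF[of "st p + 1" m ta fm] by blast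
  also have "\<dots> \<longleftrightarrow> (EX j. st p + 1 <= j & j < m & fh ta m j fm)" by auto
  also have "\<dots> \<longleftrightarrow> (\<exists>s>p. st s < m & fh ta m (st s) fm)"
  proof
   assume "EX j. st p + 1 <= j & j < m & fh ta m j fm"
   then obtain j where j: "st p + 1 <= j" "j < m" "fh ta m j fm" by blast
   then obtain s where "j = st s" using sts by blast
   then show "\<exists>s>p. st s < m & fh ta m (st s) fm" using j st_next[of p s] by auto
  next
   assume "\<exists>s>p. st s < m & fh ta m (st s) fm"
   then obtain s where "p < s" "st s < m" "fh ta m (st s) fm" by blast
   then show "EX j. st p + 1 <= j & j < m & fh ta m j fm"
   using st_next[of p s] by (intro exI[of _ "st s"]) simp
  qed
  finally show ?thesis .
 qed
 have S: "fh ta m (st p) (rowsB gs) \<longleftrightarrow> z p \<in> set gs & st (p + 1) < m" if "st p < m" for p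
  using B[OF that] by auto
 have lt: "st s < m" if "st (s + 1) < m" for s using that st_lt(1)[of s] by linarith
 have 1: "fh ta m (st p) (YesterdayP (EvF (rowsB gs))) \<longleftrightarrow> (\<exists>s>p. z s \<in> set gs & st (s + 1) < m)" if "st p < m" for p
  using Y[OF that, of "rowsB gs"] B S lt by blast
 have 2: "fh ta m (st q) (YesterdayP (EvF (AndP (rowsB gs) (YesterdayP (EvF (rowsB gs)))))) \<longleftrightarrow>
   (\<exists>s>q. z s \<in> set gs & st (s + 1) < m & (\<exists>s'>s. z s' \<in> set gs & st (s' + 1) < m))"
  using Y[OF q, of "AndP (rowsB gs) (YesterdayP (EvF (rowsB gs)))"] B S lt 1 unfolding fh_bool by blast
 show ?thesis unfolding oneF_def fh_bool 1[OF q] 2 ..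
qed

end

text \<open>Binary increment: bit \<open>j\<close> flips exactly when all lower bits are ones, that
  is, when \<open>2 ^ j\<close> divides the successor.\<close>

lemma odd_Suc_div: "odd (Suc p div 2 ^ j) \<longleftrightarrow> (odd (p div 2 ^ j) ~= (2 ^ j dvd Suc p))"
 by (cases "2 ^ j dvd Suc p") (simp_all add: div_Suc mod_eq_0_iff_dvd)

text \<open>The carry into bit \<open>j + 1\<close> is the carry into bit \<open>j\<close> together
  with bit \<open>j\<close> itself.\<close>

lemma pow_dvd_Suc: "2 ^ Suc j dvd Suc p \<longleftrightarrow> 2 ^ j dvd Suc p & odd (p div 2 ^ j)"
proof (cases "2 ^ j dvd Suc p")
 case True
 then obtain k where k: "Suc p = 2 ^ j * k" by blast
 have "2 ^ Suc j dvd Suc p \<longleftrightarrow> even k" unfolding k by simp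
 moreover have "Suc p div 2 ^ j = k" unfolding k by simp
 ultimately show ?thesis using odd_Suc_div[of p j] True by auto
next
 case False
 then show ?thesis by (metis dvd_mult_right power_Suc)
qed

lemma mod_pow_eq_iff: "(\<forall>j<N. odd (p div 2 ^ j) = odd (q div 2 ^ j)) \<longleftrightarrow> p mod 2 ^ N = q mod (2 ^ N :: nat)"
 unfolding take_bit_eq_mod[symmetric] bit_eq_iff bit_take_bit_iff by (auto simp: bit_iff_odd)

text \<open>Congruent positions differ by \<open>k * W\<close> for some \<open>k\<close>, and
  \<open>k * W\<close> consecutive numbers contain exactly \<open>k\<close> multiples of
  \<open>W\<close>.\<close>

lemma one_multiple_iff:
 fixes W :: nat
 assumes W: "0 < W" and le: "p <= q" and m: "p mod W = q mod W"
 shows "(\<exists>t>p. W dvd t & t <= q) & ~ (\<exists>t>p. W dvd t & t <= q & (\<exists>t'>t. W dvd t' & t' <= q)) \<longleftrightarrow> q = p + W"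
proof -
 have "W dvd q - p" using m le by (metis mod_eq_dvd_iff_nat)
 then obtain k where k: "q = p + W * k" using le by (metis dvdE le_add_diff_inverse)
 define t where "t = W * (p div W + 1)"
 have t: "p < t" "t <= p + W" "W dvd t"
  using dividend_less_times_div[OF W, of p] times_div_less_eq_dividend[of W p] by (auto simp: t_def)
 show ?thesis
 proof
  assume *: "(\<exists>t>p. W dvd t & t <= q) & ~ (\<exists>t>p. W dvd t & t <= q & (\<exists>t'>t. W dvd t' & t' <= q))"
  have "k ~= 0"
  proof
   assume "k = 0"
   then show False using * k by auto
  qed
  moreover have "~ 2 <= k"
  proof
   assume "2 <= k"
   then have "W * 2 <= W * k" by simp
   then have "t + W <= q" using t(2) k by linarith
   moreover have "W dvd t + W" "t < t + W" using t W by auto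
   ultimately show False using * t by (meson le_add1 order_trans)
  qed
  ultimately have "k = 1" by simp
  then show "q = p + W" using k by simp
 next
  assume q: "q = p + W"
  have "~ (t'' > t' & W dvd t'' & t'' <= q)" if "t' > p" "W dvd t'" for t' t''
  proof
   assume a: "t'' > t' & W dvd t'' & t'' <= q"
   then have "W dvd t'' - t'" "0 < t'' - t'" using that by auto
   then have "W <= t'' - t'" by (rule dvd_imp_le)
   then show False using a that q by linarith
  qed
  then show "(\<exists>t>p. W dvd t & t <= q) & ~ (\<exists>t>p. W dvd t & t <= q & (\<exists>t'>t. W dvd t' & t' <= q))"
   using t q by blast
 qed
qed

section \<open>Reductions from space-bounded machines\<close>

section \<open>Hardness\<close>

lemma run_halted: "t <= t' ==> halted M (run M w t) ==> run M w t' = run M w t"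
proof (induction t' rule: dec_induct)
 case (step n)
 then show ?case by (simp add: run_def step_def)
qed simp

lemma tiling_iff:
 assumes M: "wf_tm M" "decides M L" and B: "!!t. card (scanned_cells M w t) <= B" and W: "2 * B + length w + 10 <= W"
 shows "(EX x. tiles.tiling M w W x) \<longleftrightarrow> w \<in> L"
proof
 interpret tiles M by standard (rule M(1))
 assume "EX x. tiling w W x"
 then obtain t where t: "fst (run M w t) = accept M" using tiling_accepts[of w W] W by auto
 obtain t' where t': "fst (run M w t') = (if w \<in> L then accept M else reject M)"
  using M(2) by (auto simp: decides_def)
 have "halted M (run M w t)" "halted M (run M w t')" using t t' by (auto simp: halted_def)
 then have "run M w t = run M w t'" using run_halted[of t "max t t'" M w] run_halted[of t' "max t t'" M w] by simp
 then show "w \<in> L" using t t' M(1) by (auto simp: wf_tm_def split: if_splits)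
next
 interpret tiles M by standard (rule M(1))
 assume "w \<in> L"
 then obtain t where "fst (run M w t) = accept M" using M(2)[unfolded decides_def, THEN spec, of w] by auto
 then show "EX x. tiling w W x" using tiling_exists[OF B W] by blast
qed

text \<open>Deciders halt on every input, so exchanging the accepting and the rejecting state
  decides the complement.\<close>

lemma dspace_compl:
 assumes "L \<in> dspace s"
 shows "- L \<in> dspace s"
proof -
 obtain M d where M: "wf_tm M" "decides M L" "!!w t. card (scanned_cells M w t) <= d * s (length w) + d"
  using assms by (auto simp: dspace_def)
 let ?M = "M\<lparr>accept := reject M, reject := accept M\<rparr>"
 have "step ?M = step M" by (rule ext) (simp add: step_def halted_def insert_commute)
 then have run: "run ?M w t = run M w t" for w t by (simp add: run_def init_config_def)
 have "wf_tm ?M" using M(1) by (auto simp: wf_tm_def)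
 moreover have "decides ?M (- L)"
  unfolding decides_def
 proof
  fix w
  obtain t where "fst (run M w t) = (if w \<in> L then accept M else reject M)"
   using M(2) unfolding decides_def by blast
  then show "EX t. fst (run ?M w t) = (if w \<in> - L then accept ?M else reject ?M)"
   by (intro exI[of _ t]) (simp add: run)
 qed
 moreover have "scanned_cells ?M w t = scanned_cells M w t" for w t by (simp add: scanned_cells_def run)
 ultimately show ?thesis using M(3) unfolding dspace_def
  by (intro CollectI exI[of _ ?M] exI[of _ d]) simp
qed

definition expressible :: "('a => nat) => ('a ppltl => 'a fin_trace set) => bool list set => bool" where
 "expressible c Lg L \<longleftrightarrow> (EX f g a e. (ALL w. w \<in> L \<longleftrightarrow> plus_lang Lg (f w) ~= {}) &
   (ALL w. enc_ppltl_plus c (f w) = out g ((length w + a) ^ e) ((length w + a) ^ e) w))"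

text \<open>Validity is reached through the complement: the negated formula for \<open>- L\<close>
  is valid iff that formula is unsatisfiable. Over a one-state system with a loop for each letter,
  model checking is validity.\<close>

lemma expressible_reducible:
 fixes c :: "'a::finite => nat"
 assumes c: "inj c" and L: "expressible c Lg L" and L': "expressible c Lg (- L)"
 shows "poly_reducible L (satisfiability (enc_ppltl_plus c) (plus_lang Lg))"
  "poly_reducible L (validity (enc_ppltl_plus c) (plus_lang Lg))"
  "poly_reducible L (model_checking c (enc_ppltl_plus c) (plus_lang Lg))"
proof -
 note enc = prefix_freeD[OF prefix_free_enc_ppltl_plus[OF c]]
 have enc_eq: "enc_ppltl_plus c fm = enc_ppltl_plus c fn2 \<longleftrightarrow> fm = fn2" for fm fn2 using enc[of fm "[]" fn2 "[]"] by simp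
 obtain f g a e where f: "!!w. w \<in> L \<longleftrightarrow> plus_lang Lg (f w) ~= {}"
  "!!w. enc_ppltl_plus c (f w) = out g ((length w + a) ^ e) ((length w + a) ^ e) w"
  using L unfolding expressible_def by blast
 show "poly_reducible L (satisfiability (enc_ppltl_plus c) (plus_lang Lg))"
  unfolding poly_reducible_def
 proof (intro exI conjI allI)
  show "poly_time_computable (%w. out g ((length w + a) ^ e) ((length w + a) ^ e) w)" by (rule gen_poly_time)
  show "w \<in> L \<longleftrightarrow> out g ((length w + a) ^ e) ((length w + a) ^ e) w \<in> satisfiability (enc_ppltl_plus c) (plus_lang Lg)" for w
   unfolding f(2)[symmetric] satisfiability_def by (auto simp: enc_eq f(1))
 qed
 obtain f g a e where f: "!!w. w \<notin> L \<longleftrightarrow> plus_lang Lg (f w) ~= {}"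
  "!!w. enc_ppltl_plus c (f w) = out g ((length w + a) ^ e) ((length w + a) ^ e) w"
  using L' unfolding expressible_def by auto
 have not: "enc_ppltl_plus c (NotQ fm) = enc_nat 6 @ enc_ppltl_plus c fm" for fm by (simp add: enc_ppltl_plus_def)
 have val: "w \<in> L \<longleftrightarrow> plus_lang Lg (NotQ (f w)) = UNIV" for w using f(1)[of w] by auto
 show "poly_reducible L (validity (enc_ppltl_plus c) (plus_lang Lg))"
  unfolding poly_reducible_def
 proof (intro exI conjI allI)
  let ?g = "Cat (Lit (enc_nat 6)) g"
  show "poly_time_computable (%w. out ?g ((length w + a) ^ e) ((length w + a) ^ e) w)" by (rule gen_poly_time)
  have "out ?g ((length w + a) ^ e) ((length w + a) ^ e) w = enc_ppltl_plus c (NotQ (f w))" for w by (simp add: not f(2))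
  then show "w \<in> L \<longleftrightarrow> out ?g ((length w + a) ^ e) ((length w + a) ^ e) w \<in> validity (enc_ppltl_plus c) (plus_lang Lg)" for w
   unfolding validity_def val[of w] by (auto simp: enc_eq simp del: out.simps plus_lang.simps)
 qed
 obtain As where As: "set As = (UNIV :: 'a set set)" using finite_list[of "UNIV :: 'a set set"] by auto
 define T where "T = \<lparr>num_states = 1, initials = [0], transitions = map (%X. (0, X, 0)) As\<rparr>"
 have T: "wf_ts T" "generated_traces T = UNIV"
 proof -
  show "wf_ts T" by (auto simp: wf_ts_def T_def)
  have "ta \<in> generated_traces T" for ta
   unfolding generated_traces_def mem_Collect_eq by (intro exI[of _ "%_. 0"]) (auto simp: T_def As)
  then show "generated_traces T = UNIV" by blast
 qed
 note ts = prefix_freeD[OF prefix_free_enc_ts[OF c]]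
 have ts_eq: "enc_ts c T = enc_ts c T' \<longleftrightarrow> T = T'" for T T' using ts[of T "[]" T' "[]"] by simp
 show "poly_reducible L (model_checking c (enc_ppltl_plus c) (plus_lang Lg))"
  unfolding poly_reducible_def
 proof (intro exI conjI allI)
  let ?g = "Cat (Cat (Lit (enc_nat 6)) g) (Lit (enc_ts c T))"
  show "poly_time_computable (%w. out ?g ((length w + a) ^ e) ((length w + a) ^ e) w)" by (rule gen_poly_time)
  have o: "out ?g ((length w + a) ^ e) ((length w + a) ^ e) w = enc_ppltl_plus c (NotQ (f w)) @ enc_ts c T" for w
   by (simp add: not f(2))
  have "enc_ppltl_plus c (NotQ (f w)) @ enc_ts c T \<in> model_checking c (enc_ppltl_plus c) (plus_lang Lg) \<longleftrightarrow>
   generated_traces T \<subseteq> plus_lang Lg (NotQ (f w))" for w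
   unfolding model_checking_def mem_Collect_eq enc ts_eq using T(1) by blast
  then show "w \<in> L \<longleftrightarrow> out ?g ((length w + a) ^ e) ((length w + a) ^ e) w \<in>
   model_checking c (enc_ppltl_plus c) (plus_lang Lg)" for w
   unfolding o T(2) val[of w] by blast
 qed
qed

lemma poly_width: "2 * (d * n ^ k + d) + n + 10 <= (n + (4 * d + 20)) ^ Suc k"
 "4 * d + n + 10 + n ^ k <= (n + (4 * d + 20)) ^ Suc k" for n d :: nat
proof -
 let ?X = "(n + (4 * d + 20)) ^ k"
 have X: "n ^ k <= ?X" "1 <= ?X" by (auto intro: power_mono)
 have "4 * d + n + 10 + n ^ k <= (4 * d + n + 10) * ?X + ?X"
  by (rule add_mono[OF mult_le_mono2[OF X(2), of "4 * d + n + 10", unfolded mult_1_right] X(1)])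
 also have "\<dots> = (4 * d + n + 10 + 1) * ?X" by (simp only: add_mult_distrib mult_1)
 also have "\<dots> \<le> (n + (4 * d + 20)) * ?X" by (rule mult_le_mono1) simp
 finally show "4 * d + n + 10 + n ^ k <= (n + (4 * d + 20)) ^ Suc k" by simp
 have "2 * (d * n ^ k + d) + n + 10 = 2 * (d * n ^ k + d * 1) + (n + 10) * 1" by simp
 also have "\<dots> \<le> 2 * (d * ?X + d * ?X) + (n + 10) * ?X" by (intro add_mono mult_le_mono2 X)
 also have "\<dots> = (4 * d + n + 10) * ?X" by (simp add: algebra_simps)
 also have "\<dots> \<le> (n + (4 * d + 20)) * ?X" by (rule mult_le_mono1) simp
 finally show "2 * (d * n ^ k + d) + n + 10 <= (n + (4 * d + 20)) ^ Suc k" by simp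
qed

lemma exp_width: "2 * (d * 2 ^ (n ^ k) + d) + n + 10 <= 2 ^ ((n + (4 * d + 20)) ^ Suc k)" for n d :: nat
proof -
 let ?Y = "2 ^ (n ^ k) :: nat"
 have Y: "1 <= ?Y" by simp
 have "2 * (d * ?Y + d) + n + 10 = 2 * (d * ?Y + d * 1) + (n + 10) * 1" by simp
 also have "\<dots> \<le> 2 * (d * ?Y + d * ?Y) + (n + 10) * ?Y" by (intro add_mono mult_le_mono2 order_refl Y)
 also have "\<dots> = (4 * d + n + 10) * ?Y" by (simp add: algebra_simps)
 also have "\<dots> \<le> 2 ^ (4 * d + n + 10) * ?Y" by (intro mult_le_mono1 less_imp_le less_exp)
 also have "\<dots> = 2 ^ (4 * d + n + 10 + n ^ k)" by (simp only: power_add)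
 also have "\<dots> \<le> 2 ^ ((n + (4 * d + 20)) ^ Suc k)" by (intro power_increasing poly_width) simp
 finally show ?thesis .
qed

lemma PSPACE_expressible:
 assumes "L \<in> PSPACE"
 shows "expressible (c :: 'a => nat) ppltl_lang L"
proof -
 obtain k M d where M: "wf_tm M" "decides M L" "!!w t. card (scanned_cells M w t) <= d * length w ^ k + d"
  using assms by (auto simp: PSPACE_def dspace_def)
 \<comment> \<open>The block code uses a single atom; types are nonempty, so an arbitrary one can be
   taken.\<close>
 define p0 :: 'a where "p0 = undefined"
 interpret tile_blocks M p0 by unfold_locales (rule M(1))
 let ?N = "%w :: bool list. (length w + (4 * d + 20)) ^ Suc k"
 obtain g where g: "ALL N m w. enc_ppltl_plus c (formP N w) = out g N m w" using genable_formP[of c] by (auto simp: genable_plus_def)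
 have "w \<in> L \<longleftrightarrow> plus_lang ppltl_lang (formP (?N w) w) ~= {}" for w
  using formP_satisfiable[of "?N w" w] tiling_iff[OF M(1,2) M(3)[of w] poly_width(1)] by auto
 then show ?thesis unfolding expressible_def using g
  by (intro exI[of _ "%w. formP (?N w) w"] exI[of _ g] exI[of _ "4 * d + 20"] exI[of _ "Suc k"]) auto
qed

section \<open>EXPSPACE-hardness: tilings of exponential width in LTLf+, with binary
  addresses\<close>

section \<open>Exponential tilings\<close>

text \<open>With \<open>N\<close> address letters after each of them, the tile letters are at the indices \<open>cl N p\<close>. The
 address letters after the \<open>p\<close>-th tile spell \<open>p\<close> in binary, the least significant bit first, modulo
 \<open>2\<^sup>N\<close>; each also carries the carry of the increment, and the last carry starts a new row.\<close>

definition cl :: "nat => nat => nat" where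
 "cl N p = (N + 1) * p"

lemma cl_less [simp]: "cl N p < cl N q \<longleftrightarrow> p < q" "cl N p <= cl N q \<longleftrightarrow> p <= q" "cl N p = cl N q \<longleftrightarrow> p = q"
 by (simp_all only: cl_def mult_less_cancel1 mult_le_cancel1 mult_cancel1) auto

lemma cl_0 [simp]: "cl N 0 = 0"
 by (simp add: cl_def)

lemma cl_Suc: "cl N p + (N + 1) = cl N (p + 1)"
 by (simp add: cl_def)

lemma cl_step: "cl N p + 1 + j + (N + 1) = cl N (p + 1) + 1 + j"
 by (simp add: cl_def)

lemma cl_cases:
 obtains p where "s = cl N p" | p j where "j < N" "s = cl N p + 1 + j"
proof (cases "s mod (N + 1)")
 case 0
 then have "s = cl N (s div (N + 1))" unfolding cl_def by (metis add.right_neutral mult_div_mod_eq)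
 then show ?thesis using that(1) by blast
next
 case (Suc j)
 have "s = cl N (s div (N + 1)) + s mod (N + 1)" unfolding cl_def by (rule mult_div_mod_eq[symmetric])
 moreover have "Suc j < N + 1" using mod_less_divisor[of "N + 1" s] unfolding Suc by simp
 ultimately show ?thesis using Suc by (intro that(2)[of j "s div (N + 1)"]) simp_all
qed

locale tile_addresses = tiles M for M +
 fixes p0 :: 'a
begin

sublocale blocks p0 "length (tiles.ls M) + 4" .

abbreviation "ad x y \<equiv> G + 2 * of_bool x + of_bool y"

definition bitl :: "nat => bool" where
 "bitl g \<longleftrightarrow> g = G + 1 \<or> g = G + 3"

definition carry :: "nat => bool" where
 "carry g \<longleftrightarrow> G + 2 <= g"

lemma ad_simps: "bitl (ad x y) \<longleftrightarrow> y" "carry (ad x y) \<longleftrightarrow> x" "ad x y = G + 3 \<longleftrightarrow> x & y" "~ ad x y < G" "G <= ad x y" "ad x y < G + 4"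
 by (cases x; cases y; simp add: bitl_def carry_def)+

lemma carry_bitl: "g < G + 4 ==> g = G + 3 \<longleftrightarrow> carry g & bitl g"
 by (auto simp: carry_def bitl_def)

text \<open>Adjacent letters: the increment starts with a carry after each tile, a carry passes on
  over a bit that is one, and a carry out of the last bit makes the next tile start a row.\<close>

definition nearR :: "nat => nat => bool" where
 "nearR g g' \<longleftrightarrow> (if g < G then carry g' else if g' < G then lr (ls ! g') = (g = G + 3) else carry g' = (g = G + 3))"

text \<open>Letters at distance \<open>N + 1\<close>, at the same place of consecutive cells: a bit
  flips when it receives a carry.\<close>

definition farR :: "nat => nat => bool" where
 "farR g g' \<longleftrightarrow> (if g < G then g' < G else G <= g' & (bitl g' \<longleftrightarrow> bitl g ~= carry g))"

definition layout :: "nat => (nat => nat) => bool" where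
 "layout N z \<longleftrightarrow> (ALL p. z (cl N p) < G & (lr (ls ! z (cl N p)) \<longleftrightarrow> 2 ^ N dvd p) &
   (\<forall>j<N. G <= z (cl N p + 1 + j) & (bitl (z (cl N p + 1 + j)) \<longleftrightarrow> odd (p div 2 ^ j))))"

text \<open>The addresses count: by induction that of cell \<open>p\<close> is \<open>p\<close>
  modulo \<open>2 ^ N\<close>. It overflows exactly when \<open>2 ^ N\<close> divides
  \<open>Suc p\<close>, so the rows have width \<open>2 ^ N\<close>.\<close>

lemma layoutI:
 assumes N: "0 < N" and zA: "!!q. z q < G + 4"
  and near: "!!q. nearR (z q) (z (q + 1))" and far: "!!q. farR (z q) (z (q + (N + 1)))"
  and z0: "z 0 < G" "lr (ls ! z 0)" and zad: "!!j. j < N ==> z (1 + j) \<in> {G, G + 2}"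
 shows "layout N z"
proof -
 have T: "z (cl N p) < G" for p
 proof (induction p)
  case (Suc p)
  then show ?case using far[of "cl N p"] cl_Suc[of N p] by (simp add: farR_def)
 qed (simp add: z0)
 have C: "carry (z (cl N p + 1 + j)) \<longleftrightarrow> 2 ^ j dvd Suc p"
  if B: "\<forall>j<N. G <= z (cl N p + 1 + j) & (bitl (z (cl N p + 1 + j)) \<longleftrightarrow> odd (p div 2 ^ j))" and "j < N" for p j
  using that(2)
 proof (induction j)
  case 0
  then show ?case using near[of "cl N p"] T[of p] by (simp add: nearR_def)
 next
  case (Suc j)
  let ?g = "z (cl N p + 1 + j)" and ?g' = "z (cl N p + 1 + Suc j)"
  have "~ ?g < G" "~ ?g' < G" using B Suc.prems by (metis Suc_lessD not_less)+
  then have "carry ?g' \<longleftrightarrow> ?g = G + 3" using near[of "cl N p + 1 + j"] by (simp add: nearR_def)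
  also have "\<dots> \<longleftrightarrow> carry ?g & bitl ?g" by (rule carry_bitl[OF zA])
  also have "\<dots> \<longleftrightarrow> 2 ^ Suc j dvd Suc p" unfolding pow_dvd_Suc using Suc B by auto
  finally show ?case .
 qed
 have B: "\<forall>j<N. G <= z (cl N p + 1 + j) & (bitl (z (cl N p + 1 + j)) \<longleftrightarrow> odd (p div 2 ^ j))" for p
 proof (induction p)
  case 0
  have "G <= z (1 + j) & ~ bitl (z (1 + j))" if "j < N" for j using zad[OF that] by (auto simp: bitl_def)
  then show ?case by simp
 next
  case (Suc p)
  show ?case
  proof (intro allI impI)
   fix j assume j: "j < N"
   let ?g = "z (cl N p + 1 + j)" and ?g' = "z (cl N (Suc p) + 1 + j)"
   have "~ ?g < G" using Suc j by (metis not_less)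
   moreover have "farR ?g ?g'" using far[of "cl N p + 1 + j"] unfolding cl_step by simp
   ultimately have "G <= ?g' & (bitl ?g' \<longleftrightarrow> bitl ?g ~= carry ?g)" by (simp add: farR_def)
   then show "G <= ?g' & (bitl ?g' \<longleftrightarrow> odd (Suc p div 2 ^ j))"
   unfolding odd_Suc_div using C[OF Suc j] Suc j by blast
  qed
 qed
 have R: "lr (ls ! z (cl N p)) \<longleftrightarrow> 2 ^ N dvd p" for p
 proof (cases p)
  case (Suc p')
  obtain N' where N': "N = Suc N'" using N by (cases N) auto
  let ?g = "z (cl N p' + 1 + N')"
  have "~ ?g < G" using B[of p'] N' by (metis not_less lessI)
  moreover have "nearR ?g (z (cl N p))"
  proof -
   have "cl N p' + 1 + N' + 1 = cl N p" using cl_Suc[of N p'] N' Suc by simp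
   then show ?thesis using near[of "cl N p' + 1 + N'"] by (simp only:)
  qed
  ultimately have "lr (ls ! z (cl N p)) \<longleftrightarrow> ?g = G + 3" using T[of p] by (simp add: nearR_def)
  also have "\<dots> \<longleftrightarrow> carry ?g & bitl ?g" by (rule carry_bitl[OF zA])
  also have "\<dots> \<longleftrightarrow> 2 ^ N dvd p" unfolding N' Suc pow_dvd_Suc using C[OF B, of N' p'] B[of p'] N' by blast
  finally show ?thesis .
 qed (use z0 in simp)
 show ?thesis unfolding layout_def using T B R by blast
qed

lemma layout_exists:
 assumes N: "0 < N" and u: "!!p. u p < G" "!!p. lr (ls ! u p) \<longleftrightarrow> 2 ^ N dvd p"
 obtains z where "!!p. z (cl N p) = u p" "!!q. z q < G + 4" "!!q. nearR (z q) (z (q + 1))" "!!q. farR (z q) (z (q + (N + 1)))"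
  "!!j. j < N ==> z (1 + j) \<in> {G, G + 2}"
proof -
 define z where "z s = (let p = s div (N + 1); r = s mod (N + 1) in
  if r = 0 then u p else ad (2 ^ (r - 1) dvd Suc p) (odd (p div 2 ^ (r - 1))))" for s
 have t: "z (cl N p) = u p" for p by (simp add: z_def cl_def Let_def del: mult_Suc)
 have a: "z (cl N p + 1 + j) = ad (2 ^ j dvd Suc p) (odd (p div 2 ^ j))" if "j < N" for p j
 proof -
  have "(cl N p + 1 + j) div (N + 1) = p" "(cl N p + 1 + j) mod (N + 1) = j + 1"
  proof -
   have e: "cl N p + 1 + j = (j + 1) + (N + 1) * p" by (simp add: cl_def)
   show "(cl N p + 1 + j) div (N + 1) = p"
   unfolding e by (rule div_nat_eqI) (use that in simp_all)
   show "(cl N p + 1 + j) mod (N + 1) = j + 1"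
   unfolding e mod_mult_self2 by (rule mod_less) (use that in simp)
  qed
  then show ?thesis by (simp only: z_def Let_def) simp
 qed
 have "z q < G + 4" for q
 proof (cases q rule: cl_cases[of _ N])
  case (1 p)
  then show ?thesis using u(1)[of p] t by simp
 next
  case (2 p j)
  then show ?thesis using a[OF 2(1), of p] ad_simps(6) by (simp only:)
 qed
 moreover have "nearR (z q) (z (q + 1))" for q
 proof (cases q rule: cl_cases[of _ N])
  case (1 p)
  have "carry (z (cl N p + 1))" using a[OF N, of p] ad_simps(2) by (simp only: add_0_right power_0 one_dvd)
  then show ?thesis using u(1)[of p] t[of p] 1 by (simp add: nearR_def)
 next
  case (2 p j)
  have zq: "z q = ad (2 ^ j dvd Suc p) (odd (p div 2 ^ j))" using a[OF 2(1)] 2(2) by simp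
  have g3: "z q = G + 3 \<longleftrightarrow> 2 ^ Suc j dvd Suc p" unfolding zq ad_simps(3) pow_dvd_Suc ..
  have nG: "~ z q < G" unfolding zq by (rule ad_simps(4))
  show ?thesis
  proof (cases "Suc j = N")
   case True
   have "q + 1 = cl N (p + 1)" using cl_Suc[of N p] True 2 by simp
   then have "z (q + 1) = u (Suc p)" using t[of "p + 1"] by simp
   then show ?thesis using g3 nG u[of "Suc p"] True by (simp add: nearR_def)
  next
   case False
   then have "z (q + 1) = ad (2 ^ Suc j dvd Suc p) (odd (p div 2 ^ Suc j))" using a[of "Suc j" p] 2 by simp
   then show ?thesis unfolding nearR_def using nG g3 ad_simps(2,4) by metis
  qed
 qed
 moreover have "farR (z q) (z (q + (N + 1)))" for q
 proof (cases q rule: cl_cases[of _ N])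
  case (1 p)
  have "z (q + (N + 1)) = u (p + 1)" using t[of "p + 1"] cl_Suc[of N p] 1 by simp
  then show ?thesis using u(1) t[of p] 1 by (simp add: farR_def)
 next
  case (2 p j)
  have zq: "z q = ad (2 ^ j dvd Suc p) (odd (p div 2 ^ j))" using a[OF 2(1)] 2(2) by simp
  have zq': "z (q + (N + 1)) = ad (2 ^ j dvd Suc (p + 1)) (odd ((p + 1) div 2 ^ j))"
   unfolding 2(2) cl_step by (rule a[OF 2(1)])
  show ?thesis unfolding farR_def zq zq' ad_simps using odd_Suc_div[of p j] by (simp add: ad_simps)
 qed
 moreover have "z (1 + j) \<in> {G, G + 2}" if "j < N" for j
  using a[OF that, of 0] by (auto simp: div_eq_0_iff)
 ultimately show thesis using that[of z] t by blast
qed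

definition bads :: "(nat => nat => bool) => (nat \<times> nat) list" where
 "bads R = filter (%x. ~ R (fst x) (snd x)) (List.product [0..<G + 4] [0..<G + 4])"

lemma set_bads: "set (bads R) = {(a, b). a < G + 4 & b < G + 4 & ~ R a b}"
 by (auto simp: bads_def)

definition nxt :: "nat => 'a ppltl => 'a ppltl" where
 "nxt N fm = shift 1 (shift N fm)"

lemma fh_nxt: "st p < m ==> fh ta m (st p) (nxt N fm) \<longleftrightarrow> st (p + (N + 1)) < m & fh ta m (st (p + (N + 1))) fm"
proof -
 assume p: "st p < m"
 have "st (p + 1) < m" if "st (p + (N + 1)) < m"
  using that st_less(2)[of "p + 1" "p + (N + 1)"] by linarith
 moreover have "p + 1 + N = p + (N + 1)" by simp
 ultimately show ?thesis unfolding nxt_def fh_shift[OF p] using fh_shift[of "p + 1" m ta N fm] by metis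
qed

definition pairF :: "('a ppltl => 'a ppltl) => (nat => nat => bool) => 'a ppltl" where
 "pairF sh R = NotP (EvF (OrL (map (%x. AndP (LtF (fst x)) (sh (LtF (snd x)))) (bads R))))"

definition initF :: "nat => 'a ppltl" where
 "initF m = AndP (LF (sel lr)) (shift 1 (chain (%_. LF [G, G + 2]) (bl * 1) TT m))"

abbreviation "ones \<equiv> [G + 1, G + 3]"

text \<open>At an address letter: its bit equals that of the letter \<open>v\<close> blocks before
  the last block of the prefix.\<close>

definition sameF :: "nat => 'a ppltl" where
 "sameF v = OrP (AndP (LF ones) (EvF (AndP (LF ones) (shift v LastB))))
   (AndP (NotP (LF ones)) (NotP (EvF (AndP (LF ones) (shift v LastB)))))"

text \<open>The chain decreases \<open>v\<close> while it moves right, so bit \<open>j\<close> of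
  the present address is compared with bit \<open>j\<close> of the address in front of the last
  block.\<close>

definition eqF :: "nat => 'a ppltl" where
 "eqF m = shift 1 (chain sameF (bl * 1) TT m)"

text \<open>The core of the reduction. When the prefix ends with the tile \<open>P + 1\<close>, the
  address of \<open>P\<close> lies at fixed distances from the end and can be compared with that of
  a tile \<open>p\<close> by a formula of polynomial size. Equal addresses and exactly one row start
  in between mean \<open>P = p + 2 ^ N\<close>; the tiles \<open>p\<close>, \<open>p + 1\<close>,
  \<open>P\<close>, \<open>P + 1\<close> must then not form a forbidden pattern.\<close>

definition vertF :: "nat => nat => 'a ppltl" where
 "vertF N m = NotP (OrL (map (%x. case x of (g1, g2, g3, g4) =>
   EvF (AndP (LtF g1) (AndP (nxt N (LtF g2)) (AndP (eqF m) (AndP (oneF (sel lr))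
   (EvF (AndP (LtF g3) (nxt N (AndP (LtF g4) LastB))))))))) bad))"

text \<open>Skips the address letters by an until instead of counting \<open>N\<close> of
  them.\<close>

definition nextT :: "'a ppltl => 'a ppltl" where
 "nextT fm = YesterdayP (SinceP (NotP (LF [0..<G])) (AndP (LF [0..<G]) fm))"

definition inpF :: "bool list => 'a ppltl" where
 "inpF w = EvF (AndP (LF (sel (%a. lph a = 0)))
   (nextT (ichain (%x. LF (sel (%a. lph a = 1 & sy a 0 = bit_symbol x))) nextT (LF (sel (%a. lph a = 2))) w)))"

text \<open>The reduction takes \<open>N = m\<close>. Two parameters are kept because repetitions
  over a fixed distance are printed by \<open>Top\<close> loops, while the chains need a counter
  that runs down from \<open>m\<close>.\<close>

definition formF :: "nat => nat => bool list => 'a ppltl plus" where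
 "formF N m w = AndQ (AllQ WFF) (AndQ (AllQ (pairF (shift 1) nearR)) (AndQ (AllQ (pairF (nxt N) farR))
   (AndQ (ExQ (initF m)) (AndQ (AllQ (vertF N m)) (AndQ (ExQ (inpF w)) (ExQ (EvF (LF (sel (%a. lq a = accept M))))))))))"

lemma genable_formF: "genable_plus c (%N m w. formF N m w)"
proof -
 have nxt: "genable c (%N m w. nxt N (F N m w))" if "genable c F" for F
  unfolding nxt_def using that by (intro genable_shift)
 have ev: "genable c (%N m w. EvF (F N m w))" if "genable c F" for F
  unfolding EvF_def using that by (intro genable_binary genable_const)
 have 1: "genable c (%N m w. pairF (nxt N) farR)"
  unfolding pairF_def by (intro genable_unary ev genable_OrL genable_binary nxt genable_const)
 have 2: "genable c (%N m w. initF m)"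
  unfolding initF_def by (intro genable_binary genable_const genable_shift(1) genable_chain[where F = "%N m w. LF [G, G + 2]"])
 have "genable c (%N m w. sameF m)"
  unfolding sameF_def by (intro genable_binary genable_unary(1) ev genable_shift(3) genable_const)
 then have eq: "genable c (%N m w. eqF m)"
  unfolding eqF_def by (intro genable_shift(1) genable_chain[where F = "%N m w. sameF m"])
 have "genable c (%N m w. case x of (g1, g2, g3, g4) =>
   EvF (AndP (LtF g1) (AndP (nxt N (LtF g2)) (AndP (eqF m) (AndP (oneF (sel lr))
   (EvF (AndP (LtF g3) (nxt N (AndP (LtF g4) LastB)))))))))" for x
  by (cases x) (simp, intro ev genable_binary nxt eq genable_const)
 then have 3: "genable c (%N m w. vertF N m)"
  unfolding vertF_def by (intro genable_unary genable_OrL)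
 have us: "enc_ppltl c (nextT fm) = (enc_nat 4 @ enc_nat 5 @ enc_ppltl c (NotP (LF [0..<G])) @ enc_nat 2 @ enc_ppltl c (LF [0..<G])) @
   enc_ppltl c fm" for fm by (simp add: nextT_def)
 have "genable c (%N m w. ichain (%x. LF (sel (%a. lph a = 1 & sy a 0 = bit_symbol x))) nextT (LF (sel (%a. lph a = 2))) w)"
  by (rule genable_ichain(1)[OF us])
 then have "genable c (%N m w. nextT (ichain (%x. LF (sel (%a. lph a = 1 & sy a 0 = bit_symbol x))) nextT (LF (sel (%a. lph a = 2))) w))"
  by (rule genable_context) (rule us)
 then have 4: "genable c (%N m w. inpF w)"
  unfolding inpF_def by (intro ev genable_binary genable_const)
 show ?thesis unfolding formF_def by (intro genable_plus_and genable_plus_quantifiers genable_const 1 2 3 4)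
qed

context
 fixes ta :: "nat => 'a set" and z :: "nat => nat"
 assumes y: "coded (G + 4) (%j. p0 \<in> ta j) z"
begin

lemma zA: "z p < G + 4"
 using y by (simp add: coded_def)

lemma sel_sub: "set (sel P) \<subseteq> {..<G + 4}"
 using set_sel(2)[of P] by (auto simp: subset_iff)

lemma fh_sel: "i < m ==> fh ta m i (LF (sel P)) \<longleftrightarrow> (EX p. i = st p & z p < G & P (ls ! z p) & st (p + 1) <= m)"
 using fh_LF[OF y _ sel_sub] by (auto simp: set_sel)

lemma fh_pairF:
 "(\<forall>m>0. fh ta m 0 (pairF (shift 1) R)) \<longleftrightarrow> (ALL q. R (z q) (z (q + 1)))"
 "(\<forall>m>0. fh ta m 0 (pairF (nxt N) R)) \<longleftrightarrow> (ALL q. R (z q) (z (q + (N + 1))))"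
proof -
 have b: "set (bads R) \<subseteq> {..<G + 4} \<times> {..<G + 4}" by (auto simp: set_bads)
 have m: "(z q, z q') \<notin> set (bads R) \<longleftrightarrow> R (z q) (z q')" for q q' using zA by (simp add: set_bads)
 have "(\<forall>m>0. fh ta m 0 (pairF (shift 1) R)) \<longleftrightarrow> (ALL q. (z q, z (q + 1)) \<notin> set (bads R))"
  unfolding pairF_def by (rule pairs_iff[OF y b]) (rule fh_shift)
 then show "(\<forall>m>0. fh ta m 0 (pairF (shift 1) R)) \<longleftrightarrow> (ALL q. R (z q) (z (q + 1)))" by (simp only: m)
 have "(\<forall>m>0. fh ta m 0 (pairF (nxt N) R)) \<longleftrightarrow> (ALL q. (z q, z (q + (N + 1))) \<notin> set (bads R))"
  unfolding pairF_def by (rule pairs_iff[OF y b]) (rule fh_nxt)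
 then show "(\<forall>m>0. fh ta m 0 (pairF (nxt N) R)) \<longleftrightarrow> (ALL q. R (z q) (z (q + (N + 1))))" by (simp only: m)
qed

lemma fh_initF: "(\<exists>m>0. fh ta m 0 (initF N)) \<longleftrightarrow> z 0 < G & lr (ls ! z 0) & (\<forall>j<N. z (1 + j) \<in> {G, G + 2})"
proof -
 have g: "set [G, G + 2] \<subseteq> {..<G + 4}" by simp
 have *: "fh ta m (st 0) (initF N) \<longleftrightarrow> z 0 < G & lr (ls ! z 0) & st (1 + N) < m & (\<forall>j<N. z (1 + j) \<in> {G, G + 2})"
  if m: "st 0 < m" for m
 proof -
  have c: "fh ta m (st 1) (chain (%_. LF [G, G + 2]) (bl * 1) TT N) \<longleftrightarrow> st (1 + N) < m & (\<forall>j<N. z (1 + j) \<in> {G, G + 2})"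
   if "st 1 < m"
  proof -
   have "fh ta m (st (1 + j)) (LF [G, G + 2]) \<longleftrightarrow> z (1 + j) \<in> {G, G + 2}" if "st (1 + N) < m" "j < N" for j
   proof -
   have "st (1 + j) < st (1 + N)" "st (1 + j + 1) <= st (1 + N)" using that(2) by simp_all
   then have "st (1 + j) < m" "st (1 + j + 1) <= m" using that(1) by linarith+
   then show ?thesis using fh_LF[OF y _ g, of "st (1 + j)" m] by simp
   qed
   then show ?thesis unfolding fh_chain[OF that] by blast
  qed
  have "st 1 <= st (1 + N)" by simp
  then have lt: "st 1 < m" if "st (1 + N) < m" using that by linarith
  have "fh ta m (st 0) (initF N) \<longleftrightarrow> (z 0 < G & lr (ls ! z 0) & st 1 <= m) & st 1 < m & st (1 + N) < m & (\<forall>j<N. z (1 + j) \<in> {G, G + 2})"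
   unfolding initF_def fh_bool fh_shift[OF m] fh_sel[OF m] add_0 using c by auto
  then show ?thesis using lt by auto
 qed
 have pos: "0 < st (1 + N) + 1" "st (1 + N) < st (1 + N) + 1" by simp_all
 show ?thesis using *[unfolded st_0] pos by blast
qed

context
 fixes N :: nat
 assumes N: "0 < N" and lay: "layout N z"
begin

abbreviation "W \<equiv> 2 ^ N :: nat"
abbreviation "K \<equiv> cl N"

lemma tile: "z (K p) < G" "lr (ls ! z (K p)) \<longleftrightarrow> W dvd p"
 using lay by (auto simp: layout_def)

lemma address: "j < N ==> z (K p + 1 + j) \<in> set ones \<longleftrightarrow> odd (p div 2 ^ j)"
 using lay by (auto simp: layout_def bitl_def)

lemma is_tile: "z s < G \<longleftrightarrow> (EX p. s = K p)"
proof (cases s rule: cl_cases[of _ N])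
 case (1 p)
 then show ?thesis using tile by auto
next
 case (2 p j)
 then have "G <= z s" using lay by (auto simp: layout_def)
 then show ?thesis using tile(1) by (metis not_less)
qed

lemma fh_tile_sel: "i < m ==> fh ta m i (LF (sel P)) \<longleftrightarrow> (EX p. i = st (K p) & P (ls ! z (K p)) & st (K p + 1) <= m)"
 unfolding fh_sel by (auto simp: is_tile)

lemma fh_tile: "st (K p) < m ==> fh ta m (st (K p)) (LF (sel P)) \<longleftrightarrow> P (ls ! z (K p)) & st (K p + 1) <= m"
 using fh_tile_sel by auto

lemma K_next: "K p + 1 <= K q \<longleftrightarrow> p < q"
 by (metis Suc_eq_plus1 Suc_le_eq cl_less(1))

lemma fh_T: "i < m ==> fh ta m i (LF [0..<G]) \<longleftrightarrow> (EX p. i = st (K p) & st (K p + 1) <= m)"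
proof -
 assume i: "i < m"
 have "set [0..<G] \<subseteq> {..<G + 4}" by auto
 from fh_LF[OF y i this] show ?thesis using is_tile by auto
qed

lemma fh_nextT:
 assumes p: "st (K p) < m"
 shows "fh ta m (st (K p)) (nextT fm) \<longleftrightarrow> st (K (p + 1) + 1) <= m & fh ta m (st (K (p + 1))) fm"
proof -
 have "fh ta m (st (K p)) (nextT fm) \<longleftrightarrow> st (K p) + 1 < m & (EX j. st (K p) + 1 <= j & j < m & fh ta m j (LF [0..<G]) & fh ta m j fm &
   (ALL k. st (K p) + 1 <= k & k < j --> ~ fh ta m k (LF [0..<G])))"
  unfolding nextT_def fh_Y[OF p] using fh_Since[of "st (K p) + 1" m ta] by auto
 also have "\<dots> \<longleftrightarrow> st (K (p + 1) + 1) <= m & fh ta m (st (K (p + 1))) fm"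
 proof
  assume "st (K p) + 1 < m & (EX j. st (K p) + 1 <= j & j < m & fh ta m j (LF [0..<G]) & fh ta m j fm &
   (ALL k. st (K p) + 1 <= k & k < j --> ~ fh ta m k (LF [0..<G])))"
  then obtain j where j: "st (K p) + 1 <= j" "j < m" "fh ta m j (LF [0..<G])" "fh ta m j fm"
   "!!k. st (K p) + 1 <= k ==> k < j ==> ~ fh ta m k (LF [0..<G])" by blast
  obtain t where t: "j = st (K t)" "st (K t + 1) <= m" using fh_T[OF j(2)] j(3) by blast
  have "p < t" using j(1) t(1) st_next[of "K p" "K t"] by simp
  have "t = p + 1"
  proof (rule ccontr)
   assume "t ~= p + 1"
   then have lt: "p + 1 < t" using \<open>p < t\<close> by simp
   then have *: "st (K (p + 1)) < j" "st (K (p + 1) + 1) <= j" using K_next[of "p + 1" t] t(1) by simp_all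
   have b: "st (K (p + 1)) < m" "st (K (p + 1) + 1) <= m" using * j(2) by linarith+
   have "fh ta m (st (K (p + 1))) (LF [0..<G])" unfolding fh_T[OF b(1)] using b(2) by blast
   moreover have "st (K p) + 1 <= st (K (p + 1))" unfolding st_next by simp
   ultimately show False using j(5) *(1) by blast
  qed
  then show "st (K (p + 1) + 1) <= m & fh ta m (st (K (p + 1))) fm" using t j(4) by simp
 next
  assume a: "st (K (p + 1) + 1) <= m & fh ta m (st (K (p + 1))) fm"
  then have lt: "st (K (p + 1)) < m" using st_lt(2) by blast
  have le: "st (K p) + 1 <= st (K (p + 1))" unfolding st_next by simp
  have "~ fh ta m k (LF [0..<G])" if k: "st (K p) + 1 <= k" "k < st (K (p + 1))" for k
  proof
   assume "fh ta m k (LF [0..<G])"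
   then obtain t where "k = st (K t)" using fh_T[of k m] k(2) lt by auto
   then have "p < t" "t < p + 1" using k st_next[of "K p" "K t"] by simp_all
   then show False by simp
  qed
  then show "st (K p) + 1 < m & (EX j. st (K p) + 1 <= j & j < m & fh ta m j (LF [0..<G]) & fh ta m j fm &
   (ALL k. st (K p) + 1 <= k & k < j --> ~ fh ta m k (LF [0..<G])))"
   using a lt le fh_T[OF lt] by (intro conjI exI[of _ "st (K (p + 1))"]) auto
 qed
 finally show ?thesis .
qed

lemma fh_ichain:
 "st (K p) < m ==> fh ta m (st (K p)) (ichain (%x. LF (sel (F x))) nextT (LF (sel P)) v) \<longleftrightarrow>
  st (K (p + length v) + 1) <= m & (\<forall>i<length v. F (v ! i) (ls ! z (K (p + i)))) & P (ls ! z (K (p + length v)))"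
proof (induction v arbitrary: p)
 case Nil
 then show ?case using fh_tile by auto
next
 case (Cons x v)
 have *: "(\<forall>j<Suc n. Q j) \<longleftrightarrow> Q 0 & (\<forall>j<n. Q (Suc j))" for Q and n :: nat
  by (auto simp: less_Suc_eq_0_disj)
 have le: "st (K p + 1) <= st (K (p + 1 + length v) + 1)" "st (K (p + 1) + 1) <= st (K (p + 1 + length v) + 1)" by simp_all
 have "fh ta m (st (K p)) (ichain (%x. LF (sel (F x))) nextT (LF (sel P)) (x # v)) \<longleftrightarrow>
   (F x (ls ! z (K p)) & st (K p + 1) <= m) & st (K (p + 1) + 1) <= m &
   st (K (p + 1 + length v) + 1) <= m & (\<forall>i<length v. F (v ! i) (ls ! z (K (p + 1 + i)))) & P (ls ! z (K (p + 1 + length v)))"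
  unfolding ichain.simps fh_bool fh_tile[OF Cons.prems] fh_nextT[OF Cons.prems]
  using Cons.IH[of "p + 1"] st_lt(2)[of "K (p + 1)" m] by blast
 also have "\<dots> \<longleftrightarrow> F x (ls ! z (K p)) &
   st (K (p + 1 + length v) + 1) <= m & (\<forall>i<length v. F (v ! i) (ls ! z (K (p + 1 + i)))) & P (ls ! z (K (p + 1 + length v)))"
  using le by (meson order_trans)
 finally show ?case by (auto simp: *)
qed

lemma fh_inp:
 "(\<exists>m>0. fh ta m 0 (EvF (AndP (LF (sel A)) (nextT (ichain (%x. LF (sel (F x))) nextT (LF (sel P)) w))))) \<longleftrightarrow>
  (EX p. A (ls ! z (K p)) & (\<forall>j<length w. F (w ! j) (ls ! z (K (p + 1 + j)))) & P (ls ! z (K (p + 1 + length w))))"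
proof -
 define fm where "fm = ichain (%x. LF (sel (F x))) nextT (LF (sel P)) w"
 define R where "R p \<longleftrightarrow> (\<forall>j<length w. F (w ! j) (ls ! z (K (p + 1 + j)))) & P (ls ! z (K (p + 1 + length w)))" for p
 have *: "fh ta m (st (K p)) (nextT fm) \<longleftrightarrow> st (K (p + 1 + length w) + 1) <= m & R p"
  if p: "st (K p) < m" for p m
 proof -
  have le: "st (K (p + 1) + 1) <= st (K (p + 1 + length w) + 1)" by simp
  have 1: "fh ta m (st (K p)) (nextT fm) \<longleftrightarrow> st (K (p + 1) + 1) <= m & fh ta m (st (K (p + 1))) fm" by (rule fh_nextT[OF p])
  show ?thesis
  proof (cases "st (K (p + 1) + 1) <= m")
   case True
   then have "st (K (p + 1)) < m" by (rule st_lt(2))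
   from fh_ichain[OF this, of F P w] show ?thesis using True 1 unfolding fm_def R_def by simp
  next
   case False
   then show ?thesis using 1 le by linarith
  qed
 qed
 have "(\<exists>m>0. fh ta m 0 (EvF (AndP (LF (sel A)) (nextT fm)))) \<longleftrightarrow> (EX p. A (ls ! z (K p)) & R p)"
 proof
  assume "\<exists>m>0. fh ta m 0 (EvF (AndP (LF (sel A)) (nextT fm)))"
  then obtain m where m: "0 < m" "fh ta m 0 (EvF (AndP (LF (sel A)) (nextT fm)))" by blast
  obtain j where j: "j < m" "fh ta m j (LF (sel A))" "fh ta m j (nextT fm)"
   using m(2) unfolding fh_EvF[OF m(1)] fh_bool by blast
  obtain p where p: "j = st (K p)" "A (ls ! z (K p))" using j(2) unfolding fh_tile_sel[OF j(1)] by blast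
  then show "EX p. A (ls ! z (K p)) & R p" using *[of p m] j by blast
 next
  assume "EX p. A (ls ! z (K p)) & R p"
  then obtain p where p: "A (ls ! z (K p))" "R p" by blast
  let ?m = "st (K (p + 1 + length w) + 1)"
  have le: "st (K p + 1) <= ?m" by simp
  then have lt: "st (K p) < ?m" by (rule st_lt(2))
  then have m0: "0 < ?m" by linarith
  have "fh ta ?m (st (K p)) (nextT fm)" unfolding *[OF lt] using p by simp
  moreover have "fh ta ?m (st (K p)) (LF (sel A))" unfolding fh_tile[OF lt] using p le by simp
  ultimately have "fh ta ?m 0 (EvF (AndP (LF (sel A)) (nextT fm)))"
   unfolding fh_EvF[OF m0] fh_bool using lt by (intro exI[of _ "st (K p)"]) simp
  then show "\<exists>m>0. fh ta m 0 (EvF (AndP (LF (sel A)) (nextT fm)))" using m0 by blast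
 qed
 then show ?thesis unfolding fm_def R_def .
qed

lemma fh_inpF: "(\<exists>m>0. fh ta m 0 (inpF w)) \<longleftrightarrow> (EX p. lph (ls ! z (K p)) = 0 &
  (\<forall>j<length w. lph (ls ! z (K (p + 1 + j))) = 1 & sy (ls ! z (K (p + 1 + j))) 0 = bit_symbol (w ! j)) &
  lph (ls ! z (K (p + 1 + length w))) = 2)"
 unfolding inpF_def by (rule fh_inp)

lemma fh_accF: "(\<exists>m>0. fh ta m 0 (EvF (LF (sel P)))) \<longleftrightarrow> (EX p. P (ls ! z (K p)))"
proof
 assume "\<exists>m>0. fh ta m 0 (EvF (LF (sel P)))"
 then obtain m where m: "0 < m" "fh ta m 0 (EvF (LF (sel P)))" by blast
 then obtain j where j: "j < m" "fh ta m j (LF (sel P))" unfolding fh_EvF[OF m(1)] by blast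
 then show "EX p. P (ls ! z (K p))" unfolding fh_tile_sel[OF j(1)] by blast
next
 assume "EX p. P (ls ! z (K p))"
 then obtain p where p: "P (ls ! z (K p))" by blast
 let ?m = "st (K p + 1)"
 have lt: "st (K p) < ?m" by (rule st_lt)
 then have m0: "0 < ?m" by linarith
 have "fh ta ?m 0 (EvF (LF (sel P)))" unfolding fh_EvF[OF m0] using lt fh_tile[OF lt] p by (intro exI[of _ "st (K p)"]) simp
 then show "\<exists>m>0. fh ta m 0 (EvF (LF (sel P)))" using m0 by blast
qed

lemma fh_eqF:
 assumes m: "m = st (K (P + 1) + 1)" and le: "p <= P"
 shows "fh ta m (st (K p)) (eqF N) \<longleftrightarrow> p mod W = P mod W"
proof -
 have o: "set ones \<subseteq> {..<G + 4}" by simp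
 have kk: "K p + (N + 1) <= K (P + 1)" unfolding cl_Suc using le by simp
 then have lt: "s <= K p + (N + 1) ==> s < K (P + 1) + 1" for s by linarith
 have E: "fh ta m (st (K p + 1 + j)) (sameF (N - j)) \<longleftrightarrow> (odd (p div 2 ^ j) \<longleftrightarrow> odd (P div 2 ^ j))" if j: "j < N" for j
 proof -
  let ?u = "K p + 1 + j" and ?s = "K P + 1 + j"
  have um: "st ?u < m" "st (?u + 1) <= m" unfolding m st_less using lt[of ?u] lt[of "?u + 1"] j by simp_all
  have 1: "fh ta m (st ?u) (LF ones) \<longleftrightarrow> odd (p div 2 ^ j)"
   using fh_LF[OF y um(1) o] um(2) address[OF j, of p] by auto
  \<comment> \<open>The prefix ends with the tile \<open>P + 1\<close>, and \<open>N - j\<close>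
    blocks before it stands address letter \<open>j\<close> of the tile \<open>P\<close>.\<close>
  have 2: "fh ta m i (AndP (LF ones) (shift (N - j) LastB)) \<longleftrightarrow> i = st ?s & odd (P div 2 ^ j)" if i: "i < m" for i
  proof -
   have "st (s + (N - j)) < m & st (s + (N - j)) + bl = m \<longleftrightarrow> s = ?s" for s
   proof -
   have "st (s + (N - j)) + bl = m \<longleftrightarrow> s + (N - j) + 1 = K (P + 1) + 1" unfolding st_Suc m st_less ..
   also have "\<dots> \<longleftrightarrow> s = ?s" using cl_Suc[of N P] j by linarith
   finally show ?thesis by auto
   qed
   moreover have "fh ta m (st s) (shift (N - j) LastB) \<longleftrightarrow> st (s + (N - j)) < m & st (s + (N - j)) + bl = m" if "st s < m" for s
   unfolding fh_shift[OF that] using fh_LastB by blast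
   moreover have "st (?s + 1) <= m" unfolding m st_less using cl_Suc[of N P] j by linarith
   ultimately show ?thesis unfolding fh_bool fh_LF[OF y i o] using i address[OF j, of P] by auto
  qed
  have "?u <= ?s" using le by simp
  moreover have "st ?s < m" unfolding m st_less using cl_Suc[of N P] j by linarith
  ultimately have 3: "fh ta m (st ?u) (EvF (AndP (LF ones) (shift (N - j) LastB))) \<longleftrightarrow> odd (P div 2 ^ j)"
   unfolding fh_EvF[OF um(1)] using 2 st_less(2) by blast
  show ?thesis unfolding sameF_def fh_bool(2,3) fh_bool(1)[of ta m "st ?u"] 1 3 by blast
 qed
 have b: "st (K p) < m" "st (K p + 1) < m" "st (K p + 1 + N) < m" unfolding m st_less using kk N by linarith+
 have "fh ta m (st (K p)) (eqF N) \<longleftrightarrow> (\<forall>j<N. odd (p div 2 ^ j) \<longleftrightarrow> odd (P div 2 ^ j))"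
  unfolding eqF_def fh_shift[OF b(1)] fh_chain[OF b(2)] using b E by blast
 then show ?thesis unfolding mod_pow_eq_iff .
qed

lemma fh_row:
 assumes m: "m = st (K (P + 1) + 1)" and le: "p <= P"
 shows "fh ta m (st (K p)) (oneF (sel lr)) \<longleftrightarrow> (\<exists>t>p. W dvd t & t <= P) &
  ~ (\<exists>t>p. W dvd t & t <= P & (\<exists>t'>t. W dvd t' & t' <= P))"
proof -
 have "K p <= K (P + 1)" using le by simp
 then have b: "st (K p) < m" unfolding m st_less by linarith
 have R: "z s \<in> set (sel lr) & st (s + 1) < m \<longleftrightarrow> (EX t. s = K t & W dvd t & t <= P)" for s
 proof -
  have b: "st (K t + 1) < m \<longleftrightarrow> t <= P" for t
   unfolding m st_less add_less_cancel_right cl_less by (simp add: less_Suc_eq_le)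
  show ?thesis
  proof (cases "EX t. s = K t")
   case True
   then obtain t where t: "s = K t" by blast
   show ?thesis unfolding t b set_sel mem_Collect_eq cl_less using tile[of t] by auto
  next
   case False
   then show ?thesis using is_tile[of s] by (auto simp: set_sel)
  qed
 qed
 have 1: "(\<exists>s>K p. z s \<in> set (sel lr) & st (s + 1) < m) \<longleftrightarrow> (\<exists>t>p. W dvd t & t <= P)" for p
 proof -
  have "(\<exists>s>K p. EX t. s = K t & Q t) \<longleftrightarrow> (\<exists>t>p. Q t)" for Q
  proof
   assume "\<exists>t>p. Q t"
   then obtain t where "p < t" "Q t" by blast
   then show "\<exists>s>K p. EX t. s = K t & Q t" by (intro exI[of _ "K t"]) auto
  qed auto
  then show ?thesis unfolding R .
 qed
 have 2: "(\<exists>s>K p. z s \<in> set (sel lr) & st (s + 1) < m & (\<exists>s'>s. z s' \<in> set (sel lr) & st (s' + 1) < m)) \<longleftrightarrow>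
   (\<exists>t>p. W dvd t & t <= P & (\<exists>t'>t. W dvd t' & t' <= P))"
 proof -
  have ex2: "(\<exists>s>K p. (EX t. s = K t & Q t) & H s) \<longleftrightarrow> (\<exists>t>p. Q t & H (K t))" for Q H
  proof
   assume "\<exists>t>p. Q t & H (K t)"
   then obtain t where t: "p < t" "Q t" "H (K t)" by blast
   show "\<exists>s>K p. (EX t. s = K t & Q t) & H s" by (rule exI[of _ "K t"]) (use t in simp)
  qed auto
  have "(\<exists>s>K p. z s \<in> set (sel lr) & st (s + 1) < m & (\<exists>s'>s. z s' \<in> set (sel lr) & st (s' + 1) < m)) \<longleftrightarrow>
   (\<exists>s>K p. (EX t. s = K t & W dvd t & t <= P) & (\<exists>s'>s. z s' \<in> set (sel lr) & st (s' + 1) < m))"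
   unfolding R[symmetric] conj_assoc ..
  also have "\<dots> \<longleftrightarrow> (\<exists>t>p. W dvd t & t <= P & (\<exists>s'>K t. z s' \<in> set (sel lr) & st (s' + 1) < m))"
   unfolding ex2 conj_assoc ..
  finally show ?thesis unfolding 1 .
 qed
 show ?thesis unfolding fh_oneF[OF y sel_sub b] 1 2 ..
qed

lemma fh_vert:
 assumes m: "0 < m" and g: "g1 < G" "g2 < G" "g3 < G" "g4 < G"
 shows "fh ta m 0 (EvF (AndP (LtF g1) (AndP (nxt N (LtF g2)) (AndP (eqF N) (AndP (oneF (sel lr))
   (EvF (AndP (LtF g3) (nxt N (AndP (LtF g4) LastB))))))))) \<longleftrightarrow>
  (EX p. m = st (K (p + W + 1) + 1) & (g1, g2, g3, g4) = (z (K p), z (K (p + 1)), z (K (p + W)), z (K (p + W + 1))))"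
  (is "fh ta m 0 (EvF (AndP (LtF g1) (AndP _ (AndP _ (AndP _ (EvF ?E)))))) \<longleftrightarrow> _")
proof -
 have g': "g1 < G + 4" "g2 < G + 4" "g3 < G + 4" "g4 < G + 4" using g by auto
 have L: "fh ta m i (LtF h) \<longleftrightarrow> (EX p. i = st (K p) & z (K p) = h & st (K p + 1) <= m)" if "i < m" "h < G" for i h
  using fh_Lt[OF y that(1), of h] that(2) is_tile by auto
 have E: "fh ta m i ?E \<longleftrightarrow> (EX P. i = st (K P) & z (K P) = g3 & z (K (P + 1)) = g4 & m = st (K (P + 1) + 1))" if i: "i < m" for i
 proof -
  have "fh ta m (st (K P)) (nxt N (AndP (LtF g4) LastB)) \<longleftrightarrow> z (K (P + 1)) = g4 & m = st (K (P + 1) + 1)" if P: "st (K P) < m" for P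
  proof -
   have "fh ta m (st (K (P + 1))) (LtF g4) & fh ta m (st (K (P + 1))) LastB \<longleftrightarrow>
   z (K (P + 1)) = g4 & m = st (K (P + 1) + 1)" if "st (K (P + 1)) < m"
   unfolding fh_Lt_st[OF y that g'(4)] fh_LastB[OF that] st_Suc by auto
   moreover have "st (K (P + 1)) < m" if "m = st (K (P + 1) + 1)" using that st_lt(1) by blast
   ultimately show ?thesis unfolding fh_nxt[OF P] cl_Suc fh_bool by blast
  qed
  moreover have "st (K P + 1) <= m" if "m = st (K (P + 1) + 1)" for P
  proof -
   have "K P <= K (P + 1)" by simp
   then show ?thesis unfolding that st_less by linarith
  qed
  ultimately show ?thesis unfolding fh_bool L[OF i g(3)] using i by blast
 qed
 have lem: "(\<exists>P\<ge>p. z (K P) = g3 & z (K (P + 1)) = g4 & m = st (K (P + 1) + 1) & fh ta m (st (K p)) (eqF N) &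
   fh ta m (st (K p)) (oneF (sel lr))) \<longleftrightarrow> z (K (p + W)) = g3 & z (K (p + W + 1)) = g4 & m = st (K (p + W + 1) + 1)" for p
 proof -
  \<comment> \<open>Given that the prefix ends at \<open>P + 1\<close>, equal addresses and a single
    row start leave only \<open>P = p + W\<close>.\<close>
  have "fh ta m (st (K p)) (eqF N) & fh ta m (st (K p)) (oneF (sel lr)) \<longleftrightarrow> P = p + W"
   if "m = st (K (P + 1) + 1)" "p <= P" for P
  proof -
   have W0: "0 < W" by simp
   show ?thesis
   proof (cases "p mod W = P mod W")
   case True
   show ?thesis unfolding fh_eqF[OF that] fh_row[OF that] one_multiple_iff[OF W0 that(2) True] using True by blast
   next
   case False
   then show ?thesis unfolding fh_eqF[OF that] by auto
   qed
  qed
  then show ?thesis by (metis le_add1)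
 qed
 have ev: "fh ta m (st (K p)) (EvF ?E) \<longleftrightarrow> (\<exists>P\<ge>p. z (K P) = g3 & z (K (P + 1)) = g4 & m = st (K (P + 1) + 1))"
  if p: "st (K p) < m" for p
 proof
  assume "fh ta m (st (K p)) (EvF ?E)"
  then obtain j where j: "st (K p) <= j" "j < m" "fh ta m j ?E" unfolding fh_EvF[OF p] by blast
  then show "\<exists>P\<ge>p. z (K P) = g3 & z (K (P + 1)) = g4 & m = st (K (P + 1) + 1)" using E[OF j(2)] by auto
 next
  assume "\<exists>P\<ge>p. z (K P) = g3 & z (K (P + 1)) = g4 & m = st (K (P + 1) + 1)"
  then obtain P where P: "p <= P" "z (K P) = g3" "z (K (P + 1)) = g4" "m = st (K (P + 1) + 1)" by blast
  have "K P <= K (P + 1)" by simp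
  then have "st (K P) < m" unfolding P(4) st_less by linarith
  then show "fh ta m (st (K p)) (EvF ?E)" unfolding fh_EvF[OF p] using E P by (intro exI[of _ "st (K P)"]) auto
 qed
 have n: "fh ta m (st (K p)) (nxt N (LtF g2)) \<longleftrightarrow> z (K (p + 1)) = g2 & st (K (p + 1) + 1) <= m" if p: "st (K p) < m" for p
  unfolding fh_nxt[OF p] cl_Suc using fh_Lt_st[OF y _ g'(2), of "K (p + 1)" m] st_lt(2)[of "K (p + 1)" m] by blast
 have "fh ta m i (AndP (LtF g1) (AndP (nxt N (LtF g2)) (AndP (eqF N) (AndP (oneF (sel lr)) (EvF ?E))))) \<longleftrightarrow>
   (EX p. i = st (K p) & z (K p) = g1 & z (K (p + 1)) = g2 & z (K (p + W)) = g3 & z (K (p + W + 1)) = g4 & m = st (K (p + W + 1) + 1))"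
  if i: "i < m" for i
 proof -
  have b: "st (K (p + 1) + 1) <= m" "st (K p + 1) <= m" if "m = st (K (p + W + 1) + 1)" for p
   unfolding that st_less by simp_all
  show ?thesis unfolding fh_bool(2) L[OF i g(1)] using ev n lem b i by blast
 qed
 moreover have "st (K p) < m" if "m = st (K (p + W + 1) + 1)" for p
 proof -
  have "K p <= K (p + W + 1)" by simp
  then show ?thesis unfolding that st_less by linarith
 qed
 ultimately show ?thesis unfolding fh_EvF[OF m] by blast
qed

lemma fh_vertF: "(\<forall>m>0. fh ta m 0 (vertF N N)) \<longleftrightarrow>
  (ALL p. local_ok (ls ! z (K p)) (ls ! z (K (p + 1))) (ls ! z (K (p + W))) (ls ! z (K (p + W + 1))))"
proof -
 have "fh ta m 0 (case x of (g1, g2, g3, g4) => EvF (AndP (LtF g1) (AndP (nxt N (LtF g2)) (AndP (eqF N) (AndP (oneF (sel lr))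
   (EvF (AndP (LtF g3) (nxt N (AndP (LtF g4) LastB))))))))) \<longleftrightarrow>
   (EX p. m = st (K (p + W + 1) + 1) & x = (z (K p), z (K (p + 1)), z (K (p + W)), z (K (p + W + 1))))"
  if "0 < m" "x \<in> set bad" for m x
 proof -
  obtain g1 g2 g3 g4 where x: "x = (g1, g2, g3, g4)" by (cases x)
  then have "g1 < G" "g2 < G" "g3 < G" "g4 < G" using that(2) by (auto simp: set_bad)
  from fh_vert[OF that(1) this] show ?thesis unfolding x prod.case .
 qed
 then have "fh ta m 0 (vertF N N) \<longleftrightarrow>
   ~ (EX p. m = st (K (p + W + 1) + 1) & (z (K p), z (K (p + 1)), z (K (p + W)), z (K (p + W + 1))) \<in> set bad)" if "0 < m" for m
  unfolding vertF_def fh_bool(1) fh_OrL set_map using that by auto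
 moreover have "0 < st (K (p + W + 1) + 1)" for p by (simp add: st_def)
 ultimately have "(\<forall>m>0. fh ta m 0 (vertF N N)) \<longleftrightarrow> (ALL p. (z (K p), z (K (p + 1)), z (K (p + W)), z (K (p + W + 1))) \<notin> set bad)"
  by blast
 then show ?thesis unfolding set_bad using tile(1) by blast
qed

end

end

text \<open>The conjuncts on coding, neighbours and initial address force the block code and the
  layout of addresses, under which the others spell out \<open>tiling\<close>. Conversely
  \<open>layout_exists\<close> inserts the addresses into a given tiling.\<close>

theorem formF_satisfiable:
 assumes N: "0 < N"
 shows "plus_lang rev_lang (formF N N w) ~= {} \<longleftrightarrow> (EX x. tiling w (2 ^ N) x)"
proof -
 have vl: "valid (ls ! g)" if "g < G" for g using that nth_mem[of g ls] set_ls by auto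
 have *: "ta \<in> plus_lang rev_lang (AllQ (vertF N N)) & ta \<in> plus_lang rev_lang (ExQ (inpF w)) &
   ta \<in> plus_lang rev_lang (ExQ (EvF (LF (sel (%a. lq a = accept M))))) \<longleftrightarrow> tiling w (2 ^ N) (%p. ls ! z (cl N p))"
  if y: "coded (G + 4) (%j. p0 \<in> ta j) z" and lay: "layout N z" for ta z
 proof -
  have "valid (ls ! z (cl N p))" "lr (ls ! z (cl N p)) \<longleftrightarrow> 2 ^ N dvd p" for p
   using tile[OF y N lay, of p] vl by auto
  then show ?thesis
   unfolding plus_lang_rev_quantifiers fh_vertF[OF y N lay] fh_inpF[OF y N lay] fh_accF[OF y N lay] tiling_def by blast
 qed
 show ?thesis
 proof
  assume "plus_lang rev_lang (formF N N w) ~= {}"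
  then obtain ta where "ta \<in> plus_lang rev_lang (formF N N w)" by blast
  then have ta: "ta \<in> plus_lang rev_lang (AllQ WFF)" "ta \<in> plus_lang rev_lang (AllQ (pairF (shift 1) nearR))"
   "ta \<in> plus_lang rev_lang (AllQ (pairF (nxt N) farR))" "ta \<in> plus_lang rev_lang (ExQ (initF N))"
   "ta \<in> plus_lang rev_lang (AllQ (vertF N N)) & ta \<in> plus_lang rev_lang (ExQ (inpF w)) &
   ta \<in> plus_lang rev_lang (ExQ (EvF (LF (sel (%a. lq a = accept M)))))"
   unfolding formF_def plus_lang.simps(6) Int_iff by blast+
  obtain z where y: "coded (G + 4) (%j. p0 \<in> ta j) z" using ta(1) unfolding plus_lang_rev_quantifiers wff_iff by blast
  have "layout N z"
   using ta(2-4) unfolding plus_lang_rev_quantifiers fh_pairF[OF y] fh_initF[OF y]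
   by (intro layoutI[OF N zA[OF y]]) blast+
  then show "EX x. tiling w (2 ^ N) x" using * [OF y] ta(5) by blast
 next
  assume "EX x. tiling w (2 ^ N) x"
  then obtain u where u: "ALL p. u p < G" "tiling w (2 ^ N) (%p. ls ! u p)" unfolding tiling_numbered by blast
  then have r: "lr (ls ! u p) \<longleftrightarrow> 2 ^ N dvd p" for p by (simp add: tiling_def)
  obtain z where z: "!!p. z (cl N p) = u p" "!!q. z q < G + 4" "!!q. nearR (z q) (z (q + 1))" "!!q. farR (z q) (z (q + (N + 1)))"
   "!!j. j < N ==> z (1 + j) \<in> {G, G + 2}" using layout_exists[OF N u(1)[rule_format] r] by blast
  have z0: "z 0 < G" "lr (ls ! z 0)" using z(1)[of 0] u(1) r[of 0] by simp_all
  have lay: "layout N z" by (rule layoutI[OF N z(2,3,4) z0 z(5)])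
  define x where "x i = cw (G + 4) (z (i div bl)) ! (i mod bl)" for i
  define ta where "ta j = (if x j then {p0} else {})" for j
  have "coded (G + 4) x z" unfolding x_def using coded_exists[of z "G + 4"] z(2) by blast
  moreover have "x = (%j. p0 \<in> ta j)" by (auto simp: ta_def)
  ultimately have y: "coded (G + 4) (%j. p0 \<in> ta j) z" by simp
  have "tiling w (2 ^ N) (%p. ls ! z (cl N p))" using u(2) z(1) by simp
  then have 1: "ta \<in> plus_lang rev_lang (AllQ (vertF N N)) & ta \<in> plus_lang rev_lang (ExQ (inpF w)) &
   ta \<in> plus_lang rev_lang (ExQ (EvF (LF (sel (%a. lq a = accept M)))))" using *[OF y lay] by blast
  have 2: "ta \<in> plus_lang rev_lang (AllQ WFF)" unfolding plus_lang_rev_quantifiers wff_iff using y by blast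
  have 3: "ta \<in> plus_lang rev_lang (AllQ (pairF (shift 1) nearR))" "ta \<in> plus_lang rev_lang (AllQ (pairF (nxt N) farR))"
   "ta \<in> plus_lang rev_lang (ExQ (initF N))"
   unfolding plus_lang_rev_quantifiers fh_pairF[OF y] fh_initF[OF y] using z z0 by blast+
  show "plus_lang rev_lang (formF N N w) ~= {}"
   unfolding formF_def plus_lang.simps(6) using 1 2 3 by blast
 qed
qed

end

lemma EXPSPACE_expressible:
 assumes "L \<in> EXPSPACE"
 shows "expressible (c :: 'a => nat) rev_lang L"
proof -
 obtain k M d where M: "wf_tm M" "decides M L" "!!w t. card (scanned_cells M w t) <= d * 2 ^ (length w ^ k) + d"
  using assms by (auto simp: EXPSPACE_def dspace_def)
 define p0 :: 'a where "p0 = undefined"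
 interpret tile_addresses M p0 by unfold_locales (rule M(1))
 let ?N = "%w :: bool list. (length w + (4 * d + 20)) ^ Suc k"
 obtain g where g: "ALL N m w. enc_ppltl_plus c (formF N m w) = out g N m w" using genable_formF[of c] by (auto simp: genable_plus_def)
 have "w \<in> L \<longleftrightarrow> plus_lang rev_lang (formF (?N w) (?N w) w) ~= {}" for w
  using formF_satisfiable[of "?N w" w] tiling_iff[OF M(1,2) M(3)[of w] exp_width] by auto
 then show ?thesis unfolding expressible_def using g
  by (intro exI[of _ "%w. formF (?N w) (?N w) w"] exI[of _ g] exI[of _ "4 * d + 20"] exI[of _ "Suc k"]) auto
qed

theorem ltlf_hardness:
 fixes c :: "'a::finite => nat"
 assumes "inj c" "L \<in> EXPSPACE"
 shows "poly_reducible L (satisfiability (enc_ltlf_plus c) (ltlf_plus_lang :: 'a ltlf_plus => _))"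
  "poly_reducible L (validity (enc_ltlf_plus c) (ltlf_plus_lang :: 'a ltlf_plus => _))"
  "poly_reducible L (model_checking c (enc_ltlf_plus c) (ltlf_plus_lang :: 'a ltlf_plus => _))"
proof -
 have "- L \<in> EXPSPACE" using assms(2) dspace_compl by (auto simp: EXPSPACE_def)
 note * = expressible_reducible[OF assms(1) EXPSPACE_expressible[OF assms(2)] EXPSPACE_expressible[OF this]]
 show "poly_reducible L (satisfiability (enc_ltlf_plus c) (ltlf_plus_lang :: 'a ltlf_plus => _))"
  "poly_reducible L (validity (enc_ltlf_plus c) (ltlf_plus_lang :: 'a ltlf_plus => _))"
  "poly_reducible L (model_checking c (enc_ltlf_plus c) (ltlf_plus_lang :: 'a ltlf_plus => _))"
  unfolding ltlf_problems using * by (simp_all add: enc_ppltl_plus_def[abs_def])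
qed

theorem ppltl_hardness:
 fixes c :: "'a::finite => nat"
 assumes "inj c" "L \<in> PSPACE"
 shows "poly_reducible L (satisfiability (enc_ppltl_plus c) (ppltl_plus_lang :: 'a ppltl_plus => _))"
  "poly_reducible L (validity (enc_ppltl_plus c) (ppltl_plus_lang :: 'a ppltl_plus => _))"
  "poly_reducible L (model_checking c (enc_ppltl_plus c) (ppltl_plus_lang :: 'a ppltl_plus => _))"
proof -
 have "- L \<in> PSPACE" using assms(2) dspace_compl by (auto simp: PSPACE_def)
 note * = expressible_reducible[OF assms(1) PSPACE_expressible[OF assms(2)] PSPACE_expressible[OF this]]
 show "poly_reducible L (satisfiability (enc_ppltl_plus c) (ppltl_plus_lang :: 'a ppltl_plus => _))"
  "poly_reducible L (validity (enc_ppltl_plus c) (ppltl_plus_lang :: 'a ppltl_plus => _))"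
  "poly_reducible L (model_checking c (enc_ppltl_plus c) (ppltl_plus_lang :: 'a ppltl_plus => _))"
  unfolding ppltl_plus_lang_def using * by simp_all
qed

theorem theorem7:
  fixes c :: "'a::finite \<Rightarrow> nat"
  assumes "inj c"
  shows "complete_for EXPSPACE (satisfiability (enc_ltlf_plus c) (ltlf_plus_lang :: 'a ltlf_plus \<Rightarrow> _))
    \<and> complete_for EXPSPACE (validity (enc_ltlf_plus c) (ltlf_plus_lang :: 'a ltlf_plus \<Rightarrow> _))
    \<and> complete_for EXPSPACE (model_checking c (enc_ltlf_plus c) (ltlf_plus_lang :: 'a ltlf_plus \<Rightarrow> _))
    \<and> complete_for PSPACE (satisfiability (enc_ppltl_plus c) (ppltl_plus_lang :: 'a ppltl_plus \<Rightarrow> _))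
    \<and> complete_for PSPACE (validity (enc_ppltl_plus c) (ppltl_plus_lang :: 'a ppltl_plus \<Rightarrow> _))
    \<and> complete_for PSPACE (model_checking c (enc_ppltl_plus c) (ppltl_plus_lang :: 'a ppltl_plus \<Rightarrow> _))"
  unfolding complete_for_def
  by (intro conjI ballI ltlf_membership[OF assms] ppltl_membership[OF assms] ltlf_hardness[OF assms] ppltl_hardness[OF assms])

end
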